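(* Let $V$ be a finite dimensional complex vector space, $G$ a compact connected subgroup of $\mathrm{GL}(V)$, and $v\in V$. Suppose that $V$ contains no nonzero $G$-fixed points and that the orbit $M=Gv$ is a commutative homogeneous space of $G$. Then: (a) $P(M)=C(M)$ if and only if the complex orbit $G^{\mathbb{C}}v$ is closed in $V$; (b) $P(M)$ is antisymmetric if and only if $v\in\mathcal{N}$; in this case $\widehat M\subseteq\mathcal{N}$.
   Context: $G^{\mathbb{C}}\subseteq\mathrm{GL}(V)$ is the complexification of $G$. $\mathcal{P}(V)$ is the algebra of holomorphic polynomials on $V$; for compact $K\subset V$, $P(K)$ is the closure of $\mathcal{P}(V)|_K$ in $C(K)$ (sup-norm), and $\widehat K=\{z\in V: |p(z)|\le\sup_{\zeta\in K}|p(\zeta)| \text{ for all } p\in\mathcal{P}(V)\}$ is the polynomially convex hull. The nilpotent cone is $\mathcal{N}=\{w\in V: p(w)=0 \text{ for all } G\text{-invariant } p\in\mathcal{P}(V) \text{ with } p(0)=0\}$. A function algebra is antisymmetric if every real-valued function in it is constant. A homogeneous space $M=G/H$ of a compact Lie group is commutative if it is multiplicity free, i.e. the quasiregular representation $f(x)\mapsto f(g^{-1}x)$ of $G$ in $C(M)$ contains every irreducible representation of $G$ with multiplicity $0$ or $1$ (equivalently, $(G,H)$ is a Gelfand pair). *)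

theory Defs
  imports "HOL-Analysis.Analysis" "HOL-Algebra.Generated_Groups" "HOL-Library.Function_Algebras"
    "HOL-Library.Extended_Nat"
begin

text \<open>
  A finite dimensional complex vector space, the whole type being the space. Its topology is given
  by some norm on the underlying real space; the choice does not matter, and completeness and the
  Heine-Borel property (the superclasses \<open>banach\<close> and \<open>heine_borel\<close>) hold for every norm in finite
  dimension. The zero space is allowed.
\<close>

class fd_complex_space = banach + heine_borel +
  fixes scaleC :: "complex \<Rightarrow> 'a \<Rightarrow> 'a"  (infixr "*\<^sub>C" 75)
  assumes scaleC_add_right: "c *\<^sub>C (x + y) = c *\<^sub>C x + c *\<^sub>C y"
    and scaleC_add_left: "(c + d) *\<^sub>C x = c *\<^sub>C x + d *\<^sub>C x"
    and scaleC_scaleC: "c *\<^sub>C d *\<^sub>C x = (c * d) *\<^sub>C x"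
    and scaleC_of_real: "complex_of_real r *\<^sub>C x = r *\<^sub>R x"
    and finite_dim_scaleC: "\<exists>B. finite B \<and> (\<forall>x. \<exists>c. x = (\<Sum>b\<in>B. c b *\<^sub>C b))"

lemma vector_space_scaleC: "vector_space (scaleC :: complex \<Rightarrow> 'v \<Rightarrow> 'v::fd_complex_space)"
  using scaleC_of_real[of 1]
  by unfold_locales (simp_all add: scaleC_add_right scaleC_add_left scaleC_scaleC)

instantiation complex :: fd_complex_space
begin

definition scaleC_complex :: "complex \<Rightarrow> complex \<Rightarrow> complex" where
  "scaleC_complex = (*)"

instance
proof
  show "\<exists>B. finite B \<and> (\<forall>x::complex. \<exists>c. x = (\<Sum>b\<in>B. c b *\<^sub>C b))"
    by (rule exI[of _ "{1}"]) (auto simp: scaleC_complex_def)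
qed (simp_all add: scaleC_complex_def algebra_simps scaleR_conv_of_real)

end


subsection \<open>Linear groups and complexification\<close>

definition GL :: "('v::fd_complex_space \<Rightarrow>\<^sub>L 'v) monoid" where
  "GL = \<lparr>carrier = {g. Vector_Spaces.linear scaleC scaleC (blinfun_apply g) \<and> bij (blinfun_apply g)},
         mult = (o\<^sub>L), one = id_blinfun\<rparr>"

definition orbit_of :: "('v::fd_complex_space \<Rightarrow>\<^sub>L 'v) set \<Rightarrow> 'v \<Rightarrow> 'v set" where
  "orbit_of G v = (\<lambda>g. blinfun_apply g v) ` G"

definition op_exp :: "('v::fd_complex_space \<Rightarrow>\<^sub>L 'v) \<Rightarrow> ('v \<Rightarrow>\<^sub>L 'v)" where
  "op_exp X = (\<Sum>k. (((o\<^sub>L) X) ^^ k) id_blinfun /\<^sub>R fact k)"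

definition lie_algebra :: "('v::fd_complex_space \<Rightarrow>\<^sub>L 'v) set \<Rightarrow> ('v \<Rightarrow>\<^sub>L 'v) set" where
  "lie_algebra G = {X. \<forall>t::real. op_exp (t *\<^sub>R X) \<in> G}"

definition complexified_lie_algebra ::
    "('v::fd_complex_space \<Rightarrow>\<^sub>L 'v) set \<Rightarrow> ('v \<Rightarrow>\<^sub>L 'v) set" where
  "complexified_lie_algebra G =
     {Z. \<exists>X\<in>lie_algebra G. \<exists>Y\<in>lie_algebra G.
           \<forall>x. blinfun_apply Z x = blinfun_apply X x + \<i> *\<^sub>C blinfun_apply Y x}"

text \<open>
  For compact \<open>G\<close> with Lie algebra \<open>\<gg>\<close>, the complexification inside the general linear group is the
  Lie subgroup with Lie algebra \<open>\<gg> + \<i>\<gg>\<close> that meets the same components as \<open>G\<close>. If \<open>G\<close> is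
  connected, the generators from \<open>G\<close> itself are redundant and this is the connected Lie subgroup
  with Lie algebra \<open>\<gg> + \<i>\<gg>\<close>.
\<close>

definition complexification :: "('v::fd_complex_space \<Rightarrow>\<^sub>L 'v) set \<Rightarrow> ('v \<Rightarrow>\<^sub>L 'v) set" where
  "complexification G = generate GL (G \<union> op_exp ` complexified_lie_algebra G)"


subsection \<open>Holomorphic polynomials and function algebras\<close>

inductive_set hol_poly :: "('v::fd_complex_space \<Rightarrow> complex) set" where
  const: "(\<lambda>z. c) \<in> hol_poly"
| linear: "Vector_Spaces.linear scaleC (*) l \<Longrightarrow> l \<in> hol_poly"
| add: "p \<in> hol_poly \<Longrightarrow> q \<in> hol_poly \<Longrightarrow> (\<lambda>z. p z + q z) \<in> hol_poly"
| mult: "p \<in> hol_poly \<Longrightarrow> q \<in> hol_poly \<Longrightarrow> (\<lambda>z. p z * q z) \<in> hol_poly"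

text \<open>
  A function on \<open>K\<close> is represented by its extension by \<open>0\<close>, so that \<open>cont_fun K\<close> (that is, \<open>C(K)\<close>)
  is a complex vector space under pointwise operations and equality is equality on \<open>K\<close>.
\<close>

definition cont_fun :: "'v::topological_space set \<Rightarrow> ('v \<Rightarrow> complex) set" where
  "cont_fun K = {f. continuous_on K f \<and> (\<forall>x. x \<notin> K \<longrightarrow> f x = 0)}"

definition poly_closure :: "'v::fd_complex_space set \<Rightarrow> ('v \<Rightarrow> complex) set" where
  "poly_closure K =
     {f \<in> cont_fun K. \<forall>\<epsilon>>0. \<exists>p\<in>hol_poly. \<forall>z\<in>K. cmod (f z - p z) < \<epsilon>}"

definition antisymmetric_on :: "'v set \<Rightarrow> ('v \<Rightarrow> complex) set \<Rightarrow> bool" where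
  "antisymmetric_on K A \<longleftrightarrow> (\<forall>f\<in>A. (\<forall>x\<in>K. f x \<in> \<real>) \<longrightarrow> f constant_on K)"

definition poly_hull :: "'v::fd_complex_space set \<Rightarrow> 'v set" where
  "poly_hull K = {z. \<forall>p\<in>hol_poly. cmod (p z) \<le> (SUP \<zeta>\<in>K. cmod (p \<zeta>))}"

definition nilpotent_cone :: "('v::fd_complex_space \<Rightarrow>\<^sub>L 'v) set \<Rightarrow> 'v set" where
  "nilpotent_cone G =
     {w. \<forall>p\<in>hol_poly. (\<forall>g\<in>G. \<forall>z. p (blinfun_apply g z) = p z) \<and> p 0 = 0 \<longrightarrow> p w = 0}"


subsection \<open>Representations and commutative orbits\<close>

definition fun_scale :: "complex \<Rightarrow> ('b \<Rightarrow> complex) \<Rightarrow> ('b \<Rightarrow> complex)" where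
  "fun_scale c f = (\<lambda>x. c * f x)"

text \<open>
  A representation of \<open>G\<close> on a complex vector space \<open>W\<close> of functions: the values of \<open>\<rho>\<close> outside
  \<open>G\<close> and \<open>W\<close> are irrelevant.
\<close>

definition representation ::
    "('v::fd_complex_space \<Rightarrow>\<^sub>L 'v) set \<Rightarrow> ('b \<Rightarrow> complex) set \<Rightarrow>
     (('v \<Rightarrow>\<^sub>L 'v) \<Rightarrow> ('b \<Rightarrow> complex) \<Rightarrow> ('b \<Rightarrow> complex)) \<Rightarrow> bool" where
  "representation G W \<rho> \<longleftrightarrow>
     module.subspace fun_scale W \<and>
     (\<forall>g\<in>G. \<forall>f\<in>W. \<rho> g f \<in> W) \<and>
     (\<forall>g\<in>G. \<forall>f\<in>W. \<forall>h\<in>W. \<rho> g (f + h) = \<rho> g f + \<rho> g h) \<and>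
     (\<forall>g\<in>G. \<forall>c. \<forall>f\<in>W. \<rho> g (fun_scale c f) = fun_scale c (\<rho> g f)) \<and>
     (\<forall>f\<in>W. \<rho> id_blinfun f = f) \<and>
     (\<forall>g\<in>G. \<forall>h\<in>G. \<forall>f\<in>W. \<rho> (g o\<^sub>L h) f = \<rho> g (\<rho> h f))"

text \<open>
  Irreducible representations of a compact group are finite dimensional. On a finite dimensional
  space of functions the point evaluations span the dual space, so continuity of \<open>\<rho>\<close> may be tested
  pointwise.
\<close>

definition irreducible_rep ::
    "('v::fd_complex_space \<Rightarrow>\<^sub>L 'v) set \<Rightarrow> ('b \<Rightarrow> complex) set \<Rightarrow>
     (('v \<Rightarrow>\<^sub>L 'v) \<Rightarrow> ('b \<Rightarrow> complex) \<Rightarrow> ('b \<Rightarrow> complex)) \<Rightarrow> bool" where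
  "irreducible_rep G W \<rho> \<longleftrightarrow>
     representation G W \<rho> \<and>
     (\<exists>B. finite B \<and> module.span fun_scale B = W) \<and>
     (\<forall>f\<in>W. \<forall>x. continuous_on G (\<lambda>g. \<rho> g f x)) \<and>
     W \<noteq> {0} \<and>
     (\<forall>U. U \<subseteq> W \<and> representation G U \<rho> \<longrightarrow> U = {0} \<or> U = W)"

definition equivalent_reps ::
    "('v::fd_complex_space \<Rightarrow>\<^sub>L 'v) set \<Rightarrow>
     ('b \<Rightarrow> complex) set \<Rightarrow> (('v \<Rightarrow>\<^sub>L 'v) \<Rightarrow> ('b \<Rightarrow> complex) \<Rightarrow> ('b \<Rightarrow> complex)) \<Rightarrow>
     ('c \<Rightarrow> complex) set \<Rightarrow> (('v \<Rightarrow>\<^sub>L 'v) \<Rightarrow> ('c \<Rightarrow> complex) \<Rightarrow> ('c \<Rightarrow> complex)) \<Rightarrow> bool" where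
  "equivalent_reps G W \<rho> U \<sigma> \<longleftrightarrow>
     (\<exists>T. bij_betw T W U \<and>
          (\<forall>f\<in>W. \<forall>h\<in>W. T (f + h) = T f + T h) \<and>
          (\<forall>c. \<forall>f\<in>W. T (fun_scale c f) = fun_scale c (T f)) \<and>
          (\<forall>g\<in>G. \<forall>f\<in>W. T (\<rho> g f) = \<sigma> g (T f)))"

definition quasiregular ::
    "('v::fd_complex_space \<Rightarrow>\<^sub>L 'v) \<Rightarrow> ('v \<Rightarrow> complex) \<Rightarrow> ('v \<Rightarrow> complex)" where
  "quasiregular g f = (\<lambda>x. f (blinfun_apply (inv\<^bsub>GL\<^esub> g) x))"

text \<open>The direct sum of \<open>n\<close> copies of \<open>(W, \<rho>)\<close> is contained in the quasiregular representation.\<close>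

definition contains_copies ::
    "('v::fd_complex_space \<Rightarrow>\<^sub>L 'v) set \<Rightarrow> 'v set \<Rightarrow> ('b \<Rightarrow> complex) set \<Rightarrow>
     (('v \<Rightarrow>\<^sub>L 'v) \<Rightarrow> ('b \<Rightarrow> complex) \<Rightarrow> ('b \<Rightarrow> complex)) \<Rightarrow> nat \<Rightarrow> bool" where
  "contains_copies G M W \<rho> n \<longleftrightarrow>
     (\<exists>U. (\<forall>i<n. U i \<subseteq> cont_fun M \<and> representation G (U i) quasiregular \<and>
                 equivalent_reps G W \<rho> (U i) quasiregular) \<and>
          (\<forall>f. (\<forall>i<n. f i \<in> U i) \<and> (\<Sum>i<n. f i) = 0 \<longrightarrow> (\<forall>i<n. f i = 0)))"

definition rep_multiplicity ::
    "('v::fd_complex_space \<Rightarrow>\<^sub>L 'v) set \<Rightarrow> 'v set \<Rightarrow> ('b \<Rightarrow> complex) set \<Rightarrow>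
     (('v \<Rightarrow>\<^sub>L 'v) \<Rightarrow> ('b \<Rightarrow> complex) \<Rightarrow> ('b \<Rightarrow> complex)) \<Rightarrow> enat" where
  "rep_multiplicity G M W \<rho> = Sup {enat n |n. contains_copies G M W \<rho> n}"

text \<open>
  Carriers \<open>W\<close> inside \<open>'v \<Rightarrow> complex\<close> represent all irreducible representations up to equivalence:
  this space is infinite dimensional unless the type \<open>'v\<close> is the zero space, and then \<open>G\<close> is
  trivial and its irreducible representations are one-dimensional.
\<close>

definition commutative_orbit :: "('v::fd_complex_space \<Rightarrow>\<^sub>L 'v) set \<Rightarrow> 'v set \<Rightarrow> bool" where
  "commutative_orbit G M \<longleftrightarrow>
     (\<forall>(W :: ('v \<Rightarrow> complex) set) \<rho>. irreducible_rep G W \<rho> \<longrightarrow> rep_multiplicity G M W \<rho> \<le> 1)"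

end

theory Submission
  imports Defs "HOL-Computational_Algebra.Fundamental_Theorem_Algebra"
begin

text \<open>
  Averages over \<open>G\<close> of polynomials are invariant polynomials, and multiplicity freeness decides between
  subrepresentations: if an irreducible subspace \<open>W\<close> of \<open>C(M)\<close> is isomorphic to one in a \<open>G\<close>-invariant
  space \<open>A\<close>, then \<open>W \<subseteq> A\<close>. Hence the conjugate of a polynomial on \<open>M\<close> is the sum of a function \<open>s\<close>
  such that \<open>s\<close> and its conjugate are polynomials on \<open>M\<close>, and of the conjugate of a polynomial \<open>r\<close>
  with \<open>\<integral> r q = 0\<close> for all polynomials \<open>q\<close>. If \<open>P(M)\<close> is
  antisymmetric, then \<open>s\<close> is constant, integration over the orbit is multiplicative on polynomials, and
  therefore evaluation at a fixed point of \<open>G\<close>, that is, at \<open>0\<close>; so invariant polynomials vanish at \<open>v\<close>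
  if they vanish at \<open>0\<close>. The converse is the same computation read backwards, and the hull inherits the
  values of invariant polynomials from \<open>M\<close>.

  If the complex orbit is closed, it contains a vector of minimal length, where the moment map vanishes.
  The \<open>G\<close>-orbit of such a vector stays in a parabolic sector, so negative powers of
  \<open>\<langle>u, u\<rangle> + s - \<langle>z, u\<rangle>\<close> separate it and no nonzero polynomial on it is orthogonal to all
  polynomials. By the splitting this makes conjugates of polynomials polynomial, and Stone-Weierstrass applies.

  Conversely, if \<open>P(M) = C(M)\<close>, then every \<open>G\<close>-finite function on \<open>M\<close> is a polynomial, and so is
  every regular function on the group averaged over the stabilizer of \<open>v\<close>. A limit point \<open>z\<close> of the complex
  orbit then defines a proper ideal of regular functions on \<open>GL\<close>; its zero is an operator in the Zariski closure
  of \<open>G\<close> mapping \<open>v\<close> to \<open>z\<close>, and by polar decomposition the Zariski closure lies in the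
  complexification.
\<close>

text \<open>Two pairings must be kept apart. \<open>L2\<close> is Hermitian and positive, but the
  splitting yields a relation for the bilinear pairing, the mean of \<open>r q\<close>. There
  \<open>q\<close> cannot be chosen as the conjugate of \<open>r\<close>, so positivity does not
  give \<open>r = 0\<close>; this is why a closed complex orbit needs an asymptotic argument with
  test functions concentrating at a minimal vector. The relation passes between \<open>v\<close> and
  that vector because averages of polynomials are invariant polynomials, which are constant on the
  complex orbit. In the other direction a convergent sequence in the complex orbit need not come
  from a convergent sequence of operators, so the operator that reaches the limit point is produced
  algebraically, as a zero of an ideal. The zero exists because a field extension of the complex
  numbers of countable dimension is trivial. Polynomials and regular functions survive averaging
  because their translates are finite sums of a continuous function of the group element times a
  function of the point (\<open>sepfun\<close>).\<close>

lemma sum_list_divide: "(\<Sum>x\<leftarrow>xs. f x / c) = (\<Sum>x\<leftarrow>xs. f x) / (c::'a::field)"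
  by (induction xs) (simp_all add: add_divide_distrib)

section \<open>Invariant mean of continuous functions on a compact group\<close>

locale compact_group =
  fixes K :: "'g::metric_space set" and m :: "'g \<Rightarrow> 'g \<Rightarrow> 'g" and e :: 'g
  assumes compact_K: "compact K"
    and e_in: "e \<in> K"
    and m_in: "x \<in> K \<Longrightarrow> y \<in> K \<Longrightarrow> m x y \<in> K"
    and m_assoc: "x \<in> K \<Longrightarrow> y \<in> K \<Longrightarrow> z \<in> K \<Longrightarrow> m (m x y) z = m x (m y z)"
    and m_e_left: "x \<in> K \<Longrightarrow> m e x = x"
    and m_e_right: "x \<in> K \<Longrightarrow> m x e = x"
    and m_inverse: "x \<in> K \<Longrightarrow> \<exists>y\<in>K. m x y = e \<and> m y x = e"
    and continuous_m: "continuous_on (K \<times> K) (\<lambda>(x, y). m x y)"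
begin

definition lavg :: "'g list \<Rightarrow> ('g \<Rightarrow> real) \<Rightarrow> 'g \<Rightarrow> real" where
  "lavg gs f x = (\<Sum>g\<leftarrow>gs. f (m g x)) / real (length gs)"

definition weights :: "'g list set" where
  "weights = {gs. gs \<noteq> [] \<and> set gs \<subseteq> K}"

text \<open>This is the Haar integral, characterized as a constant in the uniform closure of the
  averages of the translates of \<open>f\<close>. The lists of translating elements may have
  repetitions, so that averages of averages are again averages.\<close>

definition is_mean :: "('g \<Rightarrow> real) \<Rightarrow> real \<Rightarrow> bool" where
  "is_mean f a \<longleftrightarrow> (\<forall>\<eta>>0. \<exists>gs\<in>weights. \<forall>x\<in>K. \<bar>lavg gs f x - a\<bar> \<le> \<eta>)"

lemma weightsI: "gs \<noteq> [] \<Longrightarrow> set gs \<subseteq> K \<Longrightarrow> gs \<in> weights"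
  by (simp add: weights_def)

lemma continuous_translate:
  assumes "continuous_on K f" "g \<in> K"
  shows "continuous_on K (\<lambda>x. f (m g x))" "continuous_on K (\<lambda>x. f (m x g))"
proof -
  have "continuous_on K (\<lambda>x. (\<lambda>(x, y). m x y) (g, x))"
    by (rule continuous_on_compose2[OF continuous_m]) (use assms in \<open>auto intro!: continuous_intros\<close>)
  then have c1: "continuous_on K (\<lambda>x. m g x)" by simp
  have "continuous_on K (\<lambda>x. (\<lambda>(x, y). m x y) (x, g))"
    by (rule continuous_on_compose2[OF continuous_m]) (use assms in \<open>auto intro!: continuous_intros\<close>)
  then have c2: "continuous_on K (\<lambda>x. m x g)" by simp
  show "continuous_on K (\<lambda>x. f (m g x))" "continuous_on K (\<lambda>x. f (m x g))"
    using assms m_in by (auto intro!: continuous_on_compose2[OF assms(1)] c1 c2)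
qed

lemma lavg_le:
  assumes "gs \<in> weights" "x \<in> K" "\<And>y. y \<in> K \<Longrightarrow> f y \<le> c"
  shows "lavg gs f x \<le> c"
proof -
  have "(\<Sum>g\<leftarrow>gs. f (m g x)) \<le> (\<Sum>g\<leftarrow>gs. c)"
    by (rule sum_list_mono) (use assms m_in in \<open>auto simp: weights_def\<close>)
  then show ?thesis using assms(1) by (simp add: lavg_def weights_def sum_list_triv divide_le_eq mult.commute)
qed

lemma lavg_uminus: "lavg gs (\<lambda>x. - f x) y = - lavg gs f y"
proof -
  have "(\<Sum>g\<leftarrow>gs. - f (m g y)) = - (\<Sum>g\<leftarrow>gs. f (m g y))" by (induction gs) simp_all
  then show ?thesis by (simp add: lavg_def)
qed

lemma lavg_ge:
  assumes "gs \<in> weights" "x \<in> K" "\<And>y. y \<in> K \<Longrightarrow> c \<le> f y"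
  shows "c \<le> lavg gs f x"
  using lavg_le[OF assms(1,2), of "\<lambda>x. - f x" "-c"] assms(3) by (simp add: lavg_uminus)

lemma lavg_add: "lavg gs (\<lambda>x. f x + h x) y = lavg gs f y + lavg gs h y"
  by (simp add: lavg_def sum_list_addf add_divide_distrib)

lemma lavg_const: "gs \<in> weights \<Longrightarrow> lavg gs (\<lambda>x. c) y = c"
  by (simp add: lavg_def weights_def sum_list_triv)

lemma lavg_cmult: "lavg gs (\<lambda>x. c * f x) y = c * lavg gs f y"
  by (simp add: lavg_def sum_list_const_mult)

lemma lavg_near:
  assumes "gs \<in> weights" "x \<in> K" "\<And>y. y \<in> K \<Longrightarrow> \<bar>f y - a\<bar> \<le> \<eta>"
  shows "\<bar>lavg gs f x - a\<bar> \<le> \<eta>"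
proof -
  have "lavg gs f x \<le> a + \<eta>" by (rule lavg_le[OF assms(1,2)]) (use assms(3) in fastforce)
  moreover have "a - \<eta> \<le> lavg gs f x" by (rule lavg_ge[OF assms(1,2)]) (use assms(3) in fastforce)
  ultimately show ?thesis by auto
qed

lemma lavg_comp:
  assumes "gs \<in> weights" "ns \<in> weights"
  shows "\<exists>ks\<in>weights. \<forall>f::'g \<Rightarrow> real. \<forall>x\<in>K. lavg ns (lavg gs f) x = lavg ks f x"
proof
  define ks where "ks = concat (map (\<lambda>n. map (\<lambda>g. m g n) gs) ns)"
  show "ks \<in> weights" using assms m_in by (auto simp: weights_def ks_def) 
  show "\<forall>f::'g \<Rightarrow> real. \<forall>x\<in>K. lavg ns (lavg gs f) x = lavg ks f x"
  proof (intro allI ballI)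
    fix f :: "'g \<Rightarrow> real" and x assume x: "x \<in> K"
    have len: "length ks = length ns * length gs"
      unfolding ks_def by (induction ns) auto
    have "set ns \<subseteq> K" using assms by (simp add: weights_def)
    then have "(\<Sum>n\<leftarrow>ns. \<Sum>g\<leftarrow>gs. f (m g (m n x))) = (\<Sum>k\<leftarrow>ks. f (m k x))"
      unfolding ks_def
    proof (induction ns)
      case (Cons n ns)
      have "(\<Sum>g\<leftarrow>gs. f (m g (m n x))) = (\<Sum>g\<leftarrow>gs. f (m (m g n) x))"
        using Cons.prems x assms(1) by (intro arg_cong[where f=sum_list] map_cong) (auto simp: weights_def m_assoc subset_iff)
      then show ?case using Cons by (simp add: comp_def)
    qed simp
    moreover have "lavg ns (lavg gs f) x = (\<Sum>n\<leftarrow>ns. \<Sum>g\<leftarrow>gs. f (m g (m n x))) / (real (length ns) * real (length gs))"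
      unfolding lavg_def by (simp add: sum_list_divide mult.commute)
    ultimately show "lavg ns (lavg gs f) x = lavg ks f x" by (simp add: lavg_def len)
  qed
qed

text \<open>The mean is the infimum, over all averages of \<open>f\<close>, of their suprema. An
  average whose supremum is close to this infimum must be nearly constant: if it were small at some
  point, averaging once more over a net would lower the supremum below the infimum. All averages
  share one modulus of continuity, which makes the gain uniform.\<close>

lemma mean_exists:
  assumes f: "continuous_on K f"
  shows "\<exists>a. is_mean f a"
proof -
  have "bounded (f ` K)" using f compact_K by (simp add: compact_continuous_image compact_imp_bounded)
  then obtain L where L: "\<And>x. x \<in> K \<Longrightarrow> \<bar>f x\<bar> \<le> L" by (auto simp: bounded_iff)
  define S where "S = (\<lambda>gs. SUP x\<in>K. lavg gs f x)"
  have bd: "\<bar>lavg gs f x\<bar> \<le> L" if "gs \<in> weights" "x \<in> K" for gs x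
    using lavg_near[OF that, of f 0 L] L by simp
  have bdd: "bdd_above (lavg gs f ` K)" if "gs \<in> weights" for gs
    using bd[OF that] by (intro bdd_aboveI[of _ L]) (auto simp: abs_le_iff)
  have S_ge: "lavg gs f x \<le> S gs" if "gs \<in> weights" "x \<in> K" for gs x
    unfolding S_def using bdd that by (intro cSUP_upper) auto
  have "- L \<le> S gs" if "gs \<in> weights" for gs
    using S_ge[OF that e_in] bd[OF that e_in] by (auto simp: abs_le_iff)
  then have bddS: "bdd_below (S ` weights)" by (intro bdd_belowI[of _ "-L"]) auto
  have ne: "weights \<noteq> {}" using e_in weightsI[of "[e]"] by auto
  define a where "a = (INF gs\<in>weights. S gs)"
  have a_le: "a \<le> S gs" if "gs \<in> weights" for gs
    unfolding a_def using bddS that by (intro cINF_lower) auto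
  have "is_mean f a" unfolding is_mean_def
  proof (intro allI impI)
    fix \<eta> :: real assume \<eta>: "\<eta> > 0"
    have "continuous_on (K \<times> K) (\<lambda>p. f ((\<lambda>(x, y). m x y) p))"
      by (rule continuous_on_compose2[OF f continuous_m]) (use m_in in auto)
    then have "uniformly_continuous_on (K \<times> K) (\<lambda>p. f ((\<lambda>(x, y). m x y) p))"
      using compact_K by (intro compact_uniformly_continuous compact_Times) auto
    then obtain \<delta> where \<delta>: "\<delta> > 0"
      and \<delta>': "\<And>p q. p \<in> K \<times> K \<Longrightarrow> q \<in> K \<times> K \<Longrightarrow> dist q p < \<delta> \<Longrightarrow>
        dist (f ((\<lambda>(x, y). m x y) q)) (f ((\<lambda>(x, y). m x y) p)) < \<eta>/2"
      using \<eta> unfolding uniformly_continuous_on_def by (metis half_gt_zero)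
    have mod: "\<bar>f (m g x) - f (m g y)\<bar> \<le> \<eta>/2" if "g \<in> K" "x \<in> K" "y \<in> K" "dist x y < \<delta>" for g x y
      using \<delta>'[of "(g, y)" "(g, x)"] that by (simp add: dist_Pair_Pair dist_real_def)
    have modl: "\<bar>lavg gs f x - lavg gs f y\<bar> \<le> \<eta>/2" if "gs \<in> weights" "x \<in> K" "y \<in> K" "dist x y < \<delta>" for gs x y
    proof -
      have "\<bar>\<Sum>g\<leftarrow>gs. f (m g x) - f (m g y)\<bar> \<le> (\<Sum>g\<leftarrow>gs. \<bar>f (m g x) - f (m g y)\<bar>)"
        using sum_list_abs[of "map (\<lambda>g. f (m g x) - f (m g y)) gs"] by (simp add: comp_def)
      also have "\<dots> \<le> (\<Sum>g\<leftarrow>gs. \<eta>/2)"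
        by (rule sum_list_mono) (use that mod in \<open>auto simp: weights_def\<close>)
      finally have "\<bar>\<Sum>g\<leftarrow>gs. f (m g x) - f (m g y)\<bar> \<le> \<eta>/2 * real (length gs)"
        by (simp add: sum_list_triv mult.commute)
      moreover have "length gs > 0" using that by (auto simp: weights_def)
      ultimately have "\<bar>\<Sum>g\<leftarrow>gs. f (m g x) - f (m g y)\<bar> / real (length gs) \<le> \<eta>/2"
        by (simp add: divide_le_eq)
      moreover have "lavg gs f x - lavg gs f y = (\<Sum>g\<leftarrow>gs. f (m g x) - f (m g y)) / real (length gs)"
        unfolding lavg_def by (simp add: diff_divide_distrib sum_list_subtractf)
      ultimately show ?thesis by simp
    qed
    have "uniformly_continuous_on (K \<times> K) (\<lambda>(x, y). m x y)"
      using compact_K continuous_m by (intro compact_uniformly_continuous compact_Times) auto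
    then obtain \<epsilon> where \<epsilon>: "\<epsilon> > 0"
      and \<epsilon>': "\<And>p q. p \<in> K \<times> K \<Longrightarrow> q \<in> K \<times> K \<Longrightarrow> dist q p < \<epsilon> \<Longrightarrow>
        dist ((\<lambda>(x, y). m x y) q) ((\<lambda>(x, y). m x y) p) < \<delta>"
      using \<delta> unfolding uniformly_continuous_on_def by metis
    have "K \<subseteq> (\<Union>x\<in>K. ball x \<epsilon>)" using \<epsilon> by auto
    then obtain N where N: "N \<subseteq> K" "finite N" "K \<subseteq> (\<Union>x\<in>N. ball x \<epsilon>)"
      by (rule compactE_image[OF compact_K, where f = "\<lambda>x. ball x \<epsilon>" and C = K, rotated]) auto
    obtain ns where ns: "set ns = N" using N(2) finite_list by blast
    have nsw: "ns \<in> weights" using N ns e_in by (intro weightsI) auto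
    define n where "n = real (length ns)"
    have n: "n > 0" using nsw by (auto simp: weights_def n_def)
    \<comment> \<open>Averaging over the net \<open>ns\<close> lowers the supremum by \<open>\<eta>/(2n)\<close> unless the oscillation is at most \<open>\<eta>\<close>.\<close>
    have "(INF gs\<in>weights. S gs) < a + \<eta>/(2*n)" using \<eta> n by (simp add: a_def)
    then obtain gs where gs: "gs \<in> weights" "S gs < a + \<eta>/(2*n)"
      using cINF_less_iff[OF ne bddS] by auto
    have "lavg gs f x0 \<ge> a - \<eta>" if x0: "x0 \<in> K" for x0
    proof (rule ccontr)
      assume "\<not> ?thesis"
      then have small: "lavg gs f x0 < a - \<eta>" by simp
      have up: "lavg ns (lavg gs f) x \<le> S gs - \<eta>/(2*n)" if x: "x \<in> K" for x
      proof -
        \<comment> \<open>With \<open>y\<close> inverse to \<open>x\<close>, a net point close to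
          \<open>m x0 y\<close> moves \<open>x\<close> close to \<open>x0\<close>. Hence for every
          \<open>x\<close> at least one summand of the average over the net is small.\<close>
        obtain y where y: "y \<in> K" "m y x = e" using m_inverse[OF x] by blast
        obtain g where g: "g \<in> set ns" "dist g (m x0 y) < \<epsilon>"
          using N(3) m_in[OF x0 y(1)] ns by (auto simp: subset_iff)
        have gK: "g \<in> K" using g ns N by auto
        have "m (m x0 y) x = x0" using x x0 y by (simp add: m_assoc m_e_right)
        then have "dist (m g x) x0 < \<delta>"
          using \<epsilon>'[of "(m x0 y, x)" "(g, x)"] g gK x x0 y m_in by (simp add: dist_Pair_Pair)
        then have "lavg gs f (m g x) \<le> lavg gs f x0 + \<eta>/2"
          using modl[OF gs(1) m_in[OF gK x] x0] by linarith
        also have "\<dots> \<le> S gs - \<eta>/2" using small a_le[OF gs(1)] by simp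
        finally have *: "lavg gs f (m g x) \<le> S gs - \<eta>/2" .
        obtain ys zs where split: "ns = ys @ g # zs" using g(1) split_list by metis
        have "(\<Sum>g\<leftarrow>ns. lavg gs f (m g x)) \<le> (\<Sum>g\<leftarrow>ns. S gs) - \<eta>/2"
        proof -
          have "(\<Sum>g\<leftarrow>ys. lavg gs f (m g x)) \<le> (\<Sum>g\<leftarrow>ys. S gs)" "(\<Sum>g\<leftarrow>zs. lavg gs f (m g x)) \<le> (\<Sum>g\<leftarrow>zs. S gs)"
            using split nsw gs(1) x by (auto intro!: sum_list_mono S_ge m_in simp: weights_def)
          then show ?thesis using * by (simp add: split)
        qed
        then have "(\<Sum>g\<leftarrow>ns. lavg gs f (m g x)) \<le> n * S gs - \<eta>/2" by (simp add: sum_list_triv n_def)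
        then have "(\<Sum>g\<leftarrow>ns. lavg gs f (m g x)) / n \<le> (n * S gs - \<eta>/2) / n"
          using n by (intro divide_right_mono) auto
        also have "\<dots> = S gs - \<eta>/(2*n)" using n by (simp add: field_simps)
        finally show ?thesis by (simp add: lavg_def[of ns] n_def)
      qed
      obtain ks where ks: "ks \<in> weights" "\<And>x. x \<in> K \<Longrightarrow> lavg ns (lavg gs f) x = lavg ks f x"
        using lavg_comp[OF gs(1) nsw] by blast
      have "(SUP x\<in>K. lavg ks f x) \<le> S gs - \<eta>/(2*n)"
        by (rule cSUP_least) (use e_in up ks in auto)
      moreover have "S ks = (SUP x\<in>K. lavg ks f x)" by (simp add: S_def)
      ultimately show False using a_le[OF ks(1)] gs(2) by simp
    qed
    moreover have "\<eta>/(2*n) \<le> \<eta>"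
    proof -
      have "1 \<le> n" using nsw by (cases ns) (auto simp: weights_def n_def)
      then have "\<eta> * 1 \<le> \<eta> * (2*n)" using \<eta> by (intro mult_left_mono) auto
      then show ?thesis using n by (simp add: divide_le_eq)
    qed
    ultimately have "\<forall>x\<in>K. \<bar>lavg gs f x - a\<bar> \<le> \<eta>"
      using S_ge[OF gs(1)] gs(2) by (fastforce simp: abs_le_iff)
    then show "\<exists>gs\<in>weights. \<forall>x\<in>K. \<bar>lavg gs f x - a\<bar> \<le> \<eta>" using gs(1) by blast
  qed
  then show ?thesis by blast
qed

end

text \<open>Right averages are left averages for the reversed multiplication; uniqueness and
  two-sided invariance of the mean come from playing one against the other.\<close>

lemma (in compact_group) opposite: "compact_group K (\<lambda>x y. m y x) e"
proof
  show "continuous_on (K \<times> K) (\<lambda>(x, y). m y x)"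
  proof -
    have "continuous_on (K \<times> K) (\<lambda>p. (\<lambda>(x, y). m x y) (snd p, fst p))"
      by (rule continuous_on_compose2[OF continuous_m]) (auto intro!: continuous_intros)
    then show ?thesis by (simp add: case_prod_unfold)
  qed
  show "\<exists>y\<in>K. m y x = e \<and> m x y = e" if "x \<in> K" for x using m_inverse[OF that] by blast
qed (use compact_K e_in m_in m_assoc m_e_left m_e_right in \<open>auto\<close>)

context compact_group begin

interpretation op: compact_group K "\<lambda>x y. m y x" e by (rule opposite)


lemma lavg_ravg_commute:
  assumes "gs \<in> weights" "hs \<in> weights" "x \<in> K"
  shows "lavg gs (op.lavg hs f) x = op.lavg hs (lavg gs f) x"
proof -
  have "lavg gs (op.lavg hs f) x = (\<Sum>g\<leftarrow>gs. \<Sum>h\<leftarrow>hs. f (m (m g x) h)) / (real (length gs) * real (length hs))"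
    unfolding lavg_def op.lavg_def
    by (simp add: sum_list_divide mult.commute)
  also have "(\<Sum>g\<leftarrow>gs. \<Sum>h\<leftarrow>hs. f (m (m g x) h)) = (\<Sum>g\<leftarrow>gs. \<Sum>h\<leftarrow>hs. f (m g (m x h)))"
    using assms by (intro arg_cong[where f=sum_list] map_cong refl) (auto simp: weights_def m_assoc subset_iff)
  also have "\<dots> = (\<Sum>h\<leftarrow>hs. \<Sum>g\<leftarrow>gs. f (m g (m x h)))"
    by (induction gs) (simp_all add: sum_list_addf)
  also have "\<dots> / (real (length gs) * real (length hs)) = op.lavg hs (lavg gs f) x"
    unfolding lavg_def op.lavg_def
    by (simp add: sum_list_divide mult.commute)
  finally show ?thesis .
qed

text \<open>Left and right averages commute, and averaging preserves closeness to a constant. The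
  double average at the identity is therefore close to both \<open>a\<close> and
  \<open>c\<close>.\<close>

lemma is_mean_op_unique:
  assumes "is_mean f a" "op.is_mean f c"
  shows "a = c"
proof (rule ccontr)
  assume "a \<noteq> c"
  define \<eta> where "\<eta> = \<bar>a - c\<bar>/3"
  with \<open>a \<noteq> c\<close> have \<eta>: "\<eta> > 0" "\<eta> = \<bar>a - c\<bar>/3" by auto
  obtain gs where gs: "gs \<in> weights" "\<And>x. x \<in> K \<Longrightarrow> \<bar>lavg gs f x - a\<bar> \<le> \<eta>"
    using assms(1)[unfolded is_mean_def, rule_format, OF \<eta>(1)] by blast
  obtain hs where hs: "hs \<in> weights" "\<And>x. x \<in> K \<Longrightarrow> \<bar>op.lavg hs f x - c\<bar> \<le> \<eta>"
    using assms(2)[unfolded op.is_mean_def, rule_format, OF \<eta>(1)] by blast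
  have "\<bar>lavg gs (op.lavg hs f) e - c\<bar> \<le> \<eta>" by (rule lavg_near[OF gs(1) e_in hs(2)])
  moreover have "\<bar>op.lavg hs (lavg gs f) e - a\<bar> \<le> \<eta>"
    by (rule op.lavg_near[OF hs(1) e_in gs(2)])
  ultimately have "\<bar>a - c\<bar> \<le> 2 * \<eta>" using lavg_ravg_commute[OF gs(1) hs(1) e_in, of f] by linarith
  then show False using \<eta> by simp
qed

definition mean :: "('g \<Rightarrow> real) \<Rightarrow> real" where
  "mean f = (THE a. is_mean f a)"

lemma is_mean_iff:
  assumes "continuous_on K f"
  shows "is_mean f a \<longleftrightarrow> a = mean f" "op.is_mean f a \<longleftrightarrow> a = mean f"
proof -
  obtain b where b: "is_mean f b" using mean_exists[OF assms] by blast
  obtain c where c: "op.is_mean f c" using op.mean_exists[OF assms] by blast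
  have bc: "b = c" by (rule is_mean_op_unique[OF b c])
  have 1: "is_mean f a \<longleftrightarrow> a = b" for a using is_mean_op_unique[OF _ c, of a] b bc by auto
  moreover have 2: "op.is_mean f a \<longleftrightarrow> a = b" for a using is_mean_op_unique[OF b, of a] c bc by auto
  moreover have "mean f = b" unfolding mean_def 1 by simp
  ultimately show "is_mean f a \<longleftrightarrow> a = mean f" "op.is_mean f a \<longleftrightarrow> a = mean f" by auto
qed

lemma continuous_lavg:
  assumes f: "continuous_on K f" and hs: "hs \<in> weights"
  shows "continuous_on K (lavg hs f)"
proof -
  have "continuous_on K (\<lambda>x. \<Sum>h\<leftarrow>hs. F h x)" if "\<And>h. h \<in> set hs \<Longrightarrow> continuous_on K (F h)"
    for hs and F :: "'g \<Rightarrow> 'g \<Rightarrow> real"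
    using that by (induction hs) (auto intro!: continuous_intros)
  note gen = this
  have "continuous_on K (\<lambda>x. lavg hs f x)"
    unfolding lavg_def by (intro continuous_intros gen) (use f hs in \<open>auto simp: weights_def intro: continuous_translate\<close>)
  then show ?thesis by simp
qed

text \<open>The mean is tested by right averages: they commute with the left average, which leaves a
  function uniformly close to \<open>mean f\<close> equally close.\<close>

lemma mean_lavg:
  assumes f: "continuous_on K f" and gs: "gs \<in> weights"
  shows "mean (lavg gs f) = mean f"
proof -
  have "op.is_mean (lavg gs f) (mean f)" unfolding op.is_mean_def
  proof (intro allI impI)
    fix \<eta> :: real assume "\<eta> > 0"
    then obtain hs where hs: "hs \<in> weights" "\<And>x. x \<in> K \<Longrightarrow> \<bar>op.lavg hs f x - mean f\<bar> \<le> \<eta>"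
      using is_mean_iff(2)[OF f, of "mean f"] unfolding op.is_mean_def by blast
    have "\<bar>op.lavg hs (lavg gs f) x - mean f\<bar> \<le> \<eta>" if "x \<in> K" for x
      using lavg_near[OF gs that, of "op.lavg hs f", OF hs(2)] lavg_ravg_commute[OF gs hs(1) that, of f] by simp
    then show "\<exists>hs\<in>op.weights. \<forall>x\<in>K. \<bar>op.lavg hs (lavg gs f) x - mean f\<bar> \<le> \<eta>"
      using hs(1) by blast
  qed
  then show ?thesis using is_mean_iff(2)[OF continuous_lavg[OF f gs]] by simp
qed

text \<open>An average that nearly flattens \<open>f\<close> is followed by one that nearly flattens
  the averaged \<open>h\<close>. The second average does not spoil the first estimate, and the first
  does not change the mean of \<open>h\<close>.\<close>

lemma mean_add:
  assumes f: "continuous_on K f" and h: "continuous_on K h"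
  shows "mean (\<lambda>x. f x + h x) = mean f + mean h"
proof -
  have "is_mean (\<lambda>x. f x + h x) (mean f + mean h)" unfolding is_mean_def
  proof (intro allI impI)
    fix \<eta> :: real assume \<eta>: "\<eta> > 0"
    then obtain gs where gs: "gs \<in> weights" "\<And>x. x \<in> K \<Longrightarrow> \<bar>lavg gs f x - mean f\<bar> \<le> \<eta>/2"
      using is_mean_iff(1)[OF f, of "mean f"] half_gt_zero unfolding is_mean_def by blast
    have ch: "continuous_on K (lavg gs h)" using continuous_lavg[OF h gs(1)] .
    obtain ns where ns: "ns \<in> weights" "\<And>x. x \<in> K \<Longrightarrow> \<bar>lavg ns (lavg gs h) x - mean h\<bar> \<le> \<eta>/2"
      using is_mean_iff(1)[OF ch, of "mean h", unfolded is_mean_def] mean_lavg[OF h gs(1)] half_gt_zero[OF \<eta>] by metis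
    obtain ks where ks: "ks \<in> weights" "\<And>f x. x \<in> K \<Longrightarrow> lavg ns (lavg gs f) x = lavg ks f x"
      using lavg_comp[OF gs(1) ns(1)] by blast
    have "\<bar>lavg ks (\<lambda>x. f x + h x) x - (mean f + mean h)\<bar> \<le> \<eta>" if "x \<in> K" for x
      using lavg_near[OF ns(1) that, of "lavg gs f", OF gs(2)] ns(2)[OF that] ks(2)[OF that, of f] ks(2)[OF that, of h]
      unfolding lavg_add by linarith
    then show "\<exists>gs\<in>weights. \<forall>x\<in>K. \<bar>lavg gs (\<lambda>x. f x + h x) x - (mean f + mean h)\<bar> \<le> \<eta>" using ks(1) by blast
  qed
  then show ?thesis using is_mean_iff(1)[of "\<lambda>x. f x + h x"] f h by (simp add: continuous_on_add)
qed

lemma mean_uminus: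
  assumes f: "continuous_on K f"
  shows "mean (\<lambda>x. - f x) = - mean f"
proof -
  have "\<bar>- a - - b\<bar> = \<bar>a - b\<bar>" for a b :: real by arith
  then have "is_mean (\<lambda>x. - f x) (- mean f) \<longleftrightarrow> is_mean f (mean f)"
    unfolding is_mean_def lavg_uminus by (simp only:)
  then have "is_mean (\<lambda>x. - f x) (- mean f)" using is_mean_iff(1)[OF f] by simp
  then show ?thesis using is_mean_iff(1)[of "\<lambda>x. - f x"] f by (simp add: continuous_on_minus)
qed

lemma mean_cong:
  assumes "continuous_on K f" "\<And>x. x \<in> K \<Longrightarrow> f x = h x"
  shows "mean f = mean h"
proof -
  have h: "continuous_on K h" by (rule continuous_on_eq[OF assms])
  have "lavg gs f x = lavg gs h x" if "gs \<in> weights" "x \<in> K" for gs x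
  proof -
    have "map (\<lambda>g. f (m g x)) gs = map (\<lambda>g. h (m g x)) gs"
      using that assms(2) m_in by (auto simp: weights_def)
    then have "(\<Sum>g\<leftarrow>gs. f (m g x)) = (\<Sum>g\<leftarrow>gs. h (m g x))" by (rule arg_cong)
    then show ?thesis unfolding lavg_def by (simp only:)
  qed
  then have "is_mean h (mean f) \<longleftrightarrow> is_mean f (mean f)" by (simp add: is_mean_def)
  then have "is_mean h (mean f)" using is_mean_iff(1)[OF assms(1)] by simp
  then show ?thesis using is_mean_iff(1)[OF h] by simp
qed

lemma mean_const: "mean (\<lambda>x. c) = c"
proof -
  have "weights \<noteq> {}" using e_in weightsI[of "[e]"] by auto
  then have "is_mean (\<lambda>x. c) c" by (auto simp: is_mean_def lavg_const)
  then show ?thesis using is_mean_iff(1)[of "\<lambda>x. c"] by simp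
qed

lemma mean_le:
  assumes "continuous_on K f" "\<And>x. x \<in> K \<Longrightarrow> f x \<le> c"
  shows "mean f \<le> c"
proof (rule field_le_epsilon)
  fix \<eta> :: real assume "\<eta> > 0"
  then obtain gs where gs: "gs \<in> weights" "\<And>x. x \<in> K \<Longrightarrow> \<bar>lavg gs f x - mean f\<bar> \<le> \<eta>"
    using is_mean_iff(1)[OF assms(1), of "mean f"] unfolding is_mean_def by blast
  have "lavg gs f e \<le> c" by (rule lavg_le[OF gs(1) e_in assms(2)])
  then show "mean f \<le> c + \<eta>" using gs(2)[OF e_in] by (simp add: abs_le_iff)
qed

lemma mean_ge:
  assumes "continuous_on K f" "\<And>x. x \<in> K \<Longrightarrow> c \<le> f x"
  shows "c \<le> mean f"
  using mean_le[of "\<lambda>x. - f x" "-c"] assms mean_uminus[OF assms(1)] by (simp add: continuous_on_minus)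

lemma mean_mono:
  assumes "continuous_on K f" "continuous_on K h" "\<And>x. x \<in> K \<Longrightarrow> f x \<le> h x"
  shows "mean f \<le> mean h"
proof -
  have "0 \<le> mean (\<lambda>x. h x + - f x)"
    by (rule mean_ge) (use assms in \<open>auto intro!: continuous_intros\<close>)
  also have "\<dots> = mean h - mean f"
    using assms by (subst mean_add) (auto intro!: continuous_intros simp: mean_uminus)
  finally show ?thesis by simp
qed

lemma mean_cmult:
  assumes f: "continuous_on K f"
  shows "mean (\<lambda>x. c * f x) = c * mean f"
proof -
  have "is_mean (\<lambda>x. c * f x) (c * mean f)" unfolding is_mean_def
  proof (intro allI impI)
    fix \<eta> :: real assume \<eta>: "\<eta> > 0"
    then have "\<eta> / (\<bar>c\<bar> + 1) > 0" by (simp add: divide_pos_pos)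
    then obtain gs where gs: "gs \<in> weights" "\<And>x. x \<in> K \<Longrightarrow> \<bar>lavg gs f x - mean f\<bar> \<le> \<eta> / (\<bar>c\<bar> + 1)"
      using is_mean_iff(1)[OF f, of "mean f"] unfolding is_mean_def by blast
    have "\<bar>lavg gs (\<lambda>x. c * f x) x - c * mean f\<bar> \<le> \<eta>" if "x \<in> K" for x
    proof -
      have "\<bar>lavg gs (\<lambda>x. c * f x) x - c * mean f\<bar> = \<bar>c\<bar> * \<bar>lavg gs f x - mean f\<bar>"
        unfolding lavg_cmult by (simp add: right_diff_distrib flip: abs_mult)
      also have "\<dots> \<le> (\<bar>c\<bar> + 1) * (\<eta> / (\<bar>c\<bar> + 1))" using gs(2)[OF that] by (intro mult_mono) auto
      also have "\<dots> = \<eta>" by simp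
      finally show ?thesis .
    qed
    then show "\<exists>gs\<in>weights. \<forall>x\<in>K. \<bar>lavg gs (\<lambda>x. c * f x) x - c * mean f\<bar> \<le> \<eta>" using gs(1) by blast
  qed
  then show ?thesis using is_mean_iff(1)[of "\<lambda>x. c * f x"] f by (simp add: continuous_on_mult_left)
qed

lemma mean_left: "continuous_on K f \<Longrightarrow> g \<in> K \<Longrightarrow> mean (\<lambda>x. f (m g x)) = mean f"
  using mean_lavg[of f "[g]"] by (simp add: lavg_def[abs_def] weightsI)

end

context compact_group begin

interpretation op: compact_group K "\<lambda>x y. m y x" e by (rule opposite)

lemma mean_eq_op: "continuous_on K f \<Longrightarrow> op.mean f = mean f"
  using op.is_mean_iff(1)[of f "op.mean f"] is_mean_iff(2)[of f "op.mean f"] by simp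

lemma mean_right:
  assumes f: "continuous_on K f" and g: "g \<in> K"
  shows "mean (\<lambda>x. f (m x g)) = mean f"
  using op.mean_left[OF f g] mean_eq_op[OF f] mean_eq_op[OF continuous_translate(2)[OF f g]] by simp

text \<open>If finitely many translates of the set where \<open>f\<close> is at least
  \<open>c\<close> cover the group, every value of the corresponding average contains a summand of
  size \<open>c\<close>. This is the lower volume bound used for small balls in an orbit.\<close>

lemma mean_ge_cover:
  assumes f: "continuous_on K f" and gs: "gs \<in> weights"
    and nonneg: "\<And>x. x \<in> K \<Longrightarrow> 0 \<le> f x"
    and cover: "\<And>x. x \<in> K \<Longrightarrow> \<exists>g\<in>set gs. c \<le> f (m g x)"
  shows "c / real (length gs) \<le> mean f"
proof -
  have "c / real (length gs) \<le> mean (lavg gs f)"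
  proof (rule mean_ge[OF continuous_lavg[OF f gs]])
    fix x assume x: "x \<in> K"
    obtain g where g: "g \<in> set gs" "c \<le> f (m g x)" using cover[OF x] by blast
    have "f (m g x) \<le> (\<Sum>g\<leftarrow>gs. f (m g x))"
      by (rule member_le_sum_list) (use g gs x nonneg m_in in \<open>auto simp: weights_def\<close>)
    then show "c / real (length gs) \<le> lavg gs f x"
      unfolding lavg_def using g by (intro divide_right_mono) auto
  qed
  then show ?thesis by (simp add: mean_lavg[OF f gs])
qed

text \<open>The translates of the open set where \<open>f\<close> exceeds half of its value at
  \<open>x0\<close> cover the group, and by compactness finitely many suffice.\<close>

lemma mean_pos:
  assumes f: "continuous_on K f" and nonneg: "\<And>x. x \<in> K \<Longrightarrow> 0 \<le> f x" and x0: "x0 \<in> K" "f x0 > 0"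
  shows "mean f > 0"
proof -
  define U where "U = (\<lambda>y. {x\<in>K. f (m y x) > f x0 / 2})"
  have op: "openin (top_of_set K) (U y)" if "y \<in> K" for y
  proof -
    have "openin (top_of_set K) (K \<inter> (\<lambda>x. f (m y x)) -` {f x0/2 <..})"
      by (rule continuous_openin_preimage_gen[OF continuous_translate(1)[OF f that]]) auto
    moreover have "U y = K \<inter> (\<lambda>x. f (m y x)) -` {f x0/2 <..}" by (auto simp: U_def)
    ultimately show ?thesis by simp
  qed
  have "K \<subseteq> (\<Union>y\<in>K. U y)"
  proof
    fix x assume x: "x \<in> K"
    obtain z where z: "z \<in> K" "m z x = e" using m_inverse[OF x] by blast
    have "m (m x0 z) x = x0" using x x0 z by (simp add: m_assoc m_e_right)
    then have "x \<in> U (m x0 z)" using x x0(2) by (simp add: U_def)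
    then show "x \<in> (\<Union>y\<in>K. U y)" using m_in x0(1) z(1) by blast
  qed
  moreover have "\<forall>y\<in>K. \<exists>V. open V \<and> U y = K \<inter> V" using op unfolding openin_open by blast
  then obtain V where V: "\<And>y. y \<in> K \<Longrightarrow> open (V y) \<and> U y = K \<inter> V y" by metis
  ultimately have "K \<subseteq> (\<Union>y\<in>K. V y)" by blast
  then obtain N where N: "N \<subseteq> K" "finite N" "K \<subseteq> (\<Union>y\<in>N. V y)"
    by (rule compactE_image[OF compact_K, where f = V and C = K, rotated]) (use V in auto)
  then have NU: "K \<subseteq> (\<Union>y\<in>N. U y)" using V by blast
  obtain gs where gs: "set gs = N" using N(2) finite_list by blast
  have w: "gs \<in> weights" using gs N e_in by (intro weightsI) auto
  have "f x0 / 2 / real (length gs) \<le> mean f"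
  proof (rule mean_ge_cover[OF f w nonneg])
    fix x assume "x \<in> K"
    then obtain g where "g \<in> N" "x \<in> U g" using NU by blast
    then show "\<exists>g\<in>set gs. f x0 / 2 \<le> f (m g x)" using gs by (auto simp: U_def intro!: bexI[of _ g])
  qed
  moreover have "f x0 / 2 / real (length gs) > 0" using w x0(2) by (simp add: weights_def)
  ultimately show ?thesis by linarith
qed

section \<open>Means of complex valued functions\<close>

definition cmean :: "('g \<Rightarrow> complex) \<Rightarrow> complex" where
  "cmean f = Complex (mean (\<lambda>x. Re (f x))) (mean (\<lambda>x. Im (f x)))"

lemma Re_cmean: "Re (cmean f) = mean (\<lambda>x. Re (f x))"
  and Im_cmean: "Im (cmean f) = mean (\<lambda>x. Im (f x))"
  by (simp_all add: cmean_def)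

lemma cmean_add:
  assumes "continuous_on K f" "continuous_on K h"
  shows "cmean (\<lambda>x. f x + h x) = cmean f + cmean h"
  using assms by (simp add: complex_eq_iff Re_cmean Im_cmean mean_add continuous_on_Re continuous_on_Im)

lemma cmean_cmult:
  assumes "continuous_on K f"
  shows "cmean (\<lambda>x. c * f x) = c * cmean f"
proof -
  have cont: "continuous_on K (\<lambda>x. Re (f x))" "continuous_on K (\<lambda>x. Im (f x))"
    using assms by (simp_all add: continuous_on_Re continuous_on_Im)
  have "mean (\<lambda>x. Re c * Re (f x) + - (Im c * Im (f x))) = Re c * mean (\<lambda>x. Re (f x)) + - (Im c * mean (\<lambda>x. Im (f x)))"
    using cont by (subst mean_add) (auto intro!: continuous_intros simp: mean_cmult mean_uminus continuous_on_mult_left)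
  moreover have "mean (\<lambda>x. Re c * Im (f x) + Im c * Re (f x)) = Re c * mean (\<lambda>x. Im (f x)) + Im c * mean (\<lambda>x. Re (f x))"
    using cont by (subst mean_add) (auto intro!: continuous_intros simp: mean_cmult)
  ultimately show ?thesis by (simp add: complex_eq_iff Re_cmean Im_cmean)
qed

lemma cmean_const: "cmean (\<lambda>x. c) = c"
  by (simp add: complex_eq_iff Re_cmean Im_cmean mean_const)

lemma cmean_diff:
  assumes "continuous_on K f" "continuous_on K h"
  shows "cmean (\<lambda>x. f x - h x) = cmean f - cmean h"
  using cmean_add[of f "\<lambda>x. (-1) * h x"] cmean_cmult[of h "-1"] assms by (simp add: continuous_intros)

lemma cmean_sum:
  assumes "\<And>i. i \<in> I \<Longrightarrow> continuous_on K (f i)"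
  shows "cmean (\<lambda>x. \<Sum>i\<in>I. f i x) = (\<Sum>i\<in>I. cmean (f i))"
  using assms
  by (induction I rule: infinite_finite_induct)
     (auto simp: cmean_const cmean_add continuous_on_sum)

lemma cmean_cnj: "continuous_on K f \<Longrightarrow> cmean (\<lambda>x. cnj (f x)) = cnj (cmean f)"
  by (simp add: complex_eq_iff Re_cmean Im_cmean mean_uminus continuous_on_Im)

lemma cmean_cong:
  assumes "continuous_on K f" "\<And>x. x \<in> K \<Longrightarrow> f x = h x"
  shows "cmean f = cmean h"
  using assms unfolding cmean_def
  by (simp add: mean_cong[of "\<lambda>x. Re (f x)" "\<lambda>x. Re (h x)"] mean_cong[of "\<lambda>x. Im (f x)" "\<lambda>x. Im (h x)"] continuous_on_Re continuous_on_Im)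

lemma cmean_left: "continuous_on K f \<Longrightarrow> g \<in> K \<Longrightarrow> cmean (\<lambda>x. f (m g x)) = cmean f"
  unfolding cmean_def using mean_left[of "\<lambda>x. Re (f x)" g] mean_left[of "\<lambda>x. Im (f x)" g]
  by (simp add: continuous_on_Re continuous_on_Im)

lemma cmean_right: "continuous_on K f \<Longrightarrow> g \<in> K \<Longrightarrow> cmean (\<lambda>x. f (m x g)) = cmean f"
  unfolding cmean_def using mean_right[of "\<lambda>x. Re (f x)" g] mean_right[of "\<lambda>x. Im (f x)" g]
  by (simp add: continuous_on_Re continuous_on_Im)

lemma cmod_cmean_le:
  assumes f: "continuous_on K f" and c: "\<And>x. x \<in> K \<Longrightarrow> cmod (f x) \<le> c"
  shows "cmod (cmean f) \<le> c"
proof (cases "cmean f = 0")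
  case True
  then show ?thesis using order_trans[OF norm_ge_zero c[OF e_in]] by simp
next
  case False
  \<comment> \<open>Multiplication by the phase \<open>u\<close> makes the mean equal to its
    modulus, so that it suffices to bound real parts.\<close>
  define u where "u = cnj (cmean f) / cmod (cmean f)"
  have u1: "cmod u = 1" using False by (simp add: u_def norm_divide)
  have "u * cmean f = cmean f * cnj (cmean f) / cmod (cmean f)" by (simp add: u_def mult.commute)
  also have "\<dots> = cmod (cmean f)"
    using False unfolding complex_norm_square[symmetric] by (simp add: power2_eq_square)
  finally have "cmean (\<lambda>x. u * f x) = cmod (cmean f)" by (simp add: cmean_cmult[OF f])
  then have "Re (cmean (\<lambda>x. u * f x)) = cmod (cmean f)" by simp
  then have "cmod (cmean f) = mean (\<lambda>x. Re (u * f x))" unfolding Re_cmean by simp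
  also have "\<dots> \<le> c"
  proof (rule mean_le)
    show "continuous_on K (\<lambda>x. Re (u * f x))" using f by (intro continuous_intros)
    fix x assume "x \<in> K"
    have "Re (u * f x) \<le> cmod (u * f x)" by (rule complex_Re_le_cmod)
    then show "Re (u * f x) \<le> c" using c[OF \<open>x \<in> K\<close>] u1 by (simp add: norm_mult)
  qed
  finally show ?thesis .
qed

lemma cmean_cnj_self_eq_0:
  assumes f: "continuous_on K f" and 0: "cmean (\<lambda>x. f x * cnj (f x)) = 0" and x: "x \<in> K"
  shows "f x = 0"
proof (rule ccontr)
  assume "f x \<noteq> 0"
  then have "mean (\<lambda>x. (cmod (f x))\<^sup>2) > 0"
    using x f by (intro mean_pos[of _ x]) (auto intro!: continuous_intros)
  moreover have "(\<lambda>x. (cmod (f x))\<^sup>2) = (\<lambda>x. Re (f x * cnj (f x)))"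
    unfolding complex_norm_square[symmetric] by simp
  moreover have "Re (cmean (\<lambda>x. f x * cnj (f x))) = 0" using 0 by simp
  ultimately show False unfolding Re_cmean by simp
qed

end

section \<open>Hermitian forms\<close>

text \<open>The form is an inner product on the subspace \<open>D\<close> only. This lets one theory
  serve an inner product on the whole of a finite dimensional space as well as the \<open>L2\<close>
  product on the continuous functions inside the space of all functions.\<close>

locale hermitian_space = vector_space sc
  for sc :: "complex \<Rightarrow> 'b::ab_group_add \<Rightarrow> 'b" +
  fixes D :: "'b set" and H :: "'b \<Rightarrow> 'b \<Rightarrow> complex"
  assumes subspace_D: "subspace D"
    and H_add: "x \<in> D \<Longrightarrow> y \<in> D \<Longrightarrow> z \<in> D \<Longrightarrow> H (x + y) z = H x z + H y z"
    and H_scale: "x \<in> D \<Longrightarrow> z \<in> D \<Longrightarrow> H (sc c x) z = c * H x z"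
    and H_cnj: "x \<in> D \<Longrightarrow> y \<in> D \<Longrightarrow> H y x = cnj (H x y)"
    and H_nonneg: "x \<in> D \<Longrightarrow> 0 \<le> Re (H x x)"
    and H_eq_0: "x \<in> D \<Longrightarrow> H x x = 0 \<Longrightarrow> x = 0"
begin

lemma D_add: "x \<in> D \<Longrightarrow> y \<in> D \<Longrightarrow> x + y \<in> D" and D_scale: "x \<in> D \<Longrightarrow> sc c x \<in> D"
  and D_0: "0 \<in> D" and D_diff: "x \<in> D \<Longrightarrow> y \<in> D \<Longrightarrow> x - y \<in> D"
  using subspace_D by (auto simp: subspace_add subspace_scale subspace_0 subspace_diff)

lemma D_sum: "(\<And>i. i \<in> I \<Longrightarrow> f i \<in> D) \<Longrightarrow> (\<Sum>i\<in>I. f i) \<in> D"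
  using subspace_D by (rule subspace_sum)

lemma D_span: "S \<subseteq> D \<Longrightarrow> span S \<subseteq> D"
  using subspace_D by (rule span_minimal[rotated])

lemma H_add_right: "x \<in> D \<Longrightarrow> y \<in> D \<Longrightarrow> z \<in> D \<Longrightarrow> H z (x + y) = H z x + H z y"
  using H_cnj[of "x + y" z] H_cnj[of x z] H_cnj[of y z] by (simp add: D_add H_add)

lemma H_scale_right: "x \<in> D \<Longrightarrow> z \<in> D \<Longrightarrow> H z (sc c x) = cnj c * H z x"
  using H_cnj[of "sc c x" z] H_cnj[of x z] by (simp add: D_scale H_scale)

lemma H_0_left [simp]: "z \<in> D \<Longrightarrow> H 0 z = 0"
  using H_scale[of 0 z 0] D_0 by simp

lemma H_0_right [simp]: "z \<in> D \<Longrightarrow> H z 0 = 0"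
  using H_cnj[of 0 z] D_0 by simp

lemma H_diff: "x \<in> D \<Longrightarrow> y \<in> D \<Longrightarrow> z \<in> D \<Longrightarrow> H (x - y) z = H x z - H y z"
  using H_add[of "x - y" y z] by (simp add: D_diff)

lemma H_diff_right: "x \<in> D \<Longrightarrow> y \<in> D \<Longrightarrow> z \<in> D \<Longrightarrow> H z (x - y) = H z x - H z y"
  using H_add_right[of "x - y" y z] by (simp add: D_diff)

lemma H_sum: "(\<And>i. i \<in> I \<Longrightarrow> f i \<in> D) \<Longrightarrow> z \<in> D \<Longrightarrow> H (\<Sum>i\<in>I. f i) z = (\<Sum>i\<in>I. H (f i) z)"
  by (induction I rule: infinite_finite_induct) (simp_all add: H_add D_sum)

lemma Im_H_self: "x \<in> D \<Longrightarrow> Im (H x x) = 0"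
  using arg_cong[OF H_cnj[of x x], of Im] by simp

definition orthonormal :: "'b set \<Rightarrow> bool" where
  "orthonormal E \<longleftrightarrow> finite E \<and> E \<subseteq> D \<and> (\<forall>e\<in>E. \<forall>e'\<in>E. H e e' = (if e = e' then 1 else 0))"

definition proj :: "'b set \<Rightarrow> 'b \<Rightarrow> 'b" where
  "proj E x = (\<Sum>e\<in>E. sc (H x e) e)"

lemma proj_in_span: "proj E x \<in> span E"
  unfolding proj_def by (intro span_sum span_scale span_base)

lemma proj_in_D: "orthonormal E \<Longrightarrow> proj E x \<in> D"
  using proj_in_span D_span unfolding orthonormal_def by blast

lemma H_proj:
  assumes E: "orthonormal E" and x: "x \<in> D" and e: "e \<in> E"
  shows "H (proj E x) e = H x e"
proof -
  have ED: "\<And>e. e \<in> E \<Longrightarrow> e \<in> D" and fin: "finite E" using E by (auto simp: orthonormal_def)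
  have "H (proj E x) e = (\<Sum>e'\<in>E. H x e' * H e' e)"
    unfolding proj_def using ED e by (simp add: H_sum D_scale H_scale)
  also have "\<dots> = (\<Sum>e'\<in>E. if e' = e then H x e' else 0)"
    by (rule sum.cong) (use E e in \<open>auto simp: orthonormal_def\<close>)
  also have "\<dots> = H x e" using fin e by (simp add: sum.delta)
  finally show ?thesis .
qed

lemma span_orthogonal:
  assumes "S \<subseteq> D" "y \<in> D" "\<And>s. s \<in> S \<Longrightarrow> H y s = 0" "x \<in> span S"
  shows "H y x = 0"
proof -
  have "x \<in> D \<and> H y x = 0" using assms(4)
  proof (induction rule: span_induct_alt)
    case (step c s t)
    then show ?case using assms by (auto simp: H_add_right D_scale D_add H_scale_right)
  qed (use D_0 assms in auto)
  then show ?thesis by simp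
qed

lemma proj_orthogonal:
  assumes E: "orthonormal E" and x: "x \<in> D" and y: "y \<in> span E"
  shows "H (x - proj E x) y = 0"
proof (rule span_orthogonal[OF _ _ _ y])
  show "E \<subseteq> D" using E by (simp add: orthonormal_def)
  show "x - proj E x \<in> D" using x proj_in_D[OF E] by (simp add: D_diff)
  show "H (x - proj E x) s = 0" if "s \<in> E" for s
    using H_proj[OF E x that] E x that proj_in_D[OF E] by (auto simp: H_diff orthonormal_def)
qed

lemma proj_unique:
  assumes E: "orthonormal E" and x: "x \<in> D" and u: "u \<in> span E" and o: "\<And>e. e \<in> E \<Longrightarrow> H (x - u) e = 0"
  shows "u = proj E x"
proof -
  have ED: "E \<subseteq> D" using E by (simp add: orthonormal_def)
  then have uD: "u \<in> D" using D_span u by blast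
  define d where "d = proj E x - u"
  have d: "d \<in> span E" unfolding d_def using u proj_in_span by (simp add: span_diff)
  have dD: "d \<in> D" unfolding d_def using uD proj_in_D[OF E] by (simp add: D_diff)
  have "H d e = 0" if "e \<in> E" for e
  proof -
    have "e \<in> D" using that ED by blast
    then show ?thesis using o[OF that] H_proj[OF E x that] x uD proj_in_D[OF E] by (simp add: H_diff d_def)
  qed
  then have "H d d = 0" using span_orthogonal[OF ED dD _ d] by blast
  then show ?thesis using H_eq_0[OF dD] by (simp add: d_def)
qed

lemma proj_id: "orthonormal E \<Longrightarrow> x \<in> span E \<Longrightarrow> proj E x = x"
  using proj_unique[of E x x] D_span[of E] by (auto simp: orthonormal_def subset_iff)

lemma gram_schmidt:
  assumes "finite S" "S \<subseteq> D"
  shows "\<exists>E. orthonormal E \<and> span E = span S"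
  using assms
proof (induction S)
  case empty
  then show ?case by (intro exI[of _ "{}"]) (simp add: orthonormal_def)
next
  case (insert s S)
  then obtain E where E: "orthonormal E" "span E = span S" by auto
  have ED: "E \<subseteq> D" "finite E" using E by (auto simp: orthonormal_def)
  have sD: "s \<in> D" using insert by simp
  define t where "t = s - proj E s"
  have tD: "t \<in> D" unfolding t_def using sD proj_in_D[OF E(1)] by (simp add: D_diff)
  have sp: "span (insert t E) = span (insert s S)"
  proof -
    have "span (insert t E) = span (insert s E)"
      unfolding t_def using eq_span_insert_eq[of s "s - proj E s" E] proj_in_span by simp
    also have "\<dots> = span (insert s S)" using E(2) by (simp add: span_insert)
    finally show ?thesis .
  qed
  show ?case
  proof (cases "t = 0")
    case True
    then have "span E = span (insert s S)" using sp by (simp add: span_insert_0)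
    then show ?thesis using E(1) by blast
  next
    case False
    define n where "n = sqrt (Re (H t t))"
    have "Re (H t t) \<noteq> 0" using H_eq_0[OF tD] False Im_H_self[OF tD] by (auto simp: complex_eq_iff)
    then have n: "n > 0" "n * n = Re (H t t)" using H_nonneg[OF tD] by (auto simp: n_def)
    have Htt: "H t t = complex_of_real (n * n)" using n(2) Im_H_self[OF tD] by (simp add: complex_eq_iff)
    define u where "u = sc (1 / n) t"
    have uD: "u \<in> D" unfolding u_def using tD by (rule D_scale)
    have uu: "H u u = 1" unfolding u_def using tD n(1) Htt by (simp add: H_scale H_scale_right D_scale)
    have te: "H t e = 0" if "e \<in> E" for e
      unfolding t_def using proj_orthogonal[OF E(1) sD span_base[OF that]] .
    have ue: "H u e = 0" "H e u = 0" if "e \<in> E" for e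
    proof -
      have "e \<in> D" using that ED by blast
      then show "H u e = 0" using te[OF that] tD by (simp add: u_def H_scale)
      then show "H e u = 0" using H_cnj[OF uD \<open>e \<in> D\<close>] by simp
    qed
    have "orthonormal (insert u E)"
      using E(1) uD uu ue unfolding orthonormal_def by auto
    moreover have "span (insert u E) = span (insert t E)"
    proof -
      have "t = sc n u" using n(1) by (simp add: u_def)
      then have "t \<in> span (insert u E)" by (metis insertI1 span_base span_scale)
      moreover have "u \<in> span (insert t E)" unfolding u_def by (intro span_scale span_base) simp
      ultimately show ?thesis
        by (intro antisym span_minimal subspace_span) (auto intro: span_base)
    qed
    ultimately show ?thesis using sp by auto
  qed
qed

lemma orthonormal_basis:
  assumes "subspace U" "U \<subseteq> span S" "finite S" "U \<subseteq> D"
  shows "\<exists>E. orthonormal E \<and> span E = U"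
proof -
  obtain B where B: "B \<subseteq> U" "independent B" "U \<subseteq> span B" using maximal_independent_subset by blast
  have "finite B" using independent_span_bound[OF assms(3) B(2)] B(1) assms(2) by blast
  moreover have "span B = U" using B span_minimal[OF B(1) assms(1)] by blast
  ultimately show ?thesis using gram_schmidt[of B] B(1) assms(4) by auto
qed

lemma orthonormal_independent:
  assumes E: "orthonormal E"
  shows "independent E"
proof
  assume "dependent E"
  then obtain e where e: "e \<in> E" "e \<in> span (E - {e})" unfolding dependent_def by blast
  have "H e e = 0"
    by (rule span_orthogonal[OF _ _ _ e(2)]) (use E e(1) in \<open>auto simp: orthonormal_def\<close>)
  then show False using E e(1) by (auto simp: orthonormal_def)
qed

end

section \<open>Linear algebra in a finite dimensional complex space\<close>

interpretation cv: vector_space "scaleC :: complex \<Rightarrow> 'v \<Rightarrow> 'v::fd_complex_space"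
  by (rule vector_space_scaleC)

interpretation cf: vector_space "(*) :: complex \<Rightarrow> complex \<Rightarrow> complex"
  by unfold_locales (simp_all add: algebra_simps)

abbreviation clin :: "('v::fd_complex_space \<Rightarrow> complex) \<Rightarrow> bool" where
  "clin \<equiv> Vector_Spaces.linear scaleC (*)"

abbreviation cendo :: "('v::fd_complex_space \<Rightarrow> 'v) \<Rightarrow> bool" where
  "cendo \<equiv> Vector_Spaces.linear scaleC scaleC"

lemma clinI:
  assumes "\<And>x y. l (x + y) = l x + l y" "\<And>c x. l (c *\<^sub>C x) = c * l x"
  shows "clin l"
  by unfold_locales (use assms in auto)

lemma cendoI:
  assumes "\<And>x y. f (x + y) = f x + f y" "\<And>c x. f (c *\<^sub>C x) = c *\<^sub>C f x"
  shows "cendo f"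
  by unfold_locales (use assms in auto)

lemma clin_module_hom: "clin l \<Longrightarrow> module_hom scaleC (*) l"
  and cendo_module_hom: "cendo f \<Longrightarrow> module_hom scaleC scaleC f"
  by (simp_all add: Vector_Spaces.linear_def)

lemmas clin_add = module_hom.add[OF clin_module_hom]
  and clin_scale = module_hom.scale[OF clin_module_hom]
  and clin_0 = module_hom.zero[OF clin_module_hom]
  and clin_sum = module_hom.sum[OF clin_module_hom]

lemmas cendo_add = module_hom.add[OF cendo_module_hom]
  and cendo_scale = module_hom.scale[OF cendo_module_hom]
  and cendo_sum = module_hom.sum[OF cendo_module_hom]

lemma cendo_comp: "cendo f \<Longrightarrow> cendo g \<Longrightarrow> cendo (\<lambda>x. f (g x))"
  by (intro cendoI) (simp_all add: cendo_add cendo_scale)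

lemma clin_comp: "clin f \<Longrightarrow> cendo g \<Longrightarrow> clin (\<lambda>x. f (g x))"
  by (intro clinI) (simp_all add: cendo_add cendo_scale clin_add clin_scale)

lemma scaleC_eq_scaleR: "c *\<^sub>C x = Re c *\<^sub>R x + Im c *\<^sub>R (\<i> *\<^sub>C (x::'v::fd_complex_space))"
proof -
  have "c = complex_of_real (Re c) + complex_of_real (Im c) * \<i>" by (simp add: complex_eq_iff)
  then have "c *\<^sub>C x = (complex_of_real (Re c) + complex_of_real (Im c) * \<i>) *\<^sub>C x" by simp
  also have "\<dots> = Re c *\<^sub>R x + Im c *\<^sub>R (\<i> *\<^sub>C x)"
    by (simp only: scaleC_add_left scaleC_scaleC[symmetric] scaleC_of_real)
  finally show ?thesis .
qed

lemma coordinates_exist: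
  obtains B :: "'v::fd_complex_space set" and r :: "'v \<Rightarrow> 'v \<Rightarrow> complex"
  where "finite B" "\<And>b. clin (r b)" "\<And>x. (\<Sum>b\<in>B. r b x *\<^sub>C b) = x"
    "\<And>c. (\<Sum>b\<in>B. c b *\<^sub>C b) = 0 \<Longrightarrow> \<forall>b\<in>B. c b = 0"
proof -
  obtain B0 :: "'v set" where B0: "finite B0" "\<And>x. \<exists>c. x = (\<Sum>b\<in>B0. c b *\<^sub>C b)"
    using finite_dim_scaleC by metis
  obtain B where B: "B \<subseteq> B0" "cv.independent B" "B0 \<subseteq> cv.span B"
    using cv.maximal_independent_subset[of B0] by blast
  have fin: "finite B" using B(1) B0(1) finite_subset by blast
  have "cv.span B = UNIV"
  proof -
    have "x \<in> cv.span B" for x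
    proof -
      obtain c where "x = (\<Sum>b\<in>B0. c b *\<^sub>C b)" using B0(2) by blast
      then show ?thesis using B(3) by (auto intro!: cv.span_sum cv.span_scale)
    qed
    then show ?thesis by auto
  qed
  then have sp: "x \<in> cv.span B" for x by simp
  define r where "r = (\<lambda>b x. cv.representation B x b)"
  show thesis
  proof
    show "finite B" by (rule fin)
    show "clin (r b)" for b
      unfolding r_def using B(2) sp by (intro clinI) (simp_all add: cv.representation_add cv.representation_scale)
    show "(\<Sum>b\<in>B. r b x *\<^sub>C b) = x" for x
      unfolding r_def using cv.sum_representation_eq[OF B(2) sp fin] by simp
    show "\<forall>b\<in>B. c b = 0" if "(\<Sum>b\<in>B. c b *\<^sub>C b) = 0" for c
      using B(2) that fin unfolding cv.dependent_finite[OF fin] by blast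
  qed
qed

text \<open>The given norm is only real homogeneous, so multiplication by \<i> need not be
  isometric; the second term accounts for it.\<close>

lemma norm_scaleC_le: "norm (c *\<^sub>C x) \<le> cmod c * (norm x + norm (\<i> *\<^sub>C (x::'v::fd_complex_space)))"
proof -
  have "norm (c *\<^sub>C x) \<le> \<bar>Re c\<bar> * norm x + \<bar>Im c\<bar> * norm (\<i> *\<^sub>C x)"
    unfolding scaleC_eq_scaleR[of c] by (rule order_trans[OF norm_triangle_ineq]) simp
  also have "\<dots> \<le> cmod c * norm x + cmod c * norm (\<i> *\<^sub>C x)"
    by (intro add_mono mult_right_mono abs_Re_le_cmod abs_Im_le_cmod norm_ge_zero)
  finally show ?thesis by (simp add: distrib_left)
qed

text \<open>Otherwise there are vectors tending to 0 whose coordinates have absolute sum 1. A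
  subsequence of the coordinates converges, and the limit is a nontrivial relation between the basis
  vectors.\<close>

lemma coordinates_bounded:
  fixes B :: "'v::fd_complex_space set"
  assumes B: "finite B" "\<And>b. clin (r b)" "\<And>x. (\<Sum>b\<in>B. r b x *\<^sub>C b) = x"
    "\<And>c. (\<Sum>b\<in>B. c b *\<^sub>C b) = 0 \<Longrightarrow> \<forall>b\<in>B. c b = 0"
  shows "\<exists>C. \<forall>x. (\<Sum>b\<in>B. cmod (r b x)) \<le> C * norm x"
proof (rule ccontr)
  define N where "N = (\<lambda>x. \<Sum>b\<in>B. cmod (r b x))"
  assume "\<not> ?thesis"
  then have "\<forall>n::nat. \<exists>x. N x > real (Suc n) * norm x" unfolding N_def not_le[symmetric] by blast
  then obtain x where x: "\<And>n::nat. N (x n) > real (Suc n) * norm (x n)" by metis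
  have rscale: "r b (t *\<^sub>R y) = complex_of_real t * r b y" for b t y
    using clin_scale[OF B(2), of b "complex_of_real t" y] by (simp add: scaleC_of_real)
  have Nscale: "N (t *\<^sub>R y) = \<bar>t\<bar> * N y" for t y
    unfolding N_def by (simp add: rscale norm_mult sum_distrib_left)
  have Npos: "N (x n) > 0" for n
    using x[of n] mult_nonneg_nonneg[OF of_nat_0_le_iff[of "Suc n"] norm_ge_zero[of "x n"]] by linarith
  define y where "y = (\<lambda>n. (1 / N (x n)) *\<^sub>R x n)"
  have Ny: "N (y n) = 1" for n unfolding y_def Nscale using Npos[of n] by simp
  have ny: "norm (y n) \<le> inverse (real (Suc n))" for n
  proof -
    have "norm (y n) = norm (x n) / N (x n)" using Npos[of n] by (simp add: y_def)
    also have "\<dots> \<le> inverse (real (Suc n))"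
      using x[of n] Npos[of n] by (simp add: field_simps)
    finally show ?thesis .
  qed
  have y0: "y \<longlonglongrightarrow> 0"
    by (rule Lim_null_comparison[OF _ LIMSEQ_inverse_real_of_nat]) (rule always_eventually, rule allI, rule ny)
  have le1: "cmod (r b (y n)) \<le> 1" if "b \<in> B" for b n
    using member_le_sum[OF that, of "\<lambda>b. cmod (r b (y n))"] B(1) Ny[of n] by (simp add: N_def)
  have "\<forall>d\<subseteq>B. \<exists>l::'v\<Rightarrow>complex. \<exists>s::nat\<Rightarrow>nat. strict_mono s \<and>
      (\<forall>e>0. eventually (\<lambda>n. \<forall>i\<in>d. dist (r i (y (s n))) (l i) < e) sequentially)"
    by (rule compact_lemma_general[where f="\<lambda>n b. r b (y n)" and proj="\<lambda>x k. x k" and unproj="\<lambda>x. x"])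
       (use B(1) le1 in \<open>auto simp: bounded_iff\<close>)
  then obtain l s where ls: "strict_mono s"
    "\<And>e. e > 0 \<Longrightarrow> eventually (\<lambda>n. \<forall>b\<in>B. dist (r b (y (s n))) (l b) < e) sequentially" by blast
  have lim: "(\<lambda>n. r b (y (s n))) \<longlonglongrightarrow> l b" if "b \<in> B" for b
    unfolding tendsto_iff
  proof (intro allI impI)
    fix e :: real assume "e > 0"
    from ls(2)[OF this] show "\<forall>\<^sub>F n in sequentially. dist (r b (y (s n))) (l b) < e"
      by (rule eventually_mono) (use that in auto)
  qed
  have "(\<lambda>n. N (y (s n))) \<longlonglongrightarrow> (\<Sum>b\<in>B. cmod (l b))"
    unfolding N_def by (intro tendsto_sum tendsto_norm lim)
  then have l1: "(\<Sum>b\<in>B. cmod (l b)) = 1" by (simp add: Ny LIMSEQ_const_iff)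
  have sc: "(\<lambda>n. r b (y (s n)) *\<^sub>C b) \<longlonglongrightarrow> l b *\<^sub>C b" if "b \<in> B" for b
  proof -
    have "(\<lambda>n. Re (r b (y (s n))) *\<^sub>R b + Im (r b (y (s n))) *\<^sub>R (\<i> *\<^sub>C b)) \<longlonglongrightarrow> Re (l b) *\<^sub>R b + Im (l b) *\<^sub>R (\<i> *\<^sub>C b)"
      by (intro tendsto_intros lim that)
    then show ?thesis by (simp only: scaleC_eq_scaleR[symmetric])
  qed
  have "(\<lambda>n. \<Sum>b\<in>B. r b (y (s n)) *\<^sub>C b) \<longlonglongrightarrow> (\<Sum>b\<in>B. l b *\<^sub>C b)"
    by (intro tendsto_sum sc)
  then have "(\<lambda>n. y (s n)) \<longlonglongrightarrow> (\<Sum>b\<in>B. l b *\<^sub>C b)" by (simp add: B(3))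
  moreover have "(\<lambda>n. y (s n)) \<longlonglongrightarrow> 0" using LIMSEQ_subseq_LIMSEQ[OF y0 ls(1)] by (simp add: comp_def)
  ultimately have "(\<Sum>b\<in>B. l b *\<^sub>C b) = 0" by (rule LIMSEQ_unique)
  from B(4)[OF this] have "(\<Sum>b\<in>B. cmod (l b)) = 0" by simp
  then show False using l1 by simp
qed

lemma clin_bounded_linear:
  assumes l: "clin (l :: 'v::fd_complex_space \<Rightarrow> complex)"
  shows "bounded_linear l"
proof -
  obtain B :: "'v set" and r where B: "finite B" "\<And>b. clin (r b)" "\<And>x. (\<Sum>b\<in>B. r b x *\<^sub>C b) = x"
    "\<And>c. (\<Sum>b\<in>B. c b *\<^sub>C b) = 0 \<Longrightarrow> \<forall>b\<in>B. c b = 0" by (rule coordinates_exist) (rule that; assumption)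
  obtain C where C: "\<And>x. (\<Sum>b\<in>B. cmod (r b x)) \<le> C * norm x" using coordinates_bounded[OF B] by blast
  define L where "L = (\<Sum>b\<in>B. cmod (l b))"
  have Lb: "cmod (l b) \<le> L" if "b \<in> B" for b unfolding L_def by (rule member_le_sum) (use B that in auto)
  have L0: "L \<ge> 0" unfolding L_def by (rule sum_nonneg) simp
  show ?thesis
  proof (rule bounded_linear_intro)
    show "l (x + y) = l x + l y" for x y using l by (rule clin_add)
    show "l (t *\<^sub>R x) = t *\<^sub>R l x" for t x
      using clin_scale[OF l, of "complex_of_real t" x] by (simp add: scaleC_of_real scaleR_conv_of_real)
    show "norm (l x) \<le> norm x * (C * L)" for x
    proof -
      have "l x = l (\<Sum>b\<in>B. r b x *\<^sub>C b)" by (simp add: B(3))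
      also have "\<dots> = (\<Sum>b\<in>B. r b x * l b)" by (simp add: clin_sum[OF l] clin_scale[OF l])
      finally have "l x = (\<Sum>b\<in>B. r b x * l b)" .
      then have "norm (l x) \<le> (\<Sum>b\<in>B. cmod (r b x) * cmod (l b))"
        using norm_sum[of "\<lambda>b. r b x * l b" B] by (simp add: norm_mult)
      also have "\<dots> \<le> (\<Sum>b\<in>B. cmod (r b x) * L)" by (intro sum_mono mult_left_mono Lb) auto
      also have "\<dots> = (\<Sum>b\<in>B. cmod (r b x)) * L" by (simp add: sum_distrib_right)
      also have "\<dots> \<le> C * norm x * L" using C L0 by (rule mult_right_mono)
      finally show ?thesis by (simp add: mult_ac)
    qed
  qed
qed

lemma cendo_bounded_linear:
  assumes f: "cendo (f :: 'v::fd_complex_space \<Rightarrow> 'v)"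
  shows "bounded_linear f"
proof -
  obtain B :: "'v set" and r where B: "finite B" "\<And>b. clin (r b)" "\<And>x. (\<Sum>b\<in>B. r b x *\<^sub>C b) = x"
    "\<And>c. (\<Sum>b\<in>B. c b *\<^sub>C b) = 0 \<Longrightarrow> \<forall>b\<in>B. c b = 0" by (rule coordinates_exist) (rule that; assumption)
  obtain C where C: "\<And>x. (\<Sum>b\<in>B. cmod (r b x)) \<le> C * norm x" using coordinates_bounded[OF B] by blast
  define q where "q = (\<lambda>b. norm (f b) + norm (\<i> *\<^sub>C f b))"
  define L where "L = (\<Sum>b\<in>B. q b)"
  have q0: "q b \<ge> 0" for b by (simp add: q_def)
  have Lb: "q b \<le> L" if "b \<in> B" for b unfolding L_def by (rule member_le_sum) (use B that q0 in auto)
  have L0: "L \<ge> 0" unfolding L_def by (rule sum_nonneg) (rule q0)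
  show ?thesis
  proof (rule bounded_linear_intro)
    show "f (x + y) = f x + f y" for x y using f by (rule cendo_add)
    show "f (t *\<^sub>R x) = t *\<^sub>R f x" for t x
      using cendo_scale[OF f, of "complex_of_real t" x] by (simp add: scaleC_of_real)
    show "norm (f x) \<le> norm x * (C * L)" for x
    proof -
      have "f x = f (\<Sum>b\<in>B. r b x *\<^sub>C b)" by (simp add: B(3))
      also have "\<dots> = (\<Sum>b\<in>B. r b x *\<^sub>C f b)" by (simp add: cendo_sum[OF f] cendo_scale[OF f])
      finally have "f x = (\<Sum>b\<in>B. r b x *\<^sub>C f b)" .
      then have "norm (f x) \<le> (\<Sum>b\<in>B. norm (r b x *\<^sub>C f b))"
        using norm_sum[of "\<lambda>b. r b x *\<^sub>C f b" B] by simp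
      also have "\<dots> \<le> (\<Sum>b\<in>B. cmod (r b x) * L)"
      proof (rule sum_mono)
        fix b assume "b \<in> B"
        have "norm (r b x *\<^sub>C f b) \<le> cmod (r b x) * q b" unfolding q_def by (rule norm_scaleC_le)
        also have "\<dots> \<le> cmod (r b x) * L" by (rule mult_left_mono) (use Lb[OF \<open>b \<in> B\<close>] in auto)
        finally show "norm (r b x *\<^sub>C f b) \<le> cmod (r b x) * L" .
      qed
      also have "\<dots> = (\<Sum>b\<in>B. cmod (r b x)) * L" by (simp add: sum_distrib_right)
      also have "\<dots> \<le> C * norm x * L" using C L0 by (rule mult_right_mono)
      finally show ?thesis by (simp add: mult_ac)
    qed
  qed
qed

lemma cendo_scaleC: "cendo (\<lambda>x. c *\<^sub>C x)"
  by (rule cendoI) (simp_all add: scaleC_add_right scaleC_scaleC mult.commute)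

lemma clin_continuous_on:
  "clin l \<Longrightarrow> continuous_on S f \<Longrightarrow> continuous_on S (\<lambda>x. l (f x))"
  by (rule bounded_linear.continuous_on[OF clin_bounded_linear])

lemma scaleC_norm_bound:
  obtains K where "K > 0" "\<And>c (x::'v::fd_complex_space). norm (c *\<^sub>C x) \<le> K * cmod c * norm x"
proof -
  obtain k where k: "k > 0" "\<And>x::'v. norm (\<i> *\<^sub>C x) \<le> norm x * k"
    using bounded_linear.pos_bounded[OF cendo_bounded_linear[OF cendo_scaleC]] by blast
  have "norm (c *\<^sub>C x) \<le> (1 + k) * cmod c * norm x" for c and x :: 'v
  proof -
    have "norm (c *\<^sub>C x) \<le> cmod c * (norm x + norm (\<i> *\<^sub>C x))" by (rule norm_scaleC_le)
    also have "\<dots> \<le> cmod c * (norm x + norm x * k)" by (intro mult_left_mono add_left_mono k norm_ge_zero)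
    finally show ?thesis by (simp add: algebra_simps)
  qed
  then show thesis using that[of "1 + k"] k(1) by auto
qed

text \<open>A complex linear operator is determined by its values on a finite basis, with
  coordinates bounded by the norm. So a subsequence converging on the basis vectors converges in
  operator norm.\<close>

lemma cendo_seq_compact:
  fixes f :: "nat \<Rightarrow> 'v::fd_complex_space \<Rightarrow>\<^sub>L 'v"
  assumes f: "\<And>n. cendo (blinfun_apply (f n))" and bd: "\<And>n. norm (f n) \<le> c"
  obtains l s where "strict_mono s" "(\<lambda>n. f (s n)) \<longlonglongrightarrow> l" "cendo (blinfun_apply l)"
proof -
  obtain B :: "'v set" and r where B: "finite B" "\<And>b. clin (r b)" "\<And>x. (\<Sum>b\<in>B. r b x *\<^sub>C b) = x"
    "\<And>c. (\<Sum>b\<in>B. c b *\<^sub>C b) = 0 \<Longrightarrow> \<forall>b\<in>B. c b = 0" by (rule coordinates_exist) (rule that; assumption)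
  obtain C where C: "\<And>x. (\<Sum>b\<in>B. cmod (r b x)) \<le> C * norm x" using coordinates_bounded[OF B] by blast
  obtain K where K: "K > 0" "\<And>c (x::'v). norm (c *\<^sub>C x) \<le> K * cmod c * norm x" by (rule scaleC_norm_bound) (rule that)
  have "bounded (range (\<lambda>n. f n b))" for b
    unfolding bounded_iff
    by (intro exI[of _ "c * norm b"])
       (auto intro!: order_trans[OF norm_blinfun] mult_right_mono bd)
  then have "\<forall>d\<subseteq>B. \<exists>l::'v\<Rightarrow>'v. \<exists>s::nat\<Rightarrow>nat. strict_mono s \<and>
      (\<forall>e>0. eventually (\<lambda>n. \<forall>i\<in>d. dist (f (s n) i) (l i) < e) sequentially)"
    using compact_lemma_general[of B "\<lambda>x k. x k" "\<lambda>n b. f n b" "\<lambda>x. x"] B(1)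
    by (simp add: image_image)
  then obtain L s where ls: "strict_mono s"
    "\<And>e. e > 0 \<Longrightarrow> eventually (\<lambda>n. \<forall>b\<in>B. dist (f (s n) b) (L b) < e) sequentially" by blast
  define l0 where "l0 = (\<lambda>x. \<Sum>b\<in>B. r b x *\<^sub>C L b)"
  have l0: "cendo l0" unfolding l0_def
    by (intro cendoI)
       (simp_all add: clin_add[OF B(2)] clin_scale[OF B(2)] scaleC_add_left sum.distrib cv.scale_sum_right scaleC_scaleC)
  define l where "l = Blinfun l0"
  have la: "blinfun_apply l = l0" unfolding l_def by (rule bounded_linear_Blinfun_apply[OF cendo_bounded_linear[OF l0]])
  have fx: "f n x = (\<Sum>b\<in>B. r b x *\<^sub>C f n b)" for n x
  proof -
    have "f n x = f n (\<Sum>b\<in>B. r b x *\<^sub>C b)" by (simp add: B(3))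
    then show ?thesis by (simp only: cendo_sum[OF f] cendo_scale[OF f])
  qed
  have "(\<lambda>n. f (s n)) \<longlonglongrightarrow> l" unfolding tendsto_iff
  proof (intro allI impI)
    fix e :: real assume e: "e > 0"
    define M where "M = K * (\<bar>C\<bar> + 1)"
    have M: "M > 0" unfolding M_def using K(1) by (intro mult_pos_pos) auto
    define d where "d = e / (2 * M)"
    have d: "d > 0" unfolding d_def using e M by simp
    show "eventually (\<lambda>n. dist (f (s n)) l < e) sequentially" using ls(2)[OF d]
    proof (rule eventually_mono)
      fix n assume n: "\<forall>b\<in>B. dist (f (s n) b) (L b) < d"
      have "norm (f (s n) - l) \<le> e/2"
      proof (rule norm_blinfun_bound)
        fix x
        have "(f (s n) - l) x = (\<Sum>b\<in>B. r b x *\<^sub>C (f (s n) b - L b))"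
          unfolding blinfun.diff_left la l0_def by (subst fx) (simp add: cv.scale_right_diff_distrib sum_subtractf)
        also have "norm \<dots> \<le> (\<Sum>b\<in>B. norm (r b x *\<^sub>C (f (s n) b - L b)))" by (rule norm_sum)
        also have "\<dots> \<le> (\<Sum>b\<in>B. K * cmod (r b x) * d)"
        proof (rule sum_mono)
          fix b assume "b \<in> B"
          have "norm (r b x *\<^sub>C (f (s n) b - L b)) \<le> K * cmod (r b x) * norm (f (s n) b - L b)" by (rule K(2))
          also have "\<dots> \<le> K * cmod (r b x) * d"
            using n \<open>b \<in> B\<close> K(1) by (intro mult_left_mono) (auto simp: dist_norm less_imp_le)
          finally show "norm (r b x *\<^sub>C (f (s n) b - L b)) \<le> K * cmod (r b x) * d" .
        qed
        also have "\<dots> = K * d * (\<Sum>b\<in>B. cmod (r b x))" by (simp add: sum_distrib_left sum_distrib_right mult_ac)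
        also have "\<dots> \<le> K * d * ((\<bar>C\<bar> + 1) * norm x)"
        proof (intro mult_left_mono)
          have "C * norm x \<le> (\<bar>C\<bar> + 1) * norm x" by (intro mult_right_mono) auto
          then show "(\<Sum>b\<in>B. cmod (r b x)) \<le> (\<bar>C\<bar> + 1) * norm x" using C[of x] by linarith
        qed (use K d in auto)
        also have "\<dots> = M * d * norm x" by (simp add: M_def mult_ac)
        also have "M * d = e/2" using M by (simp add: d_def)
        finally show "norm ((f (s n) - l) x) \<le> e/2 * norm x" .
      qed (use e in auto)
      then show "dist (f (s n)) l < e" using e by (simp add: dist_norm)
    qed
  qed
  then show thesis using that[of s l] ls(1) l0 la by simp
qed

section \<open>The general linear group\<close>

lemma GL_carrier: "g \<in> carrier GL \<longleftrightarrow> cendo (blinfun_apply g) \<and> bij (blinfun_apply g)"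
  by (simp add: GL_def)

lemma GL_mult: "g \<otimes>\<^bsub>GL\<^esub> h = g o\<^sub>L h" and GL_one: "\<one>\<^bsub>GL\<^esub> = id_blinfun"
  by (simp_all add: GL_def)

lemma blinfun_eq_iff: "f = g \<longleftrightarrow> (\<forall>x. blinfun_apply f x = blinfun_apply g x)"
  by (auto intro: blinfun_eqI)

lemma blinfun_compose_assoc: "(f o\<^sub>L g) o\<^sub>L h = f o\<^sub>L (g o\<^sub>L h)"
  by (simp add: blinfun_eq_iff)

lemma blinfun_compose_fun: "blinfun_apply (f o\<^sub>L g) = (\<lambda>x. blinfun_apply f (blinfun_apply g x))"
  by auto

lemma GL_I:
  assumes "cendo (blinfun_apply g)" "g o\<^sub>L k = id_blinfun" "k o\<^sub>L g = id_blinfun"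
  shows "g \<in> carrier GL"
proof -
  have "bij (blinfun_apply g)"
  proof (rule o_bij[of "blinfun_apply k"])
    show "blinfun_apply k \<circ> blinfun_apply g = id" using assms(3) by (auto simp: blinfun_eq_iff)
    show "blinfun_apply g \<circ> blinfun_apply k = id" using assms(2) by (auto simp: blinfun_eq_iff)
  qed
  then show ?thesis using assms(1) by (simp add: GL_carrier)
qed

lemma GL_inverse_exists:
  assumes "g \<in> carrier GL"
  shows "\<exists>k\<in>carrier GL. k o\<^sub>L g = id_blinfun \<and> g o\<^sub>L k = id_blinfun"
proof -
  have g: "cendo (blinfun_apply g)" "bij (blinfun_apply g)" using assms by (auto simp: GL_carrier)
  define f where "f = inv_into UNIV (blinfun_apply g)"
  have fg: "f (g x) = x" "g (f x) = x" for x
    using g(2) by (simp_all add: f_def bij_is_inj bij_is_surj surj_f_inv_f)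
  have f: "cendo f"
    by (rule cendoI; rule injD[OF bij_is_inj[OF g(2)]]) (simp_all add: fg cendo_add[OF g(1)] cendo_scale[OF g(1)])
  define k where "k = Blinfun f"
  have k: "blinfun_apply k = f" unfolding k_def by (rule bounded_linear_Blinfun_apply[OF cendo_bounded_linear[OF f]])
  have "k o\<^sub>L g = id_blinfun" "g o\<^sub>L k = id_blinfun" by (auto intro!: blinfun_eqI simp: k fg)
  moreover have "k \<in> carrier GL" by (rule GL_I[OF _ calculation]) (simp add: k f)
  ultimately show ?thesis by blast
qed

lemma group_GL: "group (GL :: ('v::fd_complex_space \<Rightarrow>\<^sub>L 'v) monoid)"
proof (rule groupI)
  fix x y z :: "'v \<Rightarrow>\<^sub>L 'v" assume x: "x \<in> carrier GL" and y: "y \<in> carrier GL" and z: "z \<in> carrier GL"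
  show "x \<otimes>\<^bsub>GL\<^esub> y \<in> carrier GL"
    using x y bij_comp[of "blinfun_apply y" "blinfun_apply x"]
    by (simp add: GL_carrier GL_mult blinfun_compose_fun cendo_comp comp_def)
  show "x \<otimes>\<^bsub>GL\<^esub> y \<otimes>\<^bsub>GL\<^esub> z = x \<otimes>\<^bsub>GL\<^esub> (y \<otimes>\<^bsub>GL\<^esub> z)" by (simp add: GL_mult blinfun_compose_assoc)
  show "\<one>\<^bsub>GL\<^esub> \<otimes>\<^bsub>GL\<^esub> x = x" by (auto simp: GL_mult GL_one intro!: blinfun_eqI)
  show "\<exists>y\<in>carrier GL. y \<otimes>\<^bsub>GL\<^esub> x = \<one>\<^bsub>GL\<^esub>" using GL_inverse_exists[OF x] by (auto simp: GL_mult GL_one)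
next
  show "\<one>\<^bsub>GL\<^esub> \<in> carrier (GL :: ('v \<Rightarrow>\<^sub>L 'v) monoid)"
    by (rule GL_I[of _ id_blinfun]) (auto simp: GL_one intro!: cendoI blinfun_eqI)
qed

lemma GL_inv_apply:
  assumes "g \<in> carrier GL"
  shows "blinfun_apply (inv\<^bsub>GL\<^esub> g) (blinfun_apply g x) = x" "blinfun_apply g (blinfun_apply (inv\<^bsub>GL\<^esub> g) x) = x"
proof -
  interpret GL: group "GL :: ('a \<Rightarrow>\<^sub>L 'a) monoid" by (rule group_GL)
  have "inv\<^bsub>GL\<^esub> g o\<^sub>L g = id_blinfun" "g o\<^sub>L inv\<^bsub>GL\<^esub> g = id_blinfun"
    using GL.l_inv[OF assms] GL.r_inv[OF assms] by (simp_all add: GL_mult GL_one)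
  then show "blinfun_apply (inv\<^bsub>GL\<^esub> g) (blinfun_apply g x) = x" "blinfun_apply g (blinfun_apply (inv\<^bsub>GL\<^esub> g) x) = x"
    by (simp_all add: blinfun_eq_iff)
qed

lemma GL_inv_eqI:
  assumes "g \<in> carrier GL" "k o\<^sub>L g = id_blinfun" "k \<in> carrier GL"
  shows "inv\<^bsub>GL\<^esub> g = k"
  using group.inv_equality[OF group_GL, of k g] assms by (simp add: GL_mult GL_one)

section \<open>Polynomials under a compact linear group\<close>

interpretation fv: vector_space "fun_scale :: complex \<Rightarrow> ('b \<Rightarrow> complex) \<Rightarrow> ('b \<Rightarrow> complex)"
  by unfold_locales (auto simp: fun_scale_def fun_eq_iff algebra_simps)

definition fun_algebra :: "('x \<Rightarrow> complex) set \<Rightarrow> bool" where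
  "fun_algebra A \<longleftrightarrow> (\<forall>c. (\<lambda>x. c) \<in> A) \<and> (\<forall>f\<in>A. \<forall>h\<in>A. (\<lambda>x. f x + h x) \<in> A \<and> (\<lambda>x. f x * h x) \<in> A)"

lemma fun_algebra_const: "fun_algebra A \<Longrightarrow> (\<lambda>x. c) \<in> A"
  and fun_algebra_add: "fun_algebra A \<Longrightarrow> f \<in> A \<Longrightarrow> h \<in> A \<Longrightarrow> (\<lambda>x. f x + h x) \<in> A"
  and fun_algebra_mult: "fun_algebra A \<Longrightarrow> f \<in> A \<Longrightarrow> h \<in> A \<Longrightarrow> (\<lambda>x. f x * h x) \<in> A"
  by (simp_all add: fun_algebra_def)

lemma fun_algebra_cmult: "fun_algebra A \<Longrightarrow> f \<in> A \<Longrightarrow> (\<lambda>x. c * f x) \<in> A"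
  by (simp add: fun_algebra_mult fun_algebra_const)

lemma fun_algebra_diff: "fun_algebra A \<Longrightarrow> f \<in> A \<Longrightarrow> h \<in> A \<Longrightarrow> (\<lambda>x. f x - h x) \<in> A"
  using fun_algebra_add[of A f "\<lambda>x. (-1) * h x"] fun_algebra_cmult[of A h "-1"] by simp

lemma fun_algebra_sum:
  assumes "fun_algebra A" "\<And>i. i \<in> I \<Longrightarrow> f i \<in> A"
  shows "(\<lambda>x. \<Sum>i\<in>I. f i x) \<in> A"
  using assms(2)
  by (induction I rule: infinite_finite_induct) (simp_all add: fun_algebra_const[OF assms(1)] fun_algebra_add[OF assms(1)])

text \<open>These are the finite sums of terms \<open>a g * f x\<close>. Translates of this shape
  span a finite dimensional space, and their average over the group is a finite combination of
  elements of \<open>A\<close>, with no passage to a closure.\<close>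

inductive_set sepfun :: "'g::topological_space set \<Rightarrow> ('x \<Rightarrow> complex) set \<Rightarrow> ('g \<Rightarrow> 'x \<Rightarrow> complex) set"
  for G A where
  prod: "continuous_on G a \<Longrightarrow> f \<in> A \<Longrightarrow> (\<lambda>g x. a g * f x) \<in> sepfun G A"
| add: "F \<in> sepfun G A \<Longrightarrow> F' \<in> sepfun G A \<Longrightarrow> (\<lambda>g x. F g x + F' g x) \<in> sepfun G A"

lemma sepfun_sum:
  assumes A: "fun_algebra A" and "\<And>b. b \<in> B \<Longrightarrow> continuous_on G (a b)" "\<And>b. b \<in> B \<Longrightarrow> f b \<in> A"
  shows "(\<lambda>g x. \<Sum>b\<in>B. a b g * f b x) \<in> sepfun G A"
proof -
  have 0: "(\<lambda>g x. 0 :: complex) \<in> sepfun G A"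
    using sepfun.prod[of G "\<lambda>g. 0" "\<lambda>x. 0" A] fun_algebra_const[OF A] by simp
  show ?thesis using assms(2,3)
    by (induction B rule: infinite_finite_induct) (simp_all add: 0 sepfun.add sepfun.prod)
qed

lemma sepfun_mult:
  assumes A: "fun_algebra A" and F: "F \<in> sepfun G A" and F': "F' \<in> sepfun G A"
  shows "(\<lambda>g x. F g x * F' g x) \<in> sepfun G A"
  using F
proof induction
  case (prod a f)
  show ?case using F'
  proof induction
    case (prod a' f')
    have "(\<lambda>g x. (a g * a' g) * (f x * f' x)) \<in> sepfun G A"
      by (rule sepfun.prod) (use \<open>continuous_on G a\<close> \<open>f \<in> A\<close> prod fun_algebra_mult[OF A] in \<open>auto intro: continuous_intros\<close>)
    then show ?case by (simp add: mult_ac)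
  next
    case (add F1 F2)
    then show ?case using sepfun.add[OF add.IH] by (simp add: distrib_left)
  qed
next
  case (add F1 F2)
  then show ?case using sepfun.add[OF add.IH] by (simp add: distrib_right)
qed

lemma sepfun_continuous: "F \<in> sepfun G A \<Longrightarrow> continuous_on G (\<lambda>g. F g x)"
  by (induction rule: sepfun.induct) (auto intro!: continuous_intros)

lemma (in compact_group) sepfun_cmean:
  assumes A: "fun_algebra A" and F: "F \<in> sepfun K A"
  shows "(\<lambda>x. cmean (\<lambda>g. F g x)) \<in> A"
  using F
proof induction
  case (prod a f)
  have "cmean (\<lambda>g. a g * f x) = cmean a * f x" for x
    using cmean_cmult[OF prod(1), of "f x"] by (simp add: mult.commute)
  then show ?case using fun_algebra_cmult[OF A prod(2)] by simp
next
  case (add F1 F2)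
  then show ?case by (simp add: cmean_add sepfun_continuous fun_algebra_add[OF A])
qed

lemma sepfun_span:
  assumes "F \<in> sepfun G A"
  shows "\<exists>S. finite S \<and> S \<subseteq> A \<and> (\<forall>g. F g \<in> fv.span S)"
  using assms
proof induction
  case (prod a f)
  have "(\<lambda>x. a g * f x) \<in> fv.span {f}" for g
    using fv.span_scale[OF fv.span_base[of f "{f}"], of "a g"] by (simp add: fun_scale_def)
  then show ?case using prod by (intro exI[of _ "{f}"]) auto
next
  case (add F1 F2)
  then obtain S1 S2 where S: "finite S1" "S1 \<subseteq> A" "\<And>g. F1 g \<in> fv.span S1" "finite S2" "S2 \<subseteq> A" "\<And>g. F2 g \<in> fv.span S2"
    by blast
  have "(\<lambda>x. F1 g x + F2 g x) \<in> fv.span (S1 \<union> S2)" for g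
  proof -
    have "F1 g \<in> fv.span (S1 \<union> S2)" "F2 g \<in> fv.span (S1 \<union> S2)"
      using S(3)[of g] S(6)[of g] fv.span_mono[of S1 "S1 \<union> S2"] fv.span_mono[of S2 "S1 \<union> S2"] by auto
    from fv.span_add[OF this] show ?thesis by (simp add: plus_fun_def)
  qed
  then show ?case using S by (intro exI[of _ "S1 \<union> S2"]) auto
qed

lemma fun_algebra_hol_poly: "fun_algebra (hol_poly :: ('v::fd_complex_space \<Rightarrow> complex) set)"
  by (simp add: fun_algebra_def hol_poly.intros)

lemmas hol_poly_diff = fun_algebra_diff[OF fun_algebra_hol_poly]
  and hol_poly_cmult = fun_algebra_cmult[OF fun_algebra_hol_poly]
  and hol_poly_sum = fun_algebra_sum[OF fun_algebra_hol_poly]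

lemma hol_poly_continuous_on: "p \<in> hol_poly \<Longrightarrow> continuous_on S p"
proof (induction rule: hol_poly.induct)
  case (linear l)
  then show ?case using clin_continuous_on[of l S "\<lambda>x. x"] by simp
qed (auto intro!: continuous_intros)

lemma hol_poly_compose: "p \<in> hol_poly \<Longrightarrow> cendo f \<Longrightarrow> (\<lambda>x. p (f x)) \<in> hol_poly"
  by (induction rule: hol_poly.induct) (auto intro: hol_poly.intros clin_comp)

text \<open>For a linear functional the argument is expanded in a basis, so that the dependence on
  \<open>g\<close> sits in matrix coefficients; sums and products preserve the form.\<close>

lemma hol_poly_sepfun:
  fixes G :: "('v::fd_complex_space \<Rightarrow>\<^sub>L 'v) set"
  assumes "p \<in> hol_poly" and G: "\<And>g. g \<in> G \<Longrightarrow> cendo (blinfun_apply g)"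
  shows "\<exists>F\<in>sepfun G hol_poly. \<forall>g\<in>G. \<forall>x. p (blinfun_apply g x) = F g x"
  using assms(1)
proof induction
  case (const c)
  have "(\<lambda>g x. c * 1) \<in> sepfun G hol_poly" by (intro sepfun.prod continuous_intros hol_poly.const)
  then show ?case by force
next
  case (linear l)
  obtain B :: "'v set" and r where B: "finite B" "\<And>b. clin (r b)" "\<And>x. (\<Sum>b\<in>B. r b x *\<^sub>C b) = x"
    "\<And>c. (\<Sum>b\<in>B. c b *\<^sub>C b) = 0 \<Longrightarrow> \<forall>b\<in>B. c b = 0" by (rule coordinates_exist) (rule that; assumption)
  have "(\<lambda>g x. \<Sum>b\<in>B. l (blinfun_apply g b) * r b x) \<in> sepfun G hol_poly"
    by (intro sepfun_sum fun_algebra_hol_poly hol_poly.linear B(2) clin_continuous_on[OF linear] continuous_intros)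
  moreover have "l (blinfun_apply g x) = (\<Sum>b\<in>B. l (blinfun_apply g b) * r b x)" if "g \<in> G" for g x
  proof -
    have "l (blinfun_apply g x) = l (blinfun_apply g (\<Sum>b\<in>B. r b x *\<^sub>C b))" by (simp add: B(3))
    also have "\<dots> = (\<Sum>b\<in>B. r b x * l (blinfun_apply g b))"
      by (simp only: cendo_sum[OF G[OF that]] cendo_scale[OF G[OF that]] clin_sum[OF linear] clin_scale[OF linear])
    finally show ?thesis by (simp add: mult.commute)
  qed
  ultimately show ?case by (intro bexI) auto
next
  case (add p q)
  then obtain F F' where "F \<in> sepfun G hol_poly" "F' \<in> sepfun G hol_poly"
    "\<forall>g\<in>G. \<forall>x. p (blinfun_apply g x) = F g x" "\<forall>g\<in>G. \<forall>x. q (blinfun_apply g x) = F' g x" by blast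
  then show ?case by (intro bexI[of _ "\<lambda>g x. F g x + F' g x"] sepfun.add) auto
next
  case (mult p q)
  then obtain F F' where "F \<in> sepfun G hol_poly" "F' \<in> sepfun G hol_poly"
    "\<forall>g\<in>G. \<forall>x. p (blinfun_apply g x) = F g x" "\<forall>g\<in>G. \<forall>x. q (blinfun_apply g x) = F' g x" by blast
  then show ?case by (intro bexI[of _ "\<lambda>g x. F g x * F' g x"] sepfun_mult fun_algebra_hol_poly) auto
qed

section \<open>Compact linear groups\<close>

locale lin_group =
  fixes G :: "('v::fd_complex_space \<Rightarrow>\<^sub>L 'v) set"
  assumes subgroup_G: "subgroup G GL" and compact_G: "compact G"
begin

lemma in_GL: "g \<in> G \<Longrightarrow> g \<in> carrier GL"
  using subgroup.subset[OF subgroup_G] by blast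

lemma cendo_G: "g \<in> G \<Longrightarrow> cendo (blinfun_apply g)"
  using in_GL by (simp add: GL_carrier)

lemma compose_in: "g \<in> G \<Longrightarrow> k \<in> G \<Longrightarrow> g o\<^sub>L k \<in> G"
  using subgroup.m_closed[OF subgroup_G] by (simp add: GL_mult)

lemma id_in: "id_blinfun \<in> G"
  using subgroup.one_closed[OF subgroup_G] by (simp add: GL_one)

lemma inv_in: "g \<in> G \<Longrightarrow> inv\<^bsub>GL\<^esub> g \<in> G"
  using subgroup.m_inv_closed[OF subgroup_G] by simp

lemma inv_apply: "g \<in> G \<Longrightarrow> blinfun_apply (inv\<^bsub>GL\<^esub> g) (blinfun_apply g x) = x"
  "g \<in> G \<Longrightarrow> blinfun_apply g (blinfun_apply (inv\<^bsub>GL\<^esub> g) x) = x"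
  using GL_inv_apply in_GL by blast+

lemma inv_compose: "g \<in> G \<Longrightarrow> inv\<^bsub>GL\<^esub> g o\<^sub>L g = id_blinfun" "g \<in> G \<Longrightarrow> g o\<^sub>L inv\<^bsub>GL\<^esub> g = id_blinfun"
  by (simp_all add: blinfun_eq_iff inv_apply)

sublocale compact_group G "(o\<^sub>L)" id_blinfun
proof
  show "continuous_on (G \<times> G) (\<lambda>(x, y). x o\<^sub>L y)"
    unfolding case_prod_unfold by (intro continuous_intros)
  show "\<exists>y\<in>G. x o\<^sub>L y = id_blinfun \<and> y o\<^sub>L x = id_blinfun" if "x \<in> G" for x
    using inv_in[OF that] inv_compose[OF that] by blast
qed (simp_all add: compact_G id_in compose_in blinfun_eq_iff)

lemma hol_poly_sepfun_G:
  assumes "p \<in> hol_poly"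
  obtains F where "F \<in> sepfun G hol_poly" "\<And>g x. g \<in> G \<Longrightarrow> p (blinfun_apply g x) = F g x"
proof (rule bexE[OF hol_poly_sepfun[OF assms cendo_G]])
  show thesis if "F \<in> sepfun G hol_poly" "\<forall>g\<in>G. \<forall>x. p (blinfun_apply g x) = F g x" for F
    by (rule \<open>\<And>F. F \<in> sepfun G hol_poly \<Longrightarrow> (\<And>g x. g \<in> G \<Longrightarrow> p (blinfun_apply g x) = F g x) \<Longrightarrow> thesis\<close>[of F])
      (use that in auto)
qed

lemma continuous_hol_poly_orbit: "p \<in> hol_poly \<Longrightarrow> continuous_on G (\<lambda>g. p (blinfun_apply g x))"
  by (rule continuous_on_compose2[OF hol_poly_continuous_on[of _ UNIV]]) (auto intro!: continuous_intros)

text \<open>The Reynolds operator, which produces invariant polynomials.\<close>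

definition average :: "('v \<Rightarrow> complex) \<Rightarrow> 'v \<Rightarrow> complex" where
  "average p x = cmean (\<lambda>g. p (blinfun_apply g x))"

lemma average_hol_poly:
  assumes p: "p \<in> hol_poly"
  shows "average p \<in> hol_poly"
proof -
  obtain F where F: "F \<in> sepfun G hol_poly" "\<And>g x. g \<in> G \<Longrightarrow> p (blinfun_apply g x) = F g x"
    by (rule hol_poly_sepfun_G[OF p]) (rule that; assumption)
  have "average p = (\<lambda>x. cmean (\<lambda>g. F g x))"
    unfolding average_def by (intro ext cmean_cong continuous_hol_poly_orbit p) (simp add: F(2))
  then show ?thesis using sepfun_cmean[OF fun_algebra_hol_poly F(1)] by simp
qed

lemma average_invariant:
  assumes p: "p \<in> hol_poly" and k: "k \<in> G"
  shows "average p (blinfun_apply k x) = average p x"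
  unfolding average_def using cmean_right[OF continuous_hol_poly_orbit[OF p, of x] k] by simp

end

section \<open>Invariant inner products\<close>

text \<open>The orthonormal basis is a parameter beside the invariant inner product, so that the
  same theory can be instantiated again with an eigenbasis of a positive operator.\<close>

locale unitary_group = lin_group G
  for G :: "('v::fd_complex_space \<Rightarrow>\<^sub>L 'v) set" +
  fixes h :: "'v \<Rightarrow> 'v \<Rightarrow> complex" and E :: "'v set"
  assumes hermitian: "hermitian_space scaleC UNIV h"
    and h_inv: "g \<in> G \<Longrightarrow> h (blinfun_apply g x) (blinfun_apply g y) = h x y"
    and orthonormal_E: "hermitian_space.orthonormal UNIV h E"
    and span_E: "cv.span E = UNIV"

text \<open>Weyl's averaging of the inner product \<open>h0\<close> given by coordinates.
  Definiteness survives because the mean of a nonnegative continuous function is positive as soon as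
  one of its values is.\<close>

lemma (in lin_group) unitary_group_exists: "\<exists>h E. unitary_group G h E"
proof -
  obtain B :: "'v set" and r where B: "finite B" "\<And>b. clin (r b)" "\<And>x. (\<Sum>b\<in>B. r b x *\<^sub>C b) = x"
    "\<And>c. (\<Sum>b\<in>B. c b *\<^sub>C b) = 0 \<Longrightarrow> \<forall>b\<in>B. c b = 0" by (rule coordinates_exist) (rule that; assumption)
  define h0 where "h0 = (\<lambda>x y. \<Sum>b\<in>B. r b x * cnj (r b y))"
  define h where "h = (\<lambda>x y. cmean (\<lambda>g. h0 (blinfun_apply g x) (blinfun_apply g y)))"
  have cont: "continuous_on G (\<lambda>g. h0 (blinfun_apply g x) (blinfun_apply g y))" for x y
    unfolding h0_def by (intro continuous_intros clin_continuous_on[OF B(2)])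
  have h0_add: "h0 (x + y) z = h0 x z + h0 y z" and h0_scale: "h0 (c *\<^sub>C x) z = c * h0 x z"
    and h0_cnj: "h0 y x = cnj (h0 x y)" for x y z c
    subgoal by (simp add: h0_def clin_add[OF B(2)] sum.distrib distrib_right)
    subgoal by (simp add: h0_def clin_scale[OF B(2)] sum_distrib_left mult_ac)
    subgoal by (simp add: h0_def mult.commute)
    done
  have h0_self: "h0 x x = complex_of_real (\<Sum>b\<in>B. (cmod (r b x))\<^sup>2)" for x
    by (simp only: h0_def complex_norm_square of_real_sum)
  have h0_pos: "Re (h0 x x) \<ge> 0" for x unfolding h0_self by (simp add: sum_nonneg)
  have h0_0: "x = 0" if "Re (h0 x x) = 0" for x
  proof -
    have "(\<Sum>b\<in>B. (cmod (r b x))\<^sup>2) = 0" using that unfolding h0_self by simp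
    then have "\<forall>b\<in>B. r b x = 0" using B(1) by (simp add: sum_nonneg_eq_0_iff)
    then have "(\<Sum>b\<in>B. r b x *\<^sub>C b) = 0" by simp
    then show ?thesis by (simp add: B(3))
  qed
  have herm: "hermitian_space scaleC UNIV h"
  proof
    fix x y z :: 'v and c
    show "h (x + y) z = h x z + h y z"
      unfolding h_def blinfun.add_right h0_add by (rule cmean_add[OF cont cont])
    have "h (c *\<^sub>C x) z = cmean (\<lambda>g. c * h0 (blinfun_apply g x) (blinfun_apply g z))"
      unfolding h_def by (rule cmean_cong[OF cont]) (simp add: cendo_scale[OF cendo_G] h0_scale)
    then show "h (c *\<^sub>C x) z = c * h x z" unfolding h_def by (simp add: cmean_cmult[OF cont])
    have "h y x = cmean (\<lambda>g. cnj (h0 (blinfun_apply g x) (blinfun_apply g y)))"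
      unfolding h_def h0_cnj[of "blinfun_apply _ y" "blinfun_apply _ x", symmetric] ..
    then show "h y x = cnj (h x y)" unfolding h_def cmean_cnj[OF cont] .
    show "0 \<le> Re (h x x)"
      unfolding h_def Re_cmean by (rule mean_ge) (use cont h0_pos in \<open>auto intro: continuous_intros\<close>)
    show "x = 0" if hx: "h x x = 0"
    proof (rule h0_0, rule ccontr)
      assume "Re (h0 x x) \<noteq> 0"
      then have "Re (h0 x x) > 0" using h0_pos[of x] by simp
      then have "mean (\<lambda>g. Re (h0 (blinfun_apply g x) (blinfun_apply g x))) > 0"
        by (intro mean_pos[of _ id_blinfun]) (use cont h0_pos id_in in \<open>auto intro: continuous_intros\<close>)
      moreover have "Re (h x x) = mean (\<lambda>g. Re (h0 (blinfun_apply g x) (blinfun_apply g x)))" by (simp add: h_def Re_cmean)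
      ultimately show False using hx by simp
    qed
  qed (simp add: cv.subspace_UNIV)
  have inv: "h (blinfun_apply g x) (blinfun_apply g y) = h x y" if "g \<in> G" for g x y
    unfolding h_def using cmean_right[OF cont[of x y] that] by simp
  interpret H: hermitian_space scaleC UNIV h by (rule herm)
  have "x \<in> cv.span B" for x
  proof -
    have "(\<Sum>b\<in>B. r b x *\<^sub>C b) \<in> cv.span B" by (intro cv.span_sum cv.span_scale cv.span_base)
    then show ?thesis by (simp add: B(3))
  qed
  then have "cv.span B = UNIV" by auto
  then obtain E where "H.orthonormal E" "cv.span E = UNIV" using H.gram_schmidt[OF B(1)] by auto
  then have "unitary_group G h E"
    by (intro unitary_group.intro unitary_group_axioms.intro lin_group_axioms herm inv)
  then show ?thesis by blast
qed

context unitary_group begin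

sublocale H: hermitian_space scaleC UNIV h by (rule hermitian)

lemma h_add: "h (x + y) z = h x z + h y z" and h_scale: "h (c *\<^sub>C x) z = c * h x z"
  and h_add_right: "h z (x + y) = h z x + h z y" and h_scale_right: "h z (c *\<^sub>C x) = cnj c * h z x"
  and h_diff: "h (x - y) z = h x z - h y z" and h_diff_right: "h z (x - y) = h z x - h z y"
  and h_cnj: "h y x = cnj (h x y)" and h_0 [simp]: "h 0 x = 0" "h x 0 = 0"
  and h_nonneg: "Re (h x x) \<ge> 0" and h_eq_0: "h x x = 0 \<Longrightarrow> x = 0"
  and Im_h: "Im (h x x) = 0"
  by (simp_all add: H.H_add H.H_scale H.H_add_right H.H_scale_right H.H_diff H.H_diff_right H.H_nonneg H.H_eq_0 H.Im_H_self)
    (rule H.H_cnj; simp)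

lemma clin_h: "clin (\<lambda>x. h x y)"
  by (rule clinI) (simp_all add: h_add h_scale)

lemma finite_E: "finite E"
  using orthonormal_E by (simp add: H.orthonormal_def)

lemma h_E: "e \<in> E \<Longrightarrow> e' \<in> E \<Longrightarrow> h e e' = (if e = e' then 1 else 0)"
  using orthonormal_E by (simp add: H.orthonormal_def)

lemma expand: "(\<Sum>e\<in>E. h x e *\<^sub>C e) = x"
  using H.proj_id[OF orthonormal_E, of x] span_E by (simp add: H.proj_def)

lemma clin_expand:
  assumes "clin l"
  shows "l x = (\<Sum>e\<in>E. h x e * l e)"
proof -
  have "l x = l (\<Sum>e\<in>E. h x e *\<^sub>C e)" by (simp add: expand)
  then show ?thesis by (simp only: clin_sum[OF assms] clin_scale[OF assms])
qed

lemma cendo_expand: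
  assumes "cendo f"
  shows "f x = (\<Sum>e\<in>E. h x e *\<^sub>C f e)"
proof -
  have "f x = f (\<Sum>e\<in>E. h x e *\<^sub>C e)" by (simp add: expand)
  then show ?thesis by (simp only: cendo_sum[OF assms] cendo_scale[OF assms])
qed

lemma h_expand: "h x y = (\<Sum>e\<in>E. h x e * cnj (h y e))"
proof -
  have "h x y = (\<Sum>e\<in>E. h x e * h e y)" by (rule clin_expand[OF clin_h])
  also have "\<dots> = (\<Sum>e\<in>E. h x e * cnj (h y e))"
    by (intro sum.cong refl arg_cong2[where f="(*)"] h_cnj)
  finally show ?thesis .
qed

lemma h_ext: "(\<And>e. e \<in> E \<Longrightarrow> h x e = h y e) \<Longrightarrow> x = y"
  using expand[of x] expand[of y] by (metis (no_types, lifting) sum.cong)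

lemma continuous_on_h:
  assumes "continuous_on S f" "continuous_on S k"
  shows "continuous_on S (\<lambda>t. h (f t) (k t))"
proof -
  have "continuous_on S (\<lambda>t. \<Sum>e\<in>E. h (f t) e * cnj (h (k t) e))"
    by (intro continuous_intros clin_continuous_on[OF clin_h] assms)
  then show ?thesis by (simp only: h_expand[symmetric])
qed

definition sqn :: "'v \<Rightarrow> real" where "sqn x = Re (h x x)"

lemma h_self: "h x x = complex_of_real (sqn x)"
  by (simp add: sqn_def complex_eq_iff Im_h)

lemma sqn_nonneg: "sqn x \<ge> 0" and sqn_eq_0: "sqn x = 0 \<Longrightarrow> x = 0" and sqn_0 [simp]: "sqn 0 = 0"
  using h_eq_0[of x] h_nonneg by (simp_all add: h_self) (simp_all add: sqn_def)

lemma sqn_expand: "sqn x = (\<Sum>e\<in>E. (cmod (h x e))\<^sup>2)"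
proof -
  have "h x x = complex_of_real (\<Sum>e\<in>E. (cmod (h x e))\<^sup>2)"
    by (subst h_expand) (simp only: complex_norm_square of_real_sum)
  then show ?thesis by (simp add: sqn_def)
qed

lemma cmod_h_E_le: "e \<in> E \<Longrightarrow> (cmod (h x e))\<^sup>2 \<le> sqn x"
  unfolding sqn_expand by (rule member_le_sum) (use finite_E in auto)

lemma sqn_inv: "g \<in> G \<Longrightarrow> sqn (blinfun_apply g x) = sqn x"
  by (simp add: sqn_def h_inv)

lemma sqn_scale: "sqn (c *\<^sub>C x) = (cmod c)\<^sup>2 * sqn x"
proof -
  have "h (c *\<^sub>C x) (c *\<^sub>C x) = (c * cnj c) * h x x" by (simp add: h_scale h_scale_right)
  also have "\<dots> = complex_of_real ((cmod c)\<^sup>2 * sqn x)" by (simp only: complex_norm_square h_self of_real_mult)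
  finally have "h (c *\<^sub>C x) (c *\<^sub>C x) = complex_of_real ((cmod c)\<^sup>2 * sqn x)" .
  then show ?thesis by (simp add: sqn_def)
qed

lemma sqn_diff: "sqn (x - y) = sqn x + sqn y - 2 * Re (h x y)"
  using h_cnj[of y x] by (simp add: sqn_def h_diff h_diff_right)

lemma sqn_add: "sqn (x + y) = sqn x + sqn y + 2 * Re (h x y)"
  using h_cnj[of y x] by (simp add: sqn_def h_add h_add_right)

lemma cmod_h_le: "(cmod (h x y))\<^sup>2 \<le> sqn x * sqn y"
proof (cases "y = 0")
  case False
  then have y: "sqn y > 0" using sqn_nonneg[of y] sqn_eq_0[of y] by fastforce
  define c where "c = h x y / sqn y"
  have "0 \<le> sqn (x - c *\<^sub>C y)" by (rule sqn_nonneg)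
  also have "\<dots> = sqn x + (cmod c)\<^sup>2 * sqn y - 2 * Re (h x (c *\<^sub>C y))" by (simp add: sqn_diff sqn_scale)
  also have "h x (c *\<^sub>C y) = h x y * cnj (h x y) / sqn y" by (simp add: c_def h_scale_right mult.commute)
  also have "\<dots> = complex_of_real ((cmod (h x y))\<^sup>2 / sqn y)" by (simp only: complex_norm_square of_real_divide)
  also have "(cmod c)\<^sup>2 * sqn y = (cmod (h x y))\<^sup>2 / sqn y"
    using y by (simp add: c_def norm_divide power_divide power2_eq_square)
  finally have "(cmod (h x y))\<^sup>2 / sqn y \<le> sqn x" by simp
  then show ?thesis using y by (simp add: divide_le_eq)
qed simp

lemma sqn_le_norm: "\<exists>C>0. \<forall>x. sqn x \<le> C * (norm x)\<^sup>2"
proof -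
  have "\<exists>K. \<forall>x. cmod (h x e) \<le> K * norm x" for e
    using bounded_linear.bounded[OF clin_bounded_linear[OF clin_h[of e]]] by (simp add: mult.commute)
  then obtain K where K: "\<And>e x. cmod (h x e) \<le> K e * norm x" by metis
  have "sqn x \<le> (1 + (\<Sum>e\<in>E. (K e)\<^sup>2)) * (norm x)\<^sup>2" for x
  proof -
    have "sqn x \<le> (\<Sum>e\<in>E. (K e * norm x)\<^sup>2)"
      unfolding sqn_expand by (intro sum_mono power_mono K norm_ge_zero)
    also have "\<dots> = (\<Sum>e\<in>E. (K e)\<^sup>2) * (norm x)\<^sup>2" by (simp add: power_mult_distrib sum_distrib_right)
    also have "\<dots> \<le> (1 + (\<Sum>e\<in>E. (K e)\<^sup>2)) * (norm x)\<^sup>2" by (intro mult_right_mono) auto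
    finally show ?thesis .
  qed
  moreover have "1 + (\<Sum>e\<in>E. (K e)\<^sup>2) > 0" using sum_nonneg[of E "\<lambda>e. (K e)\<^sup>2"] by simp
  ultimately show ?thesis by blast
qed

lemma norm_le_sqn: "\<exists>C>0. \<forall>x. norm x \<le> C * sqrt (sqn x)"
proof -
  obtain K where K: "K > 0" "\<And>c (x::'v). norm (c *\<^sub>C x) \<le> K * cmod c * norm x"
    by (rule scaleC_norm_bound) (rule that; assumption)
  define C where "C = 1 + (\<Sum>e\<in>E. K * norm e)"
  have C: "C > 0" unfolding C_def using K(1) sum_nonneg[of E "\<lambda>e. K * norm e"] by simp
  have "norm x \<le> C * sqrt (sqn x)" for x
  proof -
    have "norm x \<le> (\<Sum>e\<in>E. norm (h x e *\<^sub>C e))" using norm_sum[of "\<lambda>e. h x e *\<^sub>C e" E] by (simp add: expand)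
    also have "\<dots> \<le> (\<Sum>e\<in>E. K * norm e * sqrt (sqn x))"
    proof (rule sum_mono)
      fix e assume e: "e \<in> E"
      have "cmod (h x e) \<le> sqrt (sqn x)" using cmod_h_E_le[OF e] real_le_rsqrt by blast
      then have "K * cmod (h x e) * norm e \<le> K * sqrt (sqn x) * norm e" using K(1) by (intro mult_right_mono mult_left_mono) auto
      then show "norm (h x e *\<^sub>C e) \<le> K * norm e * sqrt (sqn x)" using K(2)[of "h x e" e] by (simp add: mult_ac)
    qed
    also have "\<dots> = (\<Sum>e\<in>E. K * norm e) * sqrt (sqn x)" by (simp add: sum_distrib_right)
    also have "\<dots> \<le> C * sqrt (sqn x)" unfolding C_def using sqn_nonneg by (intro mult_right_mono) auto
    finally show ?thesis .
  qed
  then show ?thesis using C by blast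
qed

end

section \<open>Functions on an orbit\<close>

text \<open>Inverses stay in the bounded set \<open>G\<close>, so writing the difference of two
  inverses as inverse times difference times inverse gives a Lipschitz bound.\<close>

lemma (in lin_group) continuous_inv: "continuous_on G (\<lambda>g. inv\<^bsub>GL\<^esub> g)"
proof -
  obtain C where C: "\<And>g. g \<in> G \<Longrightarrow> norm g \<le> C"
    using compact_imp_bounded[OF compact_G] unfolding bounded_iff by blast
  have C0: "C \<ge> 0" using order_trans[OF norm_ge_zero C[OF id_in]] .
  have "(C * C)-lipschitz_on G (\<lambda>g. inv\<^bsub>GL\<^esub> g)"
  proof (rule lipschitz_onI)
    fix g k assume gk: "g \<in> G" "k \<in> G"
    have "inv\<^bsub>GL\<^esub> g - inv\<^bsub>GL\<^esub> k = inv\<^bsub>GL\<^esub> g o\<^sub>L ((k - g) o\<^sub>L inv\<^bsub>GL\<^esub> k)"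
      by (simp add: blinfun_eq_iff blinfun.diff_left blinfun.diff_right inv_apply gk)
    also have "norm \<dots> \<le> norm (inv\<^bsub>GL\<^esub> g) * (norm (k - g) * norm (inv\<^bsub>GL\<^esub> k))"
      by (rule order_trans[OF norm_blinfun_compose]) (intro mult_left_mono norm_blinfun_compose norm_ge_zero)
    also have "\<dots> \<le> C * (norm (k - g) * C)"
      using C[OF inv_in[OF gk(1)]] C[OF inv_in[OF gk(2)]] C0 by (intro mult_mono) auto
    finally show "dist (inv\<^bsub>GL\<^esub> g) (inv\<^bsub>GL\<^esub> k) \<le> C * C * dist g k"
      by (simp add: dist_norm norm_minus_commute mult_ac)
  qed (use C0 in simp)
  then show ?thesis by (rule lipschitz_on_continuous_on)
qed

locale orbit_space = lin_group G for G :: "('v::fd_complex_space \<Rightarrow>\<^sub>L 'v) set" +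
  fixes v :: 'v
begin

abbreviation M :: "'v set" where "M \<equiv> orbit_of G v"

lemma in_M: "g \<in> G \<Longrightarrow> blinfun_apply g v \<in> M"
  by (simp add: orbit_of_def)

lemma M_E: "x \<in> M \<Longrightarrow> (\<And>g. g \<in> G \<Longrightarrow> x = blinfun_apply g v \<Longrightarrow> thesis) \<Longrightarrow> thesis"
  by (auto simp: orbit_of_def)

lemma v_in_M: "v \<in> M"
  using in_M[OF id_in] by simp

lemma compact_M: "compact M"
  unfolding orbit_of_def by (intro compact_continuous_image continuous_intros compact_G)

lemma M_apply: "g \<in> G \<Longrightarrow> x \<in> M \<Longrightarrow> blinfun_apply g x \<in> M"
  by (erule M_E) (metis blinfun_apply_blinfun_compose compose_in in_M)

lemma M_apply_iff: "g \<in> G \<Longrightarrow> blinfun_apply g x \<in> M \<longleftrightarrow> x \<in> M"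
  using M_apply[of g x] M_apply[OF inv_in, of g "blinfun_apply g x"] inv_apply by auto

lemma cont_fun_pull: "f \<in> cont_fun M \<Longrightarrow> continuous_on G (\<lambda>g. f (blinfun_apply g v))"
  by (rule continuous_on_compose2[of M f]) (auto simp: cont_fun_def in_M intro!: continuous_intros)

lemma cont_fun_ext:
  assumes "f \<in> cont_fun M" "k \<in> cont_fun M" "\<And>g. g \<in> G \<Longrightarrow> f (blinfun_apply g v) = k (blinfun_apply g v)"
  shows "f = k"
proof
  fix x show "f x = k x"
    using assms by (cases "x \<in> M") (auto simp: cont_fun_def elim: M_E)
qed

text \<open>Functions on the orbit are integrated after pulling them back to the group along
  \<open>g \<mapsto> g v\<close>; this is integration against the invariant probability measure of
  the orbit.\<close>

definition L2 :: "('v \<Rightarrow> complex) \<Rightarrow> ('v \<Rightarrow> complex) \<Rightarrow> complex" where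
  "L2 f k = cmean (\<lambda>g. f (blinfun_apply g v) * cnj (k (blinfun_apply g v)))"

lemma L2_cont:
  "f \<in> cont_fun M \<Longrightarrow> k \<in> cont_fun M \<Longrightarrow> continuous_on G (\<lambda>g. f (blinfun_apply g v) * cnj (k (blinfun_apply g v)))"
  by (intro continuous_intros cont_fun_pull)

sublocale L: hermitian_space fun_scale "cont_fun M" L2
proof
  show "fv.subspace (cont_fun M)"
    by (rule fv.subspaceI) (auto simp: cont_fun_def fun_scale_def plus_fun_def zero_fun_def intro!: continuous_intros)
  fix f k l :: "'v \<Rightarrow> complex" and c assume f: "f \<in> cont_fun M"
  show "L2 (f + k) l = L2 f l + L2 k l" if "k \<in> cont_fun M" "l \<in> cont_fun M"
    unfolding L2_def using cmean_add[OF L2_cont[OF f that(2)] L2_cont[OF that]] by (simp add: distrib_right)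
  show "L2 (fun_scale c f) l = c * L2 f l" if "l \<in> cont_fun M"
    unfolding L2_def using cmean_cmult[OF L2_cont[OF f that], of c] by (simp add: fun_scale_def mult.assoc)
  show "L2 k f = cnj (L2 f k)" if "k \<in> cont_fun M"
    unfolding L2_def using cmean_cnj[OF L2_cont[OF f that]] by (simp add: mult.commute)
  show "0 \<le> Re (L2 f f)"
    unfolding L2_def Re_cmean
    by (rule mean_ge) (intro continuous_on_Re L2_cont f, simp)
  show "f = 0" if "L2 f f = 0"
  proof (rule cont_fun_ext[OF f])
    show "0 \<in> cont_fun M" by (simp add: cont_fun_def)
    show "f (blinfun_apply g v) = 0 (blinfun_apply g v)" if "g \<in> G" for g
      using cmean_cnj_self_eq_0[OF cont_fun_pull[OF f] _ that] \<open>L2 f f = 0\<close> by (simp add: L2_def)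
  qed
qed

section \<open>The quasiregular representation and its irreducible subspaces\<close>

abbreviation qr :: "('v \<Rightarrow>\<^sub>L 'v) \<Rightarrow> ('v \<Rightarrow> complex) \<Rightarrow> 'v \<Rightarrow> complex" where "qr \<equiv> quasiregular"

lemma qr_add: "qr g (f + k) = qr g f + qr g k"
  and qr_scale: "qr g (fun_scale c f) = fun_scale c (qr g f)"
  and qr_diff: "qr g (f - k) = qr g f - qr g k"
  and qr_0: "qr g 0 = 0"
  by (simp_all add: quasiregular_def fun_eq_iff fun_scale_def)

lemma qr_id: "qr id_blinfun f = f"
proof -
  have "blinfun_apply (inv\<^bsub>GL\<^esub> id_blinfun) x = x" for x :: 'v using inv_apply(1)[OF id_in, of x] by simp
  then show ?thesis by (simp add: quasiregular_def)
qed

lemma qr_compose: "g \<in> G \<Longrightarrow> k \<in> G \<Longrightarrow> qr (g o\<^sub>L k) f = qr g (qr k f)"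
proof -
  assume gk: "g \<in> G" "k \<in> G"
  have "inv\<^bsub>GL\<^esub> (g o\<^sub>L k) = inv\<^bsub>GL\<^esub> k o\<^sub>L inv\<^bsub>GL\<^esub> g"
    using group.inv_mult_group[OF group_GL in_GL[OF gk(1)] in_GL[OF gk(2)]] by (simp add: GL_mult)
  then show ?thesis by (simp add: quasiregular_def)
qed

lemma qr_inv: "g \<in> G \<Longrightarrow> qr g (qr (inv\<^bsub>GL\<^esub> g) f) = f"
  using qr_compose[OF _ inv_in, of g g f] by (simp add: inv_compose qr_id)

lemma qr_cont_fun: "g \<in> G \<Longrightarrow> f \<in> cont_fun M \<Longrightarrow> qr g f \<in> cont_fun M"
  unfolding cont_fun_def quasiregular_def
  by (auto simp: M_apply_iff inv_in intro!: continuous_on_compose2[of M f] continuous_intros)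

lemma L2_qr_qr:
  assumes g: "g \<in> G" and f: "f \<in> cont_fun M" and k: "k \<in> cont_fun M"
  shows "L2 (qr g f) (qr g k) = L2 f k"
  unfolding L2_def quasiregular_def using cmean_left[OF L2_cont[OF f k] inv_in[OF g]] by simp

lemma L2_qr:
  assumes g: "g \<in> G" and f: "f \<in> cont_fun M" and k: "k \<in> cont_fun M"
  shows "L2 (qr g f) k = L2 f (qr (inv\<^bsub>GL\<^esub> g) k)"
  using L2_qr_qr[OF g f qr_cont_fun[OF inv_in[OF g] k]] by (simp add: qr_inv g)

definition invariant :: "('v \<Rightarrow> complex) set \<Rightarrow> bool" where
  "invariant U \<longleftrightarrow> fv.subspace U \<and> (\<forall>g\<in>G. \<forall>f\<in>U. qr g f \<in> U)"

lemma representation_iff: "representation G U quasiregular \<longleftrightarrow> invariant U"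
  unfolding representation_def invariant_def by (auto simp: qr_add qr_scale qr_id qr_compose)

lemma invariant_orthogonal:
  assumes U: "invariant U" "U \<subseteq> cont_fun M" and A: "invariant A" "A \<subseteq> cont_fun M"
  shows "invariant {x \<in> U. \<forall>a\<in>A. L2 x a = 0}"
  unfolding invariant_def
proof (intro conjI ballI)
  show "fv.subspace {x \<in> U. \<forall>a\<in>A. L2 x a = 0}"
  proof (rule fv.subspaceI)
    show "0 \<in> {x \<in> U. \<forall>a\<in>A. L2 x a = 0}"
      using U A by (auto simp: invariant_def fv.subspace_0)
    fix x y c assume x: "x \<in> {x \<in> U. \<forall>a\<in>A. L2 x a = 0}"
    show "fun_scale c x \<in> {x \<in> U. \<forall>a\<in>A. L2 x a = 0}"
      using x U A by (auto simp: invariant_def fv.subspace_scale L.H_scale subset_iff)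
    assume y: "y \<in> {x \<in> U. \<forall>a\<in>A. L2 x a = 0}"
    show "x + y \<in> {x \<in> U. \<forall>a\<in>A. L2 x a = 0}"
      using x y U A by (auto simp: invariant_def fv.subspace_add L.H_add subset_iff)
  qed
  fix g x assume g: "g \<in> G" and x: "x \<in> {x \<in> U. \<forall>a\<in>A. L2 x a = 0}"
  have "L2 (qr g x) a = 0" if "a \<in> A" for a
  proof -
    have "qr (inv\<^bsub>GL\<^esub> g) a \<in> A" using A(1) that inv_in[OF g] by (simp add: invariant_def)
    moreover have "x \<in> cont_fun M" "a \<in> cont_fun M" using x U A that by auto
    ultimately show ?thesis using x by (simp add: L2_qr[OF g])
  qed
  then show "qr g x \<in> {x \<in> U. \<forall>a\<in>A. L2 x a = 0}" using U(1) x g by (auto simp: invariant_def)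
qed

lemma invariant_Int: "invariant U \<Longrightarrow> invariant A \<Longrightarrow> invariant (U \<inter> A)"
  by (auto simp: invariant_def fv.subspace_inter)

definition fin_dim :: "('v \<Rightarrow> complex) set \<Rightarrow> bool" where
  "fin_dim U \<longleftrightarrow> (\<exists>S. finite S \<and> U \<subseteq> fv.span S)"

lemma basis:
  assumes "invariant U" "U \<subseteq> cont_fun M" "fin_dim U"
  obtains E where "L.orthonormal E" "fv.span E = U"
  using assms L.orthonormal_basis[of U] unfolding fin_dim_def invariant_def by blast

lemma proj_qr:
  assumes U: "invariant U" and E: "L.orthonormal E" "fv.span E = U" and f: "f \<in> cont_fun M" and g: "g \<in> G"
  shows "L.proj E (qr g f) = qr g (L.proj E f)"
proof (rule L.proj_unique[OF E(1), symmetric])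
  have pD: "L.proj E f \<in> cont_fun M" by (rule L.proj_in_D[OF E(1)])
  show "qr g f \<in> cont_fun M" by (rule qr_cont_fun[OF g f])
  show "qr g (L.proj E f) \<in> fv.span E" using U g L.proj_in_span[of E f] by (simp add: E(2) invariant_def)
  fix e assume e: "e \<in> E"
  have eD: "e \<in> cont_fun M" using E(1) e by (auto simp: L.orthonormal_def)
  have "e \<in> U" using e E(2) fv.span_base by blast
  then have "qr (inv\<^bsub>GL\<^esub> g) e \<in> fv.span E" using U inv_in[OF g] by (simp add: E(2) invariant_def)
  then have "L2 (f - L.proj E f) (qr (inv\<^bsub>GL\<^esub> g) e) = 0" by (rule L.proj_orthogonal[OF E(1) f])
  then show "L2 (qr g f - qr g (L.proj E f)) e = 0"
    using L2_qr[OF g L.D_diff[OF f pD] eD] by (simp add: qr_diff)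
qed

text \<open>A nonzero invariant subspace of least dimension is irreducible; the dimension is read
  off as the size of an orthonormal basis.\<close>

lemma irreducible_exists:
  assumes U: "invariant U" "U \<subseteq> cont_fun M" "fin_dim U" "U \<noteq> {0}"
  obtains W where "W \<subseteq> U" "irreducible_rep G W quasiregular"
proof -
  define P where "P = (\<lambda>n. \<exists>W E. W \<subseteq> U \<and> invariant W \<and> W \<noteq> {0} \<and> L.orthonormal E \<and> fv.span E = W \<and> card E = n)"
  obtain E0 where "L.orthonormal E0" "fv.span E0 = U" using basis[OF U(1-3)] by blast
  then have ex: "\<exists>n. P n" unfolding P_def using U by blast
  define n where "n = (LEAST n. P n)"
  have "P n" unfolding n_def using ex by (rule LeastI_ex)
  then obtain W E where W: "W \<subseteq> U" "invariant W" "W \<noteq> {0}" "L.orthonormal E" "fv.span E = W" "card E = n"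
    unfolding P_def by blast
  have finE: "finite E" using W(4) by (simp add: L.orthonormal_def)
  have WD: "W \<subseteq> cont_fun M" using W(1) U(2) by blast
  have minimal: "V = {0} \<or> V = W" if V: "V \<subseteq> W" "invariant V" for V
  proof (rule ccontr)
    assume neg: "\<not> (V = {0} \<or> V = W)"
    then obtain x where x: "x \<in> W" "x \<notin> V" using V(1) by blast
    have "fin_dim V" unfolding fin_dim_def using V(1) W(5) finE by blast
    then obtain E' where E': "L.orthonormal E'" "fv.span E' = V" using basis[of V] V WD by blast
    have finE': "finite E'" using E'(1) by (simp add: L.orthonormal_def)
    have "P (card E')" unfolding P_def using V W(1) neg E' by blast
    then have "n \<le> card E'" unfolding n_def by (rule Least_le)
    \<comment> \<open>A vector of \<open>W\<close> outside \<open>V\<close> enlarges a basis of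
      \<open>V\<close> to an independent set in \<open>W\<close>, so \<open>V\<close> would have
      smaller dimension than the least possible \<open>n\<close>.\<close>
    moreover have "fv.independent (insert x E')"
      using L.orthonormal_independent[OF E'(1)] x(2) E'(2) fv.span_base[of x E']
      by (auto simp: fv.independent_insert)
    then have "card (insert x E') \<le> card E"
      using fv.independent_span_bound[OF finE, of "insert x E'"] x(1) V(1) W(5) E'(2) fv.span_superset[of E'] by blast
    moreover have "x \<notin> E'" using x(2) E'(2) fv.span_base[of x E'] by blast
    ultimately show False using W(6) finE' by simp
  qed
  have cont: "continuous_on G (\<lambda>g. qr g f x)" if "f \<in> W" for f x
  proof (cases "x \<in> M")
    case True
    have "continuous_on M f" using that WD by (auto simp: cont_fun_def)
    then show ?thesis unfolding quasiregular_def
      by (rule continuous_on_compose2) (auto simp: True M_apply_iff inv_in intro!: continuous_intros continuous_inv)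
  next
    case False
    have "qr g f x = 0" if "g \<in> G" for g
      using False that \<open>f \<in> W\<close> WD by (auto simp: quasiregular_def cont_fun_def M_apply_iff inv_in subset_iff)
    then have "continuous_on G (\<lambda>g. qr g f x) \<longleftrightarrow> continuous_on G (\<lambda>g. 0 :: complex)"
      by (intro continuous_on_cong) auto
    then show ?thesis by simp
  qed
  have "irreducible_rep G W quasiregular"
    unfolding irreducible_rep_def representation_iff using W finE cont minimal by blast
  then show thesis using that W(1) by blast
qed

section \<open>G-finite functions and multiplicity freeness\<close>

definition gfin :: "('v \<Rightarrow> complex) \<Rightarrow> bool" where
  "gfin k \<longleftrightarrow> k \<in> cont_fun M \<and> (\<exists>S. finite S \<and> (\<forall>g\<in>G. qr g k \<in> fv.span S))"

definition orbit_span :: "('v \<Rightarrow> complex) \<Rightarrow> ('v \<Rightarrow> complex) set" where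
  "orbit_span k = fv.span ((\<lambda>g. qr g k) ` G)"

lemma in_orbit_span: "k \<in> orbit_span k"
  unfolding orbit_span_def by (rule fv.span_base, rule image_eqI[of _ _ id_blinfun]) (simp_all add: qr_id id_in)

lemma invariant_orbit_span: "invariant (orbit_span k)"
  unfolding invariant_def
proof (intro conjI ballI)
  show "fv.subspace (orbit_span k)" by (simp add: orbit_span_def fv.subspace_span)
  fix g f assume g: "g \<in> G" and f: "f \<in> orbit_span k"
  show "qr g f \<in> orbit_span k" using f unfolding orbit_span_def
  proof (induction rule: fv.span_induct_alt)
    case base
    then show ?case by (simp only: qr_0 fv.span_zero)
  next
    case (step c x y)
    then obtain g' where g': "g' \<in> G" "x = qr g' k" by blast
    have "qr g x \<in> (\<lambda>g. qr g k) ` G" using g g' by (auto simp: qr_compose[symmetric] intro!: imageI compose_in)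
    note mem = this
    have "fun_scale c (qr g x) + qr g y \<in> fv.span ((\<lambda>g. qr g k) ` G)"
      by (rule fv.span_add[OF fv.span_scale[OF fv.span_base[OF mem]] step(2)])
    then have "qr g (fun_scale c x + y) \<in> fv.span ((\<lambda>g. qr g k) ` G)" by (simp only: qr_add qr_scale)
    then show ?case by (simp add: plus_fun_def)
  qed
qed

lemma orbit_span_subset: "invariant A \<Longrightarrow> k \<in> A \<Longrightarrow> orbit_span k \<subseteq> A"
  unfolding orbit_span_def by (rule fv.span_minimal) (auto simp: invariant_def)

lemma invariant_cont_fun: "invariant (cont_fun M)"
  using L.subspace_D qr_cont_fun by (simp add: invariant_def)

lemma orbit_span_cont_fun: "k \<in> cont_fun M \<Longrightarrow> orbit_span k \<subseteq> cont_fun M"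
  by (rule orbit_span_subset[OF invariant_cont_fun])

lemma fin_dim_orbit_span: "gfin k \<Longrightarrow> fin_dim (orbit_span k)"
  unfolding gfin_def fin_dim_def orbit_span_def
  by (metis (no_types, lifting) fv.span_minimal fv.subspace_span image_subsetI)

lemma fin_dim_subset: "fin_dim U \<Longrightarrow> V \<subseteq> U \<Longrightarrow> fin_dim V"
  unfolding fin_dim_def by blast

text \<open>A nonzero equivariant projection of an irreducible \<open>W\<close> into \<open>A\<close> yields a second copy of \<open>W\<close>
  inside \<open>A\<close>, so multiplicity freeness forces \<open>W \<inter> A \<noteq> {0}\<close>.\<close>

lemma irreducible_meets:
  assumes comm: "commutative_orbit G M"
    and A: "invariant A" "A \<subseteq> cont_fun M" "\<And>a. a \<in> A \<Longrightarrow> gfin a"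
    and W: "irreducible_rep G W quasiregular" "W \<subseteq> cont_fun M"
    and w: "w \<in> W" "a \<in> A" "L2 w a \<noteq> 0"
  shows "\<exists>x\<in>W \<inter> A. x \<noteq> 0"
proof (rule ccontr)
  assume "\<not> ?thesis"
  then have disj: "\<And>x. x \<in> W \<Longrightarrow> x \<in> A \<Longrightarrow> x = 0" by blast
  have Winv: "invariant W" using W(1) by (simp add: irreducible_rep_def representation_iff)
  have Wmin: "V = {0} \<or> V = W" if "V \<subseteq> W" "invariant V" for V
    using W(1) that unfolding irreducible_rep_def representation_iff by blast
  have oA: "orbit_span a \<subseteq> A" by (rule orbit_span_subset[OF A(1) w(2)])
  have aD: "a \<in> cont_fun M" using w(2) A(2) by blast
  \<comment> \<open>The target of the projection is the finite dimensional
    \<open>orbit_span a\<close> and not \<open>A\<close>, which may have infinite dimension. It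
    contains \<open>a\<close>, which is enough to detect that \<open>w\<close> does not project to
    0.\<close>
  obtain E where E: "L.orthonormal E" "fv.span E = orbit_span a"
    using basis[OF invariant_orbit_span orbit_span_cont_fun[OF aD] fin_dim_orbit_span[OF A(3)[OF w(2)]]] by blast
  define \<pi> where "\<pi> = L.proj E"
  have WD: "\<And>x. x \<in> W \<Longrightarrow> x \<in> cont_fun M" using W(2) by blast
  have \<pi>_add: "\<pi> (x + y) = \<pi> x + \<pi> y" if "x \<in> W" "y \<in> W" for x y
  proof -
    have "L.proj E (x + y) = (\<Sum>e\<in>E. fun_scale (L2 x e) e + fun_scale (L2 y e) e)"
      unfolding L.proj_def using E(1) WD that
      by (intro sum.cong refl) (auto simp: L.H_add L.orthonormal_def subset_iff fv.scale_left_distrib)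
    then show ?thesis by (simp add: \<pi>_def L.proj_def sum.distrib)
  qed
  have \<pi>_scale: "\<pi> (fun_scale c x) = fun_scale c (\<pi> x)" if "x \<in> W" for x c
  proof -
    have "L.proj E (fun_scale c x) = (\<Sum>e\<in>E. fun_scale c (fun_scale (L2 x e) e))"
      unfolding L.proj_def using E(1) WD that
      by (intro sum.cong refl) (auto simp: L.H_scale L.orthonormal_def subset_iff)
    then show ?thesis by (simp add: \<pi>_def L.proj_def fv.scale_sum_right)
  qed
  have \<pi>_qr: "\<pi> (qr g x) = qr g (\<pi> x)" if "g \<in> G" "x \<in> W" for g x
    unfolding \<pi>_def by (rule proj_qr[OF invariant_orbit_span E WD[OF that(2)] that(1)])
  have \<pi>_A: "\<pi> x \<in> A" for x using L.proj_in_span[of E x] E(2) oA by (auto simp: \<pi>_def)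
  have Wadd: "x + y \<in> W" and Wsc: "fun_scale c x \<in> W" and Wqr: "g \<in> G \<Longrightarrow> qr g x \<in> W" and W0: "0 \<in> W"
    if "x \<in> W" "y \<in> W" for x y c g
    using Winv that by (auto simp: invariant_def fv.subspace_add fv.subspace_scale fv.subspace_0)
  have \<pi>_0: "\<pi> 0 = 0" using \<pi>_scale[OF w(1), of 0] by simp
  \<comment> \<open>Schur's argument: the kernel is an invariant subspace of the irreducible
    \<open>W\<close>, and it is proper because \<open>w\<close> and its projection have the same
    nonzero pairing with \<open>a\<close>.\<close>
  have ker: "{x \<in> W. \<pi> x = 0} = {0}"
  proof -
    have "invariant {x \<in> W. \<pi> x = 0}" unfolding invariant_def
      by (intro conjI fv.subspaceI) (use w(1) in \<open>auto simp: \<pi>_add \<pi>_scale \<pi>_qr \<pi>_0 qr_0 Wadd Wsc Wqr W0 fv.scale_zero_right\<close>)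
    moreover have "{x \<in> W. \<pi> x = 0} \<noteq> W"
    proof -
      have "a \<in> fv.span E" using in_orbit_span E(2) by simp
      then have "L2 (w - \<pi> w) a = 0" unfolding \<pi>_def by (rule L.proj_orthogonal[OF E(1) WD[OF w(1)]])
      moreover have "\<pi> w \<in> cont_fun M" using \<pi>_A A(2) by blast
      ultimately have "L2 (\<pi> w) a = L2 w a" using L.H_diff[OF WD[OF w(1)] _ aD, of "\<pi> w"] by simp
      then have "\<pi> w \<noteq> 0" using w(3) aD by auto
      then show ?thesis using w(1) by blast
    qed
    ultimately show ?thesis using Wmin[of "{x \<in> W. \<pi> x = 0}"] by blast
  qed
  have inj: "inj_on \<pi> W"
  proof (rule inj_onI)
    fix x y assume xy: "x \<in> W" "y \<in> W" "\<pi> x = \<pi> y"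
    have yW: "fun_scale (-1) y \<in> W" by (rule Wsc[OF xy(2) xy(2)])
    have "\<pi> (x + fun_scale (-1) y) = \<pi> x + fun_scale (-1) (\<pi> y)"
      unfolding \<pi>_add[OF xy(1) yW] \<pi>_scale[OF xy(2)] ..
    also have "\<dots> = 0" using xy(3) by (simp add: fun_scale_def fun_eq_iff)
    finally have "x + fun_scale (-1) y \<in> {x \<in> W. \<pi> x = 0}" using Wadd[OF xy(1) yW] by blast
    then show "x = y" unfolding ker by (simp add: fun_scale_def fun_eq_iff)
  qed
  have inv2: "invariant (\<pi> ` W)" unfolding invariant_def
  proof (intro conjI ballI fv.subspaceI)
    show "0 \<in> \<pi> ` W" using W0[OF w(1) w(1)] \<pi>_0 by force
    show "x + y \<in> \<pi> ` W" if "x \<in> \<pi> ` W" "y \<in> \<pi> ` W" for x y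
      using that by (auto simp: \<pi>_add[symmetric] Wadd)
    show "fun_scale c x \<in> \<pi> ` W" if "x \<in> \<pi> ` W" for x c
      using that by (auto simp: \<pi>_scale[symmetric] Wsc)
    show "qr g f \<in> \<pi> ` W" if "g \<in> G" "f \<in> \<pi> ` W" for g f
      using that by (auto simp: \<pi>_qr[symmetric] Wqr)
  qed
  \<comment> \<open>The second copy lies in \<open>A\<close>. A relation between the two copies thus
    puts an element of \<open>W\<close> into \<open>A\<close>, where it must be 0, so the sum is
    direct and the multiplicity would be at least 2.\<close>
  define U where "U = (\<lambda>i::nat. if i = 0 then W else \<pi> ` W)"
  have "contains_copies G M W quasiregular 2"
    unfolding contains_copies_def
  proof (intro exI[of _ U] conjI allI impI)
    fix i :: nat
    show "U i \<subseteq> cont_fun M" using W(2) \<pi>_A A(2) by (auto simp: U_def)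
    show "representation G (U i) quasiregular" using Winv inv2 by (simp add: U_def representation_iff)
    show "equivalent_reps G W quasiregular (U i) quasiregular"
      unfolding equivalent_reps_def
    proof (intro exI[of _ "if i = 0 then id else \<pi>"] conjI)
      show "bij_betw (if i = 0 then id else \<pi>) W (U i)"
        using inj by (auto simp: U_def bij_betw_def)
    qed (simp_all add: \<pi>_add \<pi>_scale \<pi>_qr)
  next
    fix f and i :: nat assume f: "(\<forall>i<2. f i \<in> U i) \<and> (\<Sum>i<2. f i) = 0" and "i < 2"
    have f01: "f 0 \<in> W" "f 1 \<in> \<pi> ` W" using f[THEN conjunct1, rule_format, of 0] f[THEN conjunct1, rule_format, of 1] by (simp_all add: U_def)
    have "f 0 + f 1 = 0" using f by (simp add: numeral_2_eq_2)
    then have eq: "f 0 = fun_scale (-1) (f 1)" by (simp add: fun_scale_def fun_eq_iff eq_neg_iff_add_eq_0)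
    have "f 1 \<in> A" using f01(2) \<pi>_A by auto
    moreover have "fv.subspace A" using A(1) by (simp add: invariant_def)
    ultimately have "f 0 \<in> A" unfolding eq by (rule fv.subspace_scale[rotated])
    then have "f 0 = 0" using disj f01(1) by blast
    moreover from this have "f 1 = 0" using \<open>f 0 + f 1 = 0\<close> by simp
    ultimately show "f i = 0" using less_2_cases[OF \<open>i < 2\<close>] by auto
  qed
  then have "enat 2 \<le> rep_multiplicity G M W quasiregular"
    unfolding rep_multiplicity_def by (intro Sup_upper) blast
  moreover have "rep_multiplicity G M W quasiregular \<le> 1" using comm W(1) unfolding commutative_orbit_def by blast
  ultimately have "enat 2 \<le> 1" by (rule order_trans)
  then show False by (simp add: one_enat_def)
qed

text \<open>\<open>u\<close> is the projection of \<open>k\<close> to the intersection of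
  \<open>A\<close> with the finite dimensional space \<open>orbit_span k\<close>. The remainder is
  orthogonal to that intersection; multiplicity freeness upgrades this to all of \<open>A\<close>,
  for an irreducible piece of the remainder pairing nontrivially with \<open>A\<close> would meet
  \<open>A\<close>, hence the intersection to which it is orthogonal.\<close>

lemma split:
  assumes comm: "commutative_orbit G M"
    and A: "invariant A" "A \<subseteq> cont_fun M" "\<And>a. a \<in> A \<Longrightarrow> gfin a"
    and k: "gfin k"
  obtains u where "u \<in> A" "u \<in> orbit_span k" "k - u \<in> orbit_span k" "\<And>a. a \<in> A \<Longrightarrow> L2 (k - u) a = 0"
proof -
  define U where "U = orbit_span k"
  have kD: "k \<in> cont_fun M" using k by (simp add: gfin_def)
  have U: "invariant U" "U \<subseteq> cont_fun M" "fin_dim U"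
    unfolding U_def by (rule invariant_orbit_span orbit_span_cont_fun[OF kD] fin_dim_orbit_span[OF k])+
  have kU: "k \<in> U" unfolding U_def by (rule in_orbit_span)
  have Udiff: "x - y \<in> U" if "x \<in> U" "y \<in> U" for x y using that U(1) by (simp add: invariant_def fv.subspace_diff)
  define D1 where "D1 = U \<inter> A"
  have D1: "invariant D1" "D1 \<subseteq> cont_fun M" "fin_dim D1" "D1 \<subseteq> U"
    unfolding D1_def using invariant_Int U A fin_dim_subset[OF U(3)] by auto
  obtain E1 where E1: "L.orthonormal E1" "fv.span E1 = D1" using basis[OF D1(1-3)] by blast
  define u where "u = L.proj E1 k"
  have u: "u \<in> D1" unfolding u_def using L.proj_in_span[of E1 k] E1(2) by simp
  define D2 where "D2 = {x \<in> U. \<forall>y\<in>D1. L2 x y = 0}"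
  have D2: "invariant D2" "D2 \<subseteq> U" unfolding D2_def using invariant_orthogonal[OF U(1,2) D1(1,2)] by auto
  then have D2': "D2 \<subseteq> cont_fun M" "fin_dim D2" using U fin_dim_subset[OF U(3)] by auto
  have ku: "k - u \<in> D2" unfolding D2_def
    using L.proj_orthogonal[OF E1(1) kD] E1(2) Udiff[OF kU] u D1(4) by (auto simp: u_def)
  have "L2 (k - u) a = 0" if a: "a \<in> A" for a
  proof (rule ccontr)
    assume neq: "L2 (k - u) a \<noteq> 0"
    define D3 where "D3 = {x \<in> D2. \<forall>a\<in>A. L2 x a = 0}"
    have D3: "invariant D3" "D3 \<subseteq> D2" unfolding D3_def using invariant_orthogonal[OF D2(1) D2'(1) A(1,2)] by auto
    then have D3': "D3 \<subseteq> cont_fun M" "fin_dim D3" using D2' fin_dim_subset[OF D2'(2)] by auto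
    obtain E3 where E3: "L.orthonormal E3" "fv.span E3 = D3" using basis[OF D3(1) D3'] by blast
    \<comment> \<open>\<open>D3\<close> collects what is orthogonal to \<open>A\<close>. A nonzero
      vector of its complement \<open>D4\<close> cannot be orthogonal to \<open>A\<close>, so every
      irreducible subspace of \<open>D4\<close> pairs nontrivially with \<open>A\<close>.\<close>
    define D4 where "D4 = {x \<in> D2. \<forall>y\<in>D3. L2 x y = 0}"
    have D4: "invariant D4" "D4 \<subseteq> D2" unfolding D4_def using invariant_orthogonal[OF D2(1) D2'(1) D3(1) D3'(1)] by auto
    then have D4': "D4 \<subseteq> cont_fun M" "fin_dim D4" using D2' fin_dim_subset[OF D2'(2)] by auto
    have kuD: "k - u \<in> cont_fun M" using ku D2'(1) by blast
    define w0 where "w0 = (k - u) - L.proj E3 (k - u)"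
    have p3: "L.proj E3 (k - u) \<in> D3" using L.proj_in_span[of E3 "k - u"] E3(2) by simp
    have "w0 \<in> D2" unfolding w0_def using ku p3 D3(2) D2(1) by (auto simp: invariant_def fv.subspace_diff)
    then have w0: "w0 \<in> D4" unfolding D4_def w0_def using L.proj_orthogonal[OF E3(1) kuD] E3(2) by auto
    have "w0 \<noteq> 0"
    proof
      assume "w0 = 0"
      then have "k - u \<in> D3" using p3 by (simp add: w0_def)
      then show False using neq a unfolding D3_def by blast
    qed
    then have "D4 \<noteq> {0}" using w0 by blast
    then obtain W where W: "W \<subseteq> D4" "irreducible_rep G W quasiregular"
      using irreducible_exists[OF D4(1) D4'] by blast
    have "W \<noteq> {0}" "fv.subspace W"
      using W(2) by (simp_all add: irreducible_rep_def representation_iff invariant_def)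
    then obtain w where w: "w \<in> W" "w \<noteq> 0" using fv.subspace_0 by blast
    have wD: "w \<in> cont_fun M" "w \<in> D2" using w(1) W(1) D4' D4(2) by auto
    have "\<exists>a\<in>A. L2 w a \<noteq> 0"
    proof (rule ccontr)
      assume "\<not> ?thesis"
      then have "w \<in> D3" using wD(2) by (simp add: D3_def)
      then have "L2 w w = 0" using w(1) W(1) by (auto simp: D4_def)
      then show False using L.H_eq_0[OF wD(1)] w(2) by blast
    qed
    then obtain a' where a': "a' \<in> A" "L2 w a' \<noteq> 0" by blast
    have "W \<subseteq> cont_fun M" using W(1) D4'(1) by blast
    then obtain x where x: "x \<in> W" "x \<in> A" "x \<noteq> 0"
      using irreducible_meets[OF comm A W(2) _ w(1) a'] by blast
    have xD2: "x \<in> D2" using x(1) W(1) D4(2) by blast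
    then have "x \<in> D1" using x(2) D2(2) by (auto simp: D1_def)
    then have "L2 x x = 0" using xD2 by (simp add: D2_def)
    then show False using L.H_eq_0[of x] xD2 D2'(1) x(3) by blast
  qed
  moreover have "u \<in> A" "u \<in> U" "k - u \<in> U" using u ku D2(2) by (auto simp: D1_def)
  ultimately show thesis using that[of u] by (simp add: U_def)
qed

section \<open>Polynomials on an orbit\<close>

definition rs :: "('v \<Rightarrow> complex) \<Rightarrow> 'v \<Rightarrow> complex" where
  "rs p = (\<lambda>x. if x \<in> M then p x else 0)"

definition A0 :: "('v \<Rightarrow> complex) set" where "A0 = rs ` hol_poly"

lemma rs_apply: "g \<in> G \<Longrightarrow> rs p (blinfun_apply g v) = p (blinfun_apply g v)"
  by (simp add: rs_def in_M)

lemma rs_in_A0: "p \<in> hol_poly \<Longrightarrow> rs p \<in> A0"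
  by (simp add: A0_def)

lemma rs_cont_fun: "continuous_on M p \<Longrightarrow> rs p \<in> cont_fun M"
  by (simp add: cont_fun_def rs_def cong: continuous_on_cong)

lemma A0_cont_fun: "A0 \<subseteq> cont_fun M"
  unfolding A0_def by (auto intro: rs_cont_fun hol_poly_continuous_on)

lemma qr_rs: "g \<in> G \<Longrightarrow> qr g (rs p) = rs (\<lambda>x. p (blinfun_apply (inv\<^bsub>GL\<^esub> g) x))"
  by (auto simp: quasiregular_def rs_def M_apply_iff inv_in fun_eq_iff)

lemma invariant_A0: "invariant A0"
  unfolding invariant_def
proof (intro conjI ballI fv.subspaceI)
  show "0 \<in> A0" unfolding A0_def
    by (rule image_eqI[OF _ hol_poly.const[of 0]]) (simp add: rs_def fun_eq_iff)
  show "x + y \<in> A0" if xy: "x \<in> A0" "y \<in> A0" for x y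
  proof -
    obtain p q where "p \<in> hol_poly" "q \<in> hol_poly" "x = rs p" "y = rs q" using xy unfolding A0_def by blast
    then show ?thesis unfolding A0_def
      by (intro image_eqI[OF _ hol_poly.add[of p q]]) (simp_all add: rs_def fun_eq_iff)
  qed
  show "fun_scale c x \<in> A0" if xA: "x \<in> A0" for c x
  proof -
    obtain p where "p \<in> hol_poly" "x = rs p" using xA unfolding A0_def by blast
    then show ?thesis unfolding A0_def
      by (intro image_eqI[OF _ hol_poly_cmult[of p c]]) (simp_all add: rs_def fun_scale_def fun_eq_iff)
  qed
  show "qr g f \<in> A0" if "g \<in> G" "f \<in> A0" for g f
    using that hol_poly_compose[OF _ cendo_G[OF inv_in]] unfolding A0_def by (auto simp: qr_rs)
qed

lemma rs_span: "p \<in> fv.span S \<Longrightarrow> rs p \<in> fv.span (rs ` S)"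
proof (induction rule: fv.span_induct_alt)
  case base
  have "rs 0 = 0" by (simp add: rs_def fun_eq_iff)
  then show ?case by (simp only: fv.span_zero)
next
  case (step c x y)
  have "rs (fun_scale c x + y) = fun_scale c (rs x) + rs y" by (simp add: rs_def fun_eq_iff fun_scale_def)
  moreover have "fun_scale c (rs x) + rs y \<in> fv.span (rs ` S)"
    by (rule fv.span_add[OF fv.span_scale[OF fv.span_base[OF imageI[OF step(1)]]] step(2)])
  ultimately have "rs (fun_scale c x + y) \<in> fv.span (rs ` S)" by (simp only:)
  then show ?case by (simp add: plus_fun_def)
qed

lemma gfin_A0: "a \<in> A0 \<Longrightarrow> gfin a"
proof -
  assume "a \<in> A0"
  then obtain p where p: "p \<in> hol_poly" "a = rs p" unfolding A0_def by blast
  obtain F where F: "F \<in> sepfun G hol_poly" "\<And>g x. g \<in> G \<Longrightarrow> p (blinfun_apply g x) = F g x"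
    by (rule hol_poly_sepfun_G[OF p(1)]) (rule that; assumption)
  obtain S where S: "finite S" "\<And>g. F g \<in> fv.span S" using sepfun_span[OF F(1)] by blast
  have "qr g a = rs (F (inv\<^bsub>GL\<^esub> g))" if "g \<in> G" for g
    unfolding p(2) qr_rs[OF that] by (simp add: F(2)[OF inv_in[OF that]])
  then have "\<forall>g\<in>G. qr g a \<in> fv.span (rs ` S)" using rs_span[OF S(2)] by simp
  then show ?thesis using S(1) \<open>a \<in> A0\<close> A0_cont_fun unfolding gfin_def by blast
qed

lemma cnj_cont_fun: "f \<in> cont_fun M \<Longrightarrow> (\<lambda>x. cnj (f x)) \<in> cont_fun M"
  by (auto simp: cont_fun_def intro: continuous_intros)

lemma gfin_cnj:
  assumes "gfin k"
  shows "gfin (\<lambda>x. cnj (k x))"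
proof -
  obtain S where S: "finite S" "\<And>g. g \<in> G \<Longrightarrow> qr g k \<in> fv.span S" using assms unfolding gfin_def by blast
  have sp: "(\<lambda>x. cnj (f x)) \<in> fv.span ((\<lambda>f x. cnj (f x)) ` S)" if "f \<in> fv.span S" for f
    using that
  proof (induction rule: fv.span_induct_alt)
    case base
    then show ?case using fv.span_zero by (simp add: zero_fun_def)
  next
    case (step c f f')
    have "(\<lambda>x. cnj ((fun_scale c f + f') x)) = fun_scale (cnj c) (\<lambda>x. cnj (f x)) + (\<lambda>x. cnj (f' x))"
      by (simp add: fun_scale_def fun_eq_iff)
    moreover have "(\<lambda>x. cnj (f x)) \<in> fv.span ((\<lambda>f x. cnj (f x)) ` S)" by (rule fv.span_base) (use step in blast)
    ultimately show ?case using step by (simp only:) (intro fv.span_add fv.span_scale)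
  qed
  have "qr g (\<lambda>x. cnj (k x)) = (\<lambda>x. cnj (qr g k x))" for g by (simp add: quasiregular_def)
  then have "\<forall>g\<in>G. qr g (\<lambda>x. cnj (k x)) \<in> fv.span ((\<lambda>f x. cnj (f x)) ` S)" using sp S(2) by simp
  then show ?thesis using S(1) assms cnj_cont_fun unfolding gfin_def by blast
qed

lemma invariant_cnj: "invariant A \<Longrightarrow> invariant {f. (\<lambda>x. cnj (f x)) \<in> A}"
  unfolding invariant_def
proof (intro conjI ballI fv.subspaceI)
  assume A: "fv.subspace A \<and> (\<forall>g\<in>G. \<forall>f\<in>A. qr g f \<in> A)"
  then have A': "0 \<in> A" "\<And>x y. x \<in> A \<Longrightarrow> y \<in> A \<Longrightarrow> x + y \<in> A" "\<And>c x. x \<in> A \<Longrightarrow> fun_scale c x \<in> A"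
    "\<And>g x. g \<in> G \<Longrightarrow> x \<in> A \<Longrightarrow> qr g x \<in> A"
    by (auto simp: fv.subspace_0 fv.subspace_add fv.subspace_scale)
  show "0 \<in> {f. (\<lambda>x. cnj (f x)) \<in> A}" using A'(1) by (simp add: zero_fun_def)
  show "x + y \<in> {f. (\<lambda>x. cnj (f x)) \<in> A}" if "x \<in> {f. (\<lambda>x. cnj (f x)) \<in> A}" "y \<in> {f. (\<lambda>x. cnj (f x)) \<in> A}" for x y
    using A'(2)[of "\<lambda>t. cnj (x t)" "\<lambda>t. cnj (y t)"] that by (simp add: plus_fun_def)
  show "fun_scale c x \<in> {f. (\<lambda>x. cnj (f x)) \<in> A}" if "x \<in> {f. (\<lambda>x. cnj (f x)) \<in> A}" for c x
    using A'(3)[of "\<lambda>t. cnj (x t)" "cnj c"] that by (simp add: fun_scale_def)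
  show "qr g f \<in> {f. (\<lambda>x. cnj (f x)) \<in> A}" if "g \<in> G" "f \<in> {f. (\<lambda>x. cnj (f x)) \<in> A}" for g f
    using A'(4)[of g "\<lambda>t. cnj (f t)"] that by (simp add: quasiregular_def)
qed

text \<open>The conjugate of a polynomial splits into a conjugate of a polynomial that is itself a polynomial
  on the orbit, and the conjugate of a polynomial \<open>r\<close> with \<open>\<integral> r q = 0\<close> for all polynomials \<open>q\<close>.\<close>

lemma cnj_split:
  assumes comm: "commutative_orbit G M" and p: "p \<in> hol_poly"
  obtains s r where "s \<in> A0" "(\<lambda>x. cnj (s x)) \<in> A0" "r \<in> hol_poly"
    "\<And>g. g \<in> G \<Longrightarrow> cnj (p (blinfun_apply g v)) = s (blinfun_apply g v) + cnj (r (blinfun_apply g v))"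
    "\<And>q. q \<in> hol_poly \<Longrightarrow> cmean (\<lambda>g. r (blinfun_apply g v) * q (blinfun_apply g v)) = 0"
proof -
  define k where "k = (\<lambda>x. cnj (rs p x))"
  have k: "gfin k" unfolding k_def by (rule gfin_cnj[OF gfin_A0[OF rs_in_A0[OF p]]])
  obtain u where u: "u \<in> A0" "u \<in> orbit_span k" "k - u \<in> orbit_span k" "\<And>a. a \<in> A0 \<Longrightarrow> L2 (k - u) a = 0"
  proof (rule split[OF comm invariant_A0 A0_cont_fun _ k])
    show "gfin a" if "a \<in> A0" for a by (rule gfin_A0[OF that])
  qed (rule that; assumption)
  \<comment> \<open>The conjugates of polynomials form an invariant space containing
    \<open>k\<close>. So both parts of the splitting are conjugates of polynomials; the part in
    \<open>A0\<close> is in addition a polynomial itself.\<close>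
  have sub: "orbit_span k \<subseteq> {f. (\<lambda>x. cnj (f x)) \<in> A0}"
    by (rule orbit_span_subset[OF invariant_cnj[OF invariant_A0]]) (simp add: k_def rs_in_A0[OF p])
  have "(\<lambda>x. cnj ((k - u) x)) \<in> A0" using sub u(3) by blast
  then obtain r where r: "r \<in> hol_poly" "(\<lambda>x. cnj ((k - u) x)) = rs r" unfolding A0_def by blast
  have r_ap: "cnj ((k - u) (blinfun_apply g v)) = r (blinfun_apply g v)" if "g \<in> G" for g
    using fun_cong[OF r(2), of "blinfun_apply g v"] by (simp only: rs_apply[OF that])
  show thesis
  proof (rule that[of u r])
    show "u \<in> A0" "r \<in> hol_poly" "(\<lambda>x. cnj (u x)) \<in> A0" using u r(1) sub by auto
    fix g assume g: "g \<in> G"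
    have "cnj (r (blinfun_apply g v)) = (k - u) (blinfun_apply g v)" unfolding r_ap[OF g, symmetric] by simp
    then show "cnj (p (blinfun_apply g v)) = u (blinfun_apply g v) + cnj (r (blinfun_apply g v))"
      by (simp add: k_def rs_apply[OF g])
  next
    fix q :: "'v \<Rightarrow> complex" assume q: "q \<in> hol_poly"
    have cont: "continuous_on G (\<lambda>g. r (blinfun_apply g v) * q (blinfun_apply g v))"
      by (intro continuous_intros continuous_hol_poly_orbit q r(1))
    \<comment> \<open>Conjugation turns the Hermitian orthogonality of the conjugate of
      \<open>r\<close> into the vanishing of the bilinear pairing.\<close>
    have "cnj (cmean (\<lambda>g. r (blinfun_apply g v) * q (blinfun_apply g v))) =
        cmean (\<lambda>g. cnj (r (blinfun_apply g v) * q (blinfun_apply g v)))" using cmean_cnj[OF cont] by simp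
    also have "\<dots> = L2 (k - u) (rs q)"
      unfolding L2_def
    proof (rule cmean_cong)
      show "continuous_on G (\<lambda>g. cnj (r (blinfun_apply g v) * q (blinfun_apply g v)))"
        by (rule continuous_on_cnj[OF cont])
      show "cnj (r (blinfun_apply g v) * q (blinfun_apply g v)) = (k - u) (blinfun_apply g v) * cnj (rs q (blinfun_apply g v))"
        if "g \<in> G" for g
        unfolding r_ap[OF that, symmetric] rs_apply[OF that] by simp
    qed
    also have "\<dots> = 0" by (rule u(4)[OF rs_in_A0[OF q]])
    finally show "cmean (\<lambda>g. r (blinfun_apply g v) * q (blinfun_apply g v)) = 0" by simp
  qed
qed

end

section \<open>Antisymmetry and the nilpotent cone\<close>

context orbit_space begin

lemma A0_poly_closure: "A0 \<subseteq> poly_closure M"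
proof
  fix f assume "f \<in> A0"
  then obtain p where p: "p \<in> hol_poly" "f = rs p" unfolding A0_def by blast
  have "\<forall>z\<in>M. cmod (f z - p z) < \<epsilon>" if "\<epsilon> > 0" for \<epsilon> using that by (simp add: p(2) rs_def)
  then show "f \<in> poly_closure M"
    unfolding poly_closure_def using p(1) \<open>f \<in> A0\<close> A0_cont_fun by blast
qed

lemma A0_add: "f \<in> A0 \<Longrightarrow> k \<in> A0 \<Longrightarrow> (\<lambda>x. f x + k x) \<in> A0"
  and A0_scale: "f \<in> A0 \<Longrightarrow> (\<lambda>x. c * f x) \<in> A0"
  using invariant_A0 fv.subspace_add[of A0 f k] fv.subspace_scale[of A0 f c]
  by (simp_all add: invariant_def plus_fun_def fun_scale_def)

lemma cmean_orbit_add: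
  assumes "p \<in> hol_poly" "q \<in> hol_poly"
  shows "cmean (\<lambda>g. p (blinfun_apply g x) + q (blinfun_apply g x)) =
    cmean (\<lambda>g. p (blinfun_apply g x)) + cmean (\<lambda>g. q (blinfun_apply g x))"
  by (intro cmean_add continuous_hol_poly_orbit assms)

text \<open>The combinations \<open>s + cnj s\<close> and \<open>\<i> * s - \<i> * cnj s\<close> are
  real functions in the algebra, hence constant, and so is \<open>s\<close>. Thus \<open>p\<close>
  equals a constant plus \<open>r\<close> on the orbit, and \<open>r\<close> contributes nothing to
  the mean of a product.\<close>

lemma antisymmetric_mean_mult:
  assumes comm: "commutative_orbit G M" and anti: "antisymmetric_on M (poly_closure M)"
    and p: "p \<in> hol_poly" and q: "q \<in> hol_poly"
  shows "cmean (\<lambda>g. p (blinfun_apply g v) * q (blinfun_apply g v)) =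
    cmean (\<lambda>g. p (blinfun_apply g v)) * cmean (\<lambda>g. q (blinfun_apply g v))"
proof -
  obtain s r where sr: "s \<in> A0" "(\<lambda>x. cnj (s x)) \<in> A0" "r \<in> hol_poly"
    "\<And>g. g \<in> G \<Longrightarrow> cnj (p (blinfun_apply g v)) = s (blinfun_apply g v) + cnj (r (blinfun_apply g v))"
    "\<And>q. q \<in> hol_poly \<Longrightarrow> cmean (\<lambda>g. r (blinfun_apply g v) * q (blinfun_apply g v)) = 0"
    by (rule cnj_split[OF comm p]) (rule that; assumption)
  have const: "\<exists>c. \<forall>x\<in>M. f x = c" if "f \<in> A0" "\<And>x. f x \<in> \<real>" for f
    using anti that A0_poly_closure unfolding antisymmetric_on_def constant_on_def by blast
  have "(\<lambda>x. s x + cnj (s x)) \<in> A0" by (rule A0_add[OF sr(1,2)])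
  then obtain c1 where c1: "\<And>x. x \<in> M \<Longrightarrow> s x + cnj (s x) = c1"
    using const[of "\<lambda>x. s x + cnj (s x)"] by (auto simp: complex_is_Real_iff)
  have "(\<lambda>x. \<i> * s x + (- \<i>) * cnj (s x)) \<in> A0" by (intro A0_add A0_scale sr(1,2))
  then obtain c2 where c2: "\<And>x. x \<in> M \<Longrightarrow> \<i> * s x + (- \<i>) * cnj (s x) = c2"
    using const[of "\<lambda>x. \<i> * s x + (- \<i>) * cnj (s x)"] by (auto simp: complex_is_Real_iff)
  \<comment> \<open>On the orbit \<open>c1\<close> is twice the real part of \<open>s\<close> and
    \<open>c2\<close> is minus twice its imaginary part.\<close>
  define c where "c = (c1 - \<i> * c2) / 2"
  have sc: "s x = c" if "x \<in> M" for x
    unfolding c_def c1[OF that, symmetric] c2[OF that, symmetric] by (simp add: algebra_simps)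
  have p_eq: "p (blinfun_apply g v) = cnj c + r (blinfun_apply g v)" if "g \<in> G" for g
  proof -
    have "cnj (cnj (p (blinfun_apply g v))) = cnj c + r (blinfun_apply g v)"
      unfolding sr(4)[OF that] by (simp add: sc[OF in_M[OF that]])
    then show ?thesis by simp
  qed
  have pq: "cmean (\<lambda>g. p (blinfun_apply g v) * f (blinfun_apply g v)) = cnj c * cmean (\<lambda>g. f (blinfun_apply g v))"
    if f: "f \<in> hol_poly" for f
  proof -
    have "cmean (\<lambda>g. p (blinfun_apply g v) * f (blinfun_apply g v)) =
        cmean (\<lambda>g. cnj c * f (blinfun_apply g v) + r (blinfun_apply g v) * f (blinfun_apply g v))"
    proof (rule cmean_cong)
      show "continuous_on G (\<lambda>g. p (blinfun_apply g v) * f (blinfun_apply g v))"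
        by (intro continuous_on_mult continuous_hol_poly_orbit p f)
    qed (simp add: p_eq distrib_right)
    also have "\<dots> = cmean (\<lambda>g. cnj c * f (blinfun_apply g v)) + cmean (\<lambda>g. r (blinfun_apply g v) * f (blinfun_apply g v))"
      by (intro cmean_add continuous_intros continuous_hol_poly_orbit f sr(3))
    also have "\<dots> = cnj c * cmean (\<lambda>g. f (blinfun_apply g v))"
      using sr(5)[OF f] cmean_cmult[OF continuous_hol_poly_orbit[OF f], of "cnj c"] by simp
    finally show ?thesis .
  qed
  have "cmean (\<lambda>g. p (blinfun_apply g v)) = cnj c"
    using pq[OF hol_poly.const[of 1]] by (simp add: cmean_const)
  then show ?thesis using pq[OF q] by simp
qed

text \<open>The mean is the value of \<open>l\<close> at the barycentre \<open>w\<close> of the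
  orbit. The barycentre is fixed by \<open>G\<close>, hence 0.\<close>

lemma mean_linear_eq_0:
  assumes nofix: "\<And>w. (\<forall>g\<in>G. blinfun_apply g w = w) \<Longrightarrow> w = 0" and l: "clin l"
  shows "cmean (\<lambda>g. l (blinfun_apply g v)) = 0"
proof -
  obtain B :: "'v set" and r where B: "finite B" "\<And>b. clin (r b)" "\<And>x. (\<Sum>b\<in>B. r b x *\<^sub>C b) = x"
    "\<And>c. (\<Sum>b\<in>B. c b *\<^sub>C b) = 0 \<Longrightarrow> \<forall>b\<in>B. c b = 0" by (rule coordinates_exist) (rule that; assumption)
  have cont: "continuous_on G (\<lambda>g. k (blinfun_apply g v))" if "clin k" for k
    by (rule continuous_hol_poly_orbit[OF hol_poly.linear[OF that]])
  define w where "w = (\<Sum>b\<in>B. cmean (\<lambda>g. r b (blinfun_apply g v)) *\<^sub>C b)"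
  have kw: "k w = cmean (\<lambda>g. k (blinfun_apply g v))" if k: "clin k" for k
  proof -
    have "k w = (\<Sum>b\<in>B. cmean (\<lambda>g. r b (blinfun_apply g v)) * k b)"
      unfolding w_def clin_sum[OF k] clin_scale[OF k] ..
    also have "\<dots> = (\<Sum>b\<in>B. cmean (\<lambda>g. k b * r b (blinfun_apply g v)))"
      using cmean_cmult[OF cont[OF B(2)]] by (simp add: mult.commute)
    also have "\<dots> = cmean (\<lambda>g. \<Sum>b\<in>B. k b * r b (blinfun_apply g v))"
      by (rule cmean_sum[symmetric]) (intro continuous_intros cont B(2))
    also have "\<dots> = cmean (\<lambda>g. k (blinfun_apply g v))"
    proof -
      have "(\<Sum>b\<in>B. k b * r b x) = k (\<Sum>b\<in>B. r b x *\<^sub>C b)" for x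
        unfolding clin_sum[OF k] clin_scale[OF k] by (simp add: mult.commute)
      then have "(\<Sum>b\<in>B. k b * r b x) = k x" for x by (simp only: B(3))
      then show ?thesis by (simp only:)
    qed
    finally show ?thesis .
  qed
  have "blinfun_apply g w = w" if g: "g \<in> G" for g
  proof -
    have "r b (blinfun_apply g w) = r b w" for b
    proof -
      have "r b (blinfun_apply g w) = cmean (\<lambda>g'. r b (blinfun_apply g (blinfun_apply g' v)))"
        by (rule kw[OF clin_comp[OF B(2) cendo_G[OF g]]])
      also have "\<dots> = cmean (\<lambda>g'. r b (blinfun_apply g' v))"
        using cmean_left[OF cont[OF B(2)] g] by simp
      finally show ?thesis by (simp add: kw[OF B(2)])
    qed
    then have "(\<Sum>b\<in>B. r b (blinfun_apply g w) *\<^sub>C b) = (\<Sum>b\<in>B. r b w *\<^sub>C b)" by simp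
    then show ?thesis by (simp only: B(3))
  qed
  then have "w = 0" using nofix by blast
  then show ?thesis using kw[OF l] clin_0[OF l] by simp
qed

lemma antisymmetric_imp_nilpotent:
  assumes comm: "commutative_orbit G M" and nofix: "\<And>w. (\<forall>g\<in>G. blinfun_apply g w = w) \<Longrightarrow> w = 0"
    and anti: "antisymmetric_on M (poly_closure M)"
  shows "v \<in> nilpotent_cone G"
proof -
  have ev: "cmean (\<lambda>g. p (blinfun_apply g v)) = p 0" if "p \<in> hol_poly" for p
    using that
  proof induction
    case (linear l)
    then show ?case using mean_linear_eq_0[OF nofix linear] clin_0[OF linear] by simp
  next
    case (mult p q)
    then show ?case using antisymmetric_mean_mult[OF comm anti mult(1,2)] by simp
  qed (simp_all add: cmean_const cmean_orbit_add)
  show ?thesis unfolding nilpotent_cone_def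
  proof safe
    fix p assume p: "p \<in> hol_poly" "\<forall>g\<in>G. \<forall>z. p (blinfun_apply g z) = p z" "p 0 = 0"
    have "cmean (\<lambda>g. p (blinfun_apply g v)) = cmean (\<lambda>g. p v)"
      by (rule cmean_cong[OF continuous_hol_poly_orbit[OF p(1)]]) (use p(2) in simp)
    then show "p v = 0" using ev[OF p(1)] p(3) by (simp add: cmean_const)
  qed
qed

text \<open>The average of \<open>p\<close> minus \<open>p 0\<close> is an invariant polynomial
  vanishing at 0, so it vanishes at \<open>v\<close>.\<close>

lemma nilpotent_mean:
  assumes N: "v \<in> nilpotent_cone G" and p: "p \<in> hol_poly"
  shows "cmean (\<lambda>g. p (blinfun_apply g v)) = p 0"
proof -
  define q where "q = (\<lambda>x. average p x - p 0)"
  have "q \<in> hol_poly" unfolding q_def by (intro hol_poly_diff average_hol_poly p hol_poly.const)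
  moreover have "\<forall>g\<in>G. \<forall>z. q (blinfun_apply g z) = q z" using average_invariant[OF p] by (simp add: q_def)
  moreover have "q 0 = 0" by (simp add: q_def average_def blinfun.zero_right cmean_const)
  ultimately have "q v = 0" using N unfolding nilpotent_cone_def by blast
  then show ?thesis by (simp add: q_def average_def)
qed

text \<open>On polynomials the mean is evaluation at 0, hence multiplicative, and this passes to
  uniform limits. For a real limit \<open>f\<close> the mean of the square equals the square of the
  mean: the variance is 0, so \<open>f\<close> is constant.\<close>

lemma nilpotent_imp_antisymmetric:
  assumes N: "v \<in> nilpotent_cone G"
  shows "antisymmetric_on M (poly_closure M)"
  unfolding antisymmetric_on_def
proof (intro ballI impI)
  fix f assume f: "f \<in> poly_closure M" and real: "\<forall>x\<in>M. f x \<in> \<real>"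
  have fc: "f \<in> cont_fun M" using f by (simp add: poly_closure_def)
  have appr: "\<exists>p\<in>hol_poly. \<forall>z\<in>M. cmod (f z - p z) < \<epsilon>" if "\<epsilon> > 0" for \<epsilon>
    using f that by (simp add: poly_closure_def)
  have contf: "continuous_on G (\<lambda>g. f (blinfun_apply g v))" by (rule cont_fun_pull[OF fc])
  define c where "c = cmean (\<lambda>g. f (blinfun_apply g v))"
  define d where "d = cmean (\<lambda>g. f (blinfun_apply g v) * f (blinfun_apply g v))"
  have "bounded (f ` M)" using fc compact_M by (auto simp: cont_fun_def intro: compact_imp_bounded compact_continuous_image)
  then obtain b where b: "\<And>x. x \<in> M \<Longrightarrow> cmod (f x) \<le> b" by (auto simp: bounded_iff)
  have b0: "b \<ge> 0" using order_trans[OF norm_ge_zero b[OF v_in_M]] .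
  have cb: "cmod c \<le> b" unfolding c_def by (rule cmod_cmean_le[OF contf]) (use b in_M in blast)
  \<comment> \<open>Replacing \<open>f\<close> by the polynomial \<open>p\<close> changes each of
    \<open>d\<close> and \<open>c * c\<close> by at most \<open>\<epsilon> * (2 * b + 1)\<close>;
    the two errors add up.\<close>
  have close: "cmod (d - c * c) \<le> \<epsilon> * (4 * b + 2)" if \<epsilon>: "\<epsilon> > 0" "\<epsilon> \<le> 1" for \<epsilon>
  proof -
    obtain p where p: "p \<in> hol_poly" "\<And>z. z \<in> M \<Longrightarrow> cmod (f z - p z) < \<epsilon>" using appr[OF \<epsilon>(1)] by blast
    have contp: "continuous_on G (\<lambda>g. p (blinfun_apply g v))" by (rule continuous_hol_poly_orbit[OF p(1)])
    have sq: "cmod (a * a - e * e) \<le> \<epsilon> * (2 * b + 1)" if "cmod (a - e) \<le> \<epsilon>" "cmod a \<le> b" for a e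
    proof -
      have "a * a - e * e = (a - e) * (2 * a - (a - e))" by (simp add: algebra_simps)
      then have "cmod (a * a - e * e) = cmod (a - e) * cmod (2 * a - (a - e))" by (simp add: norm_mult)
      also have "cmod (2 * a - (a - e)) \<le> 2 * b + 1"
        using norm_triangle_ineq4[of "2 * a" "a - e"] that \<epsilon>(2) by (simp add: norm_mult)
      then have "cmod (a - e) * cmod (2 * a - (a - e)) \<le> \<epsilon> * (2 * b + 1)"
        using that(1) \<epsilon>(1) b0 by (intro mult_mono) auto
      finally show ?thesis .
    qed
    have "c - p 0 = cmean (\<lambda>g. f (blinfun_apply g v) - p (blinfun_apply g v))"
      unfolding c_def nilpotent_mean[OF N p(1), symmetric] by (rule cmean_diff[OF contf contp, symmetric])
    also have "cmod \<dots> \<le> \<epsilon>"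
      by (rule cmod_cmean_le) (use contf contp p(2) in_M in \<open>auto intro!: continuous_intros less_imp_le\<close>)
    finally have cp: "cmod (c * c - p 0 * p 0) \<le> \<epsilon> * (2 * b + 1)" by (rule sq[OF _ cb])
    have pp: "cmean (\<lambda>g. p (blinfun_apply g v) * p (blinfun_apply g v)) = p 0 * p 0"
      using nilpotent_mean[OF N hol_poly.mult[OF p(1) p(1)]] .
    have "d - p 0 * p 0 = cmean (\<lambda>g. f (blinfun_apply g v) * f (blinfun_apply g v) - p (blinfun_apply g v) * p (blinfun_apply g v))"
      unfolding d_def pp[symmetric] by (rule cmean_diff[symmetric]) (intro continuous_intros contf contp)+
    also have "cmod \<dots> \<le> \<epsilon> * (2 * b + 1)"
    proof (rule cmod_cmean_le)
      show "continuous_on G (\<lambda>g. f (blinfun_apply g v) * f (blinfun_apply g v) - p (blinfun_apply g v) * p (blinfun_apply g v))"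
        by (intro continuous_intros contf contp)
      show "cmod (f (blinfun_apply g v) * f (blinfun_apply g v) - p (blinfun_apply g v) * p (blinfun_apply g v)) \<le> \<epsilon> * (2 * b + 1)"
        if "g \<in> G" for g by (rule sq) (use p(2)[OF in_M[OF that]] b[OF in_M[OF that]] in auto)
    qed
    finally have "cmod (d - p 0 * p 0) \<le> \<epsilon> * (2 * b + 1)" .
    then have "cmod (d - c * c) \<le> \<epsilon> * (2 * b + 1) + \<epsilon> * (2 * b + 1)"
      using cp norm_triangle_ineq4[of "d - p 0 * p 0" "c * c - p 0 * p 0"] by simp
    then show ?thesis by (simp add: algebra_simps)
  qed
  have dc: "d = c * c"
  proof (rule ccontr)
    assume "d \<noteq> c * c"
    then have pos: "cmod (d - c * c) > 0" by simp
    define \<epsilon> where "\<epsilon> = min 1 (cmod (d - c * c) / (2 * (4 * b + 2)))"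
    have "\<epsilon> > 0" "\<epsilon> \<le> 1" using pos b0 by (auto simp: \<epsilon>_def)
    then have "cmod (d - c * c) \<le> \<epsilon> * (4 * b + 2)" by (rule close)
    also have "\<dots> \<le> cmod (d - c * c) / (2 * (4 * b + 2)) * (4 * b + 2)"
      unfolding \<epsilon>_def using b0 by (intro mult_right_mono) auto
    also have "\<dots> = cmod (d - c * c) / 2" using b0 by (simp add: divide_simps)
    finally show False using pos by simp
  qed
  have cnjf: "cnj (f (blinfun_apply g v)) = f (blinfun_apply g v)" if "g \<in> G" for g
    using real in_M[OF that] by (simp add: Reals_cnj_iff)
  have "cnj c = cmean (\<lambda>g. cnj (f (blinfun_apply g v)))" unfolding c_def by (rule cmean_cnj[OF contf, symmetric])
  also have "\<dots> = c" unfolding c_def by (rule cmean_cong[OF continuous_on_cnj[OF contf] cnjf])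
  finally have cc: "cnj c = c" .
  define F where "F = (\<lambda>g. f (blinfun_apply g v) - c)"
  have contF: "continuous_on G F" unfolding F_def by (intro continuous_intros contf)
  have "cmean (\<lambda>g. F g * cnj (F g)) = cmean (\<lambda>g. (f (blinfun_apply g v) * f (blinfun_apply g v) - (2 * c) * f (blinfun_apply g v)) + c * c)"
    by (rule cmean_cong[OF continuous_on_mult[OF contF continuous_on_cnj[OF contF]]])
       (simp add: F_def cc cnjf algebra_simps)
  also have "\<dots> = (d - 2 * c * c) + c * c"
    unfolding d_def using contf
    by (subst cmean_add, (intro continuous_intros contf)+, subst cmean_diff, (intro continuous_intros contf)+)
       (simp add: cmean_const cmean_cmult c_def[symmetric])
  also have "\<dots> = 0" by (simp add: dc)
  finally have F0: "cmean (\<lambda>g. F g * cnj (F g)) = 0" .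
  have "f x = c" if "x \<in> M" for x
    using that
  proof (rule M_E)
    fix g assume g: "g \<in> G" "x = blinfun_apply g v"
    show "f x = c" using cmean_cnj_self_eq_0[OF contF F0 g(1)] by (simp add: F_def g(2))
  qed
  then show "f constant_on M" unfolding constant_on_def by blast
qed

lemma hull_in_nilpotent_cone:
  assumes N: "v \<in> nilpotent_cone G"
  shows "poly_hull M \<subseteq> nilpotent_cone G"
proof
  fix z assume z: "z \<in> poly_hull M"
  show "z \<in> nilpotent_cone G" unfolding nilpotent_cone_def
  proof safe
    fix p assume p: "p \<in> hol_poly" "\<forall>g\<in>G. \<forall>z. p (blinfun_apply g z) = p z" "p 0 = 0"
    then have "p v = 0" using N unfolding nilpotent_cone_def by blast
    then have "p x = 0" if "x \<in> M" for x using that p(2) by (auto elim: M_E)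
    then have "(SUP \<zeta>\<in>M. cmod (p \<zeta>)) = (SUP \<zeta>\<in>M. 0)" by (intro SUP_cong) auto
    also have "\<dots> = (0::real)" using v_in_M by (intro cSUP_const) auto
    finally show "p z = 0" using z p(1) unfolding poly_hull_def by force
  qed
qed

section \<open>Self-adjoint polynomial algebras\<close>

lemma selfadjoint_imp_dense:
  assumes sa: "\<And>p. p \<in> hol_poly \<Longrightarrow> \<exists>q\<in>hol_poly. \<forall>x\<in>M. q x = cnj (p x)"
  shows "poly_closure M = cont_fun M"
proof
  show "poly_closure M \<subseteq> cont_fun M" by (auto simp: poly_closure_def)
  \<comment> \<open>Only the values on the orbit matter: a member may be arbitrary elsewhere, as
    long as some polynomial takes the same values on \<open>M\<close>.\<close>
  define R where "R = {u :: 'v \<Rightarrow> real. \<exists>p\<in>hol_poly. \<forall>x\<in>M. p x = complex_of_real (u x)}"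
  have ReR: "(\<lambda>x. Re (c * p x)) \<in> R" if p: "p \<in> hol_poly" for p c
  proof -
    obtain q where q: "q \<in> hol_poly" "\<And>x. x \<in> M \<Longrightarrow> q x = cnj (c * p x)" using sa[OF hol_poly_cmult[OF p, of c]] by blast
    have "(\<lambda>x. (1/2) * (c * p x + q x)) \<in> hol_poly" by (intro hol_poly_cmult hol_poly.add p q(1))
    moreover have "(1/2) * (c * p x + q x) = complex_of_real (Re (c * p x))" if "x \<in> M" for x
      by (simp only: q(2)[OF that] complex_add_cnj) simp
    ultimately show ?thesis
      unfolding R_def by (intro CollectI bexI[of _ "\<lambda>x. (1/2) * (c * p x + q x)"] ballI)
  qed
  interpret R: function_ring_on R M
  proof
    show "compact M" by (rule compact_M)
    show "continuous_on M u" if u: "u \<in> R" for u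
    proof -
      obtain p where p: "p \<in> hol_poly" "\<And>x. x \<in> M \<Longrightarrow> p x = complex_of_real (u x)" using u unfolding R_def by blast
      have "continuous_on M (\<lambda>x. Re (p x))" by (intro continuous_intros hol_poly_continuous_on p(1))
      then show ?thesis by (rule continuous_on_eq) (simp add: p(2))
    qed
    show "(\<lambda>x. f x + k x) \<in> R" if fk: "f \<in> R" "k \<in> R" for f k
    proof -
      obtain p q where "p \<in> hol_poly" "q \<in> hol_poly" "\<forall>x\<in>M. p x = complex_of_real (f x)" "\<forall>x\<in>M. q x = complex_of_real (k x)"
        using fk unfolding R_def by blast
      then show ?thesis unfolding R_def by (intro CollectI bexI[OF _ hol_poly.add[of p q]]) auto
    qed
    show "(\<lambda>x. f x * k x) \<in> R" if fk: "f \<in> R" "k \<in> R" for f k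
    proof -
      obtain p q where "p \<in> hol_poly" "q \<in> hol_poly" "\<forall>x\<in>M. p x = complex_of_real (f x)" "\<forall>x\<in>M. q x = complex_of_real (k x)"
        using fk unfolding R_def by blast
      then show ?thesis unfolding R_def by (intro CollectI bexI[OF _ hol_poly.mult[of p q]]) auto
    qed
    show "(\<lambda>_. c) \<in> R" for c
      unfolding R_def by (intro CollectI bexI[OF _ hol_poly.const[of "complex_of_real c"]]) auto
    show "\<exists>f\<in>R. f x \<noteq> f y" if xy: "x \<noteq> y" for x y
    proof -
      obtain B :: "'v set" and r where B: "finite B" "\<And>b. clin (r b)" "\<And>x. (\<Sum>b\<in>B. r b x *\<^sub>C b) = x"
        "\<And>c. (\<Sum>b\<in>B. c b *\<^sub>C b) = 0 \<Longrightarrow> \<forall>b\<in>B. c b = 0" by (rule coordinates_exist) (rule that; assumption)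
      have "\<exists>b. r b x \<noteq> r b y"
      proof (rule ccontr)
        assume "\<not> ?thesis"
        then have "(\<Sum>b\<in>B. r b x *\<^sub>C b) = (\<Sum>b\<in>B. r b y *\<^sub>C b)" by simp
        then show False using xy by (simp add: B(3))
      qed
      then obtain b where b: "r b x \<noteq> r b y" by blast
      have rb: "r b \<in> hol_poly" by (rule hol_poly.linear[OF B(2)])
      show ?thesis
      proof (cases "Re (r b x) = Re (r b y)")
        case False
        then show ?thesis using ReR[OF rb, of 1] by (intro bexI[of _ "\<lambda>x. Re (1 * r b x)"]) auto
      next
        case True
        then have "Im (r b x) \<noteq> Im (r b y)" using b by (simp add: complex_eq_iff)
        then show ?thesis using ReR[OF rb, of "-\<i>"] by (intro bexI[of _ "\<lambda>x. Re (- \<i> * r b x)"]) auto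
      qed
    qed
  qed
  show "cont_fun M \<subseteq> poly_closure M"
  proof
    fix f assume f: "f \<in> cont_fun M"
    then have cf: "continuous_on M f" by (simp add: cont_fun_def)
    have "\<exists>p\<in>hol_poly. \<forall>z\<in>M. cmod (f z - p z) < \<epsilon>" if \<epsilon>: "\<epsilon> > 0" for \<epsilon>
    proof -
      obtain u1 where u1: "u1 \<in> R" "\<And>x. x \<in> M \<Longrightarrow> \<bar>Re (f x) - u1 x\<bar> < \<epsilon>/2"
        using R.Stone_Weierstrass_basic[of "\<lambda>x. Re (f x)" "\<epsilon>/2"] cf \<epsilon> by (auto intro: continuous_intros)
      obtain u2 where u2: "u2 \<in> R" "\<And>x. x \<in> M \<Longrightarrow> \<bar>Im (f x) - u2 x\<bar> < \<epsilon>/2"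
        using R.Stone_Weierstrass_basic[of "\<lambda>x. Im (f x)" "\<epsilon>/2"] cf \<epsilon> by (auto intro: continuous_intros)
      obtain p1 where p1: "p1 \<in> hol_poly" "\<And>x. x \<in> M \<Longrightarrow> p1 x = complex_of_real (u1 x)" using u1(1) unfolding R_def by blast
      obtain p2 where p2: "p2 \<in> hol_poly" "\<And>x. x \<in> M \<Longrightarrow> p2 x = complex_of_real (u2 x)" using u2(1) unfolding R_def by blast
      have "cmod (f z - (p1 z + \<i> * p2 z)) < \<epsilon>" if "z \<in> M" for z
      proof -
        have "cmod (f z - (p1 z + \<i> * p2 z)) \<le> \<bar>Re (f z - (p1 z + \<i> * p2 z))\<bar> + \<bar>Im (f z - (p1 z + \<i> * p2 z))\<bar>"
          by (rule cmod_le)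
        then show ?thesis using u1(2)[OF that] u2(2)[OF that] by (simp add: p1(2)[OF that] p2(2)[OF that])
      qed
      moreover have "(\<lambda>z. p1 z + \<i> * p2 z) \<in> hol_poly" by (intro hol_poly.add hol_poly_cmult p1(1) p2(1))
      ultimately show ?thesis by (intro bexI[of _ "\<lambda>z. p1 z + \<i> * p2 z"] ballI)
    qed
    then show "f \<in> poly_closure M" using f by (simp add: poly_closure_def)
  qed
qed

text \<open>The remainder of the splitting is orthogonal to all polynomials but also a uniform limit
  of polynomials, so it is orthogonal to itself. A G-finite function is therefore exactly, not only
  approximately, a polynomial on the orbit.\<close>

lemma dense_imp_gfin_poly:
  assumes comm: "commutative_orbit G M" and dense: "poly_closure M = cont_fun M" and k: "gfin k"
  shows "k \<in> A0"
proof -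
  obtain u where u: "u \<in> A0" "u \<in> orbit_span k" "k - u \<in> orbit_span k" "\<And>a. a \<in> A0 \<Longrightarrow> L2 (k - u) a = 0"
  proof (rule split[OF comm invariant_A0 A0_cont_fun _ k])
    show "gfin a" if "a \<in> A0" for a by (rule gfin_A0[OF that])
  qed (rule that; assumption)
  define d where "d = k - u"
  have d: "d \<in> cont_fun M" unfolding d_def using k u(1) A0_cont_fun by (intro L.D_diff) (auto simp: gfin_def)
  have "bounded (d ` M)" using d compact_M by (auto simp: cont_fun_def intro: compact_imp_bounded compact_continuous_image)
  then obtain b where b: "\<And>x. x \<in> M \<Longrightarrow> cmod (d x) \<le> b" by (auto simp: bounded_iff)
  have b0: "b \<ge> 0" using order_trans[OF norm_ge_zero b[OF v_in_M]] .
  have le: "cmod (L2 d d) \<le> b * \<epsilon>" if \<epsilon>: "\<epsilon> > 0" for \<epsilon>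
  proof -
    have "d \<in> poly_closure M" using d dense by simp
    then obtain p where p: "p \<in> hol_poly" "\<And>z. z \<in> M \<Longrightarrow> cmod (d z - p z) < \<epsilon>"
      using \<epsilon> unfolding poly_closure_def by blast
    have rp: "rs p \<in> cont_fun M" using rs_in_A0[OF p(1)] A0_cont_fun by blast
    have "L2 d d = L2 d (d - rs p)"
      using L.H_diff_right[OF d rp d] u(4)[OF rs_in_A0[OF p(1)]] by (simp add: d_def)
    moreover have "cmod (L2 d (d - rs p)) \<le> b * \<epsilon>"
      unfolding L2_def
    proof (rule cmod_cmean_le[OF L2_cont[OF d L.D_diff[OF d rp]]])
      fix g assume g: "g \<in> G"
      have "cmod ((d - rs p) (blinfun_apply g v)) \<le> \<epsilon>" using p(2)[OF in_M[OF g]] by (simp add: rs_apply[OF g])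
      then show "cmod (d (blinfun_apply g v) * cnj ((d - rs p) (blinfun_apply g v))) \<le> b * \<epsilon>"
        using b[OF in_M[OF g]] b0 unfolding norm_mult complex_mod_cnj by (intro mult_mono) auto
    qed
    ultimately show ?thesis by simp
  qed
  have "L2 d d = 0"
  proof (rule ccontr)
    assume "L2 d d \<noteq> 0"
    then have pos: "cmod (L2 d d) > 0" by simp
    have "cmod (L2 d d) \<le> b * (cmod (L2 d d) / (2 * (b + 1)))" by (rule le) (use pos b0 in auto)
    also have "\<dots> = cmod (L2 d d) * (b / (2 * (b + 1)))" by simp
    also have "\<dots> < cmod (L2 d d) * 1" using pos b0 by (intro mult_strict_left_mono) (auto simp: divide_less_eq)
    finally show False by simp
  qed
  then have "d = 0" by (rule L.H_eq_0[OF d])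
  then have "k = u" by (simp add: d_def)
  then show ?thesis using u(1) by simp
qed

end

section \<open>The operator exponential\<close>

definition op_pow :: "('v::fd_complex_space \<Rightarrow>\<^sub>L 'v) \<Rightarrow> nat \<Rightarrow> ('v \<Rightarrow>\<^sub>L 'v)" where
  "op_pow X k = (((o\<^sub>L) X) ^^ k) id_blinfun"

lemma op_pow_0 [simp]: "op_pow X 0 = id_blinfun"
  and op_pow_Suc: "op_pow X (Suc k) = X o\<^sub>L op_pow X k"
  by (simp_all add: op_pow_def)

lemma op_pow_1 [simp]: "op_pow X (Suc 0) = X"
  by (simp add: op_pow_Suc blinfun_eq_iff)

lemma op_exp_op_pow: "op_exp X = (\<Sum>k. op_pow X k /\<^sub>R fact k)"
  by (simp add: op_exp_def op_pow_def)

lemma op_pow_commute: "X o\<^sub>L op_pow X k = op_pow X k o\<^sub>L X"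
  by (induction k) (simp_all add: op_pow_Suc blinfun_compose_assoc blinfun_eq_iff)

lemma norm_op_pow: "norm (op_pow X k) \<le> norm X ^ k"
proof (induction k)
  case 0
  show ?case by (simp add: norm_blinfun_id_le)
next
  case (Suc k)
  have "norm (op_pow X (Suc k)) \<le> norm X * norm (op_pow X k)" unfolding op_pow_Suc by (rule norm_blinfun_compose)
  also have "\<dots> \<le> norm X * norm X ^ k" by (rule mult_left_mono[OF Suc norm_ge_zero])
  finally show ?case by simp
qed

lemma op_pow_scaleR: "op_pow (t *\<^sub>R X) k = t ^ k *\<^sub>R op_pow X k"
  by (induction k) (simp_all add: op_pow_Suc blinfun.scaleR_left blinfun_eq_iff blinfun.scaleR_right)

lemma op_pow_compose_commute: "X o\<^sub>L Y = Y o\<^sub>L X \<Longrightarrow> X o\<^sub>L op_pow Y k = op_pow Y k o\<^sub>L X"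
proof (induction k)
  case (Suc k)
  have "X o\<^sub>L op_pow Y (Suc k) = (X o\<^sub>L Y) o\<^sub>L op_pow Y k" by (simp add: op_pow_Suc blinfun_compose_assoc)
  also have "\<dots> = Y o\<^sub>L (X o\<^sub>L op_pow Y k)" by (simp add: Suc.prems blinfun_compose_assoc)
  also have "\<dots> = op_pow Y (Suc k) o\<^sub>L X" by (simp add: Suc.IH[OF Suc.prems] op_pow_Suc blinfun_compose_assoc)
  finally show ?case .
qed (simp add: blinfun_eq_iff)

lemma op_pow_compose: "X o\<^sub>L Y = Y o\<^sub>L X \<Longrightarrow> op_pow (X o\<^sub>L Y) k = op_pow X k o\<^sub>L op_pow Y k"
proof (induction k)
  case (Suc k)
  have "op_pow (X o\<^sub>L Y) (Suc k) = X o\<^sub>L ((Y o\<^sub>L op_pow X k) o\<^sub>L op_pow Y k)"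
    by (simp add: Suc.IH[OF Suc.prems] op_pow_Suc blinfun_compose_assoc)
  also have "Y o\<^sub>L op_pow X k = op_pow X k o\<^sub>L Y" by (rule op_pow_compose_commute[OF Suc.prems[symmetric]])
  finally show ?case by (simp add: op_pow_Suc blinfun_compose_assoc)
qed (simp add: blinfun_eq_iff)

lemma exp_series: "(\<lambda>k. a ^ k / fact k) sums exp (a::real)"
  using exp_converges[of a] by (simp add: field_simps)

lemma op_exp_sums: "(\<lambda>k. op_pow X k /\<^sub>R fact k) sums op_exp X"
proof -
  have le: "norm (op_pow X k /\<^sub>R fact k) \<le> norm X ^ k / fact k" for k
    using norm_op_pow[of X k] by (simp add: divide_inverse mult.commute)
  have "summable (\<lambda>k. op_pow X k /\<^sub>R fact k)"
    by (rule summable_comparison_test'[OF sums_summable[OF exp_series[of "norm X"]], of 0]) (rule le)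
  then show ?thesis unfolding op_exp_op_pow by (rule summable_sums)
qed

lemma sums_norm_le:
  fixes f :: "nat \<Rightarrow> 'a::banach"
  assumes "f sums F" "c sums C" "\<And>k. norm (f k) \<le> c k"
  shows "norm F \<le> C"
  using norm_suminf_le[of f c] assms by (simp add: sums_iff)

text \<open>In the noncommutative expansion every word containing \<open>W\<close> is bounded by its
  scalar counterpart. The induction splits off one factor instead of enumerating the words.\<close>

lemma norm_op_pow_add_diff: "norm (op_pow (Y + W) k - op_pow Y k) \<le> (norm Y + norm W) ^ k - norm Y ^ k"
proof (induction k)
  case (Suc k)
  have "op_pow (Y + W) (Suc k) - op_pow Y (Suc k) = ((Y + W) o\<^sub>L (op_pow (Y + W) k - op_pow Y k)) + (W o\<^sub>L op_pow Y k)"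
    by (simp add: op_pow_Suc blinfun_eq_iff blinfun.add_left blinfun.diff_left blinfun.diff_right blinfun.add_right)
  then have "norm (op_pow (Y + W) (Suc k) - op_pow Y (Suc k)) \<le>
      norm ((Y + W) o\<^sub>L (op_pow (Y + W) k - op_pow Y k)) + norm (W o\<^sub>L op_pow Y k)"
    by (simp add: norm_triangle_ineq)
  also have "\<dots> \<le> norm (Y + W) * norm (op_pow (Y + W) k - op_pow Y k) + norm W * norm (op_pow Y k)"
    by (intro add_mono norm_blinfun_compose)
  also have "\<dots> \<le> (norm Y + norm W) * ((norm Y + norm W) ^ k - norm Y ^ k) + norm W * norm Y ^ k"
    by (intro add_mono mult_mono Suc norm_op_pow norm_triangle_ineq) auto
  finally show ?case by (simp add: algebra_simps)
qed simp

lemma norm_op_exp_diff: "norm (op_exp (Y + W) - op_exp Y) \<le> exp (norm Y + norm W) - exp (norm Y)"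
proof (rule sums_norm_le)
  show "(\<lambda>k. op_pow (Y + W) k /\<^sub>R fact k - op_pow Y k /\<^sub>R fact k) sums (op_exp (Y + W) - op_exp Y)"
    by (intro sums_diff op_exp_sums)
  show "(\<lambda>k. (norm Y + norm W) ^ k / fact k - norm Y ^ k / fact k) sums (exp (norm Y + norm W) - exp (norm Y))"
    by (intro sums_diff exp_series)
  show "norm (op_pow (Y + W) k /\<^sub>R fact k - op_pow Y k /\<^sub>R fact k) \<le> (norm Y + norm W) ^ k / fact k - norm Y ^ k / fact k" for k
  proof -
    have "norm (op_pow (Y + W) k /\<^sub>R fact k - op_pow Y k /\<^sub>R fact k) = norm (op_pow (Y + W) k - op_pow Y k) / fact k"
      by (simp add: scaleR_diff_right[symmetric] divide_inverse mult.commute)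
    also have "\<dots> \<le> ((norm Y + norm W) ^ k - norm Y ^ k) / fact k"
      by (intro divide_right_mono norm_op_pow_add_diff) simp
    finally show ?thesis by (simp add: diff_divide_distrib)
  qed
qed

text \<open>The term of degree 1 of the difference is exactly \<open>W\<close>, and its scalar
  majorant is exactly \<open>norm W\<close>; both are removed from the two series.\<close>

lemma norm_op_exp_diff_linear:
  "norm (op_exp (Y + W) - op_exp Y - W) \<le> exp (norm Y + norm W) - exp (norm Y) - norm W"
proof (rule sums_norm_le)
  show "(\<lambda>k. op_pow (Y + W) k /\<^sub>R fact k - op_pow Y k /\<^sub>R fact k - (if k = 1 then W else 0)) sums (op_exp (Y + W) - op_exp Y - W)"
    using sums_single[of 1 "\<lambda>k. W"] by (intro sums_diff op_exp_sums) simp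
  show "(\<lambda>k. (norm Y + norm W) ^ k / fact k - norm Y ^ k / fact k - (if k = 1 then norm W else 0)) sums (exp (norm Y + norm W) - exp (norm Y) - norm W)"
    using sums_single[of 1 "\<lambda>k. norm W"] by (intro sums_diff exp_series) simp
  show "norm (op_pow (Y + W) k /\<^sub>R fact k - op_pow Y k /\<^sub>R fact k - (if k = 1 then W else 0)) \<le>
      (norm Y + norm W) ^ k / fact k - norm Y ^ k / fact k - (if k = 1 then norm W else 0)" for k
  proof (cases "k = 1")
    case False
    have "norm (op_pow (Y + W) k /\<^sub>R fact k - op_pow Y k /\<^sub>R fact k) = norm (op_pow (Y + W) k - op_pow Y k) / fact k"
      by (simp add: scaleR_diff_right[symmetric] divide_inverse mult.commute)
    also have "\<dots> \<le> ((norm Y + norm W) ^ k - norm Y ^ k) / fact k"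
      by (intro divide_right_mono norm_op_pow_add_diff) simp
    finally show ?thesis using False by (simp add: diff_divide_distrib)
  qed simp
qed

lemma op_exp_0 [simp]: "op_exp 0 = id_blinfun"
proof -
  have "op_pow (0 :: 'a \<Rightarrow>\<^sub>L 'a) k /\<^sub>R fact k = (if k = 0 then id_blinfun else 0)" for k
    by (cases k) (simp_all add: op_pow_Suc)
  then have "(\<lambda>k. op_pow (0 :: 'a \<Rightarrow>\<^sub>L 'a) k /\<^sub>R fact k) sums id_blinfun"
    using sums_single[of 0 "\<lambda>k. id_blinfun :: 'a \<Rightarrow>\<^sub>L 'a"] by simp
  then show ?thesis using op_exp_sums sums_unique2 by blast
qed

lemma tendsto_op_exp:
  assumes "(f \<longlongrightarrow> X) F"
  shows "((\<lambda>n. op_exp (f n)) \<longlongrightarrow> op_exp X) F"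
proof -
  have "((\<lambda>n. op_exp (f n) - op_exp X) \<longlongrightarrow> 0) F"
  proof (rule Lim_null_comparison)
    show "\<forall>\<^sub>F n in F. norm (op_exp (f n) - op_exp X) \<le> exp (norm X + norm (f n - X)) - exp (norm X)"
      using norm_op_exp_diff[of X "f n - X" for n] by (intro always_eventually) simp
    have "((\<lambda>n. exp (norm X + norm (f n - X)) - exp (norm X)) \<longlongrightarrow> exp (norm X + norm (X - X)) - exp (norm X)) F"
      by (intro tendsto_intros assms)
    then show "((\<lambda>n. exp (norm X + norm (f n - X)) - exp (norm X)) \<longlongrightarrow> 0) F" by simp
  qed
  then show ?thesis by (rule LIM_zero_cancel)
qed

subsection \<open>Powers close to the identity\<close>

lemma sum_choose_Suc:
  fixes f :: "nat \<Rightarrow> 'a::real_vector"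
  shows "(\<Sum>j\<le>Suc n. real (Suc n choose j) *\<^sub>R f j) =
    (\<Sum>j\<le>n. real (n choose j) *\<^sub>R f j) + (\<Sum>j\<le>n. real (n choose j) *\<^sub>R f (Suc j))"
proof -
  have "(\<Sum>j\<le>n. real (n choose j) *\<^sub>R f j) = (\<Sum>j\<le>Suc n. real (n choose j) *\<^sub>R f j)" by simp
  also have "\<dots> = f 0 + (\<Sum>j\<le>n. real (n choose Suc j) *\<^sub>R f (Suc j))" by (subst sum.atMost_Suc_shift) simp
  finally have 1: "(\<Sum>j\<le>n. real (n choose j) *\<^sub>R f j) = f 0 + (\<Sum>j\<le>n. real (n choose Suc j) *\<^sub>R f (Suc j))" .
  have "(\<Sum>j\<le>Suc n. real (Suc n choose j) *\<^sub>R f j) = f 0 + (\<Sum>j\<le>n. real (Suc n choose Suc j) *\<^sub>R f (Suc j))"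
    by (subst sum.atMost_Suc_shift) simp
  also have "(\<Sum>j\<le>n. real (Suc n choose Suc j) *\<^sub>R f (Suc j)) =
      (\<Sum>j\<le>n. real (n choose j) *\<^sub>R f (Suc j)) + (\<Sum>j\<le>n. real (n choose Suc j) *\<^sub>R f (Suc j))"
    by (simp only: binomial_Suc_Suc of_nat_add scaleR_left_distrib sum.distrib)
  finally show ?thesis unfolding 1 by (simp only: add_ac)
qed

lemma op_pow_binomial: "op_pow (id_blinfun + A) n = (\<Sum>j\<le>n. real (n choose j) *\<^sub>R op_pow A j)"
proof (induction n)
  case (Suc n)
  define S where "S = (\<Sum>j\<le>n. real (n choose j) *\<^sub>R op_pow A j)"
  have "op_pow (id_blinfun + A) (Suc n) = S + (A o\<^sub>L S)"
    by (simp add: op_pow_Suc Suc.IH S_def[symmetric] blinfun_eq_iff blinfun.add_left)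
  also have "A o\<^sub>L S = (\<Sum>j\<le>n. real (n choose j) *\<^sub>R op_pow A (Suc j))"
    unfolding S_def op_pow_Suc
    by (simp add: bounded_bilinear.sum_right[OF bounded_bilinear_blinfun_compose]
        bounded_bilinear.scaleR_right[OF bounded_bilinear_blinfun_compose])
  finally show ?case unfolding S_def by (simp only: sum_choose_Suc)
qed simp

text \<open>The coefficients \<open>n ^ k / fact k - (n choose k)\<close> of the difference are
  nonnegative, so it is dominated by the same expression in the number
  \<open>norm A\<close>.\<close>

lemma norm_op_exp_minus_op_pow:
  "norm (op_exp (real n *\<^sub>R A) - op_pow (id_blinfun + A) n) \<le> exp (real n * norm A) - (1 + norm A) ^ n"
proof (rule sums_norm_le)
  define a where "a = norm A"
  have fin: "(\<lambda>k. if k \<le> n then f k else 0) sums (\<Sum>k\<le>n. f k)" for f :: "nat \<Rightarrow> 'c::real_normed_vector"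
    using sums_If_finite_set[of "{..n}" f] by simp
  show "(\<lambda>k. op_pow (real n *\<^sub>R A) k /\<^sub>R fact k - (if k \<le> n then real (n choose k) *\<^sub>R op_pow A k else 0)) sums
      (op_exp (real n *\<^sub>R A) - op_pow (id_blinfun + A) n)"
    unfolding op_pow_binomial by (intro sums_diff op_exp_sums fin)
  have "(1 + a) ^ n = (\<Sum>k\<le>n. real (n choose k) * a ^ k)"
    using binomial_ring[of a 1 n] by (simp add: add.commute)
  then show "(\<lambda>k. (real n * a) ^ k / fact k - (if k \<le> n then real (n choose k) * a ^ k else 0)) sums (exp (real n * norm A) - (1 + norm A) ^ n)"
    unfolding a_def[symmetric] by (simp only:) (intro sums_diff exp_series fin)
  show "norm (op_pow (real n *\<^sub>R A) k /\<^sub>R fact k - (if k \<le> n then real (n choose k) *\<^sub>R op_pow A k else 0)) \<le>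
      (real n * a) ^ k / fact k - (if k \<le> n then real (n choose k) * a ^ k else 0)" for k
  proof -
    define c where "c = real n ^ k / fact k - (if k \<le> n then real (n choose k) else 0)"
    have "real ((n choose k) * fact k) \<le> real (n ^ k)" unfolding of_nat_le_iff by (rule binomial_fact_pow)
    then have "real (n choose k) \<le> real n ^ k / fact k" by (simp add: field_simps)
    then have c: "c \<ge> 0" by (simp add: c_def)
    have "op_pow (real n *\<^sub>R A) k /\<^sub>R fact k - (if k \<le> n then real (n choose k) *\<^sub>R op_pow A k else 0) = c *\<^sub>R op_pow A k"
      by (simp add: op_pow_scaleR c_def scaleR_diff_left divide_inverse mult.commute)
    then have "norm (op_pow (real n *\<^sub>R A) k /\<^sub>R fact k - (if k \<le> n then real (n choose k) *\<^sub>R op_pow A k else 0)) \<le> c * a ^ k"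
      using c norm_op_pow[of A k] by (simp add: a_def mult_left_mono)
    also have "\<dots> = (real n * a) ^ k / fact k - (if k \<le> n then real (n choose k) * a ^ k else 0)"
      by (simp add: c_def left_diff_distrib power_mult_distrib)
    finally show ?thesis .
  qed
qed

lemma exp_minus_power_le:
  fixes a :: real
  assumes "0 \<le> a" "a \<le> 1"
  shows "exp (real n * a) - (1 + a) ^ n \<le> exp (real n * a) * (real n * a\<^sup>2)"
proof -
  have "real n * (a - a\<^sup>2) \<le> real n * ln (1 + a)" using ln_one_plus_pos_lower_bound[OF assms] by (intro mult_left_mono) auto
  then have "exp (real n * (a - a\<^sup>2)) \<le> exp (real n * ln (1 + a))" by simp
  also have "\<dots> = (1 + a) ^ n" using assms by (simp add: exp_of_nat_mult)
  finally have "exp (real n * a) * exp (- (real n * a\<^sup>2)) \<le> (1 + a) ^ n"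
    by (simp add: exp_add[symmetric] right_diff_distrib)
  moreover have "exp (real n * a) * (1 - real n * a\<^sup>2) \<le> exp (real n * a) * exp (- (real n * a\<^sup>2))"
    using exp_ge_add_one_self[of "- (real n * a\<^sup>2)"] by (intro mult_left_mono) auto
  ultimately show ?thesis by (simp add: algebra_simps)
qed

text \<open>With \<open>a n = norm (A n)\<close> the error is at most
  \<open>exp (m a) * (m a) * a\<close>, where \<open>m a\<close> converges and \<open>a\<close>
  tends to 0. This one limit yields the product rule for commuting exponentials, the Trotter formula
  and the tangent directions of a closed group.\<close>

lemma op_pow_tendsto_op_exp:
  fixes A :: "nat \<Rightarrow> ('v::fd_complex_space \<Rightarrow>\<^sub>L 'v)"
  assumes m: "filterlim m at_top sequentially" and lim: "(\<lambda>n. real (m n) *\<^sub>R A n) \<longlonglongrightarrow> X"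
  shows "(\<lambda>n. op_pow (id_blinfun + A n) (m n)) \<longlonglongrightarrow> op_exp X"
proof -
  define a where "a = (\<lambda>n. norm (A n))"
  have a0: "a n \<ge> 0" for n by (simp add: a_def)
  have "(\<lambda>n. norm (real (m n) *\<^sub>R A n)) \<longlonglongrightarrow> norm X" by (intro tendsto_norm lim)
  then have ma: "(\<lambda>n. real (m n) * a n) \<longlonglongrightarrow> norm X" by (simp add: a_def)
  have inv0: "(\<lambda>n. inverse (real (m n))) \<longlonglongrightarrow> 0"
    by (rule tendsto_inverse_0_at_top[OF filterlim_compose[OF filterlim_real_sequentially m]])
  have mpos: "\<forall>\<^sub>F n in sequentially. m n \<ge> 1" using m unfolding filterlim_at_top by blast
  have a_lim: "a \<longlonglongrightarrow> 0"
  proof -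
    have "(\<lambda>n. real (m n) * a n * inverse (real (m n))) \<longlonglongrightarrow> norm X * 0" by (intro tendsto_mult ma inv0)
    moreover have "\<forall>\<^sub>F n in sequentially. real (m n) * a n * inverse (real (m n)) = a n"
      using mpos by (rule eventually_mono) simp
    ultimately have "a \<longlonglongrightarrow> norm X * 0" by (rule Lim_transform_eventually)
    then show ?thesis by simp
  qed
  have le1: "\<forall>\<^sub>F n in sequentially. a n < 1" using order_tendstoD(2)[OF a_lim, of 1] by simp
  have "(\<lambda>n. op_exp (real (m n) *\<^sub>R A n) - op_pow (id_blinfun + A n) (m n)) \<longlonglongrightarrow> 0"
  proof (rule Lim_null_comparison)
    show "\<forall>\<^sub>F n in sequentially. norm (op_exp (real (m n) *\<^sub>R A n) - op_pow (id_blinfun + A n) (m n)) \<le>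
        exp (real (m n) * a n) * ((real (m n) * a n) * a n)"
      using le1
    proof (rule eventually_mono)
      fix n assume "a n < 1"
      then have "exp (real (m n) * a n) - (1 + a n) ^ m n \<le> exp (real (m n) * a n) * (real (m n) * (a n)\<^sup>2)"
        by (intro exp_minus_power_le a0) simp
      then show "norm (op_exp (real (m n) *\<^sub>R A n) - op_pow (id_blinfun + A n) (m n)) \<le>
        exp (real (m n) * a n) * ((real (m n) * a n) * a n)"
        using norm_op_exp_minus_op_pow[of "m n" "A n"] by (simp add: a_def power2_eq_square mult.assoc)
    qed
    have "(\<lambda>n. exp (real (m n) * a n) * ((real (m n) * a n) * a n)) \<longlonglongrightarrow> exp (norm X) * (norm X * 0)"
      by (intro tendsto_intros ma a_lim)
    then show "(\<lambda>n. exp (real (m n) * a n) * ((real (m n) * a n) * a n)) \<longlonglongrightarrow> 0" by simp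
  qed
  from tendsto_diff[OF tendsto_op_exp[OF lim] this] show ?thesis by simp
qed

text \<open>The product of \<open>id_blinfun + t X\<close> and \<open>id_blinfun + t Y\<close> is
  \<open>id_blinfun + t (X + Y)\<close> up to a term of order \<open>t\<close> squared, which is
  lost in the limit of the powers.\<close>

lemma op_exp_add_commute:
  assumes "X o\<^sub>L Y = Y o\<^sub>L X"
  shows "op_exp (X + Y) = op_exp X o\<^sub>L op_exp Y"
proof -
  define t where "t = (\<lambda>n. inverse (real (Suc n)))"
  have t0: "t \<longlonglongrightarrow> 0" unfolding t_def by (rule LIMSEQ_inverse_real_of_nat)
  have st: "real (Suc n) * t n = 1" for n by (simp add: t_def)
  have top: "filterlim Suc at_top sequentially" by (rule filterlim_Suc)
  define B where "B = (\<lambda>n. t n *\<^sub>R (X + Y) + (t n * t n) *\<^sub>R (X o\<^sub>L Y))"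
  have lim: "(\<lambda>n. op_pow (id_blinfun + t n *\<^sub>R Z) (Suc n)) \<longlonglongrightarrow> op_exp Z" for Z :: "'a \<Rightarrow>\<^sub>L 'a"
    by (rule op_pow_tendsto_op_exp[OF top]) (simp only: scaleR_scaleR st scaleR_one tendsto_const)
  have prod: "op_pow (id_blinfun + t n *\<^sub>R X) (Suc n) o\<^sub>L op_pow (id_blinfun + t n *\<^sub>R Y) (Suc n) = op_pow (id_blinfun + B n) (Suc n)" for n
  proof -
    have comm: "(id_blinfun + t n *\<^sub>R X) o\<^sub>L (id_blinfun + t n *\<^sub>R Y) = (id_blinfun + t n *\<^sub>R Y) o\<^sub>L (id_blinfun + t n *\<^sub>R X)"
      using assms by (simp add: blinfun_eq_iff blinfun.add_left blinfun.add_right blinfun.scaleR_left blinfun.scaleR_right algebra_simps)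
    have "(id_blinfun + t n *\<^sub>R X) o\<^sub>L (id_blinfun + t n *\<^sub>R Y) = id_blinfun + B n"
      by (simp add: B_def blinfun_eq_iff blinfun.add_left blinfun.add_right blinfun.scaleR_left blinfun.scaleR_right scaleR_add_right)
    then show ?thesis using op_pow_compose[OF comm, of "Suc n"] by simp
  qed
  have "(\<lambda>n. op_pow (id_blinfun + B n) (Suc n)) \<longlonglongrightarrow> op_exp (X + Y)"
  proof (rule op_pow_tendsto_op_exp[OF top])
    have "real (Suc n) *\<^sub>R B n = (X + Y) + t n *\<^sub>R (X o\<^sub>L Y)" for n
      unfolding B_def scaleR_add_right[of "real (Suc n)"] scaleR_scaleR mult.assoc[symmetric] st by simp
    moreover have "(\<lambda>n. (X + Y) + t n *\<^sub>R (X o\<^sub>L Y)) \<longlonglongrightarrow> (X + Y) + 0 *\<^sub>R (X o\<^sub>L Y)"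
      by (intro tendsto_intros t0)
    ultimately show "(\<lambda>n. real (Suc n) *\<^sub>R B n) \<longlonglongrightarrow> X + Y" by simp
  qed
  moreover have "(\<lambda>n. op_pow (id_blinfun + B n) (Suc n)) \<longlonglongrightarrow> (op_exp X o\<^sub>L op_exp Y)"
    unfolding prod[symmetric] by (intro bounded_bilinear.tendsto[OF bounded_bilinear_blinfun_compose] lim)
  ultimately show ?thesis by (rule LIMSEQ_unique)
qed

lemma op_exp_minus: "op_exp X o\<^sub>L op_exp (- X) = id_blinfun" "op_exp (- X) o\<^sub>L op_exp X = id_blinfun"
  using op_exp_add_commute[of X "- X"] op_exp_add_commute[of "- X" X]
  by (simp_all add: blinfun_eq_iff blinfun.minus_left blinfun.minus_right)

lemma op_exp_apply_sums: "(\<lambda>k. blinfun_apply (op_pow X k) x /\<^sub>R fact k) sums blinfun_apply (op_exp X) x"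
  using bounded_linear.sums[OF blinfun.bounded_linear_left op_exp_sums[of X], of x] by (simp add: blinfun.scaleR_left)

lemma cendo_scaleR: "cendo f \<Longrightarrow> f (t *\<^sub>R x) = t *\<^sub>R f x"
  using cendo_scale[of f "complex_of_real t" x] by (simp add: scaleC_of_real)

lemma cendo_op_pow: "cendo (blinfun_apply X) \<Longrightarrow> cendo (blinfun_apply (op_pow X k))"
proof (induction k)
  case 0
  show ?case by (simp add: cendoI)
next
  case (Suc k)
  then show ?case by (simp add: op_pow_Suc blinfun_compose_fun cendo_comp)
qed

lemma cendo_limit:
  assumes "\<And>n. cendo (blinfun_apply (f n))" "f \<longlonglongrightarrow> (l :: 'v::fd_complex_space \<Rightarrow>\<^sub>L 'v)"
  shows "cendo (blinfun_apply l)"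
proof -
  have lim: "(\<lambda>n. blinfun_apply (f n) x) \<longlonglongrightarrow> blinfun_apply l x" for x
    by (intro blinfun.tendsto assms tendsto_const)
  show ?thesis
  proof (rule cendoI)
    show "blinfun_apply l (x + y) = blinfun_apply l x + blinfun_apply l y" for x y by (rule blinfun.add_right)
    fix c x
    have "(\<lambda>n. blinfun_apply (f n) (c *\<^sub>C x)) \<longlonglongrightarrow> c *\<^sub>C blinfun_apply l x"
      unfolding cendo_scale[OF assms(1)] by (intro bounded_linear.tendsto[OF cendo_bounded_linear[OF cendo_scaleC]] lim)
    then show "blinfun_apply l (c *\<^sub>C x) = c *\<^sub>C blinfun_apply l x" using lim LIMSEQ_unique by blast
  qed
qed

lemma cendo_sums:
  assumes "\<And>n. cendo (blinfun_apply (f n))" "f sums (l :: 'v::fd_complex_space \<Rightarrow>\<^sub>L 'v)"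
  shows "cendo (blinfun_apply l)"
proof (rule cendo_limit)
  show "(\<lambda>n. \<Sum>k<n. f k) \<longlonglongrightarrow> l" using assms(2) by (simp add: sums_def)
  show "cendo (blinfun_apply (\<Sum>k<n. f k))" for n
    by (rule cendoI) (simp_all add: blinfun.sum_left blinfun.add_right sum.distrib cendo_scale[OF assms(1)] cv.scale_sum_right)
qed

lemma cendo_scaleR_left: "cendo (blinfun_apply X) \<Longrightarrow> cendo (blinfun_apply (t *\<^sub>R X))"
  by (rule cendoI) (simp_all add: blinfun.scaleR_left blinfun.add_right scaleR_add_right cendo_scale scaleC_of_real[symmetric] scaleC_scaleC mult.commute)

lemma cendo_op_exp:
  assumes "cendo (blinfun_apply X)"
  shows "cendo (blinfun_apply (op_exp X))"
  by (rule cendo_sums[OF _ op_exp_sums]) (intro cendo_scaleR_left cendo_op_pow assms)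

lemma op_exp_GL: "cendo (blinfun_apply X) \<Longrightarrow> op_exp X \<in> carrier GL"
  by (rule GL_I[OF cendo_op_exp op_exp_minus])

lemma op_exp_derivative:
  "((\<lambda>t. (1/t) *\<^sub>R (op_exp (t *\<^sub>R X) - id_blinfun)) \<longlongrightarrow> X) (at (0::real))"
proof -
  have "((\<lambda>t. (1/t) *\<^sub>R (op_exp (t *\<^sub>R X) - id_blinfun) - X) \<longlongrightarrow> 0) (at (0::real))"
  proof (rule Lim_null_comparison)
    define a where "a = norm X"
    show "\<forall>\<^sub>F t in at 0. norm ((1/t) *\<^sub>R (op_exp (t *\<^sub>R X) - id_blinfun) - X) \<le> \<bar>(exp (\<bar>t\<bar> * a) - 1) / \<bar>t\<bar> - a\<bar>"
    proof (rule eventually_at_filter[THEN iffD2, OF always_eventually], intro allI impI)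
      fix t :: real assume t: "t \<noteq> 0"
      have eq: "(1/t) *\<^sub>R (op_exp (t *\<^sub>R X) - id_blinfun) - X = (1/t) *\<^sub>R (op_exp (0 + t *\<^sub>R X) - op_exp 0 - t *\<^sub>R X)"
        using t by (simp add: scaleR_diff_right)
      have "norm (op_exp (0 + t *\<^sub>R X) - op_exp 0 - t *\<^sub>R X) \<le> exp (\<bar>t\<bar> * a) - 1 - \<bar>t\<bar> * a"
        using norm_op_exp_diff_linear[of 0 "t *\<^sub>R X"] by (simp add: a_def)
      then have "norm (op_exp (0 + t *\<^sub>R X) - op_exp 0 - t *\<^sub>R X) / \<bar>t\<bar> \<le> (exp (\<bar>t\<bar> * a) - 1 - \<bar>t\<bar> * a) / \<bar>t\<bar>"
        by (rule divide_right_mono) simp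
      also have "\<dots> = (exp (\<bar>t\<bar> * a) - 1) / \<bar>t\<bar> - a" using t by (simp add: diff_divide_distrib)
      finally show "norm ((1/t) *\<^sub>R (op_exp (t *\<^sub>R X) - id_blinfun) - X) \<le> \<bar>(exp (\<bar>t\<bar> * a) - 1) / \<bar>t\<bar> - a\<bar>"
        unfolding eq by simp
    qed
    have "((\<lambda>s. exp (s * a)) has_real_derivative a) (at 0)"
      by (auto intro!: derivative_eq_intros)
    then have lim: "((\<lambda>s. (exp (s * a) - 1) / s) \<longlongrightarrow> a) (at 0)"
      by (simp add: has_field_derivative_iff)
    have "filterlim (\<lambda>t::real. \<bar>t\<bar>) (at 0) (at 0)"
      unfolding filterlim_at by (auto simp: eventually_at_filter intro!: tendsto_eq_intros)
    from filterlim_compose[OF lim this] have "((\<lambda>t. (exp (\<bar>t\<bar> * a) - 1) / \<bar>t\<bar>) \<longlongrightarrow> a) (at 0)" .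
    from tendsto_rabs[OF tendsto_diff[OF this tendsto_const[of a]]]
    show "((\<lambda>t. \<bar>(exp (\<bar>t\<bar> * a) - 1) / \<bar>t\<bar> - a\<bar>) \<longlongrightarrow> 0) (at 0)" by simp
  qed
  then show ?thesis by (rule LIM_zero_cancel)
qed

section \<open>The Lie algebra of a compact linear group\<close>

definition null_seq :: "nat \<Rightarrow> real" where "null_seq n = inverse (real (Suc n))"

lemma null_seq: "null_seq \<longlonglongrightarrow> 0" "null_seq n > 0" "real (Suc n) * null_seq n = 1"
  unfolding null_seq_def using LIMSEQ_inverse_real_of_nat by (auto simp: null_seq_def[abs_def])

lemma op_exp_null_seq: "(\<lambda>n. real (Suc n) *\<^sub>R (op_exp (null_seq n *\<^sub>R X) - id_blinfun)) \<longlonglongrightarrow> X"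
proof -
  have "filterlim null_seq (at 0) sequentially"
    unfolding filterlim_at using null_seq(1) null_seq(2)[THEN less_imp_neq] by (auto intro!: always_eventually)
  from filterlim_compose[OF op_exp_derivative this, of X]
  have "(\<lambda>n. (1 / null_seq n) *\<^sub>R (op_exp (null_seq n *\<^sub>R X) - id_blinfun)) \<longlonglongrightarrow> X" .
  moreover have "1 / null_seq n = real (Suc n)" for n by (simp add: null_seq_def divide_inverse del: of_nat_Suc)
  ultimately show ?thesis by (simp only:)
qed

lemma op_exp_null_seq_id: "(\<lambda>n. op_exp (null_seq n *\<^sub>R X)) \<longlonglongrightarrow> id_blinfun"
proof -
  have "(\<lambda>n. null_seq n *\<^sub>R X) \<longlonglongrightarrow> 0 *\<^sub>R X" by (intro tendsto_intros null_seq)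
  then show ?thesis using tendsto_op_exp[of "\<lambda>n. null_seq n *\<^sub>R X" "0 *\<^sub>R X"] by simp
qed

text \<open>The product of the two exponentials is the identity plus
  \<open>null_seq n *\<^sub>R (X + Y)\<close> up to a smaller error, so its powers tend to the
  exponential of the sum. For a closed group this makes the Lie algebra closed under
  addition.\<close>

lemma trotter:
  "(\<lambda>n. op_pow (op_exp (null_seq n *\<^sub>R X) o\<^sub>L op_exp (null_seq n *\<^sub>R Y)) (Suc n)) \<longlonglongrightarrow> op_exp (X + Y)"
proof -
  define A where "A = (\<lambda>n. (op_exp (null_seq n *\<^sub>R X) o\<^sub>L op_exp (null_seq n *\<^sub>R Y)) - id_blinfun)"
  have "(\<lambda>n. op_pow (id_blinfun + A n) (Suc n)) \<longlonglongrightarrow> op_exp (X + Y)"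
  proof (rule op_pow_tendsto_op_exp[OF filterlim_Suc])
    have eq: "real (Suc n) *\<^sub>R A n = ((real (Suc n) *\<^sub>R (op_exp (null_seq n *\<^sub>R X) - id_blinfun)) o\<^sub>L op_exp (null_seq n *\<^sub>R Y))
        + real (Suc n) *\<^sub>R (op_exp (null_seq n *\<^sub>R Y) - id_blinfun)" for n
      unfolding A_def blinfun_eq_iff
      by (simp only: blinfun.scaleR_left blinfun.add_left blinfun.diff_left blinfun_apply_blinfun_compose id_blinfun.rep_eq
          scaleR_diff_right) simp
    have "(\<lambda>n. ((real (Suc n) *\<^sub>R (op_exp (null_seq n *\<^sub>R X) - id_blinfun)) o\<^sub>L op_exp (null_seq n *\<^sub>R Y))
        + real (Suc n) *\<^sub>R (op_exp (null_seq n *\<^sub>R Y) - id_blinfun)) \<longlonglongrightarrow> (X o\<^sub>L id_blinfun) + Y"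
      by (intro tendsto_add bounded_bilinear.tendsto[OF bounded_bilinear_blinfun_compose] op_exp_null_seq op_exp_null_seq_id)
    moreover have "(X o\<^sub>L id_blinfun) + Y = X + Y" by (simp add: blinfun_eq_iff blinfun.add_left)
    ultimately show "(\<lambda>n. real (Suc n) *\<^sub>R A n) \<longlonglongrightarrow> X + Y" unfolding eq by simp
  qed
  then show ?thesis by (simp add: A_def)
qed

lemma closed_cendo_compact_ball:
  fixes C :: "('v::fd_complex_space \<Rightarrow>\<^sub>L 'v) set"
  assumes "\<And>X. X \<in> C \<Longrightarrow> cendo (blinfun_apply X)" "\<And>X. X \<in> C \<Longrightarrow> norm X \<le> \<delta>"
    and "\<And>f X. (\<And>n. f n \<in> C) \<Longrightarrow> f \<longlonglongrightarrow> X \<Longrightarrow> X \<in> C"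
  shows "compact C"
  unfolding compact_def
proof (intro allI impI)
  fix f :: "nat \<Rightarrow> 'v \<Rightarrow>\<^sub>L 'v" assume f: "\<forall>n. f n \<in> C"
  obtain l s where ls: "strict_mono s" "(\<lambda>n. f (s n)) \<longlonglongrightarrow> l" "cendo (blinfun_apply l)"
    by (rule cendo_seq_compact[of f \<delta>]) (use f assms in auto)
  have "l \<in> C" by (rule assms(3)[OF _ ls(2)]) (use f in blast)
  then show "\<exists>l\<in>C. \<exists>r. strict_mono r \<and> (f \<circ> r) \<longlonglongrightarrow> l" using ls by (auto simp: comp_def)
qed

context lin_group begin

abbreviation lie :: "('v \<Rightarrow>\<^sub>L 'v) set" where "lie \<equiv> lie_algebra G"

lemma lie_iff: "X \<in> lie \<longleftrightarrow> (\<forall>t. op_exp (t *\<^sub>R X) \<in> G)"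
  by (simp add: lie_algebra_def)

lemma lie_exp: "X \<in> lie \<Longrightarrow> op_exp (t *\<^sub>R X) \<in> G"
  by (simp add: lie_iff)

lemma lie_exp1: "X \<in> lie \<Longrightarrow> op_exp X \<in> G"
  using lie_exp[of X 1] by simp

lemma lie_scale: "X \<in> lie \<Longrightarrow> c *\<^sub>R X \<in> lie"
  by (simp add: lie_iff)

lemma lie_0: "0 \<in> lie"
  by (simp add: lie_iff id_in)

lemma limit_in_G: "(\<And>n. f n \<in> G) \<Longrightarrow> f \<longlonglongrightarrow> l \<Longrightarrow> l \<in> G"
  using compact_imp_closed[OF compact_G] closed_sequentially by blast

lemma op_pow_in: "g \<in> G \<Longrightarrow> op_pow g k \<in> G"
  by (induction k) (simp_all add: id_in op_pow_Suc compose_in)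

lemma lie_add:
  assumes "X \<in> lie" "Y \<in> lie"
  shows "X + Y \<in> lie"
  unfolding lie_iff
proof
  fix t
  have "op_exp (t *\<^sub>R X + t *\<^sub>R Y) \<in> G"
    by (rule limit_in_G[OF _ trotter]) (intro op_pow_in compose_in lie_exp lie_scale assms)
  then show "op_exp (t *\<^sub>R (X + Y)) \<in> G" by (simp add: scaleR_add_right)
qed

lemma lie_limit:
  assumes "\<And>n. f n \<in> lie" "f \<longlonglongrightarrow> X"
  shows "X \<in> lie"
  unfolding lie_iff
proof
  fix t
  have "(\<lambda>n. op_exp (t *\<^sub>R f n)) \<longlonglongrightarrow> op_exp (t *\<^sub>R X)"
    by (intro tendsto_op_exp tendsto_scaleR tendsto_const assms(2))
  then show "op_exp (t *\<^sub>R X) \<in> G" by (rule limit_in_G[rotated]) (rule lie_exp[OF assms(1)])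
qed

lemma lie_cendo:
  assumes X: "X \<in> lie"
  shows "cendo (blinfun_apply X)"
proof (rule cendo_limit[OF _ op_exp_null_seq])
  fix n
  have g: "cendo (blinfun_apply (op_exp (null_seq n *\<^sub>R X)))" by (rule cendo_G[OF lie_exp[OF X]])
  have "cendo (blinfun_apply (op_exp (null_seq n *\<^sub>R X) - id_blinfun))"
    by (rule cendoI) (simp_all add: blinfun.diff_left blinfun.add_right cendo_scale[OF g] cv.scale_right_diff_distrib)
  then show "cendo (blinfun_apply (real (Suc n) *\<^sub>R (op_exp (null_seq n *\<^sub>R X) - id_blinfun)))" by (rule cendo_scaleR_left)
qed

lemma inv_op_exp: "cendo (blinfun_apply X) \<Longrightarrow> inv\<^bsub>GL\<^esub> (op_exp X) = op_exp (- X)"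
proof (rule GL_inv_eqI)
  assume X: "cendo (blinfun_apply X)"
  show "op_exp X \<in> carrier GL" by (rule op_exp_GL[OF X])
  show "op_exp (- X) \<in> carrier GL" using op_exp_GL[OF cendo_scaleR_left[OF X, of "-1"]] by simp
qed (rule op_exp_minus)

text \<open>Directions in which elements of the group approach the identity lie in the Lie algebra: take
  powers \<open>g\<^sub>n ^ \<lfloor>t / r\<^sub>n\<rfloor>\<close>.\<close>

lemma tangent_in_lie:
  assumes g: "\<And>n. g n \<in> G" and r: "\<And>n. r n > 0" "r \<longlonglongrightarrow> 0"
    and lim: "(\<lambda>n. (1 / r n) *\<^sub>R (g n - id_blinfun)) \<longlonglongrightarrow> X"
  shows "X \<in> lie"
proof -
  have pos: "op_exp (t *\<^sub>R X) \<in> G" if t: "t > 0" for t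
  proof -
    define m where "m = (\<lambda>n. nat \<lfloor>t / r n\<rfloor>)"
    have fl: "real (m n) \<le> t / r n" "t / r n \<le> real (m n) + 1" for n
    proof -
      have "0 \<le> \<lfloor>t / r n\<rfloor>" using t r(1)[of n] by (simp add: less_imp_le)
      then have "real (m n) = of_int \<lfloor>t / r n\<rfloor>" by (simp add: m_def)
      then show "real (m n) \<le> t / r n" "t / r n \<le> real (m n) + 1" by linarith+
    qed
    have mr: "t - r n \<le> real (m n) * r n" "real (m n) * r n \<le> t" for n
    proof -
      show "real (m n) * r n \<le> t" using fl(1)[of n] r(1)[of n] by (simp add: pos_le_divide_eq)
      have "t \<le> (real (m n) + 1) * r n" using fl(2)[of n] r(1)[of n] by (simp add: pos_divide_le_eq)
      then show "t - r n \<le> real (m n) * r n" by (simp add: algebra_simps)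
    qed
    have tr: "(\<lambda>n. t - r n) \<longlonglongrightarrow> t" using tendsto_diff[OF tendsto_const[of t] r(2)] by simp
    have mt: "(\<lambda>n. real (m n) * r n) \<longlonglongrightarrow> t"
      by (rule tendsto_sandwich[OF always_eventually[OF allI[OF mr(1)]] always_eventually[OF allI[OF mr(2)]] tr tendsto_const])
    have mtop: "filterlim m at_top sequentially"
      unfolding filterlim_at_top
    proof
      fix N
      have "\<forall>\<^sub>F n in sequentially. r n < t / (real N + 1)"
        using order_tendstoD(2)[OF r(2), of "t / (real N + 1)"] t by simp
      then show "\<forall>\<^sub>F n in sequentially. N \<le> m n"
      proof (rule eventually_mono)
        fix n assume "r n < t / (real N + 1)"
        then have "r n * (real N + 1) < t" by (simp add: pos_less_divide_eq)
        then have "real N + 1 < t / r n" using r(1)[of n] by (simp add: pos_less_divide_eq mult.commute)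
        then have "real N < real (m n)" using fl(2)[of n] by linarith
        then show "N \<le> m n" by simp
      qed
    qed
    have "(\<lambda>n. (real (m n) * r n) *\<^sub>R ((1 / r n) *\<^sub>R (g n - id_blinfun))) \<longlonglongrightarrow> t *\<^sub>R X"
      by (intro tendsto_scaleR mt lim)
    moreover have "(real (m n) * r n) *\<^sub>R ((1 / r n) *\<^sub>R (g n - id_blinfun)) = real (m n) *\<^sub>R (g n - id_blinfun)" for n
      using r(1)[of n] by simp
    ultimately have "(\<lambda>n. real (m n) *\<^sub>R (g n - id_blinfun)) \<longlonglongrightarrow> t *\<^sub>R X" by (simp only:)
    from op_pow_tendsto_op_exp[OF mtop this] have "(\<lambda>n. op_pow (g n) (m n)) \<longlonglongrightarrow> op_exp (t *\<^sub>R X)" by simp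
    then show ?thesis by (rule limit_in_G[rotated]) (rule op_pow_in[OF g])
  qed
  have cX: "cendo (blinfun_apply X)"
  proof (rule cendo_limit[OF _ lim])
    fix n
    have "cendo (blinfun_apply (g n - id_blinfun))"
      by (rule cendoI) (simp_all add: blinfun.diff_left blinfun.add_right cendo_scale[OF cendo_G[OF g]] cv.scale_right_diff_distrib)
    then show "cendo (blinfun_apply ((1 / r n) *\<^sub>R (g n - id_blinfun)))" by (rule cendo_scaleR_left)
  qed
  show ?thesis unfolding lie_iff
  proof
    fix t :: real
    consider "t > 0" | "t = 0" | "t < 0" by linarith
    then show "op_exp (t *\<^sub>R X) \<in> G"
    proof cases
      case 3
      have "inv\<^bsub>GL\<^esub> (op_exp ((- t) *\<^sub>R X)) \<in> G" by (rule inv_in[OF pos]) (use 3 in simp)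
      then show ?thesis using inv_op_exp[OF cendo_scaleR_left[OF cX, of "-t"]] by simp
    qed (use pos id_in in auto)
  qed
qed

lemma exp_minus_one_le: "0 \<le> s \<Longrightarrow> s \<le> 1 \<Longrightarrow> exp s \<le> 1 + s + s\<^sup>2" for s :: real
  by (rule exp_bound)

text \<open>The exponential covers a neighbourhood of the identity of the closed group. For group
  elements \<open>g n\<close> tending to the identity let \<open>op_exp (Y n)\<close> be a best
  approximation with \<open>Y n\<close> in the ball of radius \<open>d\<close>. If the approximation
  is never exact, the normalized errors accumulate at some \<open>Z\<close>, which is a tangent
  direction and so lies in the Lie algebra; but then adding \<open>Z\<close> times the error size to
  \<open>Y n\<close> approximates better.\<close>

lemma near_identity_small:
  assumes d: "d > 0" "d \<le> 1/2"
  shows "\<exists>\<eta>>0. \<forall>g\<in>G. norm (g - id_blinfun) < \<eta> \<longrightarrow> (\<exists>Y\<in>lie. norm Y \<le> d \<and> g = op_exp Y)"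
proof (rule ccontr)
  assume neg: "\<not> ?thesis"
  have "\<forall>n. \<exists>g\<in>G. norm (g - id_blinfun) < null_seq n \<and> \<not> (\<exists>Y\<in>lie. norm Y \<le> d \<and> g = op_exp Y)"
    using neg null_seq(2) by blast
  then obtain g where g: "\<And>n. g n \<in> G" "\<And>n. norm (g n - id_blinfun) < null_seq n"
    "\<And>n Y. Y \<in> lie \<Longrightarrow> norm Y \<le> d \<Longrightarrow> g n \<noteq> op_exp Y" by metis
  define C where "C = {Y \<in> lie. norm Y \<le> d}"
  have C0: "0 \<in> C" using lie_0 d by (simp add: C_def)
  have compC: "compact C"
  proof (rule closed_cendo_compact_ball)
    show "X \<in> C" if f: "\<And>n. f n \<in> C" and lim: "f \<longlonglongrightarrow> X" for f X
    proof -
      have "X \<in> lie" by (rule lie_limit[OF _ lim]) (use f in \<open>auto simp: C_def\<close>)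
      moreover have "norm X \<le> d" by (rule LIMSEQ_le_const2[OF tendsto_norm[OF lim]]) (use f in \<open>auto simp: C_def\<close>)
      ultimately show ?thesis by (simp add: C_def)
    qed
  qed (auto simp: C_def lie_cendo)
  have contexp: "continuous_on C op_exp"
    unfolding continuous_on_def by (intro ballI tendsto_op_exp tendsto_ident_at)
  have "\<exists>Y\<in>C. \<forall>Y'\<in>C. norm (g n - op_exp Y) \<le> norm (g n - op_exp Y')" for n
    by (rule continuous_attains_inf[OF compC]) (use C0 in \<open>auto intro!: continuous_intros contexp\<close>)
  then obtain Y where Y: "\<And>n. Y n \<in> C" "\<And>n Y'. Y' \<in> C \<Longrightarrow> norm (g n - op_exp (Y n)) \<le> norm (g n - op_exp Y')"
    by metis
  have Ylie: "Y n \<in> lie" and Yd: "norm (Y n) \<le> d" for n using Y(1)[of n] by (simp_all add: C_def)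
  define s where "s = (\<lambda>n. norm (g n - op_exp (Y n)))"
  have s0: "s n > 0" for n using g(3)[OF Ylie Yd, of n n] by (simp add: s_def)
  have sle: "s n \<le> null_seq n" for n
    using Y(2)[OF C0, of n] g(2)[of n] by (simp add: s_def)
  have slim: "s \<longlonglongrightarrow> 0"
    by (rule tendsto_sandwich[OF always_eventually[OF allI[OF less_imp_le[OF s0]]] always_eventually[OF allI[OF sle]]
          tendsto_const null_seq(1)])
  have Ylim: "Y \<longlonglongrightarrow> 0"
  proof (rule Lim_null_comparison)
    \<comment> \<open>The exponential differs from the identity by \<open>Y n\<close> up to at most
      half of \<open>norm (Y n)\<close>, because \<open>d \<le> 1/2\<close>, and its distance to the
      identity is at most \<open>2 * null_seq n\<close>.\<close>
    show "\<forall>\<^sub>F n in sequentially. norm (Y n) \<le> 4 * null_seq n"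
    proof (rule always_eventually, rule allI)
      fix n
      define y where "y = norm (Y n)"
      have "norm (op_exp (0 + Y n) - op_exp 0 - Y n) \<le> exp y - 1 - y"
        using norm_op_exp_diff_linear[of 0 "Y n"] by (simp add: y_def)
      also have "\<dots> \<le> y\<^sup>2" using exp_minus_one_le[of y] Yd[of n] d by (simp add: y_def)
      finally have 1: "norm (op_exp (Y n) - id_blinfun - Y n) \<le> y\<^sup>2" by simp
      have "y * y \<le> 1/2 * y" using Yd[of n] d by (intro mult_right_mono) (auto simp: y_def)
      then have y2: "y\<^sup>2 \<le> y / 2" by (simp add: power2_eq_square)
      have "norm (op_exp (Y n) - id_blinfun) \<le> norm (g n - id_blinfun) + norm (g n - op_exp (Y n))"
        using norm_triangle_ineq4[of "g n - id_blinfun" "g n - op_exp (Y n)"] by simp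
      also have "\<dots> \<le> 2 * null_seq n" using g(2)[of n] sle[of n] by (simp add: s_def)
      finally have 2: "norm (op_exp (Y n) - id_blinfun) \<le> 2 * null_seq n" .
      have "y \<le> norm (op_exp (Y n) - id_blinfun) + norm (op_exp (Y n) - id_blinfun - Y n)"
        using norm_triangle_ineq4[of "op_exp (Y n) - id_blinfun" "op_exp (Y n) - id_blinfun - Y n"] by (simp add: y_def)
      then show "norm (Y n) \<le> 4 * null_seq n" using 1 2 y2 by (simp add: y_def)
    qed
    have "(\<lambda>n. 4 * null_seq n) \<longlonglongrightarrow> 4 * 0" by (intro tendsto_intros null_seq)
    then show "(\<lambda>n. 4 * null_seq n) \<longlonglongrightarrow> 0" by simp
  qed
  define D where "D = (\<lambda>n. (1 / s n) *\<^sub>R (g n - op_exp (Y n)))"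
  have Dnorm: "norm (D n) = 1" for n using s0[of n] by (simp add: D_def s_def)
  have Dc: "cendo (blinfun_apply (D n))" for n
  proof -
    have "cendo (blinfun_apply (g n - op_exp (Y n)))"
      by (rule cendoI) (simp_all add: blinfun.diff_left blinfun.add_right cendo_scale[OF cendo_G[OF g(1)]]
          cendo_scale[OF cendo_G[OF lie_exp1[OF Ylie]]] cv.scale_right_diff_distrib)
    then show ?thesis unfolding D_def by (rule cendo_scaleR_left)
  qed
  obtain Z \<sigma> where Z: "strict_mono \<sigma>" "(\<lambda>n. D (\<sigma> n)) \<longlonglongrightarrow> Z" "cendo (blinfun_apply Z)"
    by (rule cendo_seq_compact[of D 1]) (auto simp: Dc Dnorm)
  have sub: "(\<lambda>n. f (\<sigma> n)) \<longlonglongrightarrow> l" if "f \<longlonglongrightarrow> l" for f :: "nat \<Rightarrow> 'c::topological_space" and l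
    using LIMSEQ_subseq_LIMSEQ[OF that Z(1)] by (simp add: comp_def)
  have Zlie: "Z \<in> lie"
  \<comment> \<open>Left multiplication by the inverse of the best approximation moves the error to
    the identity without changing its limit direction, since \<open>Y n\<close> tends to 0.\<close>
  proof (rule tangent_in_lie)
    show "op_exp (- Y (\<sigma> n)) o\<^sub>L g (\<sigma> n) \<in> G" for n
      using lie_exp1[OF lie_scale[OF Ylie, of "-1"]] by (simp add: compose_in g(1))
    show "s (\<sigma> n) > 0" for n by (rule s0)
    show "(\<lambda>n. s (\<sigma> n)) \<longlonglongrightarrow> 0" by (rule sub[OF slim])
    have eq: "(1 / s n) *\<^sub>R ((op_exp (- Y n) o\<^sub>L g n) - id_blinfun) = op_exp (- Y n) o\<^sub>L D n" for n
    proof -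
      have "(op_exp (- Y n) o\<^sub>L g n) - id_blinfun = op_exp (- Y n) o\<^sub>L (g n - op_exp (Y n))"
        unfolding op_exp_minus(2)[of "Y n", symmetric] by (simp add: blinfun_eq_iff blinfun.diff_left blinfun.diff_right)
      then show ?thesis by (simp add: D_def blinfun_eq_iff blinfun.scaleR_left blinfun.scaleR_right)
    qed
    have "(\<lambda>n. - Y n) \<longlonglongrightarrow> - 0" by (rule tendsto_minus[OF Ylim])
    then have "(\<lambda>n. op_exp (- Y n)) \<longlonglongrightarrow> id_blinfun" using tendsto_op_exp by fastforce
    then have "(\<lambda>n. op_exp (- Y (\<sigma> n)) o\<^sub>L D (\<sigma> n)) \<longlonglongrightarrow> (id_blinfun o\<^sub>L Z)"
      by (intro bounded_bilinear.tendsto[OF bounded_bilinear_blinfun_compose] Z(2) sub)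
    moreover have "id_blinfun o\<^sub>L Z = Z" by (simp add: blinfun_eq_iff)
    ultimately have "(\<lambda>n. op_exp (- Y (\<sigma> n)) o\<^sub>L D (\<sigma> n)) \<longlonglongrightarrow> Z" by simp
    then show "(\<lambda>n. (1 / s (\<sigma> n)) *\<^sub>R ((op_exp (- Y (\<sigma> n)) o\<^sub>L g (\<sigma> n)) - id_blinfun)) \<longlonglongrightarrow> Z"
      unfolding eq .
  qed
  have "(\<lambda>n. norm (D (\<sigma> n))) \<longlonglongrightarrow> norm Z" by (rule tendsto_norm[OF Z(2)])
  then have Z1: "norm Z = 1" by (simp add: Dnorm LIMSEQ_const_iff)
  define y where "y = (\<lambda>n. norm (Y (\<sigma> n)))"
  define t where "t = (\<lambda>n. s (\<sigma> n))"
  have ylim: "y \<longlonglongrightarrow> 0" unfolding y_def using tendsto_norm[OF sub[OF Ylim]] by simp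
  have tlim: "t \<longlonglongrightarrow> 0" unfolding t_def by (rule sub[OF slim])
  have "(\<lambda>n. y n + t n) \<longlonglongrightarrow> 0 + 0" by (intro tendsto_add ylim tlim)
  then have "\<forall>\<^sub>F n in sequentially. y n + t n < d" using order_tendstoD(2)[of _ 0 _ d] d(1) by simp
  moreover have "(\<lambda>n. norm (D (\<sigma> n) - Z) + (exp (y n) * (1 + t n) - 1)) \<longlonglongrightarrow> norm (Z - Z) + (exp 0 * (1 + 0) - 1)"
    by (intro tendsto_intros Z(2) ylim tlim)
  then have "(\<lambda>n. norm (D (\<sigma> n) - Z) + (exp (y n) * (1 + t n) - 1)) \<longlonglongrightarrow> 0" by simp
  then have "\<forall>\<^sub>F n in sequentially. norm (D (\<sigma> n) - Z) + (exp (y n) * (1 + t n) - 1) < 1"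
    by (rule order_tendstoD(2)) simp
  ultimately have "\<forall>\<^sub>F n in sequentially. False"
  proof eventually_elim
    case (elim n)
    have t0: "t n > 0" unfolding t_def by (rule s0)
    have t1: "t n \<le> 1" using elim(1) d(2) norm_ge_zero[of "Y (\<sigma> n)"] unfolding y_def by linarith
    \<comment> \<open>The corrected exponent leaves an error of \<open>t n\<close> times a factor
      that is below 1 for large \<open>n\<close>, while minimality demands an error of at least
      \<open>t n\<close>.\<close>
    define Y' where "Y' = Y (\<sigma> n) + t n *\<^sub>R Z"
    have "norm Y' \<le> y n + t n" unfolding Y'_def y_def
      using norm_triangle_ineq[of "Y (\<sigma> n)" "t n *\<^sub>R Z"] Z1 t0 by simp
    then have "Y' \<in> C" using elim(1) lie_add[OF Ylie lie_scale[OF Zlie]] by (simp add: C_def Y'_def)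
    then have "t n \<le> norm (g (\<sigma> n) - op_exp Y')" using Y(2)[of Y' "\<sigma> n"] by (simp add: t_def s_def)
    also have "\<dots> \<le> norm (g (\<sigma> n) - op_exp (Y (\<sigma> n)) - t n *\<^sub>R Z) + norm (op_exp Y' - op_exp (Y (\<sigma> n)) - t n *\<^sub>R Z)"
      using norm_triangle_ineq4[of "g (\<sigma> n) - op_exp (Y (\<sigma> n)) - t n *\<^sub>R Z" "op_exp Y' - op_exp (Y (\<sigma> n)) - t n *\<^sub>R Z"] by simp
    also have "g (\<sigma> n) - op_exp (Y (\<sigma> n)) - t n *\<^sub>R Z = t n *\<^sub>R (D (\<sigma> n) - Z)"
      using t0 by (simp add: D_def t_def scaleR_diff_right)
    also have "norm (t n *\<^sub>R (D (\<sigma> n) - Z)) = t n * norm (D (\<sigma> n) - Z)" using t0 by simp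
    also have "norm (op_exp Y' - op_exp (Y (\<sigma> n)) - t n *\<^sub>R Z) \<le> exp (y n + t n) - exp (y n) - t n"
      using norm_op_exp_diff_linear[of "Y (\<sigma> n)" "t n *\<^sub>R Z"] Z1 t0 by (simp add: Y'_def y_def)
    also have "\<dots> = exp (y n) * (exp (t n) - 1) - t n" by (simp add: exp_add right_diff_distrib)
    also have "\<dots> \<le> exp (y n) * (t n + (t n)\<^sup>2) - t n"
      using exp_minus_one_le[of "t n"] t0 t1 by (intro diff_right_mono mult_left_mono) auto
    also have "\<dots> = t n * (exp (y n) * (1 + t n) - 1)" by (simp add: power2_eq_square algebra_simps)
    finally have "t n * 1 \<le> t n * (norm (D (\<sigma> n) - Z) + (exp (y n) * (1 + t n) - 1))" by (simp add: distrib_left)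
    then show False using elim(2) t0 by (simp add: mult_le_cancel_left)
  qed
  then show False by simp
qed

lemma near_identity:
  assumes d: "d > 0"
  shows "\<exists>\<eta>>0. \<forall>g\<in>G. norm (g - id_blinfun) < \<eta> \<longrightarrow> (\<exists>Y\<in>lie. norm Y \<le> d \<and> g = op_exp Y)"
proof -
  obtain \<eta> where "\<eta> > 0" "\<And>g. g \<in> G \<Longrightarrow> norm (g - id_blinfun) < \<eta> \<Longrightarrow> \<exists>Y\<in>lie. norm Y \<le> min d (1/2) \<and> g = op_exp Y"
  proof -
    have "min d (1/2) > 0" "min d (1/2) \<le> 1/2" using d by auto
    from near_identity_small[OF this] show thesis using that by blast
  qed
  moreover have "min d (1/2) \<le> d" by simp
  ultimately show ?thesis by (meson order_trans)
qed

end

section \<open>Polynomials on the complexified group\<close>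

text \<open>Entire functions as everywhere convergent power series at 0, so that products and
  uniqueness become statements about coefficients.\<close>

definition entire :: "(complex \<Rightarrow> complex) \<Rightarrow> bool" where
  "entire f \<longleftrightarrow> (\<exists>c. \<forall>s. (\<lambda>k. c k * s ^ k) sums f s)"

lemma entire_const: "entire (\<lambda>s. a)"
proof -
  have "(\<lambda>k. (if k = 0 then a else 0) * s ^ k) sums a" for s
    using sums_single[of 0 "\<lambda>k. a"] by (rule sums_cong[THEN iffD1, rotated]) auto
  then show ?thesis unfolding entire_def by (intro exI allI)
qed

lemma entire_add: "entire f \<Longrightarrow> entire g \<Longrightarrow> entire (\<lambda>s. f s + g s)"
proof -
  assume "entire f" "entire g"
  then obtain c d where "\<And>s. (\<lambda>k. c k * s ^ k) sums f s" "\<And>s. (\<lambda>k. d k * s ^ k) sums g s" unfolding entire_def by blast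
  then have "(\<lambda>k. (c k + d k) * s ^ k) sums (f s + g s)" for s
    using sums_add[of "\<lambda>k. c k * s ^ k" "f s" "\<lambda>k. d k * s ^ k" "g s"] by (simp add: distrib_right)
  then show ?thesis unfolding entire_def by (intro exI[of _ "\<lambda>k. c k + d k"]) blast
qed

lemma entire_mult: "entire f \<Longrightarrow> entire g \<Longrightarrow> entire (\<lambda>s. f s * g s)"
proof -
  assume "entire f" "entire g"
  then obtain c d where c: "\<And>s. (\<lambda>k. c k * s ^ k) sums f s" and d: "\<And>s. (\<lambda>k. d k * s ^ k) sums g s" unfolding entire_def by blast
  have absc: "summable (\<lambda>k. norm (c k * s ^ k))" for s
    using powser_insidea[of c "complex_of_real (norm s + 1)" s] sums_summable[OF c] by simp
  have absd: "summable (\<lambda>k. norm (d k * s ^ k))" for s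
    using powser_insidea[of d "complex_of_real (norm s + 1)" s] sums_summable[OF d] by simp
  define e where "e = (\<lambda>k. \<Sum>i\<le>k. c i * d (k - i))"
  have "(\<lambda>k. e k * s ^ k) sums (f s * g s)" for s
  proof -
    have "(\<lambda>k. \<Sum>i\<le>k. (c i * s ^ i) * (d (k - i) * s ^ (k - i))) sums ((\<Sum>k. c k * s ^ k) * (\<Sum>k. d k * s ^ k))"
      by (rule Cauchy_product_sums[OF absc absd])
    moreover have "(\<Sum>i\<le>k. (c i * s ^ i) * (d (k - i) * s ^ (k - i))) = e k * s ^ k" for k
      unfolding e_def sum_distrib_right
    proof (rule sum.cong[OF refl])
      fix i assume "i \<in> {..k}"
      then have "s ^ i * s ^ (k - i) = s ^ k" by (simp flip: power_add)
      then show "(c i * s ^ i) * (d (k - i) * s ^ (k - i)) = c i * d (k - i) * s ^ k" by (metis mult.assoc mult.left_commute)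
    qed
    ultimately show ?thesis using c[of s] d[of s] by (simp add: sums_iff)
  qed
  then show ?thesis unfolding entire_def by blast
qed

text \<open>If the coefficients below \<open>k\<close> vanish, the \<open>k\<close>-th one is the
  limit of \<open>f s / s ^ k\<close> at 0, which can be taken along real \<open>s\<close>.\<close>

lemma entire_zero_on_reals:
  assumes "entire f" and 0: "\<And>t::real. f (complex_of_real t) = 0"
  shows "f s = 0"
proof -
  obtain c where c: "\<And>s. (\<lambda>k. c k * s ^ k) sums f s" using assms(1) unfolding entire_def by blast
  have "c k = 0" for k
  proof (induction k rule: less_induct)
    case (less k)
    define f' where "f' = (\<lambda>s. \<Sum>n. c (n + k) * s ^ n)"
    have sums': "(\<lambda>n. c (n + k) * s ^ n) sums (f s / s ^ k)" if s: "s \<noteq> 0" for s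
    proof -
      have "(\<lambda>n. c (n + k) * s ^ (n + k)) sums (f s - (\<Sum>i<k. c i * s ^ i))"
        using c[of s] by (rule sums_split_initial_segment)
      then have "(\<lambda>n. c (n + k) * s ^ (n + k) / s ^ k) sums (f s / s ^ k)"
        using less by (intro sums_divide) simp
      then show ?thesis using s by (simp add: power_add)
    qed
    have "((\<lambda>s. f s / s ^ k) \<longlongrightarrow> c (0 + k)) (at 0)"
      by (rule powser_limit_0_strong[of 1 "\<lambda>n. c (n + k)"]) (use sums' in auto)
    moreover have "filterlim (\<lambda>n. complex_of_real (null_seq n)) (at 0) sequentially"
      unfolding filterlim_at using null_seq(1) null_seq(2)[THEN less_imp_neq]
      by (auto intro!: always_eventually tendsto_eq_intros)
    ultimately have "(\<lambda>n. f (complex_of_real (null_seq n)) / complex_of_real (null_seq n) ^ k) \<longlonglongrightarrow> c (0 + k)"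
      by (rule filterlim_compose)
    then show ?case by (simp add: 0 LIMSEQ_const_iff)
  qed
  then show ?thesis using c[of s] by (simp add: sums_iff)
qed

text \<open>Analytic continuation from the compact group to its complexification: for a linear
  functional the coefficients are its values on \<open>op_pow Y k\<close> applied to
  \<open>x\<close>, divided by \<open>fact k\<close>, and evaluating the series at \<i> replaces
  \<open>Y\<close> by \<open>Z\<close>. Sums and products of entire functions do the rest.\<close>

lemma hol_poly_exp_entire:
  assumes Y: "cendo (blinfun_apply Y)" and Z: "\<And>x. blinfun_apply Z x = \<i> *\<^sub>C blinfun_apply Y x" and p: "p \<in> hol_poly"
  shows "\<exists>f. entire f \<and> (\<forall>t. f (complex_of_real t) = p (blinfun_apply (op_exp (t *\<^sub>R Y)) x)) \<and> f \<i> = p (blinfun_apply (op_exp Z) x)"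
  using p
proof induction
  case (const c)
  show ?case using entire_const by blast
next
  case (linear l)
  have bl: "bounded_linear l" by (rule clin_bounded_linear[OF linear])
  obtain K where K: "K > 0" "\<And>y. norm (l y) \<le> norm y * K" using bounded_linear.pos_bounded[OF bl] by blast
  define c where "c = (\<lambda>k. l (blinfun_apply (op_pow Y k) x) / fact k)"
  define f where "f = (\<lambda>s. \<Sum>k. c k * s ^ k)"
  have summ: "summable (\<lambda>k. c k * s ^ k)" for s
  proof (rule summable_comparison_test'[of "\<lambda>k. (K * norm x) * ((norm Y * norm s) ^ k / fact k)" 0])
    show "summable (\<lambda>k. (K * norm x) * ((norm Y * norm s) ^ k / fact k))"
      by (intro summable_mult sums_summable[OF exp_series])
    fix k
    have "norm (l (blinfun_apply (op_pow Y k) x)) \<le> norm (blinfun_apply (op_pow Y k) x) * K" by (rule K)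
    also have "\<dots> \<le> (norm (op_pow Y k) * norm x) * K" using K(1) by (intro mult_right_mono norm_blinfun) simp
    also have "\<dots> \<le> (norm Y ^ k * norm x) * K" using K(1) by (intro mult_right_mono norm_op_pow) auto
    finally have "norm (l (blinfun_apply (op_pow Y k) x)) * norm s ^ k / fact k \<le> (norm Y ^ k * norm x) * K * norm s ^ k / fact k"
      by (intro divide_right_mono mult_right_mono) auto
    then show "norm (c k * s ^ k) \<le> (K * norm x) * ((norm Y * norm s) ^ k / fact k)"
      by (simp add: c_def norm_mult norm_divide norm_power power_mult_distrib mult_ac)
  qed
  then have fs: "(\<lambda>k. c k * s ^ k) sums f s" for s unfolding f_def by (rule summable_sums)
  have lexp: "(\<lambda>k. l (blinfun_apply (op_pow X k) x) / fact k) sums l (blinfun_apply (op_exp X) x)" for X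
    using bounded_linear.sums[OF bl op_exp_apply_sums[of X x]]
    by (simp add: linear_scale[OF bounded_linear.linear[OF bl]] scaleR_conv_of_real divide_inverse mult.commute)
  have "f (complex_of_real t) = l (blinfun_apply (op_exp (t *\<^sub>R Y)) x)" for t
  proof -
    have "l (blinfun_apply (op_pow (t *\<^sub>R Y) k) x) / fact k = c k * complex_of_real t ^ k" for k
      by (simp add: c_def op_pow_scaleR blinfun.scaleR_left linear_scale[OF bounded_linear.linear[OF bl]] scaleR_conv_of_real)
    then have "(\<lambda>k. c k * complex_of_real t ^ k) sums l (blinfun_apply (op_exp (t *\<^sub>R Y)) x)"
      using lexp[of "t *\<^sub>R Y"] by (simp only:)
    then show ?thesis by (rule sums_unique2[OF fs])
  qed
  moreover have "f \<i> = l (blinfun_apply (op_exp Z) x)"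
  proof -
    have pw: "blinfun_apply (op_pow Z k) x = (\<i> ^ k) *\<^sub>C blinfun_apply (op_pow Y k) x" for k
    proof (induction k)
      case 0
      show ?case using scaleC_of_real[of 1 x] by simp
    next
      case (Suc k)
      then show ?case by (simp add: op_pow_Suc Z cendo_scale[OF Y] scaleC_scaleC)
    qed
    have "l (blinfun_apply (op_pow Z k) x) / fact k = c k * \<i> ^ k" for k
      by (simp add: c_def pw clin_scale[OF linear])
    then have "(\<lambda>k. c k * \<i> ^ k) sums l (blinfun_apply (op_exp Z) x)" using lexp[of Z] by (simp only:)
    then show ?thesis by (rule sums_unique2[OF fs])
  qed
  ultimately show ?case using fs unfolding entire_def by blast
next
  case (add p q)
  then obtain f f' where "entire f" "\<forall>t. f (complex_of_real t) = p (blinfun_apply (op_exp (t *\<^sub>R Y)) x)" "f \<i> = p (blinfun_apply (op_exp Z) x)"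
    "entire f'" "\<forall>t. f' (complex_of_real t) = q (blinfun_apply (op_exp (t *\<^sub>R Y)) x)" "f' \<i> = q (blinfun_apply (op_exp Z) x)" by blast
  then show ?case by (intro exI[of _ "\<lambda>s. f s + f' s"]) (simp add: entire_add)
next
  case (mult p q)
  then obtain f f' where "entire f" "\<forall>t. f (complex_of_real t) = p (blinfun_apply (op_exp (t *\<^sub>R Y)) x)" "f \<i> = p (blinfun_apply (op_exp Z) x)"
    "entire f'" "\<forall>t. f' (complex_of_real t) = q (blinfun_apply (op_exp (t *\<^sub>R Y)) x)" "f' \<i> = q (blinfun_apply (op_exp Z) x)" by blast
  then show ?case by (intro exI[of _ "\<lambda>s. f s * f' s"]) (simp add: entire_mult)
qed

definition iop :: "('v::fd_complex_space \<Rightarrow>\<^sub>L 'v) \<Rightarrow> ('v \<Rightarrow>\<^sub>L 'v)" where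
  "iop Y = Blinfun (\<lambda>x. \<i> *\<^sub>C blinfun_apply Y x)"

lemma iop_apply: "blinfun_apply (iop Y) x = \<i> *\<^sub>C blinfun_apply Y x"
  unfolding iop_def
  by (simp add: bounded_linear_Blinfun_apply bounded_linear_compose[OF cendo_bounded_linear[OF cendo_scaleC] blinfun.bounded_linear_right])

lemma iop_scaleR: "iop (t *\<^sub>R Y) = t *\<^sub>R iop Y"
  by (simp add: blinfun_eq_iff iop_apply blinfun.scaleR_left cendo_scaleR[OF cendo_scaleC])

context lin_group begin

abbreviation GC :: "('v \<Rightarrow>\<^sub>L 'v) set" where "GC \<equiv> complexification G"

lemma complexified_cendo: "Z \<in> complexified_lie_algebra G \<Longrightarrow> cendo (blinfun_apply Z)"
proof -
  assume "Z \<in> complexified_lie_algebra G"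
  then obtain X Y where XY: "X \<in> lie" "Y \<in> lie" "\<And>x. blinfun_apply Z x = blinfun_apply X x + \<i> *\<^sub>C blinfun_apply Y x"
    unfolding complexified_lie_algebra_def by blast
  show ?thesis
    by (rule cendoI) (simp_all add: blinfun.add_right XY(3) cendo_scale[OF lie_cendo[OF XY(1)]] cendo_scale[OF lie_cendo[OF XY(2)]]
        scaleC_add_right scaleC_scaleC mult.commute)
qed

lemma subgroup_GC: "subgroup GC GL"
  unfolding complexification_def
  by (rule group.generate_is_subgroup[OF group_GL]) (auto simp: in_GL intro: op_exp_GL complexified_cendo)

lemma GC_compose: "a \<in> GC \<Longrightarrow> b \<in> GC \<Longrightarrow> a o\<^sub>L b \<in> GC"
  using subgroup.m_closed[OF subgroup_GC] by (simp add: GL_mult)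

lemma GC_inv: "a \<in> GC \<Longrightarrow> inv\<^bsub>GL\<^esub> a \<in> GC"
  using subgroup.m_inv_closed[OF subgroup_GC] by simp

lemma GC_GL: "a \<in> GC \<Longrightarrow> a \<in> carrier GL"
  using subgroup.subset[OF subgroup_GC] by blast

lemma G_GC: "g \<in> G \<Longrightarrow> g \<in> GC"
  unfolding complexification_def by (rule generate.incl) simp

lemma iop_complexified: "Y \<in> lie \<Longrightarrow> iop Y \<in> complexified_lie_algebra G"
  unfolding complexified_lie_algebra_def
  by (intro CollectI bexI[of _ 0] bexI[of _ Y] lie_0) (simp_all add: iop_apply)

lemma GC_exp_iop: "Y \<in> lie \<Longrightarrow> op_exp (iop Y) \<in> GC"
  unfolding complexification_def by (intro generate.incl UnI2 imageI iop_complexified)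

text \<open>Polynomials vanishing on a \<open>G\<close>-orbit vanish on the complex orbit. The set of operators preserving the
  vanishing is a closed semigroup, so by the Trotter formula it suffices to treat \<open>exp (\<i>Y)\<close>.\<close>

lemma GC_vanish:
  assumes p: "p \<in> hol_poly" and 0: "\<And>g. g \<in> G \<Longrightarrow> p (blinfun_apply g z) = 0" and a: "a \<in> GC"
  shows "p (blinfun_apply a z) = 0"
proof -
  \<comment> \<open>Membership speaks of all polynomials and of the whole orbit of \<open>z\<close>
    at once. Only in this strong form is the set closed under composition.\<close>
  define S where "S = {a. cendo (blinfun_apply a) \<and> (\<forall>p\<in>hol_poly. (\<forall>g\<in>G. p (blinfun_apply g z) = 0) \<longrightarrow>
    (\<forall>g\<in>G. p (blinfun_apply a (blinfun_apply g z)) = 0))}"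
  have SD: "p (blinfun_apply a (blinfun_apply g z)) = 0"
    if "a \<in> S" "p \<in> hol_poly" "\<And>g. g \<in> G \<Longrightarrow> p (blinfun_apply g z) = 0" "g \<in> G" for a p g
    using that unfolding S_def by blast
  have Sc: "cendo (blinfun_apply a)" if "a \<in> S" for a using that by (simp add: S_def)
  have Smult: "a o\<^sub>L b \<in> S" if ab: "a \<in> S" "b \<in> S" for a b
    unfolding S_def
  proof (intro CollectI conjI ballI impI)
    show "cendo (blinfun_apply (a o\<^sub>L b))" by (simp add: blinfun_compose_fun cendo_comp Sc ab)
    fix p g assume p: "p \<in> hol_poly" "\<forall>g\<in>G. p (blinfun_apply g z) = 0" and g: "g \<in> G"
    have "p (blinfun_apply a (blinfun_apply g z)) = 0" if "g \<in> G" for g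
      using SD[OF ab(1) p(1) _ that] p(2) by blast
    from SD[OF ab(2) hol_poly_compose[OF p(1) Sc[OF ab(1)]] this g]
    show "p (blinfun_apply (a o\<^sub>L b) (blinfun_apply g z)) = 0" by simp
  qed
  have GS: "g \<in> S" if g: "g \<in> G" for g
    unfolding S_def
  proof (intro CollectI conjI ballI impI)
    show "cendo (blinfun_apply g)" by (rule cendo_G[OF g])
    fix p g' assume "p \<in> hol_poly" "\<forall>g\<in>G. p (blinfun_apply g z) = 0" "g' \<in> G"
    then show "p (blinfun_apply g (blinfun_apply g' z)) = 0" using compose_in[OF g \<open>g' \<in> G\<close>] by fastforce
  qed
  have Slim: "l \<in> S" if f: "\<And>n. f n \<in> S" and lim: "f \<longlonglongrightarrow> l" for f l
    unfolding S_def
  proof (intro CollectI conjI ballI impI)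
    show "cendo (blinfun_apply l)" by (rule cendo_limit[OF Sc[OF f] lim])
    fix p g assume p: "p \<in> hol_poly" "\<forall>g\<in>G. p (blinfun_apply g z) = 0" and g: "g \<in> G"
    have "isCont p y" for y using hol_poly_continuous_on[OF p(1), of UNIV] by (simp add: continuous_on_eq_continuous_at)
    then have "(\<lambda>n. p (blinfun_apply (f n) (blinfun_apply g z))) \<longlonglongrightarrow> p (blinfun_apply l (blinfun_apply g z))"
      by (rule isCont_tendsto_compose) (intro blinfun.tendsto lim tendsto_const)
    moreover have "p (blinfun_apply (f n) (blinfun_apply g z)) = 0" for n using SD[OF f p(1) _ g] p(2) by blast
    ultimately show "p (blinfun_apply l (blinfun_apply g z)) = 0" by (simp add: LIMSEQ_const_iff)
  qed
  have iS: "op_exp (iop Y) \<in> S" if Y: "Y \<in> lie" for Y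
    unfolding S_def
  proof (intro CollectI conjI ballI impI)
    show "cendo (blinfun_apply (op_exp (iop Y)))" by (intro cendo_op_exp complexified_cendo iop_complexified Y)
    fix p g assume p: "p \<in> hol_poly" "\<forall>g\<in>G. p (blinfun_apply g z) = 0" and g: "g \<in> G"
    obtain f where f: "entire f" "\<forall>t. f (complex_of_real t) = p (blinfun_apply (op_exp (t *\<^sub>R Y)) (blinfun_apply g z))"
      "f \<i> = p (blinfun_apply (op_exp (iop Y)) (blinfun_apply g z))"
      using hol_poly_exp_entire[OF lie_cendo[OF Y] iop_apply p(1)] by blast
    have "f (complex_of_real t) = 0" for t
      using f(2) p(2) compose_in[OF lie_exp[OF Y, of t] g] by fastforce
    then show "p (blinfun_apply (op_exp (iop Y)) (blinfun_apply g z)) = 0"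
      using entire_zero_on_reals[OF f(1)] f(3) by simp
  qed
  have powS: "op_pow a k \<in> S" if "a \<in> S" for a k
    by (induction k) (simp_all add: GS[OF id_in] op_pow_Suc Smult that)
  have expS: "op_exp Z \<in> S" if Z: "Z \<in> complexified_lie_algebra G" for Z
  proof -
    obtain X Y where XY: "X \<in> lie" "Y \<in> lie" "\<And>x. blinfun_apply Z x = blinfun_apply X x + \<i> *\<^sub>C blinfun_apply Y x"
      using Z unfolding complexified_lie_algebra_def by blast
    have "Z = X + iop Y" by (simp add: blinfun_eq_iff blinfun.add_left iop_apply XY(3))
    moreover have s: "op_exp (null_seq n *\<^sub>R iop Y) \<in> S" for n
      unfolding iop_scaleR[symmetric] by (intro iS lie_scale XY(2))
    have "op_exp (X + iop Y) \<in> S"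
      by (rule Slim[OF _ trotter]) (intro powS Smult GS lie_exp XY(1) s)
    ultimately show ?thesis by simp
  qed
  have "a \<in> S" using a unfolding complexification_def
  proof (induction rule: generate.induct)
    case one
    show ?case by (simp add: GL_one GS[OF id_in])
  next
    case (incl h)
    then show ?case using GS expS by blast
  next
    case (inv h)
    then consider "h \<in> G" | Z where "Z \<in> complexified_lie_algebra G" "h = op_exp Z" by blast
    then show ?case
    proof cases
      case 1
      then show ?thesis by (intro GS inv_in)
    next
      case 2
      obtain X Y where XY: "X \<in> lie" "Y \<in> lie" "\<And>x. blinfun_apply Z x = blinfun_apply X x + \<i> *\<^sub>C blinfun_apply Y x"
        using 2(1) unfolding complexified_lie_algebra_def by blast
      have "- Z \<in> complexified_lie_algebra G"
        unfolding complexified_lie_algebra_def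
        by (intro CollectI bexI[of _ "(-1) *\<^sub>R X"] bexI[of _ "(-1) *\<^sub>R Y"] lie_scale XY)
           (simp add: blinfun.minus_left XY(3) cv.scale_minus_right)
      then show ?thesis using inv_op_exp[OF complexified_cendo[OF 2(1)]] expS 2(2) by simp
    qed
  next
    case (eng h1 h2)
    then show ?case by (simp add: GL_mult Smult)
  qed
  then show ?thesis using SD[OF _ p 0 id_in] by simp
qed

end

section \<open>Minimal vectors\<close>

context unitary_group begin

lemma tendsto_h:
  assumes "(f \<longlongrightarrow> a) F" "(k \<longlongrightarrow> b) F"
  shows "((\<lambda>t. h (f t) (k t)) \<longlongrightarrow> h a b) F"
proof -
  have "((\<lambda>t. \<Sum>e\<in>E. h (f t) e * cnj (h (k t) e)) \<longlongrightarrow> (\<Sum>e\<in>E. h a e * cnj (h b e))) F"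
    by (intro tendsto_intros bounded_linear.tendsto[OF clin_bounded_linear[OF clin_h]] assms)
  then show ?thesis by (simp only: h_expand[symmetric])
qed

lemma tendsto_sqn: "(f \<longlongrightarrow> a) F \<Longrightarrow> ((\<lambda>t. sqn (f t)) \<longlongrightarrow> sqn a) F"
  unfolding sqn_def by (intro tendsto_Re tendsto_h)

lemma continuous_on_sqn: "continuous_on S f \<Longrightarrow> continuous_on S (\<lambda>t. sqn (f t))"
  unfolding sqn_def by (intro continuous_on_Re continuous_on_h)

lemma h_scaleR: "h (t *\<^sub>R x) y = complex_of_real t * h x y" "h x (t *\<^sub>R y) = complex_of_real t * h x y"
  using h_scale[of "complex_of_real t" x y] h_scale_right[of x "complex_of_real t" y] by (simp_all add: scaleC_of_real)

lemma sqn_scaleR: "sqn (t *\<^sub>R x) = t\<^sup>2 * sqn x"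
  using sqn_scale[of "complex_of_real t" x] by (simp add: scaleC_of_real)

text \<open>This is the invariance of \<open>h\<close> under the one-parameter group of
  \<open>Y\<close>, differentiated at 0 through difference quotients.\<close>

lemma lie_skew:
  assumes Y: "Y \<in> lie"
  shows "h (blinfun_apply Y x) y = - h x (blinfun_apply Y y)"
proof -
  define g where "g = (\<lambda>n. op_exp (null_seq n *\<^sub>R Y))"
  define A where "A = (\<lambda>n. real (Suc n) *\<^sub>R (g n - id_blinfun))"
  have Alim: "(\<lambda>n. blinfun_apply (A n) z) \<longlonglongrightarrow> blinfun_apply Y z" for z
    unfolding A_def g_def by (intro blinfun.tendsto op_exp_null_seq tendsto_const)
  have glim: "(\<lambda>n. blinfun_apply (g n) z) \<longlonglongrightarrow> z" for z
    using blinfun.tendsto[OF op_exp_null_seq_id tendsto_const, of Y z] by (simp add: g_def)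
  have zero: "h (blinfun_apply (A n) x) (blinfun_apply (g n) y) + h x (blinfun_apply (A n) y) = 0" for n
  proof -
    have "g n \<in> G" unfolding g_def by (rule lie_exp[OF Y])
    then have "h (blinfun_apply (g n) x) (blinfun_apply (g n) y) = h x y" by (rule h_inv)
    then show ?thesis
      by (simp add: A_def blinfun.scaleR_left blinfun.diff_left h_scaleR h_diff h_diff_right flip: distrib_left)
  qed
  have "(\<lambda>n. h (blinfun_apply (A n) x) (blinfun_apply (g n) y) + h x (blinfun_apply (A n) y)) \<longlonglongrightarrow>
      h (blinfun_apply Y x) y + h x (blinfun_apply Y y)"
    by (intro tendsto_add tendsto_h Alim glim tendsto_const)
  then have "h (blinfun_apply Y x) y + h x (blinfun_apply Y y) = 0" by (simp add: zero LIMSEQ_const_iff)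
  then show ?thesis by (simp add: eq_neg_iff_add_eq_0)
qed

lemma minimal_vector_exists:
  assumes cl: "closed (orbit_of GC v)"
  obtains a where "a \<in> GC" "\<And>b. b \<in> GC \<Longrightarrow> sqn (blinfun_apply a v) \<le> sqn (blinfun_apply b v)"
proof -
  define Orb where "Orb = orbit_of GC v"
  have vO: "v \<in> Orb" unfolding Orb_def orbit_of_def using G_GC[OF id_in] by (force intro: image_eqI[of _ _ id_blinfun])
  define K where "K = Orb \<inter> {x. sqn x \<le> sqn v}"
  obtain C where C: "C > 0" "\<And>x. norm x \<le> C * sqrt (sqn x)" using norm_le_sqn by blast
  have "closed {x. sqn x \<le> sqn v}"
    by (intro closed_Collect_le continuous_on_sqn continuous_intros)
  then have "closed K" unfolding K_def Orb_def using cl by (intro closed_Int)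
  moreover have "bounded K"
  proof -
    have "norm x \<le> C * sqrt (sqn v)" if "x \<in> K" for x
    proof -
      have "C * sqrt (sqn x) \<le> C * sqrt (sqn v)" using that C(1) by (intro mult_left_mono) (auto simp: K_def)
      then show ?thesis using C(2)[of x] by linarith
    qed
    then show ?thesis unfolding bounded_iff by blast
  qed
  ultimately have compK: "compact K" by (simp add: compact_eq_bounded_closed)
  have neK: "K \<noteq> {}" using vO by (auto simp: K_def)
  have contK: "continuous_on K sqn" using continuous_on_sqn[of K "\<lambda>x. x"] by simp
  obtain x where x: "x \<in> K" "\<And>y. y \<in> K \<Longrightarrow> sqn x \<le> sqn y"
    using continuous_attains_inf[OF compK neK contK] by blast
  then obtain a where a: "a \<in> GC" "x = blinfun_apply a v" by (auto simp: K_def Orb_def orbit_of_def)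
  have "sqn x \<le> sqn (blinfun_apply b v)" if "b \<in> GC" for b
  proof (cases "sqn (blinfun_apply b v) \<le> sqn v")
    case True
    then show ?thesis using x(2)[of "blinfun_apply b v"] that by (simp add: K_def Orb_def orbit_of_def)
  next
    case False
    then show ?thesis using x(1) by (simp add: K_def)
  qed
  then show thesis using that a by blast
qed

text \<open>Vanishing of the moment map of the unitary action. As \<open>Y\<close> is skew, the
  number \<open>h (Y u) u\<close> is purely imaginary, so its imaginary part is all of it.\<close>

definition moment_zero :: "'v \<Rightarrow> bool" where
  "moment_zero u \<longleftrightarrow> (\<forall>Y\<in>lie. Im (h (blinfun_apply Y u) u) = 0)"

text \<open>The derivative of the squared length along the curve generated by \<open>iop Y\<close>
  is twice \<open>Im (h u (Y u))\<close>. Minimality makes it nonnegative for both \<open>Y\<close>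
  and its negative.\<close>

lemma minimal_moment_zero:
  assumes min: "\<And>Y. Y \<in> lie \<Longrightarrow> sqn u \<le> sqn (blinfun_apply (op_exp (iop Y)) u)"
  shows "moment_zero u"
proof -
  have ge: "Im (h u (blinfun_apply Y u)) \<ge> 0" if Y: "Y \<in> lie" for Y
  proof -
    define B where "B = (\<lambda>n. blinfun_apply (real (Suc n) *\<^sub>R (op_exp (null_seq n *\<^sub>R iop Y) - id_blinfun)) u)"
    have Blim: "B \<longlonglongrightarrow> blinfun_apply (iop Y) u"
      unfolding B_def by (intro blinfun.tendsto op_exp_null_seq tendsto_const)
    have pos: "0 \<le> null_seq n * sqn (B n) + 2 * Re (h u (B n))" for n
    proof -
      define b where "b = blinfun_apply (op_exp (null_seq n *\<^sub>R iop Y)) u - u"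
      have Bb: "B n = real (Suc n) *\<^sub>R b" by (simp add: B_def b_def blinfun.scaleR_left blinfun.diff_left)
      have bB: "b = null_seq n *\<^sub>R B n" unfolding Bb using null_seq(3)[of n] by (simp add: mult.commute)
      have "sqn u \<le> sqn (u + b)"
        using min[OF lie_scale[OF Y, of "null_seq n"]] by (simp add: iop_scaleR b_def)
      then have "0 \<le> sqn b + 2 * Re (h u b)" by (simp add: sqn_add)
      also have "\<dots> = null_seq n * (null_seq n * sqn (B n) + 2 * Re (h u (B n)))"
        unfolding bB by (simp add: sqn_scaleR h_scaleR power2_eq_square algebra_simps)
      finally show ?thesis using null_seq(2)[of n] by (simp add: zero_le_mult_iff)
    qed
    have "(\<lambda>n. null_seq n * sqn (B n) + 2 * Re (h u (B n))) \<longlonglongrightarrow>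
        0 * sqn (blinfun_apply (iop Y) u) + 2 * Re (h u (blinfun_apply (iop Y) u))"
      by (intro tendsto_intros null_seq(1) tendsto_sqn tendsto_h Blim)
    then have "0 * sqn (blinfun_apply (iop Y) u) + 2 * Re (h u (blinfun_apply (iop Y) u)) \<ge> 0"
      by (rule LIMSEQ_le_const) (use pos in auto)
    then show ?thesis by (simp add: iop_apply h_scale_right)
  qed
  show ?thesis unfolding moment_zero_def
  proof
    fix Y assume Y: "Y \<in> lie"
    have "Im (h u (blinfun_apply ((-1) *\<^sub>R Y) u)) \<ge> 0" by (rule ge[OF lie_scale[OF Y]])
    moreover have "h u (blinfun_apply ((-1) *\<^sub>R Y) u) = - h u (blinfun_apply Y u)"
      using h_scaleR(2)[of u "-1" "blinfun_apply Y u"] by (simp only: blinfun.scaleR_left) simp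
    ultimately have "Im (h u (blinfun_apply Y u)) = 0" using ge[OF Y] by simp
    then show "Im (h (blinfun_apply Y u) u) = 0" using h_cnj[of u "blinfun_apply Y u"] by simp
  qed
qed

definition hn :: "'v \<Rightarrow> real" where "hn x = sqrt (sqn x)"

lemma hn_nonneg: "hn x \<ge> 0" and hn_square: "(hn x)\<^sup>2 = sqn x"
  using sqn_nonneg by (simp_all add: hn_def)

lemma cmod_h_le_hn: "cmod (h x y) \<le> hn x * hn y"
proof -
  have "(cmod (h x y))\<^sup>2 \<le> (hn x * hn y)\<^sup>2" using cmod_h_le[of x y] by (simp add: power_mult_distrib hn_square)
  then show ?thesis by (rule power2_le_imp_le) (simp add: hn_nonneg)
qed

lemma hn_triangle: "hn (x + y) \<le> hn x + hn y"
proof (rule power2_le_imp_le)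
  have "Re (h x y) \<le> hn x * hn y" using cmod_h_le_hn[of x y] complex_Re_le_cmod[of "h x y"] by linarith
  then show "(hn (x + y))\<^sup>2 \<le> (hn x + hn y)\<^sup>2" by (simp add: hn_square sqn_add power2_sum)
qed (simp add: hn_nonneg)

lemma hn_op_bound: "\<exists>K>0. \<forall>A x. hn (blinfun_apply A x) \<le> K * norm A * hn x"
proof -
  obtain C where C: "C > 0" "\<And>x. sqn x \<le> C * (norm x)\<^sup>2" using sqn_le_norm by blast
  obtain D where D: "D > 0" "\<And>x. norm x \<le> D * sqrt (sqn x)" using norm_le_sqn by blast
  have "hn (blinfun_apply A x) \<le> (sqrt C * D) * norm A * hn x" for A x
  proof -
    have "hn (blinfun_apply A x) \<le> sqrt (C * (norm (blinfun_apply A x))\<^sup>2)" unfolding hn_def using C(2) by simp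
    also have "\<dots> = sqrt C * norm (blinfun_apply A x)" by (simp add: real_sqrt_mult)
    also have "\<dots> \<le> sqrt C * (norm A * (D * hn x))"
      using D(2)[of x] C(1) by (intro mult_left_mono order_trans[OF norm_blinfun] mult_left_mono) (auto simp: hn_def)
    finally show ?thesis by (simp add: mult_ac)
  qed
  then show ?thesis using C(1) D(1) by (intro exI[of _ "sqrt C * D"]) auto
qed

text \<open>The vanishing moment kills the first order term of \<open>Im \<langle>g u, u\<rangle>\<close>, and the second order term
  \<open>\<langle>Y\<^sup>2 u, u\<rangle> / 2\<close> is real because \<open>Y\<close> is skew.\<close>

lemma op_exp_cubic:
  "\<exists>T. op_exp Y = id_blinfun + Y + (1/2) *\<^sub>R (Y o\<^sub>L Y) + (Y o\<^sub>L (T o\<^sub>L Y)) \<and> norm T \<le> norm Y * exp (norm Y)"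
proof -
  define y where "y = norm Y"
  \<comment> \<open>The remainder of order 3 is written as \<open>Y T Y\<close> and not as
    \<open>T\<close> times a cube, so that skewness can later move the left factor to the other
    argument and leave \<open>Y u\<close> on both sides.\<close>
  define c where "c = (\<lambda>k. op_pow Y (Suc k) /\<^sub>R fact (k + 3))"
  have le: "norm (c k) \<le> y * (y ^ k / fact k)" for k
  proof -
    have "(fact k :: real) \<le> fact (k + 3)" by (rule fact_mono) simp
    then have "y ^ Suc k / fact (k + 3) \<le> y ^ Suc k / fact k"
      by (intro divide_left_mono) (auto simp: y_def)
    moreover have "norm (c k) \<le> y ^ Suc k / fact (k + 3)"
      unfolding c_def y_def using norm_op_pow[of Y "Suc k"] by (simp add: divide_inverse mult.commute del: fact_Suc)
    ultimately show ?thesis by simp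
  qed
  have es: "(\<lambda>k. y * (y ^ k / fact k)) sums (y * exp y)" by (intro sums_mult exp_series)
  have "summable c" by (rule summable_comparison_test'[OF sums_summable[OF es], of 0]) (rule le)
  then have cs: "c sums suminf c" by (rule summable_sums)
  have T: "norm (suminf c) \<le> y * exp y" by (rule sums_norm_le[OF cs es le])
  have pw: "op_pow Y (k + 3) = Y o\<^sub>L (op_pow Y (Suc k) o\<^sub>L Y)" for k
  proof -
    have "op_pow Y (k + 3) = Y o\<^sub>L (Y o\<^sub>L op_pow Y (Suc k))" by (simp add: op_pow_Suc numeral_3_eq_3)
    then show ?thesis by (simp only: op_pow_commute)
  qed
  have bl: "bounded_linear (\<lambda>A. Y o\<^sub>L (A o\<^sub>L Y))"
    by (intro bounded_linear_compose[OF bounded_bilinear.bounded_linear_right[OF bounded_bilinear_blinfun_compose]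
          bounded_bilinear.bounded_linear_left[OF bounded_bilinear_blinfun_compose]])
  have "(\<lambda>k. Y o\<^sub>L (c k o\<^sub>L Y)) sums (Y o\<^sub>L (suminf c o\<^sub>L Y))" by (rule bounded_linear.sums[OF bl cs])
  moreover have "Y o\<^sub>L (c k o\<^sub>L Y) = op_pow Y (k + 3) /\<^sub>R fact (k + 3)" for k
    unfolding pw c_def by (simp add: blinfun_eq_iff blinfun.scaleR_left blinfun.scaleR_right)
  ultimately have s1: "(\<lambda>k. op_pow Y (k + 3) /\<^sub>R fact (k + 3)) sums (Y o\<^sub>L (suminf c o\<^sub>L Y))" by (simp only:)
  have s2: "(\<lambda>k. op_pow Y (k + 3) /\<^sub>R fact (k + 3)) sums (op_exp Y - (\<Sum>k<3. op_pow Y k /\<^sub>R fact k))"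
    by (rule sums_split_initial_segment[OF op_exp_sums])
  have "(\<Sum>k<3. op_pow Y k /\<^sub>R fact k) = id_blinfun + Y + (1/2) *\<^sub>R (Y o\<^sub>L Y)"
    by (simp add: numeral_3_eq_3 op_pow_Suc blinfun_eq_iff blinfun.add_left blinfun.scaleR_left)
  then have "op_exp Y = id_blinfun + Y + (1/2) *\<^sub>R (Y o\<^sub>L Y) + (Y o\<^sub>L (suminf c o\<^sub>L Y))"
    using sums_unique2[OF s1 s2] by (simp add: algebra_simps)
  then show ?thesis using T unfolding y_def by blast
qed

text \<open>With \<open>w = Y u\<close> the imaginary part reduces to that of
  \<open>- h (T w) w\<close>, which is of order \<open>norm Y\<close> times \<open>sqn w\<close>.
  For small \<open>Y\<close> the vector \<open>w\<close> is comparable to the displacement of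
  \<open>u\<close>, so the bound can be stated by the displacement, which depends only on the point
  of the orbit.\<close>

lemma Im_h_exp_le:
  assumes u: "moment_zero u"
  shows "\<exists>d>0. \<exists>C>0. \<forall>Y\<in>lie. norm Y \<le> d \<longrightarrow>
    \<bar>Im (h (blinfun_apply (op_exp Y) u) u)\<bar> \<le> C * norm Y * sqn (blinfun_apply (op_exp Y) u - u)"
proof -
  obtain K where K: "K > 0" "\<And>A x. hn (blinfun_apply A x) \<le> K * norm A * hn x" using hn_op_bound by blast
  \<comment> \<open>Below this bound the terms of order at least 2 in the displacement amount to at
    most an eighth of the length of \<open>w\<close>.\<close>
  define d where "d = min 1 (1 / (8 * (K + K * K * exp 1)))"
  have KK: "K + K * K * exp 1 > 0" using K(1) by (intro add_pos_pos mult_pos_pos) auto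
  then have d: "d > 0" "d \<le> 1" "d * (K + K * K * exp 1) \<le> 1/8"
  proof -
    have "d * (K + K * K * exp 1) \<le> 1 / (8 * (K + K * K * exp 1)) * (K + K * K * exp 1)"
      unfolding d_def using KK by (intro mult_right_mono) auto
    also have "\<dots> = 1/8" using KK by simp
    finally show "d * (K + K * K * exp 1) \<le> 1/8" .
  qed (use KK in \<open>auto simp: d_def\<close>)
  have main: "\<bar>Im (h (blinfun_apply (op_exp Y) u) u)\<bar> \<le> (4 * K * exp 1) * norm Y * sqn (blinfun_apply (op_exp Y) u - u)"
    if Y: "Y \<in> lie" "norm Y \<le> d" for Y
  proof -
    obtain T where T: "op_exp Y = id_blinfun + Y + (1/2) *\<^sub>R (Y o\<^sub>L Y) + (Y o\<^sub>L (T o\<^sub>L Y))" "norm T \<le> norm Y * exp (norm Y)"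
      using op_exp_cubic by blast
    define y where "y = norm Y"
    have y: "0 \<le> y" "y \<le> 1" "y \<le> d" using Y(2) d by (auto simp: y_def)
    have Ty: "norm T \<le> y * exp 1"
    proof -
      have "y * exp y \<le> y * exp 1" using y by (intro mult_left_mono) auto
      then show ?thesis using T(2) by (simp add: y_def)
    qed
    define w where "w = blinfun_apply Y u"
    have ex: "blinfun_apply (op_exp Y) u = u + w + (1/2) *\<^sub>R blinfun_apply Y w + blinfun_apply Y (blinfun_apply T w)"
      by (simp add: T(1) blinfun.add_left blinfun.scaleR_left w_def)
    have "h (blinfun_apply (op_exp Y) u) u = h u u + h w u + (1/2) * h (blinfun_apply Y w) u + h (blinfun_apply Y (blinfun_apply T w)) u"
      unfolding ex by (simp add: h_add h_scaleR)
    also have "h (blinfun_apply Y w) u = - h w w" using lie_skew[OF Y(1), of w u] by (simp add: w_def)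
    also have "h (blinfun_apply Y (blinfun_apply T w)) u = - h (blinfun_apply T w) w"
      using lie_skew[OF Y(1), of "blinfun_apply T w" u] by (simp add: w_def)
    finally have hh: "h (blinfun_apply (op_exp Y) u) u = h u u + h w u - (1/2) * h w w - h (blinfun_apply T w) w" by simp
    have "Im (h w u) = 0" using u Y(1) by (simp add: moment_zero_def w_def)
    then have "Im (h (blinfun_apply (op_exp Y) u) u) = - Im (h (blinfun_apply T w) w)"
      unfolding hh by (simp add: Im_h)
    then have "\<bar>Im (h (blinfun_apply (op_exp Y) u) u)\<bar> \<le> cmod (h (blinfun_apply T w) w)"
      using abs_Im_le_cmod[of "h (blinfun_apply T w) w"] by simp
    also have "\<dots> \<le> hn (blinfun_apply T w) * hn w" by (rule cmod_h_le_hn)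
    also have "\<dots> \<le> (K * (y * exp 1) * hn w) * hn w"
    proof (rule mult_right_mono[OF _ hn_nonneg])
      have "K * norm T * hn w \<le> K * (y * exp 1) * hn w"
        using Ty K(1) hn_nonneg by (intro mult_right_mono mult_left_mono) auto
      then show "hn (blinfun_apply T w) \<le> K * (y * exp 1) * hn w" using K(2)[of T w] by linarith
    qed
    also have "\<dots> = (K * exp 1) * y * (hn w)\<^sup>2" by (simp add: power2_eq_square mult_ac)
    finally have 1: "\<bar>Im (h (blinfun_apply (op_exp Y) u) u)\<bar> \<le> (K * exp 1) * y * (hn w)\<^sup>2" .
    define D where "D = blinfun_apply (op_exp Y) u - u"
    \<comment> \<open>Solving the expansion of the displacement for \<open>w\<close> and absorbing
      the higher order terms into the left-hand side gives this with room to spare.\<close>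
    have "hn w \<le> 2 * hn D"
    proof -
      have "w = D + ((- 1/2) *\<^sub>R blinfun_apply Y w + (-1) *\<^sub>R blinfun_apply Y (blinfun_apply T w))"
        unfolding D_def ex by simp
      then have "hn w \<le> hn D + hn ((- 1/2) *\<^sub>R blinfun_apply Y w + (-1) *\<^sub>R blinfun_apply Y (blinfun_apply T w))"
        using hn_triangle by metis
      also have "\<dots> \<le> hn D + (hn ((- 1/2) *\<^sub>R blinfun_apply Y w) + hn ((-1) *\<^sub>R blinfun_apply Y (blinfun_apply T w)))"
        by (intro add_left_mono hn_triangle)
      also have "hn ((- 1/2) *\<^sub>R blinfun_apply Y w) = 1/2 * hn (blinfun_apply Y w)"
        unfolding hn_def sqn_scaleR real_sqrt_mult real_sqrt_abs by simp
      also have "hn ((-1) *\<^sub>R blinfun_apply Y (blinfun_apply T w)) = hn (blinfun_apply Y (blinfun_apply T w))"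
        unfolding hn_def sqn_scaleR by simp
      also have "hn (blinfun_apply Y w) \<le> K * y * hn w" using K(2)[of Y w] by (simp add: y_def)
      also have "hn (blinfun_apply Y (blinfun_apply T w)) \<le> K * y * (K * (y * exp 1) * hn w)"
      proof -
        have "K * norm T * hn w \<le> K * (y * exp 1) * hn w"
          using Ty K(1) hn_nonneg by (intro mult_right_mono mult_left_mono) auto
        then have "hn (blinfun_apply T w) \<le> K * (y * exp 1) * hn w" using K(2)[of T w] by linarith
        then have "K * y * hn (blinfun_apply T w) \<le> K * y * (K * (y * exp 1) * hn w)"
          using K(1) y(1) by (intro mult_left_mono) auto
        then show ?thesis using K(2)[of Y "blinfun_apply T w"] by (simp add: y_def)
      qed
      also have "K * y * (K * (y * exp 1) * hn w) \<le> K * y * (K * (1 * exp 1) * hn w)"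
        using y K(1) hn_nonneg by (intro mult_left_mono mult_right_mono) auto
      finally have A: "hn w \<le> hn D + (1/2 * (K * y * hn w) + K * y * (K * (1 * exp 1) * hn w))" by simp
      have "1/2 * (K * y * hn w) + K * y * (K * (1 * exp 1) * hn w) \<le> y * (K + K * K * exp 1) * hn w"
        using K(1) y(1) hn_nonneg[of w] by (simp add: algebra_simps)
      also have "\<dots> \<le> d * (K + K * K * exp 1) * hn w"
        using y(3) KK hn_nonneg by (intro mult_right_mono) auto
      also have "\<dots> \<le> 1/8 * hn w" using d(3) hn_nonneg by (intro mult_right_mono)
      finally show ?thesis using A hn_nonneg[of w] by linarith
    qed
    then have "(hn w)\<^sup>2 \<le> (2 * hn D)\<^sup>2" using hn_nonneg by (intro power_mono)
    also have "\<dots> = 4 * sqn D" by (simp add: power_mult_distrib hn_square)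
    finally have "(K * exp 1) * y * (hn w)\<^sup>2 \<le> (K * exp 1) * y * (4 * sqn D)"
      using K(1) y(1) by (intro mult_left_mono) auto
    then show ?thesis using 1 by (simp add: D_def y_def mult_ac)
  qed
  then show ?thesis using d(1) K(1) by (intro exI[of _ d] conjI exI[of _ "4 * K * exp 1"]) auto
qed

text \<open>Only the point \<open>g u\<close>, not \<open>g\<close>, is known to be close to
  \<open>u\<close>. By compactness \<open>g\<close> is then close to some \<open>l\<close> fixing
  \<open>u\<close>, and composing with the inverse of \<open>l\<close> on the right keeps the point
  and brings the operator close to the identity.\<close>

lemma near_stabilizer:
  assumes \<eta>: "\<eta> > 0"
  shows "\<exists>\<rho>>0. \<forall>g\<in>G. sqn (blinfun_apply g u - u) < \<rho> \<longrightarrow>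
    (\<exists>k\<in>G. blinfun_apply k u = blinfun_apply g u \<and> norm (k - id_blinfun) < \<eta>)"
proof (rule ccontr)
  assume neg: "\<not> ?thesis"
  have "\<forall>n. \<exists>g\<in>G. sqn (blinfun_apply g u - u) < null_seq n \<and>
      \<not> (\<exists>k\<in>G. blinfun_apply k u = blinfun_apply g u \<and> norm (k - id_blinfun) < \<eta>)"
    using neg null_seq(2) by blast
  then obtain g where g: "\<And>n. g n \<in> G" "\<And>n. sqn (blinfun_apply (g n) u - u) < null_seq n"
    "\<And>n k. k \<in> G \<Longrightarrow> blinfun_apply k u = blinfun_apply (g n) u \<Longrightarrow> \<not> norm (k - id_blinfun) < \<eta>" by metis
  obtain l \<sigma> where l: "l \<in> G" "strict_mono \<sigma>" "(\<lambda>n. g (\<sigma> n)) \<longlonglongrightarrow> l"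
    using compact_G g(1) unfolding compact_def comp_def by metis
  have "(\<lambda>n. sqn (blinfun_apply (g (\<sigma> n)) u - u)) \<longlonglongrightarrow> sqn (blinfun_apply l u - u)"
    by (intro tendsto_sqn tendsto_diff blinfun.tendsto l(3) tendsto_const)
  moreover have "(\<lambda>n. sqn (blinfun_apply (g (\<sigma> n)) u - u)) \<longlonglongrightarrow> 0"
  proof (rule tendsto_sandwich[OF always_eventually[OF allI] always_eventually[OF allI] tendsto_const])
    show "(\<lambda>n. null_seq (\<sigma> n)) \<longlonglongrightarrow> 0" using LIMSEQ_subseq_LIMSEQ[OF null_seq(1) l(2)] by (simp add: comp_def)
    show "0 \<le> sqn (blinfun_apply (g (\<sigma> n)) u - u)" for n by (rule sqn_nonneg)
    show "sqn (blinfun_apply (g (\<sigma> n)) u - u) \<le> null_seq (\<sigma> n)" for n using g(2)[of "\<sigma> n"] by simp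
  qed
  ultimately have "sqn (blinfun_apply l u - u) = 0" by (rule LIMSEQ_unique)
  then have lu: "blinfun_apply l u = u" using sqn_eq_0 by fastforce
  define k where "k = (\<lambda>n. g (\<sigma> n) o\<^sub>L inv\<^bsub>GL\<^esub> l)"
  have "k \<longlonglongrightarrow> (l o\<^sub>L inv\<^bsub>GL\<^esub> l)"
    unfolding k_def by (intro bounded_bilinear.tendsto[OF bounded_bilinear_blinfun_compose] l(3) tendsto_const)
  then have "k \<longlonglongrightarrow> id_blinfun" by (simp add: inv_compose l(1))
  then have "\<forall>\<^sub>F n in sequentially. dist (k n) id_blinfun < \<eta>" using \<eta> by (rule tendstoD)
  then obtain n where n: "norm (k n - id_blinfun) < \<eta>" by (auto simp: eventually_sequentially dist_norm)
  have "blinfun_apply (inv\<^bsub>GL\<^esub> l) u = u" using inv_apply(1)[OF l(1), of u] lu by simp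
  then have "blinfun_apply (k n) u = blinfun_apply (g (\<sigma> n)) u" by (simp add: k_def)
  moreover have "k n \<in> G" unfolding k_def by (intro compose_in g(1) inv_in l(1))
  ultimately show False using g(3) n by blast
qed

text \<open>The real part of \<open>sqn u - h (g u) u\<close> is half of
  \<open>sqn (g u - u)\<close>. So this says that near \<open>u\<close> the imaginary part of that
  difference is as small as desired relative to its real part.\<close>

lemma sector:
  assumes u: "moment_zero u" and \<epsilon>: "\<epsilon> > 0"
  shows "\<exists>\<rho>>0. \<forall>g\<in>G. sqn (blinfun_apply g u - u) < \<rho> \<longrightarrow>
    \<bar>Im (h (blinfun_apply g u) u)\<bar> \<le> \<epsilon> * sqn (blinfun_apply g u - u)"
proof -
  obtain d C where dC: "d > 0" "C > 0" "\<And>Y. Y \<in> lie \<Longrightarrow> norm Y \<le> d \<Longrightarrow>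
    \<bar>Im (h (blinfun_apply (op_exp Y) u) u)\<bar> \<le> C * norm Y * sqn (blinfun_apply (op_exp Y) u - u)"
    using Im_h_exp_le[OF u] by blast
  define d' where "d' = min d (\<epsilon> / C)"
  have "d' > 0" using dC \<epsilon> by (simp add: d'_def)
  then obtain \<eta> where \<eta>: "\<eta> > 0" "\<And>g. g \<in> G \<Longrightarrow> norm (g - id_blinfun) < \<eta> \<Longrightarrow> \<exists>Y\<in>lie. norm Y \<le> d' \<and> g = op_exp Y"
    using near_identity by blast
  obtain \<rho> where \<rho>: "\<rho> > 0" "\<And>g. g \<in> G \<Longrightarrow> sqn (blinfun_apply g u - u) < \<rho> \<Longrightarrow>
    \<exists>k\<in>G. blinfun_apply k u = blinfun_apply g u \<and> norm (k - id_blinfun) < \<eta>"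
    using near_stabilizer[OF \<eta>(1), of u] by blast
  have "\<bar>Im (h (blinfun_apply g u) u)\<bar> \<le> \<epsilon> * sqn (blinfun_apply g u - u)"
    if g: "g \<in> G" "sqn (blinfun_apply g u - u) < \<rho>" for g
  proof -
    obtain k where k: "k \<in> G" "blinfun_apply k u = blinfun_apply g u" "norm (k - id_blinfun) < \<eta>" using \<rho>(2)[OF g] by blast
    obtain Y where Y: "Y \<in> lie" "norm Y \<le> d'" "k = op_exp Y" using \<eta>(2)[OF k(1,3)] by blast
    have "\<bar>Im (h (blinfun_apply g u) u)\<bar> \<le> C * norm Y * sqn (blinfun_apply g u - u)"
      using dC(3)[OF Y(1)] Y(2,3) k(2) by (simp add: d'_def)
    also have "\<dots> \<le> \<epsilon> * sqn (blinfun_apply g u - u)"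
    proof (rule mult_right_mono[OF _ sqn_nonneg])
      have "C * norm Y \<le> C * (\<epsilon> / C)" using Y(2) dC(2) by (intro mult_left_mono) (auto simp: d'_def)
      then show "C * norm Y \<le> \<epsilon>" using dC(2) by simp
    qed
    finally show ?thesis .
  qed
  then show ?thesis using \<rho>(1) by blast
qed

end

section \<open>Orbits of minimal vectors\<close>

context unitary_group begin

text \<open>Uniform limits of polynomials on the orbit of \<open>u\<close>, written as functions of
  the group element because \<open>cmean\<close> integrates over the group.\<close>

definition orbit_limits :: "'v \<Rightarrow> (('v \<Rightarrow>\<^sub>L 'v) \<Rightarrow> complex) set" where
  "orbit_limits u = {F. continuous_on G F \<and> (\<forall>\<epsilon>>0. \<exists>q\<in>hol_poly. \<forall>g\<in>G. cmod (F g - q (blinfun_apply g u)) < \<epsilon>)}"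

lemma continuous_bounded:
  assumes "continuous_on G F"
  shows "\<exists>b\<ge>0. \<forall>g\<in>G. cmod (F g) \<le> b"
proof -
  have "bounded (F ` G)" using assms compact_G by (intro compact_imp_bounded compact_continuous_image)
  then obtain b where b: "\<And>g. g \<in> G \<Longrightarrow> cmod (F g) \<le> b" by (auto simp: bounded_iff)
  have "b \<ge> 0" using order_trans[OF norm_ge_zero b[OF id_in]] .
  then show ?thesis using b by blast
qed

lemma orbit_limits_const: "(\<lambda>g. c) \<in> orbit_limits u"
  unfolding orbit_limits_def by (auto intro!: bexI[OF _ hol_poly.const[of c]])

lemma orbit_limits_mult:
  assumes F: "F \<in> orbit_limits u" and F': "F' \<in> orbit_limits u"
  shows "(\<lambda>g. F g * F' g) \<in> orbit_limits u"
proof -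
  have cont: "continuous_on G F" "continuous_on G F'" using F F' by (auto simp: orbit_limits_def)
  obtain b where b: "b \<ge> 0" "\<And>g. g \<in> G \<Longrightarrow> cmod (F g) \<le> b" using continuous_bounded[OF cont(1)] by blast
  obtain b' where b': "b' \<ge> 0" "\<And>g. g \<in> G \<Longrightarrow> cmod (F' g) \<le> b'" using continuous_bounded[OF cont(2)] by blast
  have "\<exists>q\<in>hol_poly. \<forall>g\<in>G. cmod (F g * F' g - q (blinfun_apply g u)) < \<epsilon>" if \<epsilon>: "\<epsilon> > 0" for \<epsilon>
  proof -
    define \<delta> where "\<delta> = min 1 (\<epsilon> / (b + b' + 2))"
    have \<delta>: "\<delta> > 0" "\<delta> \<le> 1" using \<epsilon> b(1) b'(1) by (auto simp: \<delta>_def)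
    have "(b + b' + 2) * \<delta> \<le> (b + b' + 2) * (\<epsilon> / (b + b' + 2))"
      unfolding \<delta>_def using b(1) b'(1) by (intro mult_left_mono) auto
    also have "\<dots> = \<epsilon>" using b(1) b'(1) by simp
    finally have d: "(b + b' + 2) * \<delta> \<le> \<epsilon>" .
    obtain q where q: "q \<in> hol_poly" "\<And>g. g \<in> G \<Longrightarrow> cmod (F g - q (blinfun_apply g u)) < \<delta>"
      using F \<delta>(1) unfolding orbit_limits_def by blast
    obtain q' where q': "q' \<in> hol_poly" "\<And>g. g \<in> G \<Longrightarrow> cmod (F' g - q' (blinfun_apply g u)) < \<delta>"
      using F' \<delta>(1) unfolding orbit_limits_def by blast
    have "cmod (F g * F' g - q (blinfun_apply g u) * q' (blinfun_apply g u)) < \<epsilon>" if g: "g \<in> G" for g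
    proof -
      define A B where "A = F g - q (blinfun_apply g u)" and "B = F' g - q' (blinfun_apply g u)"
      have AB: "cmod A \<le> \<delta>" "cmod B \<le> \<delta>" using q(2)[OF g] q'(2)[OF g] by (simp_all add: A_def B_def)
      have "F g * F' g - q (blinfun_apply g u) * q' (blinfun_apply g u) = F g * B + (F' g - B) * A"
        by (simp add: A_def B_def algebra_simps)
      then have "cmod (F g * F' g - q (blinfun_apply g u) * q' (blinfun_apply g u)) \<le> cmod (F g * B) + cmod ((F' g - B) * A)"
        using norm_triangle_ineq by metis
      also have "\<dots> \<le> b * \<delta> + (b' + 1) * \<delta>"
      proof (rule add_mono)
        show "cmod (F g * B) \<le> b * \<delta>" unfolding norm_mult using b(2)[OF g] AB b(1) by (intro mult_mono) auto
        have "cmod (F' g - B) \<le> b' + 1" using norm_triangle_ineq4[of "F' g" B] b'(2)[OF g] AB \<delta>(2) by linarith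
        then show "cmod ((F' g - B) * A) \<le> (b' + 1) * \<delta>" unfolding norm_mult using AB b'(1) by (intro mult_mono) auto
      qed
      also have "\<dots> < (b + b' + 2) * \<delta>" using \<delta>(1) by (simp add: algebra_simps)
      finally show ?thesis using d by simp
    qed
    then show ?thesis using hol_poly.mult[OF q(1) q'(1)] by (intro bexI[of _ "\<lambda>x. q x * q' x"]) auto
  qed
  then show ?thesis unfolding orbit_limits_def using cont by (auto intro: continuous_intros)
qed

lemma orbit_limits_power: "F \<in> orbit_limits u \<Longrightarrow> (\<lambda>g. F g ^ m) \<in> orbit_limits u"
  by (induction m) (simp_all add: orbit_limits_const orbit_limits_mult)

lemma cmod_h_orbit_le: "g \<in> G \<Longrightarrow> cmod (h (blinfun_apply g u) u) \<le> sqn u"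
  using cmod_h_le_hn[of "blinfun_apply g u" u] hn_square[of u]
  by (simp add: hn_def sqn_inv power2_eq_square sqn_nonneg)

text \<open>By Cauchy-Schwarz \<open>h (g u) u\<close> is bounded by \<open>sqn u\<close>, strictly
  below the constant \<open>s + sqn u\<close>. The geometric series in their quotient thus converges
  uniformly, and its partial sums are polynomials in the point.\<close>

lemma orbit_limits_resolvent:
  assumes s: "s > 0"
  shows "(\<lambda>g. 1 / (complex_of_real (s + sqn u) - h (blinfun_apply g u) u)) \<in> orbit_limits u"
proof -
  define c where "c = complex_of_real (s + sqn u)"
  have c0: "s + sqn u > 0" using s sqn_nonneg[of u] by simp
  then have cn: "cmod c = s + sqn u" "c \<noteq> 0" unfolding c_def using norm_of_real[of "s + sqn u", where 'a=complex] by auto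
  define \<theta> where "\<theta> = sqn u / (s + sqn u)"
  have \<theta>: "0 \<le> \<theta>" "\<theta> < 1" using c0 s sqn_nonneg[of u] by (auto simp: \<theta>_def)
  have wge: "cmod (c - h (blinfun_apply g u) u) \<ge> s" if "g \<in> G" for g
    using norm_triangle_ineq2[of c "h (blinfun_apply g u) u"] cmod_h_orbit_le[OF that, of u] cn by simp
  have wne: "c - h (blinfun_apply g u) u \<noteq> 0" if "g \<in> G" for g using wge[OF that] s by auto
  have cont: "continuous_on G (\<lambda>g. 1 / (c - h (blinfun_apply g u) u))"
    by (intro continuous_intros continuous_on_h) (use wne in auto)
  have "\<exists>q\<in>hol_poly. \<forall>g\<in>G. cmod (1 / (c - h (blinfun_apply g u) u) - q (blinfun_apply g u)) < \<epsilon>" if \<epsilon>: "\<epsilon> > 0" for \<epsilon>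
  proof -
    have "\<epsilon> * s > 0" using \<epsilon> s by simp
    then obtain N where N: "\<theta> ^ N < \<epsilon> * s" using real_arch_pow_inv[OF _ \<theta>(2)] by blast
    define q where "q = (\<lambda>z. \<Sum>n<N. (1 / c ^ Suc n) * (h z u) ^ n)"
    have pw: "(\<lambda>z. (h z u) ^ n) \<in> hol_poly" for n
    proof (induction n)
      case 0
      show ?case by (simp add: hol_poly.const)
    next
      case (Suc n)
      then show ?case using hol_poly.mult[OF hol_poly.linear[OF clin_h[of u]] Suc.IH] by simp
    qed
    have "q \<in> hol_poly" unfolding q_def by (intro hol_poly_sum hol_poly_cmult pw)
    moreover have "cmod (1 / (c - h (blinfun_apply g u) u) - q (blinfun_apply g u)) < \<epsilon>" if g: "g \<in> G" for g
    proof -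
      define \<zeta> where "\<zeta> = h (blinfun_apply g u) u"
      define x where "x = \<zeta> / c"
      have ne: "c - \<zeta> \<noteq> 0" using wne[OF g] by (simp add: \<zeta>_def)
      then have x1: "x \<noteq> 1" using cn(2) by (auto simp: x_def)
      have "q (blinfun_apply g u) = (\<Sum>n<N. (1 / c) * x ^ n)"
        unfolding q_def \<zeta>_def[symmetric] x_def by (intro sum.cong refl) (simp add: power_divide)
      also have "\<dots> = (1 / c) * ((1 - x ^ N) / (1 - x))"
        unfolding sum_distrib_left[symmetric] using x1 by (simp add: sum_gp_strict)
      also have "\<dots> = (1 - x ^ N) / (c - \<zeta>)"
      proof -
        have "c * (1 - x) = c - \<zeta>" using cn(2) by (simp add: x_def algebra_simps)
        then show ?thesis by (metis times_divide_times_eq mult_1)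
      qed
      finally have "1 / (c - \<zeta>) - q (blinfun_apply g u) = x ^ N / (c - \<zeta>)" by (simp add: diff_divide_distrib)
      then have "cmod (1 / (c - \<zeta>) - q (blinfun_apply g u)) = cmod x ^ N / cmod (c - \<zeta>)" by (simp add: norm_divide norm_power)
      also have "\<dots> \<le> \<theta> ^ N / s"
      proof (rule frac_le)
        have "cmod x \<le> \<theta>" unfolding x_def \<theta>_def norm_divide cn(1) \<zeta>_def using cmod_h_orbit_le[OF g, of u] c0 by (intro divide_right_mono) auto
        then show "cmod x ^ N \<le> \<theta> ^ N" by (intro power_mono) auto
        show "s \<le> cmod (c - \<zeta>)" using wge[OF g] by (simp add: \<zeta>_def)
      qed (use s \<theta> in auto)
      also have "\<dots> < \<epsilon>" using N s by (simp add: divide_less_eq)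
      finally show ?thesis by (simp add: \<zeta>_def)
    qed
    ultimately show ?thesis by blast
  qed
  then show ?thesis unfolding orbit_limits_def c_def[symmetric] using cont by simp
qed

lemma orbit_limits_orthogonal:
  assumes r: "r \<in> hol_poly" and 0: "\<And>q. q \<in> hol_poly \<Longrightarrow> cmean (\<lambda>g. r (blinfun_apply g u) * q (blinfun_apply g u)) = 0"
    and F: "F \<in> orbit_limits u"
  shows "cmean (\<lambda>g. r (blinfun_apply g u) * F g) = 0"
proof (rule ccontr)
  assume neq: "cmean (\<lambda>g. r (blinfun_apply g u) * F g) \<noteq> 0"
  have cr: "continuous_on G (\<lambda>g. r (blinfun_apply g u))" by (rule continuous_hol_poly_orbit[OF r])
  have cF: "continuous_on G F" using F by (simp add: orbit_limits_def)
  obtain b where b: "b \<ge> 0" "\<And>g. g \<in> G \<Longrightarrow> cmod (r (blinfun_apply g u)) \<le> b" using continuous_bounded[OF cr] by blast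
  define \<epsilon> where "\<epsilon> = cmod (cmean (\<lambda>g. r (blinfun_apply g u) * F g)) / (b + 1)"
  have \<epsilon>: "\<epsilon> > 0" using neq b(1) by (simp add: \<epsilon>_def)
  obtain q where q: "q \<in> hol_poly" "\<And>g. g \<in> G \<Longrightarrow> cmod (F g - q (blinfun_apply g u)) < \<epsilon>"
    using F \<epsilon> unfolding orbit_limits_def by blast
  have cq: "continuous_on G (\<lambda>g. q (blinfun_apply g u))" by (rule continuous_hol_poly_orbit[OF q(1)])
  have "cmean (\<lambda>g. r (blinfun_apply g u) * F g) = cmean (\<lambda>g. r (blinfun_apply g u) * F g - r (blinfun_apply g u) * q (blinfun_apply g u))"
    using 0[OF q(1)] by (subst cmean_diff) (auto intro!: continuous_on_mult cr cF cq)
  also have "cmod \<dots> \<le> b * \<epsilon>"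
  proof (rule cmod_cmean_le)
    show "continuous_on G (\<lambda>g. r (blinfun_apply g u) * F g - r (blinfun_apply g u) * q (blinfun_apply g u))"
      by (intro continuous_on_diff continuous_on_mult cr cF cq)
    fix g assume g: "g \<in> G"
    have "cmod (r (blinfun_apply g u) * (F g - q (blinfun_apply g u))) \<le> b * \<epsilon>"
      unfolding norm_mult using b(2)[OF g] q(2)[OF g] b(1) by (intro mult_mono) auto
    then show "cmod (r (blinfun_apply g u) * F g - r (blinfun_apply g u) * q (blinfun_apply g u)) \<le> b * \<epsilon>"
      by (simp add: right_diff_distrib)
  qed
  finally have "\<epsilon> * (b + 1) \<le> b * \<epsilon>" using b(1) by (simp add: \<epsilon>_def)
  then show False using \<epsilon> by (simp add: algebra_simps)
qed

text \<open>A continuous substitute for the indicator function of a ball: it is 1 up to distance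
  \<open>\<rho>\<close> from \<open>u\<close> and 0 from distance \<open>2 * \<rho>\<close>
  on.\<close>

definition bump :: "'v \<Rightarrow> real \<Rightarrow> ('v \<Rightarrow>\<^sub>L 'v) \<Rightarrow> real" where
  "bump u \<rho> g = max 0 (min 1 (2 - hn (blinfun_apply g u - u) / \<rho>))"

lemma continuous_bump: "continuous_on G (bump u \<rho>)"
proof -
  have "continuous_on G (\<lambda>g. max 0 (min 1 (2 - (1/\<rho>) * sqrt (sqn (blinfun_apply g u - u)))))"
    by (intro continuous_intros continuous_on_sqn)
  then show ?thesis by (simp add: bump_def[abs_def] hn_def)
qed

text \<open>A grid of mesh \<open>\<delta>\<close> proportional to \<open>\<rho>\<close> covers the orbit by \<open>O(\<rho> ^ - 2 dim V)\<close> sets of diameter at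
  most \<open>\<rho>\<close>, and by invariance each translate of a ball has the same measure.\<close>

lemma mean_bump_ge: "\<exists>C>0. \<forall>\<rho>. 0 < \<rho> \<longrightarrow> \<rho> \<le> 1 \<longrightarrow> (\<rho> / C) ^ (2 * card E) \<le> mean (bump u \<rho>)"
proof -
  define k where "k = card E"
  \<comment> \<open>The number of grid positions in one real coordinate is at most
    \<open>4 * hn u * (k + 1) / \<rho> + 5\<close>, and 5 is at most \<open>5 / \<rho>\<close>;
    together this is \<open>C / \<rho>\<close>.\<close>
  define C where "C = 4 * hn u * (real k + 1) + 5"
  have C: "C > 0" using hn_nonneg[of u] by (simp add: C_def add_nonneg_pos)
  have "(\<rho> / C) ^ (2 * k) \<le> mean (bump u \<rho>)" if \<rho>: "0 < \<rho>" "\<rho> \<le> 1" for \<rho>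
  proof -
    \<comment> \<open>Two points in one cell differ by at most \<open>2 * \<delta>\<close> in each
      of the \<open>k\<close> complex coordinates, and \<open>k\<close> times the square of this is
      at most the square of \<open>\<rho>\<close>.\<close>
    define \<delta> where "\<delta> = \<rho> / (2 * (real k + 1))"
    have \<delta>: "\<delta> > 0" using \<rho> by (simp add: \<delta>_def)
    define J where "J = \<lceil>hn u / \<delta>\<rceil> + 1"
    have "0 \<le> hn u / \<delta>" using hn_nonneg[of u] \<delta> by simp
    then have "-1 < hn u / \<delta>" by linarith
    then have J0: "J \<ge> 1" by (simp add: J_def)
    define \<kappa> where "\<kappa> = (\<lambda>g. restrict (\<lambda>e. (\<lfloor>Re (h (blinfun_apply g u) e) / \<delta>\<rfloor>, \<lfloor>Im (h (blinfun_apply g u) e) / \<delta>\<rfloor>)) E)"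
    have fl: "\<lfloor>x / \<delta>\<rfloor> \<in> {-J..J}" if "\<bar>x\<bar> \<le> hn u" for x
    proof -
      have "x / \<delta> \<le> hn u / \<delta>" using that \<delta> by (intro divide_right_mono) auto
      moreover have "(- hn u) / \<delta> \<le> x / \<delta>" using that \<delta> by (intro divide_right_mono) auto
      moreover have "(- hn u) / \<delta> = - (hn u / \<delta>)" by simp
      moreover note of_int_floor_le[of "x / \<delta>"] floor_correct[of "x / \<delta>"] le_of_int_ceiling[of "hn u / \<delta>"]
      ultimately have "of_int \<lfloor>x / \<delta>\<rfloor> \<le> (of_int J :: real)" "of_int (- J) \<le> (of_int \<lfloor>x / \<delta>\<rfloor> :: real)"
        unfolding J_def of_int_minus of_int_add of_int_1 by linarith+
      then have "\<lfloor>x / \<delta>\<rfloor> \<le> J" "- J \<le> \<lfloor>x / \<delta>\<rfloor>" by (simp_all only: of_int_le_iff)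
      then show ?thesis by simp
    qed
    have range: "\<kappa> ` G \<subseteq> (\<Pi>\<^sub>E e\<in>E. {-J..J} \<times> {-J..J})"
    proof
      fix c assume "c \<in> \<kappa> ` G"
      then obtain g where g: "g \<in> G" "c = \<kappa> g" by blast
      have "cmod (h (blinfun_apply g u) e) \<le> hn u" if "e \<in> E" for e
        using real_le_rsqrt[OF cmod_h_E_le[OF that, of "blinfun_apply g u"]] by (simp add: hn_def sqn_inv g(1))
      then have "\<bar>Re (h (blinfun_apply g u) e)\<bar> \<le> hn u \<and> \<bar>Im (h (blinfun_apply g u) e)\<bar> \<le> hn u" if "e \<in> E" for e
        using that abs_Re_le_cmod abs_Im_le_cmod order_trans by blast
      then show "c \<in> (\<Pi>\<^sub>E e\<in>E. {-J..J} \<times> {-J..J})" unfolding g(2) \<kappa>_def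
        using fl by (intro restrict_PiE_iff[THEN iffD2] ballI SigmaI) auto
    qed
    have finP: "finite (\<Pi>\<^sub>E e\<in>E. {-J..J} \<times> {-J..J})" by (intro finite_PiE finite_E) auto
    have cardP: "card (\<Pi>\<^sub>E e\<in>E. {-J..J} \<times> {-J..J}) = (nat (2 * J + 1) * nat (2 * J + 1)) ^ k"
      using J0 by (simp add: card_PiE[OF finite_E] k_def card_cartesian_product algebra_simps)
    have fink: "finite (\<kappa> ` G)" using finite_subset[OF range finP] .
    \<comment> \<open>One group element is chosen for each occupied cell. Translating by its inverse
      carries every orbit point of that cell into the ball of radius \<open>\<rho>\<close> about
      \<open>u\<close>.\<close>
    define rep where "rep = (\<lambda>c. SOME g. g \<in> G \<and> \<kappa> g = c)"
    have rep: "rep (\<kappa> g) \<in> G" "\<kappa> (rep (\<kappa> g)) = \<kappa> g" if "g \<in> G" for g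
      unfolding rep_def using someI[of "\<lambda>g'. g' \<in> G \<and> \<kappa> g' = \<kappa> g" g] that by simp_all
    have "\<exists>gs. set gs = (\<lambda>c. inv\<^bsub>GL\<^esub> (rep c)) ` (\<kappa> ` G) \<and> distinct gs"
      by (rule finite_distinct_list[OF finite_imageI[OF fink]])
    then obtain gs where gs: "set gs = (\<lambda>c. inv\<^bsub>GL\<^esub> (rep c)) ` (\<kappa> ` G)" "distinct gs"
      by (elim exE conjE)
    have "length gs = card ((\<lambda>c. inv\<^bsub>GL\<^esub> (rep c)) ` (\<kappa> ` G))" using distinct_card[OF gs(2)] gs(1) by simp
    also have "\<dots> \<le> card (\<kappa> ` G)" by (rule card_image_le[OF fink])
    also have "\<dots> \<le> (nat (2 * J + 1) * nat (2 * J + 1)) ^ k" using card_mono[OF finP range] cardP by simp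
    finally have len: "length gs \<le> (nat (2 * J + 1)) ^ (2 * k)" by (simp add: power_mult power2_eq_square power_mult_distrib)
    have gsw: "gs \<in> weights"
    proof (rule weightsI)
      show "gs \<noteq> []" using gs(1) id_in by auto
      show "set gs \<subseteq> G" unfolding gs(1) using rep(1) inv_in by auto
    qed
    have cover: "\<exists>g\<in>set gs. 1 \<le> bump u \<rho> (g o\<^sub>L x)" if x: "x \<in> G" for x
    proof -
      define y where "y = rep (\<kappa> x)"
      have y: "y \<in> G" "\<kappa> y = \<kappa> x" using rep[OF x] by (simp_all add: y_def)
      have memb: "inv\<^bsub>GL\<^esub> y \<in> set gs" unfolding gs(1) y_def using x by blast
      have fd: "\<bar>a - b\<bar> \<le> \<delta>" if "\<lfloor>a / \<delta>\<rfloor> = \<lfloor>b / \<delta>\<rfloor>" for a b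
      proof -
        have "\<bar>a / \<delta> - b / \<delta>\<bar> \<le> 1" using that by linarith
        then have "\<bar>(a - b) / \<delta>\<bar> \<le> 1" by (simp add: diff_divide_distrib)
        then show ?thesis using \<delta> by (simp add: abs_divide divide_le_eq)
      qed
      have he: "cmod (h (blinfun_apply x u - blinfun_apply y u) e) \<le> 2 * \<delta>" if e: "e \<in> E" for e
      proof -
        have "\<kappa> y e = \<kappa> x e" using y(2) by simp
        then have "\<bar>Re (h (blinfun_apply x u) e) - Re (h (blinfun_apply y u) e)\<bar> \<le> \<delta>"
          "\<bar>Im (h (blinfun_apply x u) e) - Im (h (blinfun_apply y u) e)\<bar> \<le> \<delta>"
          using fd e by (auto simp: \<kappa>_def)
        then show ?thesis using cmod_le[of "h (blinfun_apply x u - blinfun_apply y u) e"] by (simp add: h_diff)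
      qed
      have "sqn (blinfun_apply x u - blinfun_apply y u) \<le> (\<Sum>e\<in>E. (2 * \<delta>)\<^sup>2)"
        unfolding sqn_expand by (intro sum_mono power_mono he norm_ge_zero)
      also have "\<dots> = real k * (2 * \<delta>)\<^sup>2" by (simp add: k_def)
      also have "\<dots> \<le> (real k + 1)\<^sup>2 * (2 * \<delta>)\<^sup>2"
        by (intro mult_right_mono) (auto simp: power2_eq_square algebra_simps)
      also have "\<dots> = \<rho>\<^sup>2"
      proof -
        have "0 < 2 * (real k + 1)" by simp
        then have kk: "2 * (real k + 1) \<noteq> 0" by (rule less_imp_neq[symmetric])
        have "\<delta> * (2 * (real k + 1)) = \<rho>" by (rule iffD1[OF nonzero_eq_divide_eq[OF kk] \<delta>_def])
        then have "(real k + 1) * (2 * \<delta>) = \<rho>" by (simp only: mult_ac)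
        then show ?thesis by (metis power_mult_distrib)
      qed
      finally have "sqn (blinfun_apply x u - blinfun_apply y u) \<le> \<rho>\<^sup>2" .
      moreover have "blinfun_apply (inv\<^bsub>GL\<^esub> y) (blinfun_apply x u - blinfun_apply y u) = blinfun_apply (inv\<^bsub>GL\<^esub> y o\<^sub>L x) u - u"
        by (simp add: blinfun.diff_right inv_apply y(1))
      ultimately have "sqn (blinfun_apply (inv\<^bsub>GL\<^esub> y o\<^sub>L x) u - u) \<le> \<rho>\<^sup>2"
        using sqn_inv[OF inv_in[OF y(1)], of "blinfun_apply x u - blinfun_apply y u"] by simp
      then have "hn (blinfun_apply (inv\<^bsub>GL\<^esub> y o\<^sub>L x) u - u) \<le> \<rho>"
        unfolding hn_def using \<rho>(1) by (intro real_le_lsqrt) auto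
      then have "1 \<le> bump u \<rho> (inv\<^bsub>GL\<^esub> y o\<^sub>L x)" using \<rho>(1) by (simp add: bump_def divide_le_eq)
      then show ?thesis using memb by blast
    qed
    have m: "1 / real (length gs) \<le> mean (bump u \<rho>)"
      by (rule mean_ge_cover[OF continuous_bump gsw _ cover]) (simp add: bump_def)
    have len0: "length gs > 0" using gsw by (auto simp: weights_def)
    have "real (nat (2 * J + 1)) = 2 * of_int J + 1" using J0 by simp
    also have "\<dots> \<le> 2 * (hn u / \<delta> + 2) + 1"
    proof -
      have "2 * (a + 1) + 1 \<le> 2 * (b + 2) + 1" if "a \<le> b + 1" for a b :: real
        using that by (simp add: distrib_left)
      from this[OF of_int_ceiling_le_add_one[of "hn u / \<delta>"]] show ?thesis by (simp only: J_def of_int_add of_int_1)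
    qed
    also have "\<dots> = 4 * hn u * (real k + 1) / \<rho> + 5"
    proof -
      have "hn u / \<delta> = hn u * (2 * (real k + 1)) / \<rho>" by (simp only: \<delta>_def divide_divide_eq_right)
      then have e1: "hn u / \<delta> = 2 * (hn u * (real k + 1) / \<rho>)" by (simp only: mult.left_commute times_divide_eq_right)
      have e2: "4 * hn u * (real k + 1) / \<rho> = 4 * (hn u * (real k + 1) / \<rho>)" by (simp only: mult.assoc times_divide_eq_right)
      have "2 * (c + 2) + 1 = 4 * x + 5" if "c = 2 * x" for c x :: real using that by (simp add: distrib_left)
      from this[OF e1] show ?thesis unfolding e2 .
    qed
    also have "\<dots> \<le> 4 * hn u * (real k + 1) / \<rho> + 5 / \<rho>"
    proof -
      have "5 * \<rho> \<le> 5" using \<rho> by simp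
      then have "5 \<le> 5 / \<rho>" using \<rho>(1) by (simp only: pos_le_divide_eq)
      then show ?thesis by simp
    qed
    also have "\<dots> = C / \<rho>" by (simp add: C_def add_divide_distrib)
    finally have "real (nat (2 * J + 1)) \<le> C / \<rho>" .
    then have "real (nat (2 * J + 1)) ^ (2 * k) \<le> (C / \<rho>) ^ (2 * k)" by (intro power_mono) auto
    then have "real (length gs) \<le> (C / \<rho>) ^ (2 * k)"
      using len by (metis of_nat_le_iff of_nat_power order_trans)
    then have "1 / (C / \<rho>) ^ (2 * k) \<le> 1 / real (length gs)" using len0 C \<rho>(1) by (intro divide_left_mono) auto
    then show ?thesis using m C \<rho>(1) by (simp add: power_divide)
  qed
  then show ?thesis using C unfolding k_def by blast
qed

text \<open>The test functions are \<open>(s + \<langle>u, u\<rangle> - \<langle>z, u\<rangle>) ^ - m\<close>, uniform limits of polynomials in \<open>z\<close> on the orbit.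
  As \<open>s \<rightarrow> 0\<close> they blow up at \<open>u\<close> only; by the sector bound their argument tends to 0 there, so their
  integrals cannot cancel, and \<open>m\<close> is taken so large that they are unbounded.\<close>

lemma minimal_orbit_separating:
  assumes u: "moment_zero u" and r: "r \<in> hol_poly" "r u \<noteq> 0"
  shows "\<exists>q\<in>hol_poly. cmean (\<lambda>g. r (blinfun_apply g u) * q (blinfun_apply g u)) \<noteq> 0"
proof (rule ccontr)
  assume neg: "\<not> ?thesis"
  \<comment> \<open>Normalized to the value 1 at \<open>u\<close>, so that near \<open>u\<close> the
    factor does not affect the argument of the integrand much.\<close>
  define r1 where "r1 = (\<lambda>x. (1 / r u) * r x)"
  have r1: "r1 \<in> hol_poly" unfolding r1_def by (rule hol_poly_cmult[OF r(1)])
  have r1u: "r1 u = 1" using r(2) by (simp add: r1_def)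
  have r10: "cmean (\<lambda>g. r1 (blinfun_apply g u) * q (blinfun_apply g u)) = 0" if q: "q \<in> hol_poly" for q
  proof -
    have "cmean (\<lambda>g. (1 / r u) * (r (blinfun_apply g u) * q (blinfun_apply g u))) = (1 / r u) * cmean (\<lambda>g. r (blinfun_apply g u) * q (blinfun_apply g u))"
      by (intro cmean_cmult continuous_on_mult continuous_hol_poly_orbit r(1) q)
    then show ?thesis using neg q by (simp add: r1_def mult.assoc)
  qed
  define k where "k = card E"
  \<comment> \<open>At scale \<open>s\<close> the bump has mean at least of order
    \<open>s ^ k\<close>, the test function has size of order \<open>s ^ (-m)\<close>; the choice
    \<open>m = k + 1\<close> makes the product grow like \<open>1 / s\<close>.\<close>
  define m where "m = Suc k"
  obtain C where C: "C > 0" "\<And>\<rho>. 0 < \<rho> \<Longrightarrow> \<rho> \<le> 1 \<Longrightarrow> (\<rho> / C) ^ (2 * k) \<le> mean (bump u \<rho>)"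
    using mean_bump_ge[of u] unfolding k_def by blast
  \<comment> \<open>The slope \<open>\<epsilon>0\<close> describes a sector in which the
    \<open>m\<close>-th power of the test function stays within 1/4 of a positive number in relative
    size, so that it does not oscillate.\<close>
  have "isCont (\<lambda>t::real. (1 / (1 + \<i> * complex_of_real t)) ^ m) 0"
    by (intro continuous_intros) auto
  from this[unfolded continuous_at_eps_delta, rule_format, of "1/4"]
  obtain \<epsilon>0 where \<epsilon>0: "\<epsilon>0 > 0" "\<And>t. \<bar>t\<bar> < \<epsilon>0 \<Longrightarrow> cmod ((1 / (1 + \<i> * complex_of_real t)) ^ m - 1) < 1/4"
    by (auto simp: dist_norm)
  define \<epsilon> where "\<epsilon> = \<epsilon>0 / 2"
  have \<epsilon>: "\<epsilon> > 0" "\<epsilon> < \<epsilon>0" using \<epsilon>0(1) by (auto simp: \<epsilon>_def)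
  obtain \<rho>s where \<rho>s: "\<rho>s > 0" "\<And>g. g \<in> G \<Longrightarrow> sqn (blinfun_apply g u - u) < \<rho>s \<Longrightarrow>
      \<bar>Im (h (blinfun_apply g u) u)\<bar> \<le> (\<epsilon>/2) * sqn (blinfun_apply g u - u)"
    using sector[OF u, of "\<epsilon>/2"] \<epsilon>(1) by auto
  have "isCont r1 u" using hol_poly_continuous_on[OF r1, of UNIV] by (simp add: continuous_on_eq_continuous_at)
  then obtain d where d: "d > 0" "\<And>y. norm (y - u) < d \<Longrightarrow> cmod (r1 y - 1) < 1/4"
    unfolding continuous_at_eps_delta using r1u by (metis dist_norm zero_less_divide_1_iff zero_less_numeral)
  obtain D where D: "D > 0" "\<And>x. norm x \<le> D * sqrt (sqn x)" using norm_le_sqn by blast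
  define \<rho>0 where "\<rho>0 = min \<rho>s ((d / D)\<^sup>2)"
  have \<rho>0: "\<rho>0 > 0" using \<rho>s(1) d(1) D(1) by (simp add: \<rho>0_def)
  have r1near: "cmod (r1 y - 1) < 1/4" if "sqn (y - u) < \<rho>0" for y
  proof -
    have "sqn (y - u) < (d / D)\<^sup>2" using that by (simp add: \<rho>0_def)
    then have "sqrt (sqn (y - u)) < sqrt ((d / D)\<^sup>2)" by (rule real_sqrt_less_mono)
    also have "\<dots> = d / D" using d(1) D(1) by simp
    finally have "D * sqrt (sqn (y - u)) < d" using D(1) by (simp add: pos_less_divide_eq mult.commute)
    then show ?thesis using d(2)[of y] D(2)[of "y - u"] by simp
  qed
  obtain R where R: "R \<ge> 0" "\<And>g. g \<in> G \<Longrightarrow> cmod (r1 (blinfun_apply g u)) \<le> R"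
    using continuous_bounded[OF continuous_hol_poly_orbit[OF r1, of u]] by blast
  \<comment> \<open>A bound for the integrand away from \<open>u\<close>, uniform in
    \<open>s\<close>, since the real part of the denominator is at least \<open>\<rho>0 / 2\<close>
    there.\<close>
  define F where "F = R * (2 / \<rho>0) ^ m"
  have F0: "F \<ge> 0" using R(1) \<rho>0 by (simp add: F_def)
  define A where "A = (1/4) * (1/3) ^ m * (1 / C) ^ (2 * k)"
  have A: "A > 0" using C(1) by (simp add: A_def)
  \<comment> \<open>Small enough that the support of the bump lies in the region controlled by the
    sector bound and that \<open>A / s\<close>, a lower bound for the main term, exceeds the bound
    \<open>F\<close> for the rest.\<close>
  define s where "s = min 1 (min (\<rho>0 / 8) (A / (2 * (F + 1))))"
  have s: "s > 0" "s \<le> 1" "4 * s < \<rho>0" "s * (2 * (F + 1)) \<le> A"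
  proof -
    show "s > 0" "s \<le> 1" using \<rho>0 A F0 by (auto simp: s_def)
    have "s \<le> \<rho>0 / 8" unfolding s_def by (intro min.coboundedI2 min.coboundedI1 order_refl)
    then show "4 * s < \<rho>0" using \<rho>0 by linarith
    have "s \<le> A / (2 * (F + 1))" unfolding s_def by (intro min.coboundedI2 order_refl)
    then show "s * (2 * (F + 1)) \<le> A" using F0 by (simp add: pos_le_divide_eq)
  qed
  define Q where "Q = (\<lambda>g. (1 / (complex_of_real (s + sqn u) - h (blinfun_apply g u) u)) ^ m)"
  have Q: "Q \<in> orbit_limits u" unfolding Q_def by (rule orbit_limits_power[OF orbit_limits_resolvent[OF s(1)]])
  have Qc: "continuous_on G Q" using Q by (simp add: orbit_limits_def)
  have zero: "cmean (\<lambda>g. r1 (blinfun_apply g u) * Q g) = 0" by (rule orbit_limits_orthogonal[OF r1 r10 Q])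
  \<comment> \<open>Where \<open>q < \<rho>0\<close> the integrand has positive real part, and where
    the bump is nonzero one has \<open>q < 4 * s\<close>, so the real part of the denominator is at
    most \<open>3 * s\<close>. Elsewhere the bump vanishes and the integrand is at most
    \<open>F\<close> in modulus.\<close>
  have pw: "(1/4) * (1 / (3 * s)) ^ m * bump u (sqrt s) g - F \<le> Re (r1 (blinfun_apply g u) * Q g)" if g: "g \<in> G" for g
  proof -
    define w where "w = complex_of_real (s + sqn u) - h (blinfun_apply g u) u"
    define q where "q = sqn (blinfun_apply g u - u)"
    have Rew: "Re w = s + q / 2" using sqn_diff[of "blinfun_apply g u" u] by (simp add: w_def q_def sqn_inv g)
    have Imw: "Im w = - Im (h (blinfun_apply g u) u)" by (simp add: w_def)
    have q0: "q \<ge> 0" by (simp add: q_def sqn_nonneg)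
    define X where "X = Re w"
    have X: "X > 0" using s(1) q0 by (simp add: X_def Rew)
    have bump1: "0 \<le> bump u (sqrt s) g" "bump u (sqrt s) g \<le> 1" by (auto simp: bump_def)
    have bump0: "bump u (sqrt s) g = 0" if "q \<ge> 4 * s"
    proof -
      have "sqrt (4 * s) \<le> hn (blinfun_apply g u - u)" unfolding hn_def using that by (simp add: q_def)
      then have "2 * sqrt s \<le> hn (blinfun_apply g u - u)" by (simp add: real_sqrt_mult)
      then have "2 \<le> hn (blinfun_apply g u - u) / sqrt s" using s(1) by (simp add: pos_le_divide_eq)
      then show ?thesis by (simp add: bump_def)
    qed
    show ?thesis
    proof (cases "q < \<rho>0")
      case True
      define \<eta> where "\<eta> = Im w / X"
      have "\<bar>Im w\<bar> \<le> (\<epsilon>/2) * q" using \<rho>s(2)[OF g] True by (simp add: Imw q_def \<rho>0_def)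
      also have "\<dots> \<le> \<epsilon> * X" using s(1) \<epsilon>(1) by (simp add: X_def Rew algebra_simps)
      finally have "\<bar>\<eta>\<bar> \<le> \<epsilon>" using X by (simp add: \<eta>_def pos_divide_le_eq)
      then have e1: "cmod ((1 / (1 + \<i> * complex_of_real \<eta>)) ^ m - 1) < 1/4" using \<epsilon>0(2) \<epsilon>(2) by simp
      define z1 where "z1 = (1 / (1 + \<i> * complex_of_real \<eta>)) ^ m"
      define z2 where "z2 = r1 (blinfun_apply g u)"
      have e2: "cmod (z2 - 1) < 1/4" unfolding z2_def by (rule r1near) (use True in \<open>simp add: q_def\<close>)
      have wX: "w = complex_of_real X * (1 + \<i> * complex_of_real \<eta>)"
        using X by (simp add: complex_eq_iff \<eta>_def X_def)
      have "Q g = (1 / w) ^ m" by (simp add: Q_def w_def)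
      also have "\<dots> = complex_of_real ((1 / X) ^ m) * z1" unfolding wX z1_def by (simp add: power_divide power_mult_distrib)
      finally have Qg: "Q g = complex_of_real ((1 / X) ^ m) * z1" .
      have "z2 * z1 - 1 = (z2 - 1) * (z1 - 1) + (z2 - 1) + (z1 - 1)" by (simp add: algebra_simps)
      then have "cmod (z2 * z1 - 1) \<le> cmod ((z2 - 1) * (z1 - 1)) + cmod (z2 - 1) + cmod (z1 - 1)"
        by (metis norm_triangle_ineq norm_triangle_le add_right_mono order_trans)
      also have "cmod ((z2 - 1) * (z1 - 1)) \<le> 1/4 * (1/4)" unfolding norm_mult using e1 e2 by (intro mult_mono) (auto simp: z1_def)
      finally have "cmod (z2 * z1 - 1) \<le> 3/4" using e1 e2 by (simp add: z1_def)
      then have "\<bar>Re (z2 * z1 - 1)\<bar> \<le> 3/4" using abs_Re_le_cmod order_trans by blast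
      moreover have "Re (z2 * z1 - 1) = Re (z2 * z1) - 1" by (simp only: minus_complex.sel one_complex.sel)
      ultimately have Rez: "Re (z2 * z1) \<ge> 1/4" by linarith
      have "r1 (blinfun_apply g u) * Q g = complex_of_real ((1 / X) ^ m) * (z2 * z1)" by (simp add: Qg z2_def)
      then have "Re (r1 (blinfun_apply g u) * Q g) = (1 / X) ^ m * Re (z2 * z1)" by simp
      moreover have "(1 / X) ^ m * (1/4) \<le> (1 / X) ^ m * Re (z2 * z1)" using Rez X by (intro mult_left_mono) auto
      ultimately have low: "(1/4) * (1 / X) ^ m \<le> Re (r1 (blinfun_apply g u) * Q g)" by simp
      have "(1/4) * (1 / (3 * s)) ^ m * bump u (sqrt s) g \<le> (1/4) * (1 / X) ^ m"
      proof (cases "q < 4 * s")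
        case True
        then have "X \<le> 3 * s" by (simp add: X_def Rew)
        then have "(1 / (3 * s)) ^ m \<le> (1 / X) ^ m" using X s(1) by (intro power_mono divide_left_mono) auto
        moreover have "(1 / (3 * s)) ^ m * bump u (sqrt s) g \<le> (1 / (3 * s)) ^ m * 1"
          using bump1 s(1) by (intro mult_left_mono) auto
        ultimately show ?thesis by simp
      next
        case False
        then show ?thesis using bump0 X by simp
      qed
      then show ?thesis using low F0 by linarith
    next
      case False
      then have b0: "bump u (sqrt s) g = 0" using bump0 s(3) by simp
      have wge: "cmod w \<ge> \<rho>0 / 2" using complex_Re_le_cmod[of w] False s(1) by (simp add: Rew)
      then have cw: "cmod w > 0" using \<rho>0 by linarith
      have "1 / cmod w \<le> 1 / (\<rho>0 / 2)" using wge cw \<rho>0 by (intro divide_left_mono) auto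
      then have "1 / cmod w \<le> 2 / \<rho>0" by simp
      then have "(1 / cmod w) ^ m \<le> (2 / \<rho>0) ^ m" by (intro power_mono) auto
      then have "cmod (r1 (blinfun_apply g u)) * (1 / cmod w) ^ m \<le> F"
        unfolding F_def using R(2)[OF g] R(1) by (intro mult_mono) auto
      moreover have "cmod (r1 (blinfun_apply g u) * Q g) = cmod (r1 (blinfun_apply g u)) * (1 / cmod w) ^ m"
        unfolding Q_def w_def[symmetric] norm_mult norm_power norm_divide norm_one ..
      ultimately have "\<bar>Re (r1 (blinfun_apply g u) * Q g)\<bar> \<le> F"
        using abs_Re_le_cmod[of "r1 (blinfun_apply g u) * Q g"] by linarith
      then show ?thesis using b0 by simp
    qed
  qed
  define c1 where "c1 = (1/4) * (1 / (3 * s)) ^ m"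
  have cont1: "continuous_on G (\<lambda>g. c1 * bump u (sqrt s) g)" by (intro continuous_intros continuous_bump)
  have "mean (\<lambda>g. c1 * bump u (sqrt s) g + - F) \<le> mean (\<lambda>g. Re (r1 (blinfun_apply g u) * Q g))"
  proof (rule mean_mono)
    show "continuous_on G (\<lambda>g. c1 * bump u (sqrt s) g + - F)"
      by (intro continuous_on_add cont1 continuous_on_const)
    show "continuous_on G (\<lambda>g. Re (r1 (blinfun_apply g u) * Q g))"
      by (intro continuous_on_Re continuous_on_mult continuous_hol_poly_orbit r1 Qc)
    show "c1 * bump u (sqrt s) g + - F \<le> Re (r1 (blinfun_apply g u) * Q g)" if "g \<in> G" for g
      using pw[OF that] by (simp only: c1_def diff_conv_add_uminus)
  qed
  also have "\<dots> = 0" using zero Re_cmean[of "\<lambda>g. r1 (blinfun_apply g u) * Q g"] by simp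
  also have "mean (\<lambda>g. c1 * bump u (sqrt s) g + - F) = c1 * mean (bump u (sqrt s)) + - F"
    using mean_add[OF cont1 continuous_on_const[of G "- F"]] mean_cmult[OF continuous_bump] mean_const by simp
  finally have 1: "c1 * mean (bump u (sqrt s)) \<le> F" by simp
  have "(sqrt s / C) ^ (2 * k) \<le> mean (bump u (sqrt s))" using C(2)[of "sqrt s"] s(1,2) by simp
  then have "c1 * (sqrt s / C) ^ (2 * k) \<le> c1 * mean (bump u (sqrt s))"
    using s(1) by (intro mult_left_mono) (auto simp: c1_def)
  then have 2: "c1 * (sqrt s / C) ^ (2 * k) \<le> F" using 1 by linarith
  have "sqrt s ^ (2 * k) = s ^ k" using s(1) by (simp add: power_mult)
  then have scal: "(sqrt s / C) ^ (2 * k) = s ^ k * (1 / C) ^ (2 * k)"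
    by (simp add: power_divide)
  have "c1 * (sqrt s / C) ^ (2 * k) = A / s"
    unfolding scal using s(1) by (simp add: c1_def A_def m_def power_divide power_mult_distrib field_simps)
  then have "A / s \<le> F" using 2 by simp
  then have "A \<le> F * s" using s(1) by (simp add: pos_divide_le_eq)
  then have "s * (2 * (F + 1)) \<le> F * s" using s(4) by linarith
  then have "s * (2 * (F + 1) - F) \<le> 0" by (simp add: algebra_simps)
  then show False using s(1) F0 by (simp add: mult_le_0_iff)
qed

end

section \<open>Closed complex orbits\<close>

text \<open>It suffices that the remainder \<open>r\<close> vanishes on the orbit of the minimal
  vector \<open>u\<close>: then it vanishes on the whole complex orbit, and the conjugate of
  \<open>p\<close> agrees with a polynomial on \<open>M\<close>. If \<open>r\<close> did not vanish
  there, some polynomial would pair nontrivially with a translate of it on the orbit of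
  \<open>u\<close>, and the pairing would have the same value on \<open>M\<close>.\<close>

lemma (in orbit_space) closed_imp_dense:
  assumes comm: "commutative_orbit G M" and cl: "closed (orbit_of GC v)"
  shows "poly_closure M = cont_fun M"
proof (rule selfadjoint_imp_dense)
  obtain h E where "unitary_group G h E" using unitary_group_exists by blast
  then interpret U: unitary_group G h E .
  obtain a where a: "a \<in> GC" "\<And>b. b \<in> GC \<Longrightarrow> U.sqn (blinfun_apply a v) \<le> U.sqn (blinfun_apply b v)"
    using U.minimal_vector_exists[OF cl] by blast
  define u where "u = blinfun_apply a v"
  have mz: "U.moment_zero u"
  proof (rule U.minimal_moment_zero)
    fix Y assume Y: "Y \<in> lie"
    have "op_exp (iop Y) o\<^sub>L a \<in> GC" by (intro GC_compose GC_exp_iop Y a(1))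
    from a(2)[OF this] show "U.sqn u \<le> U.sqn (blinfun_apply (op_exp (iop Y)) u)" by (simp add: u_def)
  qed
  have v: "blinfun_apply (inv\<^bsub>GL\<^esub> a) u = v" unfolding u_def by (rule GL_inv_apply(1)[OF GC_GL[OF a(1)]])
  fix p :: "'v \<Rightarrow> complex" assume p: "p \<in> hol_poly"
  obtain s r where sr: "s \<in> A0" "(\<lambda>x. cnj (s x)) \<in> A0" "r \<in> hol_poly"
    "\<And>g. g \<in> G \<Longrightarrow> cnj (p (blinfun_apply g v)) = s (blinfun_apply g v) + cnj (r (blinfun_apply g v))"
    "\<And>q. q \<in> hol_poly \<Longrightarrow> cmean (\<lambda>g. r (blinfun_apply g v) * q (blinfun_apply g v)) = 0"
    by (rule cnj_split[OF comm p]) (rule that; assumption)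
  have ru: "r (blinfun_apply g1 u) = 0" if g1: "g1 \<in> G" for g1
  proof (rule ccontr)
    assume neq: "r (blinfun_apply g1 u) \<noteq> 0"
    define r1 where "r1 = (\<lambda>x. r (blinfun_apply g1 x))"
    have r1: "r1 \<in> hol_poly" unfolding r1_def by (rule hol_poly_compose[OF sr(3) cendo_G[OF g1]])
    obtain q where q: "q \<in> hol_poly" "cmean (\<lambda>g. r1 (blinfun_apply g u) * q (blinfun_apply g u)) \<noteq> 0"
      using U.minimal_orbit_separating[OF mz r1] neq by (auto simp: r1_def)
    define P where "P = (\<lambda>x. r1 x * q x)"
    have P: "P \<in> hol_poly" unfolding P_def by (rule hol_poly.mult[OF r1 q(1)])
    \<comment> \<open>The average minus its value at \<open>u\<close> vanishes on the orbit of
      \<open>u\<close>, hence on its complex orbit, which contains \<open>v\<close>. So the mean of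
      \<open>P\<close> over both orbits is the same.\<close>
    define P1 where "P1 = (\<lambda>x. average P x - average P u)"
    have P1: "P1 \<in> hol_poly" unfolding P1_def by (intro hol_poly_diff average_hol_poly P hol_poly.const)
    have "P1 (blinfun_apply g u) = 0" if "g \<in> G" for g using average_invariant[OF P that] by (simp add: P1_def)
    then have "P1 (blinfun_apply (inv\<^bsub>GL\<^esub> a) u) = 0" by (rule GC_vanish[OF P1 _ GC_inv[OF a(1)]])
    then have ne: "average P v \<noteq> 0" using q(2) by (simp add: P1_def v average_def P_def)
    \<comment> \<open>Undoing the translation by \<open>g1\<close> in \<open>q\<close> turns the
      pairing of the translated \<open>r\<close> with \<open>q\<close> into one of \<open>r\<close>
      itself, by left invariance of the mean.\<close>
    define q' where "q' = (\<lambda>x. q (blinfun_apply (inv\<^bsub>GL\<^esub> g1) x))"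
    have q': "q' \<in> hol_poly" unfolding q'_def by (rule hol_poly_compose[OF q(1) cendo_G[OF inv_in[OF g1]]])
    have "average P v = cmean (\<lambda>g. r (blinfun_apply (g1 o\<^sub>L g) v) * q' (blinfun_apply (g1 o\<^sub>L g) v))"
      by (simp add: average_def P_def r1_def q'_def inv_apply g1)
    also have "\<dots> = cmean (\<lambda>g. r (blinfun_apply g v) * q' (blinfun_apply g v))"
      by (rule cmean_left[OF _ g1]) (intro continuous_on_mult continuous_hol_poly_orbit sr(3) q')
    also have "\<dots> = 0" by (rule sr(5)[OF q'])
    finally show False using ne by simp
  qed
  have rv: "r (blinfun_apply g v) = 0" if g: "g \<in> G" for g
  proof -
    have ga: "g o\<^sub>L inv\<^bsub>GL\<^esub> a \<in> GC" by (intro GC_compose G_GC g GC_inv a(1))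
    have "r (blinfun_apply (g o\<^sub>L inv\<^bsub>GL\<^esub> a) u) = 0"
      by (rule GC_vanish[OF sr(3) _ ga]) (rule ru)
    then show ?thesis by (simp add: v)
  qed
  obtain q where q: "q \<in> hol_poly" "s = rs q" using sr(1) unfolding A0_def by blast
  have "q x = cnj (p x)" if "x \<in> M" for x
    using that
  proof (rule M_E)
    fix g assume g: "g \<in> G" "x = blinfun_apply g v"
    show "q x = cnj (p x)" unfolding g(2) sr(4)[OF g(1)] rv[OF g(1)] q(2) rs_apply[OF g(1)] by simp
  qed
  then show "\<exists>q\<in>hol_poly. \<forall>x\<in>M. q x = cnj (p x)" using q(1) by blast
qed

section \<open>Characters of countably generated function algebras\<close>

definition fun_ideal :: "('x \<Rightarrow> complex) set \<Rightarrow> ('x \<Rightarrow> complex) set \<Rightarrow> bool" where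
  "fun_ideal A I \<longleftrightarrow> I \<subseteq> A \<and> (\<lambda>x. 0) \<in> I \<and> (\<forall>f\<in>I. \<forall>k\<in>I. (\<lambda>x. f x + k x) \<in> I) \<and> (\<forall>f\<in>A. \<forall>k\<in>I. (\<lambda>x. f x * k x) \<in> I)"

lemma fun_ideal_Union:
  assumes "\<C> \<noteq> {}" "\<And>J. J \<in> \<C> \<Longrightarrow> fun_ideal A J" "\<And>J K. J \<in> \<C> \<Longrightarrow> K \<in> \<C> \<Longrightarrow> J \<subseteq> K \<or> K \<subseteq> J"
  shows "fun_ideal A (\<Union>\<C>)"
  unfolding fun_ideal_def
proof (intro conjI ballI)
  show "\<Union>\<C> \<subseteq> A" using assms(2) by (intro Union_least) (simp add: fun_ideal_def)
  obtain J0 where "J0 \<in> \<C>" using assms(1) by blast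
  moreover from this have "(\<lambda>x. 0) \<in> J0" using assms(2) by (simp add: fun_ideal_def)
  ultimately show "(\<lambda>x. 0) \<in> \<Union>\<C>" by blast
  fix f k assume "f \<in> \<Union>\<C>" "k \<in> \<Union>\<C>"
  then obtain J K where JK: "J \<in> \<C>" "f \<in> J" "K \<in> \<C>" "k \<in> K" by blast
  then obtain L where "L \<in> \<C>" "f \<in> L" "k \<in> L" using assms(3)[OF JK(1,3)] by blast
  moreover from this have "(\<lambda>x. f x + k x) \<in> L" using assms(2)[of L] by (simp add: fun_ideal_def)
  ultimately show "(\<lambda>x. f x + k x) \<in> \<Union>\<C>" by blast
next
  fix f k assume "f \<in> A" "k \<in> \<Union>\<C>"
  then obtain L where "L \<in> \<C>" "k \<in> L" by blast
  moreover from this have "(\<lambda>x. f x * k x) \<in> L" using assms(2)[of L] \<open>f \<in> A\<close> by (simp add: fun_ideal_def)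
  ultimately show "(\<lambda>x. f x * k x) \<in> \<Union>\<C>" by blast
qed

lemma maximal_ideal_exists:
  assumes I: "fun_ideal A I" "(\<lambda>x. 1) \<notin> I"
  obtains m where "I \<subseteq> m" "fun_ideal A m" "(\<lambda>x. 1) \<notin> m"
    "\<And>J. fun_ideal A J \<Longrightarrow> m \<subseteq> J \<Longrightarrow> (\<lambda>x. 1) \<notin> J \<Longrightarrow> J = m"
proof -
  define \<A> where "\<A> = {J. fun_ideal A J \<and> I \<subseteq> J \<and> (\<lambda>x. 1) \<notin> J}"
  have "\<exists>m\<in>\<A>. \<forall>X\<in>\<A>. m \<subseteq> X \<longrightarrow> X = m"
  proof (rule subset_Zorn_nonempty)
    show "\<A> \<noteq> {}" using I by (auto simp: \<A>_def)
    fix \<C> assume C: "\<C> \<noteq> {}" "subset.chain \<A> \<C>"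
    have sub: "\<C> \<subseteq> \<A>" and lin: "\<And>J K. J \<in> \<C> \<Longrightarrow> K \<in> \<C> \<Longrightarrow> J \<subseteq> K \<or> K \<subseteq> J"
      using C(2) by (auto simp: subset_chain_def)
    have "fun_ideal A (\<Union>\<C>)" by (rule fun_ideal_Union[OF C(1) _ lin]) (use sub in \<open>auto simp: \<A>_def\<close>)
    then show "\<Union>\<C> \<in> \<A>" using sub C(1) unfolding \<A>_def by blast
  qed
  then obtain m where m: "m \<in> \<A>" "\<And>X. X \<in> \<A> \<Longrightarrow> m \<subseteq> X \<Longrightarrow> X = m" by blast
  show thesis
  proof (rule that[of m])
    show "J = m" if "fun_ideal A J" "m \<subseteq> J" "(\<lambda>x. 1) \<notin> J" for J
      using m that by (auto simp: \<A>_def)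
  qed (use m(1) in \<open>auto simp: \<A>_def\<close>)
qed

lemma real_pigeonhole:
  assumes "\<And>t::real. \<exists>n::nat. P n t"
  shows "\<exists>n. infinite {t. P n t}"
proof (rule ccontr)
  assume "\<not> ?thesis"
  then have "countable (\<Union>n. {t. P n t})" by (intro countable_UN) (auto intro: countable_finite)
  moreover have "(\<Union>n. {t. P n t}) = UNIV" using assms by auto
  ultimately show False using uncountable_UNIV_real by simp
qed

text \<open>The residue field of a maximal ideal \<open>m\<close> containing \<open>I\<close> is the
  field of complex numbers, and the residue map is the character. That each residue is a scalar
  rests on the algebra being a countable union of finite dimensional spaces, together with the
  uncountability of the scalars.\<close>

lemma character_exists:
  assumes A: "fun_algebra A" and span: "\<And>f. f \<in> A \<Longrightarrow> \<exists>n. f \<in> fv.span (S n)" and fin: "\<And>n::nat. finite (S n)"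
    and I: "fun_ideal A I" "(\<lambda>x. 1) \<notin> I"
  obtains ch where "\<And>f k. f \<in> A \<Longrightarrow> k \<in> A \<Longrightarrow> ch (\<lambda>x. f x + k x) = ch f + ch k"
    "\<And>f k. f \<in> A \<Longrightarrow> k \<in> A \<Longrightarrow> ch (\<lambda>x. f x * k x) = ch f * ch k"
    "\<And>c. ch (\<lambda>x. c) = c" "\<And>f. f \<in> I \<Longrightarrow> ch f = 0"
proof -
  obtain m where m: "I \<subseteq> m" "fun_ideal A m" "(\<lambda>x. 1) \<notin> m"
    "\<And>J. fun_ideal A J \<Longrightarrow> m \<subseteq> J \<Longrightarrow> (\<lambda>x. 1) \<notin> J \<Longrightarrow> J = m"
    by (rule maximal_ideal_exists[OF I]) (rule that; assumption)
  have mA: "f \<in> A" if "f \<in> m" for f using m(2) that by (auto simp: fun_ideal_def)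
  have m0: "(\<lambda>x. 0) \<in> m" using m(2) by (simp add: fun_ideal_def)
  have m_add: "(\<lambda>x. f x + k x) \<in> m" if "f \<in> m" "k \<in> m" for f k using m(2) that by (simp add: fun_ideal_def)
  have m_mult: "(\<lambda>x. f x * k x) \<in> m" if "f \<in> A" "k \<in> m" for f k using m(2) that by (simp add: fun_ideal_def)
  note Ac = fun_algebra_const[OF A] and Aadd = fun_algebra_add[OF A] and Amult = fun_algebra_mult[OF A] and Adiff = fun_algebra_diff[OF A]
  have m_diff: "(\<lambda>x. f x - k x) \<in> m" if "f \<in> m" "k \<in> m" for f k
    using m_add[OF that(1) m_mult[OF Ac[of "-1"] that(2)]] by simp
  have m_const: "c = 0" if "(\<lambda>x. c) \<in> m" for c
  proof (rule ccontr)
    assume "c \<noteq> 0"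
    then show False using m_mult[OF Ac[of "1/c"] that] m(3) by simp
  qed
  have unit: "\<exists>y\<in>A. (\<lambda>x. 1 - f x * y x) \<in> m" if f: "f \<in> A" "f \<notin> m" for f
  proof -
    define J where "J = {(\<lambda>x. a x + f x * y x) | a y. a \<in> m \<and> y \<in> A}"
    have J: "fun_ideal A J" unfolding fun_ideal_def
    proof (intro conjI ballI)
      show "J \<subseteq> A"
      proof
        fix g assume "g \<in> J"
        then obtain a y where 1: "a \<in> m" "y \<in> A" "g = (\<lambda>x. a x + f x * y x)" unfolding J_def by blast
        show "g \<in> A" unfolding 1(3) by (intro Aadd Amult mA f(1) 1)
      qed
      show "(\<lambda>x. 0) \<in> J" unfolding J_def
        by (intro CollectI exI[of _ "\<lambda>x. 0"] conjI m0 Ac) simp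
      fix g k assume g: "g \<in> J" and k: "k \<in> J"
      obtain a y where 1: "a \<in> m" "y \<in> A" "g = (\<lambda>x. a x + f x * y x)" using g unfolding J_def by blast
      obtain b z where 2: "b \<in> m" "z \<in> A" "k = (\<lambda>x. b x + f x * z x)" using k unfolding J_def by blast
      show "(\<lambda>x. g x + k x) \<in> J" unfolding J_def
        by (intro CollectI exI[of _ "\<lambda>x. a x + b x"] exI[of _ "\<lambda>x. y x + z x"] conjI m_add Aadd 1 2)
           (simp add: 1 2 algebra_simps)
    next
      fix g k assume g: "g \<in> A" and k: "k \<in> J"
      obtain b z where 2: "b \<in> m" "z \<in> A" "k = (\<lambda>x. b x + f x * z x)" using k unfolding J_def by blast
      show "(\<lambda>x. g x * k x) \<in> J" unfolding J_def
        by (intro CollectI exI[of _ "\<lambda>x. g x * b x"] exI[of _ "\<lambda>x. g x * z x"] conjI m_mult Amult g 2)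
           (simp add: 2 algebra_simps)
    qed
    have "m \<subseteq> J"
    proof
      fix a assume a: "a \<in> m"
      show "a \<in> J" unfolding J_def
        by (intro CollectI exI[of _ a] exI[of _ "\<lambda>x. 0"] conjI a Ac) simp
    qed
    moreover have "f \<in> J" unfolding J_def
      by (intro CollectI exI[of _ "\<lambda>x. 0"] exI[of _ "\<lambda>x. 1"] conjI m0 Ac) simp
    ultimately have "(\<lambda>x. 1) \<in> J" using m(4)[OF J] f(2) by blast
    then obtain a y where ay: "a \<in> m" "y \<in> A" "(\<lambda>x. 1) = (\<lambda>x. a x + f x * y x)" unfolding J_def by blast
    have "1 - f x * y x = a x" for x using fun_cong[OF ay(3), of x] by (metis add_diff_cancel_right')
    then show ?thesis using ay(1,2) by (intro bexI[of _ y]) simp_all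
  qed
  have prime: "k \<in> m" if fk: "f \<in> A" "k \<in> A" "(\<lambda>x. f x * k x) \<in> m" "f \<notin> m" for f k
  proof -
    obtain y where y: "y \<in> A" "(\<lambda>x. 1 - f x * y x) \<in> m" using unit[OF fk(1,4)] by blast
    have "(\<lambda>x. k x * (1 - f x * y x) + y x * (f x * k x)) \<in> m" by (intro m_add m_mult fk(2,3) y)
    then show ?thesis by (simp add: algebra_simps)
  qed
  have polyA: "(\<lambda>x. poly q (f x)) \<in> A" if "f \<in> A" for q f
    by (induction q) (simp_all add: Ac Aadd Amult that)
  \<comment> \<open>Over the complex numbers the polynomial splits into linear factors, and as
    \<open>m\<close> is prime one of the factors evaluated at \<open>f\<close> lies in
    \<open>m\<close>.\<close>
  have poly_root: "\<exists>c. (\<lambda>x. f x - c) \<in> m" if "f \<in> A" "q \<noteq> 0" "(\<lambda>x. poly q (f x)) \<in> m" for f q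
    using that(2,3)
  proof (induction "degree q" arbitrary: q rule: less_induct)
    case (less q)
    show ?case
    proof (cases "constant (poly q)")
      case True
      then have "poly q (f x) = poly q 0" for x by (simp add: constant_def)
      then have "poly q 0 = 0" using less.prems(2) m_const by simp
      then have "poly q x = poly 0 x" for x using True unfolding constant_def by (metis poly_0)
      then have "poly q = poly 0" by (rule ext)
      then show ?thesis using less.prems(1) poly_eq_poly_eq_iff by blast
    next
      case False
      then obtain z where "poly q z = 0" using fundamental_theorem_of_algebra by blast
      then obtain q' where q': "q = [:- z, 1:] * q'" unfolding poly_eq_0_iff_dvd by (elim dvdE)
      have q'0: "q' \<noteq> 0" using less.prems(1) q' by auto
      have deg: "degree q' < degree q"
        unfolding q' using q'0 by (subst degree_mult_eq) auto
      have "poly q (f x) = (f x - z) * poly q' (f x)" for x by (simp add: q' algebra_simps)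
      then have pr: "(\<lambda>x. (f x - z) * poly q' (f x)) \<in> m" using less.prems(2) by (simp only:)
      show ?thesis
      proof (cases "(\<lambda>x. f x - z) \<in> m")
        case False
        have "(\<lambda>x. poly q' (f x)) \<in> m"
          by (rule prime[OF _ _ pr False]) (intro Adiff Ac polyA that(1))+
        then show ?thesis using less.hyps[OF deg q'0] by blast
      qed blast
    qed
  qed
  \<comment> \<open>\<open>A\<close> has countable dimension, but if no \<open>f - c\<close> lay in \<open>m\<close>, then the inverses of the \<open>f - c\<close>
    modulo \<open>m\<close> would be uncountably many independent elements.\<close>
  have ev: "\<exists>c. (\<lambda>x. f x - c) \<in> m" if f: "f \<in> A" for f
  proof (rule ccontr)
    assume neg: "\<not> ?thesis"
    have "\<forall>t::real. \<exists>y\<in>A. (\<lambda>x. 1 - (f x - complex_of_real t) * y x) \<in> m"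
      using neg unit Adiff[OF f Ac] by blast
    then obtain y where y: "\<And>t::real. y t \<in> A" "\<And>t. (\<lambda>x. 1 - (f x - complex_of_real t) * y t x) \<in> m" by metis
    obtain n where n: "infinite {t. y t \<in> fv.span (S n)}"
      using real_pigeonhole[of "\<lambda>n t. y t \<in> fv.span (S n)"] span[OF y(1)] by blast
    obtain T where T: "finite T" "card T = Suc (card (S n))" "T \<subseteq> {t. y t \<in> fv.span (S n)}"
      using infinite_arbitrarily_large[OF n] by blast
    have inj: "inj_on y T"
    proof (rule inj_onI)
      fix s t assume st: "s \<in> T" "t \<in> T" "y s = y t"
      have "(\<lambda>x. (1 - (f x - complex_of_real s) * y s x) - (1 - (f x - complex_of_real t) * y t x)) \<in> m"
        by (rule m_diff[OF y(2) y(2)])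
      moreover have "(1 - (f x - complex_of_real s) * y s x) - (1 - (f x - complex_of_real t) * y t x) =
          complex_of_real (s - t) * y t x" for x by (simp add: st(3) algebra_simps)
      ultimately have st_m: "(\<lambda>x. complex_of_real (s - t) * y t x) \<in> m" by (simp only:)
      show "s = t"
      proof (rule ccontr)
        assume "s \<noteq> t"
        then have nz: "complex_of_real (s - t) \<noteq> 0" by simp
        have "(\<lambda>x. (1 / complex_of_real (s - t)) * (complex_of_real (s - t) * y t x)) \<in> m" by (rule m_mult[OF Ac st_m])
        then have "y t \<in> m" using nz by (simp only: mult.assoc[symmetric] nonzero_divide_eq_eq times_divide_eq_left) simp
        then have "(\<lambda>x. (1 - (f x - complex_of_real t) * y t x) + (f x - complex_of_real t) * y t x) \<in> m"
          by (intro m_add y(2) m_mult Adiff f Ac)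
        then show False using m(3) by simp
      qed
    qed
    have "fv.dependent (y ` T)"
    proof (rule ccontr)
      assume "fv.independent (y ` T)"
      then have "card (y ` T) \<le> card (S n)" using fv.independent_span_bound[OF fin] T(3) by blast
      then show False using T(2) card_image[OF inj] by simp
    qed
    then obtain l where l: "\<exists>w\<in>y ` T. l w \<noteq> 0" "(\<Sum>w\<in>y ` T. fun_scale (l w) w) = 0"
      unfolding fv.dependent_finite[OF finite_imageI[OF T(1)]] by blast
    define c where "c = (\<lambda>t. l (y t))"
    obtain t0 where t0: "t0 \<in> T" "c t0 \<noteq> 0" using l(1) by (auto simp: c_def)
    have sum0: "(\<Sum>t\<in>T. c t * y t x) = 0" for x
    proof -
      have "(\<Sum>w\<in>W. fun_scale (l w) w) x = (\<Sum>w\<in>W. l w * w x)" for W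
        by (induction W rule: infinite_finite_induct) (simp_all add: fun_scale_def)
      note this[of "y ` T"]
      also have "(\<Sum>w\<in>y ` T. l w * w x) = (\<Sum>t\<in>T. c t * y t x)"
        by (simp add: sum.reindex[OF inj] c_def)
      finally have "(\<Sum>w\<in>y ` T. fun_scale (l w) w) x = (\<Sum>t\<in>T. c t * y t x)" .
      then show ?thesis using l(2) by simp
    qed
    define h where "h = (\<lambda>t x. \<Prod>t'\<in>T - {t}. f x - complex_of_real t')"
    \<comment> \<open>A linear relation between the inverses of \<open>f - t\<close> is multiplied
      by the common denominator. The resulting polynomial annihilates \<open>f\<close> modulo
      \<open>m\<close>, and it is nonzero because at \<open>t0\<close> only the term with the
      nonzero coefficient \<open>c t0\<close> survives.\<close>
    define q where "q = (\<Sum>t\<in>T. Polynomial.smult (c t) (\<Prod>t'\<in>T - {t}. [:- complex_of_real t', 1:]))"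
    have pq: "poly q z = (\<Sum>t\<in>T. c t * (\<Prod>t'\<in>T - {t}. z - complex_of_real t'))" for z
      by (simp add: q_def poly_sum poly_prod)
    have hA: "h t \<in> A" for t
    proof -
      have "(\<lambda>x. \<Prod>t'\<in>T'. f x - complex_of_real t') \<in> A" for T'
      proof (induction T' rule: infinite_finite_induct)
        case (insert t T')
        have "(\<lambda>x. (f x - complex_of_real t) * (\<Prod>t'\<in>T'. f x - complex_of_real t')) \<in> A"
          by (intro Amult Adiff Ac f insert.IH)
        then show ?case using insert.hyps by simp
      qed (simp_all add: Ac)
      then show ?thesis by (simp add: h_def)
    qed
    have m_sum: "(\<lambda>x. \<Sum>t\<in>T'. k t x) \<in> m" if "\<And>t. t \<in> T' \<Longrightarrow> k t \<in> m" for T' and k :: "real \<Rightarrow> 'a \<Rightarrow> complex"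
      using that by (induction T' rule: infinite_finite_induct) (simp_all add: m0 m_add)
    have "(\<lambda>x. \<Sum>t\<in>T. (c t * h t x) * (1 - (f x - complex_of_real t) * y t x)) \<in> m"
      by (intro m_sum m_mult y(2) fun_algebra_cmult[OF A] hA)
    moreover have "(\<Sum>t\<in>T. (c t * h t x) * (1 - (f x - complex_of_real t) * y t x)) = poly q (f x)" for x
    proof -
      define P where "P = (\<Prod>t'\<in>T. f x - complex_of_real t')"
      have hP: "h t x * (f x - complex_of_real t) = P" if "t \<in> T" for t
        unfolding h_def P_def using prod.remove[OF T(1) that, of "\<lambda>t'. f x - complex_of_real t'"] by (simp add: mult.commute)
      have "(\<Sum>t\<in>T. (c t * h t x) * (1 - (f x - complex_of_real t) * y t x)) =
          (\<Sum>t\<in>T. c t * h t x) - (\<Sum>t\<in>T. (h t x * (f x - complex_of_real t)) * (c t * y t x))"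
        unfolding sum_subtractf[symmetric] by (rule sum.cong) (auto simp: algebra_simps)
      also have "(\<Sum>t\<in>T. (h t x * (f x - complex_of_real t)) * (c t * y t x)) = (\<Sum>t\<in>T. P * (c t * y t x))"
        by (intro sum.cong refl) (simp add: hP)
      also have "\<dots> = 0" unfolding sum_distrib_left[symmetric] sum0 by simp
      finally show ?thesis by (simp add: pq h_def)
    qed
    ultimately have "(\<lambda>x. poly q (f x)) \<in> m" by (simp only:)
    moreover have "q \<noteq> 0"
    proof
      assume "q = 0"
      have "poly q (complex_of_real t0) = c t0 * (\<Prod>t'\<in>T - {t0}. complex_of_real t0 - complex_of_real t')"
      proof -
        have "(\<Prod>t'\<in>T - {t}. complex_of_real t0 - complex_of_real t') = 0" if "t \<noteq> t0" for t
          by (rule prod_zero) (use T(1) t0(1) that in auto)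
        then have "poly q (complex_of_real t0) = (\<Sum>t\<in>T. if t = t0 then c t * (\<Prod>t'\<in>T - {t}. complex_of_real t0 - complex_of_real t') else 0)"
          unfolding pq by (intro sum.cong) auto
        then show ?thesis using T(1) t0(1) by simp
      qed
      moreover have "(\<Prod>t'\<in>T - {t0}. complex_of_real t0 - complex_of_real t') \<noteq> 0" using T(1) by simp
      ultimately show False using t0(2) \<open>q = 0\<close> by simp
    qed
    ultimately show False using neg poly_root[OF f] by blast
  qed
  define ch where "ch = (\<lambda>f. SOME c. (\<lambda>x. f x - c) \<in> m)"
  have ch: "(\<lambda>x. f x - ch f) \<in> m" if "f \<in> A" for f
    unfolding ch_def using someI_ex[OF ev[OF that]] .
  have ch_eq: "ch f = c" if "f \<in> A" "(\<lambda>x. f x - c) \<in> m" for f c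
  proof -
    have "(\<lambda>x. (f x - c) - (f x - ch f)) \<in> m" by (rule m_diff[OF that(2) ch[OF that(1)]])
    then have "(\<lambda>x. ch f - c) \<in> m" by simp
    then show ?thesis using m_const by fastforce
  qed
  show thesis
  proof (rule that[of ch])
    fix f k assume fk: "f \<in> A" "k \<in> A"
    have "(\<lambda>x. (f x - ch f) + (k x - ch k)) \<in> m" by (intro m_add ch fk)
    then show "ch (\<lambda>x. f x + k x) = ch f + ch k" by (intro ch_eq Aadd fk) (simp add: algebra_simps)
    have "(\<lambda>x. f x * (k x - ch k) + ch k * (f x - ch f)) \<in> m" by (intro m_add m_mult ch fk Ac)
    then show "ch (\<lambda>x. f x * k x) = ch f * ch k" by (intro ch_eq Amult fk) (simp add: algebra_simps)
  next
    show "ch (\<lambda>x. c) = c" for c by (rule ch_eq[OF Ac]) (simp add: m0)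
    show "ch f = 0" if "f \<in> I" for f using that m(1) mA by (intro ch_eq) auto
  qed
qed

primrec words :: "('x \<Rightarrow> complex) set \<Rightarrow> nat \<Rightarrow> ('x \<Rightarrow> complex) set" where
  "words L 0 = {\<lambda>x. 1}"
| "words L (Suc n) = words L n \<union> (\<Union>l\<in>L. (\<lambda>f x. l x * f x) ` words L n)"

lemma finite_words: "finite L \<Longrightarrow> finite (words L n)"
  by (induction n) auto

lemma words_mono: "n \<le> k \<Longrightarrow> words L n \<subseteq> words L k"
  by (induction k) (auto simp: le_Suc_eq)

lemma words_mult: "f \<in> words L n \<Longrightarrow> k \<in> words L j \<Longrightarrow> (\<lambda>x. f x * k x) \<in> words L (n + j)"
proof (induction n arbitrary: f)
  case (Suc n)
  show ?case
  proof (cases "f \<in> words L n")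
    case True
    then show ?thesis using Suc.IH[OF True Suc.prems(2)] by simp
  next
    case False
    then obtain l f' where l: "l \<in> L" "f' \<in> words L n" "f = (\<lambda>x. l x * f' x)" using Suc.prems(1) by auto
    have "(\<lambda>x. f' x * k x) \<in> words L (n + j)" by (rule Suc.IH[OF l(2) Suc.prems(2)])
    then have "(\<lambda>x. l x * (f' x * k x)) \<in> (\<lambda>f x. l x * f x) ` words L (n + j)" by (rule imageI)
    moreover have "(\<lambda>x. f x * k x) = (\<lambda>x. l x * (f' x * k x))" by (simp add: l(3) mult.assoc)
    ultimately show ?thesis using l(1) by auto
  qed
qed simp

lemma words_span_mult:
  assumes f: "f \<in> fv.span (words L n)" and k: "k \<in> fv.span (words L j)"
  shows "(\<lambda>x. f x * k x) \<in> fv.span (words L (n + j))"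
proof -
  have 1: "(\<lambda>x. f x * k x) \<in> fv.span (words L (n + j))" if f: "f \<in> words L n" for f
    using k
  proof (induction rule: fv.span_induct_alt)
    case base
    then show ?case using fv.span_zero by (simp add: zero_fun_def)
  next
    case (step c k1 k2)
    have eq: "(\<lambda>x. f x * (fun_scale c k1 + k2) x) = fun_scale c (\<lambda>x. f x * k1 x) + (\<lambda>x. f x * k2 x)"
      by (simp add: fun_eq_iff fun_scale_def algebra_simps)
    show ?case unfolding eq
      by (rule fv.span_add[OF fv.span_scale[OF fv.span_base[OF words_mult[OF f step(1)]]] step(2)])
  qed
  show ?thesis using f
  proof (induction rule: fv.span_induct_alt)
    case base
    then show ?case using fv.span_zero by (simp add: zero_fun_def)
  next
    case (step c f1 f2)
    have eq: "(\<lambda>x. (fun_scale c f1 + f2) x * k x) = fun_scale c (\<lambda>x. f1 x * k x) + (\<lambda>x. f2 x * k x)"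
      by (simp add: fun_eq_iff fun_scale_def algebra_simps)
    show ?case unfolding eq by (rule fv.span_add[OF fv.span_scale[OF 1[OF step(1)]] step(2)])
  qed
qed

section \<open>Regular functions on the general linear group\<close>

text \<open>Outside \<open>GL\<close> the value of \<open>rep\<close> is the identity, so that it is always complex linear.\<close>

definition rep :: "bool \<Rightarrow> ('v::fd_complex_space \<Rightarrow>\<^sub>L 'v) \<Rightarrow> ('v \<Rightarrow>\<^sub>L 'v)" where
  "rep s b = (if b \<in> carrier GL then if s then b else inv\<^bsub>GL\<^esub> b else id_blinfun)"

lemma GL_compose: "a \<in> carrier GL \<Longrightarrow> b \<in> carrier GL \<Longrightarrow> a o\<^sub>L b \<in> carrier GL"
  using monoid.m_closed[OF group.is_monoid[OF group_GL]] by (simp add: GL_mult)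

lemma GL_inv: "a \<in> carrier GL \<Longrightarrow> inv\<^bsub>GL\<^esub> a \<in> carrier GL"
  using group.inv_closed[OF group_GL] by blast

lemma GL_inv_inv: "a \<in> carrier GL \<Longrightarrow> inv\<^bsub>GL\<^esub> (inv\<^bsub>GL\<^esub> a) = a"
  using group.inv_inv[OF group_GL] by blast

lemma GL_inv_compose:
  "a \<in> carrier GL \<Longrightarrow> b \<in> carrier GL \<Longrightarrow> inv\<^bsub>GL\<^esub> (a o\<^sub>L b) = inv\<^bsub>GL\<^esub> b o\<^sub>L inv\<^bsub>GL\<^esub> a"
  using group.inv_mult_group[OF group_GL, of a b] by (simp add: GL_mult)

lemma GL_cendo: "a \<in> carrier GL \<Longrightarrow> cendo (blinfun_apply a)"
  by (simp add: GL_carrier)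

lemma id_GL: "id_blinfun \<in> carrier GL"
  using monoid.one_closed[OF group.is_monoid[OF group_GL]] by (simp add: GL_one)

lemma rep_True: "b \<in> carrier GL \<Longrightarrow> rep True b = b" and rep_False: "b \<in> carrier GL \<Longrightarrow> rep False b = inv\<^bsub>GL\<^esub> b"
  by (simp_all add: rep_def)

lemma cendo_rep: "cendo (blinfun_apply (rep s b))"
  unfolding rep_def by (simp add: GL_cendo GL_inv id_GL del: id_blinfun.rep_eq)

lemma rep_cancel: "blinfun_apply (rep s b) (blinfun_apply (rep (\<not> s) b) x) = x"
  by (simp add: rep_def GL_inv_apply)

text \<open>The coordinate ring of the general linear group. The coefficients of the inverse
  operator (\<open>s\<close> false) take the place of the reciprocal of the determinant and keep
  inversion symmetric with the identity map.\<close>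

inductive_set regular :: "(('v::fd_complex_space \<Rightarrow>\<^sub>L 'v) \<Rightarrow> complex) set" where
  const: "(\<lambda>b. c) \<in> regular"
| coef: "clin l \<Longrightarrow> (\<lambda>b. l (blinfun_apply (rep s b) x)) \<in> regular"
| add: "F \<in> regular \<Longrightarrow> F' \<in> regular \<Longrightarrow> (\<lambda>b. F b + F' b) \<in> regular"
| mult: "F \<in> regular \<Longrightarrow> F' \<in> regular \<Longrightarrow> (\<lambda>b. F b * F' b) \<in> regular"

lemma fun_algebra_regular: "fun_algebra regular"
  by (simp add: fun_algebra_def regular.intros)

text \<open>A substitution preserves regularity as soon as it does so for matrix coefficients. The
  additive and multiplicative map \<open>\<sigma>\<close> is there to cover substitutions, such as
  the adjoint, that are regular only up to conjugation.\<close>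

lemma regular_transform:
  assumes F: "F \<in> regular"
    and \<sigma>: "\<And>x y. \<sigma> (x + y) = \<sigma> x + \<sigma> y" "\<And>x y. \<sigma> (x * y) = \<sigma> x * \<sigma> y"
    and T: "\<And>l s x. clin l \<Longrightarrow> \<exists>F'\<in>regular. \<forall>b\<in>carrier GL. F' b = \<sigma> (l (blinfun_apply (rep s (T b)) x))"
  shows "\<exists>F'\<in>regular. \<forall>b\<in>carrier GL. F' b = \<sigma> (F (T b))"
  using F
proof induction
  case (const c)
  show ?case by (intro bexI[of _ "\<lambda>b. \<sigma> c"] regular.const) simp
next
  case (coef l s x)
  then show ?case by (rule T)
next
  case (add F1 F2)
  obtain F1' where 1: "F1' \<in> regular" "\<forall>b\<in>carrier GL. F1' b = \<sigma> (F1 (T b))" using add.IH(1) by (elim bexE)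
  obtain F2' where 2: "F2' \<in> regular" "\<forall>b\<in>carrier GL. F2' b = \<sigma> (F2 (T b))" using add.IH(2) by (elim bexE)
  show ?case by (intro bexI[of _ "\<lambda>b. F1' b + F2' b"] regular.add 1(1) 2(1)) (simp add: 1(2) 2(2) \<sigma>)
next
  case (mult F1 F2)
  obtain F1' where 1: "F1' \<in> regular" "\<forall>b\<in>carrier GL. F1' b = \<sigma> (F1 (T b))" using mult.IH(1) by (elim bexE)
  obtain F2' where 2: "F2' \<in> regular" "\<forall>b\<in>carrier GL. F2' b = \<sigma> (F2 (T b))" using mult.IH(2) by (elim bexE)
  show ?case by (intro bexI[of _ "\<lambda>b. F1' b * F2' b"] regular.mult 1(1) 2(1)) (simp add: 1(2) 2(2) \<sigma>)
qed

lemma regular_left: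
  assumes "F \<in> regular" and a: "a \<in> carrier GL"
  shows "\<exists>F'\<in>regular. \<forall>b\<in>carrier GL. F' b = F (a o\<^sub>L b)"
proof (rule regular_transform[OF assms(1), of "\<lambda>z. z"])
  fix l :: "'a \<Rightarrow> complex" and s x assume l: "clin l"
  show "\<exists>F'\<in>regular. \<forall>b\<in>carrier GL. F' b = l (blinfun_apply (rep s (a o\<^sub>L b)) x)"
  proof (cases s)
    case True
    show ?thesis
      by (rule bexI[OF _ regular.coef[OF clin_comp[OF l GL_cendo[OF a]], of True x]]) (simp add: True rep_True GL_compose a)
  next
    case False
    show ?thesis
      by (rule bexI[OF _ regular.coef[OF l, of False "blinfun_apply (inv\<^bsub>GL\<^esub> a) x"]]) (simp add: False rep_False GL_compose a GL_inv_compose)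
  qed
qed simp_all

lemma regular_right:
  assumes "F \<in> regular" and a: "a \<in> carrier GL"
  shows "\<exists>F'\<in>regular. \<forall>b\<in>carrier GL. F' b = F (b o\<^sub>L a)"
proof (rule regular_transform[OF assms(1), of "\<lambda>z. z"])
  fix l :: "'a \<Rightarrow> complex" and s x assume l: "clin l"
  show "\<exists>F'\<in>regular. \<forall>b\<in>carrier GL. F' b = l (blinfun_apply (rep s (b o\<^sub>L a)) x)"
  proof (cases s)
    case True
    show ?thesis
      by (rule bexI[OF _ regular.coef[OF l, of True "blinfun_apply a x"]]) (simp add: True rep_True GL_compose a)
  next
    case False
    show ?thesis
      by (rule bexI[OF _ regular.coef[OF clin_comp[OF l GL_cendo[OF GL_inv[OF a]]], of False x]])
        (simp add: False rep_False GL_compose a GL_inv_compose)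
  qed
qed simp_all

lemma regular_inv:
  assumes "F \<in> regular"
  shows "\<exists>F'\<in>regular. \<forall>b\<in>carrier GL. F' b = F (inv\<^bsub>GL\<^esub> b)"
proof (rule regular_transform[OF assms(1), of "\<lambda>z. z"])
  fix l :: "'a \<Rightarrow> complex" and s x assume l: "clin l"
  show "\<exists>F'\<in>regular. \<forall>b\<in>carrier GL. F' b = l (blinfun_apply (rep s (inv\<^bsub>GL\<^esub> b)) x)"
    by (rule bexI[OF _ regular.coef[OF l, of "\<not> s" x]]) (simp add: rep_def GL_inv GL_inv_inv)
qed simp_all

context lin_group begin

lemma regular_continuous: "F \<in> regular \<Longrightarrow> continuous_on G F"
proof (induction rule: regular.induct)
  case (coef l s x)
  have "continuous_on G (\<lambda>b. blinfun_apply (if s then b else inv\<^bsub>GL\<^esub> b) x)"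
    by (cases s) (auto intro!: continuous_intros continuous_inv)
  then have "continuous_on G (\<lambda>b. l (blinfun_apply (if s then b else inv\<^bsub>GL\<^esub> b) x))" by (rule clin_continuous_on[OF coef])
  then show ?case by (rule continuous_on_eq) (simp add: rep_def in_GL)
qed (auto intro!: continuous_intros)

lemma regular_sepfun:
  fixes F :: "('v \<Rightarrow>\<^sub>L 'v) \<Rightarrow> complex"
  assumes "F \<in> regular"
  shows "\<exists>S\<in>sepfun G regular. \<forall>g\<in>G. \<forall>b\<in>carrier GL. F (g o\<^sub>L b) = S g b"
  using assms
proof induction
  case (const c)
  have "(\<lambda>g b. c * 1) \<in> sepfun G regular" by (intro sepfun.prod continuous_intros regular.const)
  from this show ?case by (rule bexI[rotated]) simp
next
  case (coef l s x)
  obtain B :: "'v set" and r where B: "finite B" "\<And>b. clin (r b)" "\<And>x. (\<Sum>b\<in>B. r b x *\<^sub>C b) = x"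
    "\<And>c. (\<Sum>b\<in>B. c b *\<^sub>C b) = 0 \<Longrightarrow> \<forall>b\<in>B. c b = 0" by (rule coordinates_exist) (rule that; assumption)
  have ex: "l (blinfun_apply f y) = (\<Sum>b\<in>B. r b y * l (blinfun_apply f b))" if f: "cendo (blinfun_apply f)" for f y
  proof -
    have "l (blinfun_apply f y) = l (blinfun_apply f (\<Sum>b\<in>B. r b y *\<^sub>C b))" by (simp add: B(3))
    then show ?thesis by (simp only: cendo_sum[OF f] cendo_scale[OF f] clin_sum[OF coef] clin_scale[OF coef])
  qed
  show ?case
  proof (cases s)
    case True
    have "(\<lambda>g b. \<Sum>e\<in>B. l (blinfun_apply g e) * r e (blinfun_apply (rep True b) x)) \<in> sepfun G regular"
      by (intro sepfun_sum fun_algebra_regular regular.coef B(2) clin_continuous_on[OF coef] continuous_intros)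
    from this show ?thesis
    proof (rule bexI[rotated], intro ballI)
      fix g b :: "'v \<Rightarrow>\<^sub>L 'v" assume gb: "g \<in> G" "b \<in> carrier GL"
      show "l (blinfun_apply (rep s (g o\<^sub>L b)) x) = (\<Sum>e\<in>B. l (blinfun_apply g e) * r e (blinfun_apply (rep True b) x))"
        using ex[OF cendo_G[OF gb(1)], of "blinfun_apply b x"]
        by (simp add: True rep_True GL_compose in_GL gb mult.commute)
    qed
  next
    case False
    have "(\<lambda>g b. \<Sum>e\<in>B. r e (blinfun_apply (inv\<^bsub>GL\<^esub> g) x) * l (blinfun_apply (rep False b) e)) \<in> sepfun G regular"
      by (intro sepfun_sum fun_algebra_regular regular.coef coef clin_continuous_on[OF B(2)] continuous_intros continuous_inv)
    from this show ?thesis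
    proof (rule bexI[rotated], intro ballI)
      fix g b :: "'v \<Rightarrow>\<^sub>L 'v" assume gb: "g \<in> G" "b \<in> carrier GL"
      show "l (blinfun_apply (rep s (g o\<^sub>L b)) x) = (\<Sum>e\<in>B. r e (blinfun_apply (inv\<^bsub>GL\<^esub> g) x) * l (blinfun_apply (rep False b) e))"
        using ex[OF GL_cendo[OF GL_inv[OF gb(2)]], of "blinfun_apply (inv\<^bsub>GL\<^esub> g) x"]
        by (simp add: False rep_False GL_compose GL_inv_compose in_GL gb)
    qed
  qed
next
  case (add F1 F2)
  obtain S1 where 1: "S1 \<in> sepfun G regular" "\<forall>g\<in>G. \<forall>b\<in>carrier GL. F1 (g o\<^sub>L b) = S1 g b" using add.IH(1) by (elim bexE)
  obtain S2 where 2: "S2 \<in> sepfun G regular" "\<forall>g\<in>G. \<forall>b\<in>carrier GL. F2 (g o\<^sub>L b) = S2 g b" using add.IH(2) by (elim bexE)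
  show ?case by (intro bexI[of _ "\<lambda>g b. S1 g b + S2 g b"] sepfun.add 1(1) 2(1)) (simp add: 1(2) 2(2))
next
  case (mult F1 F2)
  obtain S1 where 1: "S1 \<in> sepfun G regular" "\<forall>g\<in>G. \<forall>b\<in>carrier GL. F1 (g o\<^sub>L b) = S1 g b" using mult.IH(1) by (elim bexE)
  obtain S2 where 2: "S2 \<in> sepfun G regular" "\<forall>g\<in>G. \<forall>b\<in>carrier GL. F2 (g o\<^sub>L b) = S2 g b" using mult.IH(2) by (elim bexE)
  show ?case by (intro bexI[of _ "\<lambda>g b. S1 g b * S2 g b"] sepfun_mult fun_algebra_regular 1(1) 2(1)) (simp add: 1(2) 2(2))
qed

section \<open>The Zariski closure of a compact linear group\<close>

definition Zc :: "('v \<Rightarrow>\<^sub>L 'v) set" where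
  "Zc = {a \<in> carrier GL. \<forall>F\<in>regular. (\<forall>g\<in>G. F g = 0) \<longrightarrow> F a = 0}"

lemma Zc_GL: "a \<in> Zc \<Longrightarrow> a \<in> carrier GL"
  and Zc_D: "a \<in> Zc \<Longrightarrow> F \<in> regular \<Longrightarrow> (\<And>g. g \<in> G \<Longrightarrow> F g = 0) \<Longrightarrow> F a = 0"
  by (simp_all add: Zc_def)

lemma Zc_I: "a \<in> carrier GL \<Longrightarrow> (\<And>F. F \<in> regular \<Longrightarrow> (\<And>g. g \<in> G \<Longrightarrow> F g = 0) \<Longrightarrow> F a = 0) \<Longrightarrow> a \<in> Zc"
  by (simp add: Zc_def)

lemma G_Zc: "g \<in> G \<Longrightarrow> g \<in> Zc"
  by (rule Zc_I) (simp_all add: in_GL)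

lemma Zc_transform:
  assumes a: "a \<in> Zc" and Ta: "T a \<in> carrier GL" and TG: "\<And>g. g \<in> G \<Longrightarrow> T g \<in> Zc"
    and reg: "\<And>F. F \<in> regular \<Longrightarrow> \<exists>F'\<in>regular. \<forall>b\<in>carrier GL. F' b = \<sigma> (F (T b))"
    and \<sigma>: "\<And>z. \<sigma> z = 0 \<longleftrightarrow> z = 0"
  shows "T a \<in> Zc"
proof (rule Zc_I[OF Ta])
  fix F assume F: "F \<in> regular" "\<And>g. g \<in> G \<Longrightarrow> F g = 0"
  obtain F' where F': "F' \<in> regular" "\<forall>b\<in>carrier GL. F' b = \<sigma> (F (T b))" using reg[OF F(1)] by (elim bexE)
  have "F' g = 0" if "g \<in> G" for g
    using F'(2) in_GL[OF that] Zc_D[OF TG[OF that] F] \<sigma> by simp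
  then have "F' a = 0" by (rule Zc_D[OF a F'(1)])
  then show "F (T a) = 0" using F'(2) Zc_GL[OF a] \<sigma> by simp
qed

text \<open>The usual two-step argument for closures of groups: right translation by an element of
  \<open>G\<close> maps the closure into itself, and then so does left translation by an element of
  the closure.\<close>

lemma Zc_compose:
  assumes "a \<in> Zc" "b \<in> Zc"
  shows "a o\<^sub>L b \<in> Zc"
proof -
  have 1: "a o\<^sub>L g \<in> Zc" if g: "g \<in> G" for g
    by (rule Zc_transform[of a "\<lambda>b. b o\<^sub>L g" "\<lambda>z. z"])
      (simp_all add: assms GL_compose Zc_GL in_GL g G_Zc compose_in regular_right)
  show ?thesis
    by (rule Zc_transform[of b "\<lambda>b. a o\<^sub>L b" "\<lambda>z. z"]) (simp_all add: assms GL_compose Zc_GL 1 regular_left)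
qed

end

context unitary_group begin

definition adj :: "('v \<Rightarrow>\<^sub>L 'v) \<Rightarrow> ('v \<Rightarrow>\<^sub>L 'v)" where
  "adj b = Blinfun (\<lambda>x. \<Sum>e\<in>E. h x (blinfun_apply b e) *\<^sub>C e)"

lemma cendo_adj_fun: "cendo (\<lambda>x. \<Sum>e\<in>E. h x (blinfun_apply b e) *\<^sub>C e)"
  by (rule cendoI) (simp_all add: h_add h_scale scaleC_add_left sum.distrib cv.scale_sum_right scaleC_scaleC)

lemma adj_apply: "blinfun_apply (adj b) x = (\<Sum>e\<in>E. h x (blinfun_apply b e) *\<^sub>C e)"
  unfolding adj_def by (simp add: bounded_linear_Blinfun_apply[OF cendo_bounded_linear[OF cendo_adj_fun]])

lemma cendo_adj: "cendo (blinfun_apply (adj b))"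
  unfolding adj_apply by (rule cendo_adj_fun)

lemma h_adj:
  assumes b: "cendo (blinfun_apply b)"
  shows "h (blinfun_apply (adj b) x) y = h x (blinfun_apply b y)"
proof -
  have "h (blinfun_apply (adj b) x) y = (\<Sum>e\<in>E. h x (blinfun_apply b e) * h e y)"
    by (simp add: adj_apply clin_sum[OF clin_h] h_scale)
  also have "\<dots> = (\<Sum>e\<in>E. cnj (h y e) * cnj (h (blinfun_apply b e) x))"
    by (subst mult.commute) (intro sum.cong refl arg_cong2[where f="(*)"] h_cnj)
  also have "\<dots> = cnj (\<Sum>e\<in>E. h y e * h (blinfun_apply b e) x)" by simp
  also have "(\<Sum>e\<in>E. h y e * h (blinfun_apply b e) x) = h (blinfun_apply b y) x"
    by (rule clin_expand[OF clin_comp[OF clin_h b], symmetric])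
  also have "cnj (h (blinfun_apply b y) x) = h x (blinfun_apply b y)" by (rule h_cnj[symmetric])
  finally show ?thesis .
qed

lemma h_eqI: "(\<And>y. h x y = h x' y) \<Longrightarrow> x = x'"
  using h_ext by blast

lemma adj_unitary:
  assumes b: "b \<in> carrier GL" and u: "\<And>x y. h (blinfun_apply b x) (blinfun_apply b y) = h x y"
  shows "adj b = inv\<^bsub>GL\<^esub> b"
proof -
  have "blinfun_apply (adj b) x = blinfun_apply (inv\<^bsub>GL\<^esub> b) x" for x
  proof (rule h_eqI)
    show "h (blinfun_apply (adj b) x) y = h (blinfun_apply (inv\<^bsub>GL\<^esub> b) x) y" for y
      using u[of "blinfun_apply (inv\<^bsub>GL\<^esub> b) x" y] by (simp add: h_adj GL_cendo b GL_inv_apply)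
  qed
  then show ?thesis by (simp add: blinfun_eq_iff)
qed

lemma adj_compose: "cendo (blinfun_apply a) \<Longrightarrow> cendo (blinfun_apply b) \<Longrightarrow> adj (a o\<^sub>L b) = adj b o\<^sub>L adj a"
  by (auto simp: blinfun_eq_iff h_adj blinfun_compose_fun cendo_comp intro!: h_eqI)

lemma adj_id: "adj id_blinfun = id_blinfun"
proof -
  have "inv\<^bsub>GL\<^esub> id_blinfun = (id_blinfun :: 'v \<Rightarrow>\<^sub>L 'v)" by (rule GL_inv_eqI[OF id_GL _ id_GL]) (simp add: blinfun_eq_iff)
  then show ?thesis using adj_unitary[OF id_GL] by simp
qed

lemma adj_GL:
  assumes b: "b \<in> carrier GL"
  shows "adj b \<in> carrier GL" "inv\<^bsub>GL\<^esub> (adj b) = adj (inv\<^bsub>GL\<^esub> b)"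
proof -
  have inv: "inv\<^bsub>GL\<^esub> b o\<^sub>L b = id_blinfun" "b o\<^sub>L inv\<^bsub>GL\<^esub> b = id_blinfun"
    by (simp_all add: blinfun_eq_iff GL_inv_apply b)
  have 1: "adj b o\<^sub>L adj (inv\<^bsub>GL\<^esub> b) = id_blinfun" "adj (inv\<^bsub>GL\<^esub> b) o\<^sub>L adj b = id_blinfun"
    using adj_compose[OF GL_cendo[OF GL_inv[OF b]] GL_cendo[OF b]] adj_compose[OF GL_cendo[OF b] GL_cendo[OF GL_inv[OF b]]]
    by (simp_all only: inv adj_id)
  show "adj b \<in> carrier GL" by (rule GL_I[OF cendo_adj 1])
  then show "inv\<^bsub>GL\<^esub> (adj b) = adj (inv\<^bsub>GL\<^esub> b)" by (rule GL_inv_eqI[OF _ 1(2)]) (rule GL_I[OF cendo_adj 1(2,1)])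
qed

lemma regular_adj:
  fixes F :: "('v \<Rightarrow>\<^sub>L 'v) \<Rightarrow> complex"
  assumes "F \<in> regular"
  shows "\<exists>F'\<in>regular. \<forall>b\<in>carrier GL. F' b = cnj (F (adj b))"
proof (rule regular_transform[OF assms(1), of cnj])
  fix l :: "'v \<Rightarrow> complex" and s x assume l: "clin l"
  define y where "y = (\<Sum>e\<in>E. cnj (l e) *\<^sub>C e)"
  have ly: "l z = h z y" for z
  proof -
    have "h z y = cnj (\<Sum>e\<in>E. cnj (l e) * h e z)"
      by (subst h_cnj) (simp only: y_def clin_sum[OF clin_h] h_scale)
    also have "\<dots> = (\<Sum>e\<in>E. cnj (h e z) * l e)" by (simp add: mult.commute)
    also have "\<dots> = (\<Sum>e\<in>E. h z e * l e)"
      by (intro sum.cong refl arg_cong2[where f="(*)"] h_cnj[symmetric])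
    finally show ?thesis using clin_expand[OF l, of z] by simp
  qed
  show "\<exists>F'\<in>regular. \<forall>b\<in>carrier GL. F' b = cnj (l (blinfun_apply (rep s (adj b)) x))"
  proof (rule bexI[OF _ regular.coef[OF clin_h, of s y x]], intro ballI)
    fix b :: "'v \<Rightarrow>\<^sub>L 'v" assume b: "b \<in> carrier GL"
    have r: "rep s (adj b) = adj (rep s b)" using b adj_GL[OF b] by (simp add: rep_def)
    show "h (blinfun_apply (rep s b) y) x = cnj (l (blinfun_apply (rep s (adj b)) x))"
      unfolding ly r h_adj[OF cendo_rep] by (rule h_cnj)
  qed
qed simp_all

lemma Zc_adj:
  assumes a: "a \<in> Zc"
  shows "adj a \<in> Zc"
proof (rule Zc_transform[OF a, of adj cnj])
  show "adj a \<in> carrier GL" by (rule adj_GL[OF Zc_GL[OF a]])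
  show "adj g \<in> Zc" if "g \<in> G" for g
    using adj_unitary[OF in_GL[OF that] h_inv[OF that]] inv_in[OF that] G_Zc by simp
qed (simp_all add: regular_adj)

text \<open>On unitary operators the adjoint is the inverse, so the conjugate of \<open>F\<close> is
  obtained by substituting the adjoint, which is regular up to conjugation, into \<open>F\<close>
  after inversion. This provides the self-adjointness for Stone-Weierstrass on compact sets of
  unitary operators.\<close>

lemma regular_cnj:
  fixes F :: "('v \<Rightarrow>\<^sub>L 'v) \<Rightarrow> complex"
  assumes "F \<in> regular"
  shows "\<exists>F'\<in>regular. \<forall>b\<in>carrier GL. (\<forall>x y. h (blinfun_apply b x) (blinfun_apply b y) = h x y) \<longrightarrow> F' b = cnj (F b)"
proof -
  obtain F1 where F1: "F1 \<in> regular" "\<forall>b\<in>carrier GL. F1 b = F (inv\<^bsub>GL\<^esub> b)" using regular_inv[OF assms] by (elim bexE)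
  obtain F2 where F2: "F2 \<in> regular" "\<forall>b\<in>carrier GL. F2 b = cnj (F1 (adj b))" using regular_adj[OF F1(1)] by (elim bexE)
  show ?thesis
    by (rule bexI[OF _ F2(1)]) (simp add: F1(2) F2(2) adj_GL adj_unitary GL_inv GL_inv_inv)
qed

text \<open>If \<open>u \<notin> G\<close>, then the Stone-Weierstrass theorem yields a regular function separating \<open>G\<close> from \<open>G u\<close>;
  averaging it over left translates gives one that is constant on \<open>G\<close> and takes another value at \<open>u\<close>.\<close>

lemma unitary_Zc_in_G:
  assumes u: "u \<in> Zc" and unit: "\<And>x y. h (blinfun_apply u x) (blinfun_apply u y) = h x y"
  shows "u \<in> G"
proof (rule ccontr)
  assume nG: "u \<notin> G"
  define Gu where "Gu = (\<lambda>g. g o\<^sub>L u) ` G"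
  define K where "K = G \<union> Gu"
  have uGL: "u \<in> carrier GL" by (rule Zc_GL[OF u])
  have cGu: "compact Gu" unfolding Gu_def by (intro compact_continuous_image continuous_intros compact_G)
  have K_GL: "b \<in> carrier GL" if "b \<in> K" for b
    using that uGL by (auto simp: K_def Gu_def in_GL GL_compose)
  have K_unit: "h (blinfun_apply b x) (blinfun_apply b y) = h x y" if "b \<in> K" for b x y
    using that by (auto simp: K_def Gu_def h_inv unit)
  have disj: "G \<inter> Gu = {}"
  proof -
    have "g o\<^sub>L u \<notin> G" if g: "g \<in> G" for g
    proof
      assume "g o\<^sub>L u \<in> G"
      then have "inv\<^bsub>GL\<^esub> g o\<^sub>L (g o\<^sub>L u) \<in> G" by (rule compose_in[OF inv_in[OF g]])
      moreover have "inv\<^bsub>GL\<^esub> g o\<^sub>L (g o\<^sub>L u) = u" by (simp add: blinfun_eq_iff inv_apply g)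
      ultimately show False using nG by (simp only:)
    qed
    then show ?thesis by (auto simp: Gu_def)
  qed
  have contK: "continuous_on K F" if F: "F \<in> regular" for F
    unfolding K_def
  proof (rule continuous_on_closed_Un)
    show "closed G" "closed Gu" using compact_G cGu by (auto intro: compact_imp_closed)
    show "continuous_on G F" by (rule regular_continuous[OF F])
    obtain F' where F': "F' \<in> regular" "\<forall>b\<in>carrier GL. F' b = F (b o\<^sub>L u)" using regular_right[OF F uGL] by (elim bexE)
    have gu: "(g o\<^sub>L u) o\<^sub>L inv\<^bsub>GL\<^esub> u = g" for g by (simp add: blinfun_eq_iff GL_inv_apply uGL)
    have "continuous_on Gu (\<lambda>b. F' (b o\<^sub>L inv\<^bsub>GL\<^esub> u))"
      by (rule continuous_on_compose2[OF regular_continuous[OF F'(1)]])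
        (auto simp: Gu_def gu intro!: continuous_intros)
    then show "continuous_on Gu F"
    proof (rule continuous_on_eq)
      show "F' (b o\<^sub>L inv\<^bsub>GL\<^esub> u) = F b" if "b \<in> Gu" for b
        using that F'(2) by (auto simp: Gu_def gu in_GL)
    qed
  qed
  define R where "R = {\<phi> :: ('v \<Rightarrow>\<^sub>L 'v) \<Rightarrow> real. \<exists>F\<in>regular. \<forall>b\<in>K. complex_of_real (\<phi> b) = F b}"
  have Re_R: "(\<lambda>b. Re (F b)) \<in> R" if F: "F \<in> regular" for F
  proof -
    obtain F' where F': "F' \<in> regular" "\<forall>b\<in>carrier GL. (\<forall>x y. h (blinfun_apply b x) (blinfun_apply b y) = h x y) \<longrightarrow> F' b = cnj (F b)"
      using regular_cnj[OF F] by (elim bexE)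
    have "complex_of_real (Re (F b)) = (1/2) * (F b + F' b)" if "b \<in> K" for b
      using F'(2) K_GL[OF that] K_unit[OF that] by (simp add: complex_eq_iff)
    moreover have "(\<lambda>b. (1/2) * (F b + F' b)) \<in> regular" by (intro regular.intros F F'(1))
    ultimately show ?thesis unfolding R_def by (intro CollectI bexI) auto
  qed
  have R_E: P if "\<phi> \<in> R" "\<And>F. F \<in> regular \<Longrightarrow> \<forall>b\<in>K. complex_of_real (\<phi> b) = F b \<Longrightarrow> P" for \<phi> P
    using that(1) unfolding R_def by (elim CollectE bexE) (rule that(2))
  have R_I: "\<phi> \<in> R" if "F \<in> regular" "\<forall>b\<in>K. complex_of_real (\<phi> b) = F b" for \<phi> F
    unfolding R_def using that by (intro CollectI bexI)
  interpret R: function_ring_on R K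
  proof
    show "compact K" unfolding K_def by (intro compact_Un compact_G cGu)
    fix \<phi> assume \<phi>: "\<phi> \<in> R"
    obtain F where F: "F \<in> regular" "\<forall>b\<in>K. complex_of_real (\<phi> b) = F b" by (rule R_E[OF \<phi>]) (rule that; assumption)
    have "continuous_on K (\<lambda>b. Re (F b))" by (intro continuous_on_Re contK F)
    then show "continuous_on K \<phi>" by (rule continuous_on_eq) (simp flip: F(2)[rule_format])
    fix \<psi> assume \<psi>: "\<psi> \<in> R"
    obtain F' where F': "F' \<in> regular" "\<forall>b\<in>K. complex_of_real (\<psi> b) = F' b" by (rule R_E[OF \<psi>]) (rule that; assumption)
    show "(\<lambda>x. \<phi> x + \<psi> x) \<in> R" by (rule R_I[OF regular.add[OF F(1) F'(1)]]) (simp add: F(2) F'(2))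
    show "(\<lambda>x. \<phi> x * \<psi> x) \<in> R" by (rule R_I[OF regular.mult[OF F(1) F'(1)]]) (simp add: F(2) F'(2))
  next
    show "(\<lambda>_. c) \<in> R" for c by (rule R_I[OF regular.const[of "complex_of_real c"]]) simp
    fix a b assume ab: "a \<in> K" "b \<in> K" "a \<noteq> b"
    then obtain x where x: "blinfun_apply a x \<noteq> blinfun_apply b x" by (auto simp: blinfun_eq_iff)
    then obtain y where y: "h (blinfun_apply a x) y \<noteq> h (blinfun_apply b x) y" using h_eqI by blast
    define F where "F = (\<lambda>b. h (blinfun_apply (rep True b) x) y)"
    have F: "F \<in> regular" unfolding F_def by (rule regular.coef[OF clin_h])
    have ne: "F a \<noteq> F b" using y K_GL ab by (simp add: F_def rep_True)
    show "\<exists>f\<in>R. f a \<noteq> f b"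
    proof (cases "Re (F a) = Re (F b)")
      case False
      then show ?thesis by (intro bexI[OF _ Re_R[OF F]])
    next
      case True
      then have "Im (F a) \<noteq> Im (F b)" using ne by (simp add: complex_eq_iff)
      then have "Re (- \<i> * F a) \<noteq> Re (- \<i> * F b)" by simp
      then show ?thesis by (intro bexI[OF _ Re_R[OF regular.mult[OF regular.const[of "- \<i>"] F]]])
    qed
  qed
  obtain \<phi> where \<phi>: "\<phi> \<in> R" "\<forall>x\<in>G. \<phi> x < 1/4" "\<forall>x\<in>Gu. \<phi> x > 1 - 1/4"
  proof -
    have "\<exists>\<phi>\<in>R. \<phi> ` K \<subseteq> {0..1} \<and> (\<forall>x\<in>G. \<phi> x < 1/4) \<and> (\<forall>x\<in>Gu. \<phi> x > 1 - 1/4)"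
      by (rule R.two) (use compact_imp_closed[OF compact_G] compact_imp_closed[OF cGu] disj in \<open>auto simp: K_def\<close>)
    then show thesis by (elim bexE conjE) (rule that)
  qed
  obtain F where F: "F \<in> regular" "\<forall>b\<in>K. complex_of_real (\<phi> b) = F b" by (rule R_E[OF \<phi>(1)]) (rule that; assumption)
  obtain S where S: "S \<in> sepfun G regular" "\<forall>g\<in>G. \<forall>b\<in>carrier GL. F (g o\<^sub>L b) = S g b"
    using regular_sepfun[OF F(1)] by (elim bexE)
  define A where "A = (\<lambda>b. cmean (\<lambda>g. S g b))"
  have A: "A \<in> regular" unfolding A_def by (rule sepfun_cmean[OF fun_algebra_regular S(1)])
  have A_eq: "A b = cmean (\<lambda>g. F (g o\<^sub>L b))" if "b \<in> carrier GL" for b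
    unfolding A_def by (rule cmean_cong[OF sepfun_continuous[OF S(1)]]) (use S(2) that in auto)
  have AG: "A g = cmean F" if "g \<in> G" for g
    using cmean_right[OF regular_continuous[OF F(1)] that] A_eq[OF in_GL[OF that]] by simp
  have "(\<lambda>b. A b + - cmean F) \<in> regular" by (intro regular.add A regular.const)
  then have "A u + - cmean F = 0" by (rule Zc_D[OF u]) (simp add: AG)
  then have Au: "A u = cmean F" by simp
  have contF: "continuous_on G (\<lambda>g. F (g o\<^sub>L u))"
    by (rule continuous_on_compose2[OF contK[OF F(1)]]) (auto intro!: continuous_intros simp: K_def Gu_def)
  have "3/4 \<le> mean (\<lambda>g. Re (F (g o\<^sub>L u)))"
  proof (rule mean_ge)
    show "continuous_on G (\<lambda>g. Re (F (g o\<^sub>L u)))" by (intro continuous_on_Re contF)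
    fix g assume g: "g \<in> G"
    then have gu: "g o\<^sub>L u \<in> Gu" by (simp add: Gu_def)
    then have "Re (F (g o\<^sub>L u)) = \<phi> (g o\<^sub>L u)" using F(2)[rule_format, of "g o\<^sub>L u", symmetric] by (simp add: K_def)
    then show "3/4 \<le> Re (F (g o\<^sub>L u))" using \<phi>(3) gu by fastforce
  qed
  moreover have "mean (\<lambda>g. Re (F g)) \<le> 1/4"
  proof (rule mean_le)
    show "continuous_on G (\<lambda>g. Re (F g))" by (intro continuous_on_Re regular_continuous F)
    fix g assume g: "g \<in> G"
    then have "Re (F g) = \<phi> g" using F(2)[rule_format, of g, symmetric] by (simp add: K_def)
    then show "Re (F g) \<le> 1/4" using \<phi>(2) g by fastforce
  qed
  moreover have "mean (\<lambda>g. Re (F (g o\<^sub>L u))) = mean (\<lambda>g. Re (F g))"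
    unfolding Re_cmean[symmetric] using Au A_eq[OF uGL] by simp
  ultimately show False by simp
qed

end

section \<open>Polar decomposition in the Zariski closure\<close>

lemma interpolation:
  assumes "finite X"
  shows "\<exists>q. \<forall>x\<in>X. poly q x = (f x :: complex)"
  using assms
proof induction
  case (insert a X)
  then obtain q where q: "\<forall>x\<in>X. poly q x = f x" by blast
  define r where "r = (\<Prod>x\<in>X. [:- x, 1:])"
  have r: "poly r z = (\<Prod>x\<in>X. z - x)" for z by (simp add: r_def poly_prod)
  have ra: "poly r a \<noteq> 0" and rX: "\<forall>x\<in>X. poly r x = 0" using insert.hyps by (auto simp: r)
  define q' where "q' = q + Polynomial.smult ((f a - poly q a) / poly r a) r"
  have "poly q' x = f x" if "x \<in> insert a X" for x
    using that ra rX q by (cases "x = a") (auto simp: q'_def)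
  then show ?case by blast
qed simp

section \<open>Exponential sums with real frequencies\<close>

definition expsum :: "(complex \<times> real) list \<Rightarrow> complex \<Rightarrow> complex" where
  "expsum xs s = (\<Sum>(c, r)\<leftarrow>xs. c * exp (s * complex_of_real r))"

lemma expsum_Nil [simp]: "expsum [] s = 0"
  and expsum_Cons [simp]: "expsum ((c, r) # xs) s = c * exp (s * complex_of_real r) + expsum xs s"
  and expsum_append [simp]: "expsum (xs @ ys) s = expsum xs s + expsum ys s"
  by (simp_all add: expsum_def)

lemma expsum_mult: "\<exists>zs. \<forall>s. expsum zs s = expsum xs s * expsum ys s"
proof (induction xs)
  case Nil
  show ?case by (intro exI[of _ "[]"]) simp
next
  case (Cons x xs)
  obtain c r where x: "x = (c, r)" by (cases x)
  obtain zs where zs: "\<forall>s. expsum zs s = expsum xs s * expsum ys s" using Cons.IH by blast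
  have "expsum (map (\<lambda>(c', r'). (c * c', r + r')) ys) s = c * exp (s * complex_of_real r) * expsum ys s" for s
    by (induction ys) (auto simp: algebra_simps exp_add)
  then show ?case
    by (intro exI[of _ "map (\<lambda>(c', r'). (c * c', r + r')) ys @ zs"]) (simp add: x zs distrib_right)
qed

lemma expsum_sum:
  assumes "finite I"
  shows "\<exists>xs. \<forall>s. expsum xs s = (\<Sum>i\<in>I. c i * exp (s * complex_of_real (r i)))"
  using assms
proof induction
  case empty
  show ?case by (intro exI[of _ "[]"]) simp
next
  case (insert i I)
  then obtain xs where "\<forall>s. expsum xs s = (\<Sum>i\<in>I. c i * exp (s * complex_of_real (r i)))" by blast
  then show ?case using insert.hyps by (intro exI[of _ "(c i, r i) # xs"]) simp
qed

text \<open>Vanishing at the natural numbers kills the sum with any polynomial in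
  \<open>exp r\<close> inserted. Taking a polynomial that interpolates \<open>exp (s * r)\<close> at
  the finitely many points \<open>exp r\<close> gives the value at \<open>s\<close>; frequencies may
  repeat in the list.\<close>

lemma expsum_zero:
  assumes 0: "\<And>n::nat. expsum xs (of_nat n) = 0"
  shows "expsum xs s = 0"
proof -
  define X where "X = (\<lambda>(c :: complex, r :: real). complex_of_real (exp r)) ` set xs"
  have "finite X" by (simp add: X_def)
  then obtain q where q: "\<forall>z\<in>X. poly q z = exp (s * complex_of_real (ln (Re z)))" 
    using interpolation[of X "\<lambda>z. exp (s * complex_of_real (ln (Re z)))"] by blast
  have e: "exp (of_nat n * complex_of_real r) = complex_of_real (exp r) ^ n" for n r
    by (simp only: exp_of_real exp_of_nat_mult)
  have mono: "(\<Sum>(c, r)\<leftarrow>xs. c * complex_of_real (exp r) ^ n * poly p (complex_of_real (exp r))) = 0" for n p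
  proof (induction p arbitrary: n)
    case (pCons a p)
    have "(\<Sum>(c, r)\<leftarrow>xs. c * complex_of_real (exp r) ^ n * poly (pCons a p) (complex_of_real (exp r))) =
      (\<Sum>(c, r)\<leftarrow>xs. c * complex_of_real (exp r) ^ n) * a +
      (\<Sum>(c, r)\<leftarrow>xs. c * complex_of_real (exp r) ^ Suc n * poly p (complex_of_real (exp r)))"
      by (induction xs) (auto simp: algebra_simps)
    also have "(\<Sum>(c, r)\<leftarrow>xs. c * complex_of_real (exp r) ^ n) = 0"
      using 0[of n] unfolding expsum_def e .
    finally show ?case using pCons.IH[of "Suc n"] by simp
  qed (simp add: case_prod_unfold)
  have "expsum xs s = (\<Sum>(c, r)\<leftarrow>xs. c * complex_of_real (exp r) ^ 0 * poly q (complex_of_real (exp r)))"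
    unfolding expsum_def
  proof (rule arg_cong[where f = sum_list], rule map_cong[OF refl], clarify)
    fix c r assume "(c, r) \<in> set xs"
    then have "complex_of_real (exp r) \<in> X" unfolding X_def by (rule image_eqI[rotated]) simp
    then have "poly q (complex_of_real (exp r)) = exp (s * complex_of_real r)" using q by (simp del: of_real_exp)
    then show "c * exp (s * complex_of_real r) = c * complex_of_real (exp r) ^ 0 * poly q (complex_of_real (exp r))" by simp
  qed
  then show ?thesis using mono[of 0 q] by simp
qed

lemma op_exp_eigenvector:
  assumes X: "cendo (blinfun_apply X)" and eig: "blinfun_apply X x = c *\<^sub>C x"
  shows "blinfun_apply (op_exp X) x = exp c *\<^sub>C x"
proof -
  obtain K where K: "K > 0" "\<And>c (x::'a). norm (c *\<^sub>C x) \<le> K * cmod c * norm x"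
    by (rule scaleC_norm_bound) (rule that; assumption)
  have "bounded_linear (\<lambda>c. c *\<^sub>C x)"
  proof (rule bounded_linear_intro)
    show "norm (c *\<^sub>C x) \<le> norm c * (K * norm x)" for c using K(2)[of c x] by (simp add: mult_ac)
    show "(r *\<^sub>R c) *\<^sub>C x = r *\<^sub>R (c *\<^sub>C x)" for r c
      by (simp only: scaleR_conv_of_real[of _ c] scaleC_scaleC[symmetric] scaleC_of_real)
  qed (rule scaleC_add_left)
  then have "(\<lambda>k. (c ^ k /\<^sub>R fact k) *\<^sub>C x) sums (exp c *\<^sub>C x)"
    by (rule bounded_linear.sums) (rule exp_converges)
  moreover have pow: "blinfun_apply (op_pow X k) x = c ^ k *\<^sub>C x" for k
    by (induction k) (simp_all add: op_pow_Suc cendo_scale[OF X] eig scaleC_scaleC mult.commute cv.scale_one)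
  have "(c ^ k /\<^sub>R fact k) *\<^sub>C x = blinfun_apply (op_pow X k) x /\<^sub>R fact k" for k
    unfolding pow scaleR_conv_of_real[of _ "c ^ k"] scaleC_scaleC[symmetric] scaleC_of_real ..
  ultimately show ?thesis using op_exp_apply_sums[of X x] by (simp add: sums_iff)
qed

context unitary_group begin

section \<open>Spectral theorem for self-adjoint operators\<close>

lemma compact_unit_sphere:
  "compact {x. sqn x = 1 \<and> (\<forall>b\<in>B. h x b = 0)}"
proof -
  obtain C where C: "C > 0" "\<And>x. norm x \<le> C * sqrt (sqn x)" using norm_le_sqn by blast
  have "norm x \<le> C" if "sqn x = 1" for x using C(2)[of x] that by simp
  then have "bounded {x. sqn x = 1 \<and> (\<forall>b\<in>B. h x b = 0)}" unfolding bounded_iff by blast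
  moreover have "closed ({x. sqn x = 1} \<inter> (\<Inter>b\<in>B. {x. h x b = 0}))"
    by (intro closed_Int closed_INT ballI closed_Collect_eq continuous_on_sqn continuous_on_const clin_continuous_on[OF clin_h] continuous_on_id)
  moreover have "{x. sqn x = 1} \<inter> (\<Inter>b\<in>B. {x. h x b = 0}) = {x. sqn x = 1 \<and> (\<forall>b\<in>B. h x b = 0)}" by auto
  ultimately show ?thesis by (simp add: compact_eq_bounded_closed)
qed

text \<open>The quadratic form of \<open>P\<close> attains its maximum \<open>m\<close> on the unit
  sphere of the orthogonal complement of \<open>B\<close>. Then \<open>D = m * sqn - q\<close> is a
  nonnegative form on that complement vanishing at \<open>x\<close>, and this forces
  \<open>P x = m x\<close>.\<close>

lemma eigenvector_exists:
  assumes P: "cendo (blinfun_apply P)" and sa: "\<And>x y. h (blinfun_apply P x) y = h x (blinfun_apply P y)"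
    and inv: "\<And>x. (\<forall>b\<in>B. h x b = 0) \<Longrightarrow> \<forall>b\<in>B. h (blinfun_apply P x) b = 0"
    and x0: "x0 \<noteq> 0" "\<forall>b\<in>B. h x0 b = 0"
  obtains x m where "sqn x = 1" "\<forall>b\<in>B. h x b = 0" "blinfun_apply P x = complex_of_real m *\<^sub>C x"
proof -
  define S where "S = {x. sqn x = 1 \<and> (\<forall>b\<in>B. h x b = 0)}"
  have normalize: "complex_of_real (1 / sqrt (sqn x)) *\<^sub>C x \<in> S" if "x \<noteq> 0" "\<forall>b\<in>B. h x b = 0" for x
  proof -
    have "sqn x > 0" using that(1) sqn_nonneg[of x] sqn_eq_0[of x] by fastforce
    then show ?thesis using that(2) by (simp add: S_def sqn_scale h_scale power_divide norm_divide)
  qed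
  define q where "q = (\<lambda>x. Re (h (blinfun_apply P x) x))"
  have "continuous_on S q" unfolding q_def by (intro continuous_on_Re continuous_on_h continuous_intros)
  then obtain x where x: "x \<in> S" "\<And>y. y \<in> S \<Longrightarrow> q y \<le> q x"
    using continuous_attains_sup[of S q] compact_unit_sphere[of B] normalize[OF x0] unfolding S_def by blast
  have sx: "sqn x = 1" "\<forall>b\<in>B. h x b = 0" using x(1) by (auto simp: S_def)
  define m where "m = q x"
  define D where "D = (\<lambda>y. m * sqn y - q y)"
  have D: "D y \<ge> 0" if y: "\<forall>b\<in>B. h y b = 0" for y
  proof (cases "y = 0")
    case False
    have pos: "sqn y > 0" using False sqn_nonneg[of y] sqn_eq_0[of y] by fastforce
    define c where "c = complex_of_real (1 / sqrt (sqn y))"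
    have "h (blinfun_apply P (c *\<^sub>C y)) (c *\<^sub>C y) = complex_of_real (1 / sqn y) * h (blinfun_apply P y) y"
    proof -
      have "cnj c * c = complex_of_real (1 / sqn y)"
        unfolding c_def complex_cnj_complex_of_real of_real_mult[symmetric] using pos by simp
      then show ?thesis by (simp add: cendo_scale[OF P] h_scale h_scale_right mult.assoc[symmetric])
    qed
    then have "q (c *\<^sub>C y) = q y / sqn y" by (simp add: q_def)
    moreover have "q (c *\<^sub>C y) \<le> m" unfolding m_def c_def by (rule x(2)[OF normalize[OF False y]])
    ultimately show ?thesis using pos by (simp add: D_def divide_le_eq)
  qed (simp add: D_def q_def)
  define w where "w = complex_of_real m *\<^sub>C x - blinfun_apply P x"
  have w: "\<forall>b\<in>B. h w b = 0" using sx(2) inv[OF sx(2)] by (simp add: w_def h_diff h_scale)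
  have Dt: "D (x + complex_of_real t *\<^sub>C w) = t * (2 * sqn w) + t\<^sup>2 * D w" for t
  proof -
    have a: "sqn (x + complex_of_real t *\<^sub>C w) = 1 + t\<^sup>2 * sqn w + 2 * t * Re (h x w)"
      by (simp add: sqn_add sqn_scale sx(1) h_scale_right)
    have swap: "Re (h (blinfun_apply P w) x) = Re (h (blinfun_apply P x) w)"
      unfolding sa[of w x] using h_cnj[of w "blinfun_apply P x"] by simp
    have "q (x + complex_of_real t *\<^sub>C w) = q x + t * Re (h (blinfun_apply P x) w) + t * Re (h (blinfun_apply P w) x) + t\<^sup>2 * q w"
      by (simp add: q_def blinfun.add_right cendo_scale[OF P] h_add h_add_right h_scale h_scale_right power2_eq_square algebra_simps)
    then have b: "q (x + complex_of_real t *\<^sub>C w) = m + 2 * t * Re (h (blinfun_apply P x) w) + t\<^sup>2 * q w"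
      by (simp add: swap m_def)
    have "sqn w = Re (h w w)" by (simp add: sqn_def)
    also have "h w w = h (complex_of_real m *\<^sub>C x - blinfun_apply P x) w" by (simp only: w_def)
    also have "\<dots> = complex_of_real m * h x w - h (blinfun_apply P x) w" by (simp only: h_diff h_scale)
    finally have c: "sqn w = m * Re (h x w) - Re (h (blinfun_apply P x) w)" by simp
    show ?thesis unfolding D_def a b c by (simp add: algebra_simps)
  qed
  have "sqn w = 0"
  proof -
    define s where "s = sqn w"
    have Dw: "D w \<ge> 0" by (rule D[OF w])
    \<comment> \<open>Moving from \<open>x\<close> in direction \<open>w\<close> by this
      \<open>t\<close> makes \<open>D\<close> equal to a negative multiple of the square of
      \<open>s\<close>, so nonnegativity of \<open>D\<close> forces \<open>s = 0\<close>.\<close>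
    define t where "t = - s / (D w + 1)"
    have "\<forall>b\<in>B. h (x + complex_of_real t *\<^sub>C w) b = 0" using w sx(2) by (simp add: h_add h_scale)
    then have "t * (2 * s) + t\<^sup>2 * D w \<ge> 0" using D[of "x + complex_of_real t *\<^sub>C w"] Dt[of t] by (simp add: s_def)
    moreover have "t * (2 * s) + t\<^sup>2 * D w = - (s\<^sup>2 * (D w + 2)) / (D w + 1)\<^sup>2"
    proof -
      have "t * (D w + 1) = - s" using Dw by (simp add: t_def)
      then have "(t * (2 * s) + t\<^sup>2 * D w) * (D w + 1)\<^sup>2 = - (s\<^sup>2 * (D w + 2))" by algebra
      moreover have "(D w + 1)\<^sup>2 \<noteq> 0" using Dw by simp
      ultimately show ?thesis by (intro eq_divide_imp)
    qed
    ultimately have "s\<^sup>2 * (D w + 2) \<le> 0" using Dw by (simp add: divide_le_0_iff zero_le_divide_iff)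
    then show ?thesis using Dw by (simp add: s_def mult_le_0_iff)
  qed
  then have "blinfun_apply P x = complex_of_real m *\<^sub>C x" using sqn_eq_0[of w] by (simp add: w_def)
  then show thesis by (rule that[OF sx])
qed

text \<open>An orthonormal set of eigenvectors of maximal size spans: otherwise its orthogonal
  complement, which \<open>P\<close> preserves, contains another eigenvector.\<close>

lemma eigenbasis_exists:
  assumes P: "cendo (blinfun_apply P)" and sa: "\<And>x y. h (blinfun_apply P x) y = h x (blinfun_apply P y)"
  obtains B \<mu> where "H.orthonormal B" "cv.span B = UNIV"
    "\<And>b. b \<in> B \<Longrightarrow> blinfun_apply P b = complex_of_real (\<mu> b) *\<^sub>C b"
proof -
  define Q where "Q = (\<lambda>B. H.orthonormal B \<and> (\<forall>b\<in>B. \<exists>m. blinfun_apply P b = complex_of_real m *\<^sub>C b))"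
  have "Q {}" by (simp add: Q_def H.orthonormal_def)
  moreover have "\<forall>B. Q B \<longrightarrow> card B < Suc (card E)"
  proof (intro allI impI)
    fix B assume "Q B"
    then have "cv.independent B" by (simp add: Q_def H.orthonormal_independent)
    then show "card B < Suc (card E)" using cv.independent_span_bound[OF finite_E, of B] span_E by simp
  qed
  ultimately obtain B where B: "Q B" "\<forall>B'. Q B' \<longrightarrow> card B' \<le> card B"
    using ex_has_greatest_nat[of Q "{}" card] by blast
  have oB: "H.orthonormal B" using B(1) by (simp add: Q_def)
  obtain \<mu> where \<mu>: "\<And>b. b \<in> B \<Longrightarrow> blinfun_apply P b = complex_of_real (\<mu> b) *\<^sub>C b"
    using B(1) unfolding Q_def by metis
  have "cv.span B = UNIV"
  proof (rule ccontr)
    assume "cv.span B \<noteq> UNIV"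
    then obtain y where y: "y \<notin> cv.span B" by blast
    define x0 where "x0 = y - H.proj B y"
    have x0: "x0 \<noteq> 0" using y H.proj_in_span[of B y] by (auto simp: x0_def)
    have x0B: "\<forall>b\<in>B. h x0 b = 0"
      unfolding x0_def using H.proj_orthogonal[OF oB] cv.span_base by blast
    have inv: "\<forall>b\<in>B. h (blinfun_apply P x) b = 0" if "\<forall>b\<in>B. h x b = 0" for x
      using that by (simp add: sa \<mu> h_scale_right)
    obtain x m where x: "sqn x = 1" "\<forall>b\<in>B. h x b = 0" "blinfun_apply P x = complex_of_real m *\<^sub>C x"
    proof (rule eigenvector_exists[OF P sa _ x0 x0B])
      show "\<forall>b\<in>B. h (blinfun_apply P x) b = 0" if "\<forall>b\<in>B. h x b = 0" for x by (rule inv[OF that])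
    qed (rule that; assumption)
    have hx: "h x x = 1" by (simp add: h_self x(1))
    have xB: "x \<notin> B" using x(2) hx by auto
    have "h b x = 0" if "b \<in> B" for b using h_cnj[of b x] x(2) that by simp
    then have "H.orthonormal (insert x B)" using oB x(2) hx xB by (auto simp: H.orthonormal_def)
    then have "Q (insert x B)" using B(1) x(3) by (auto simp: Q_def)
    then have "card (insert x B) \<le> card B" using B(2) by blast
    then show False using xB oB by (simp add: H.orthonormal_def)
  qed
  then show thesis using that oB \<mu> by blast
qed

section \<open>Diagonal operators and their complex powers\<close>

definition diag :: "('v \<Rightarrow> complex) \<Rightarrow> ('v \<Rightarrow>\<^sub>L 'v)" where
  "diag d = Blinfun (\<lambda>x. \<Sum>e\<in>E. (d e * h x e) *\<^sub>C e)"

lemma cendo_diag_fun: "cendo (\<lambda>x. \<Sum>e\<in>E. (d e * h x e) *\<^sub>C e)"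
  by (rule cendoI) (simp_all add: h_add h_scale distrib_left scaleC_add_left sum.distrib cv.scale_sum_right scaleC_scaleC mult_ac)

lemma diag_apply: "blinfun_apply (diag d) x = (\<Sum>e\<in>E. (d e * h x e) *\<^sub>C e)"
  unfolding diag_def by (simp add: bounded_linear_Blinfun_apply[OF cendo_bounded_linear[OF cendo_diag_fun]])

lemma cendo_diag: "cendo (blinfun_apply (diag d))"
  unfolding diag_apply by (rule cendo_diag_fun)

lemma h_diag:
  assumes "e \<in> E"
  shows "h (blinfun_apply (diag d) x) e = d e * h x e"
proof -
  have "h (blinfun_apply (diag d) x) e = (\<Sum>e'\<in>E. if e' = e then d e' * h x e' else 0)"
    unfolding diag_apply clin_sum[OF clin_h] by (intro sum.cong refl) (simp add: h_scale h_E assms)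
  then show ?thesis using assms finite_E by simp
qed

lemma diag_compose: "diag d o\<^sub>L diag d' = diag (\<lambda>e. d e * d' e)"
  by (auto simp: blinfun_eq_iff h_diag intro!: h_ext)

lemma diag_one: "diag (\<lambda>e. 1) = id_blinfun"
  by (auto simp: blinfun_eq_iff h_diag intro!: h_ext)

lemma diag_eqI:
  assumes "cendo (blinfun_apply X)" "\<And>e. e \<in> E \<Longrightarrow> blinfun_apply X e = d e *\<^sub>C e"
  shows "X = diag d"
proof (rule blinfun_eqI)
  fix x
  have "blinfun_apply X x = (\<Sum>e\<in>E. h x e *\<^sub>C blinfun_apply X e)" by (rule cendo_expand[OF assms(1)])
  then show "blinfun_apply X x = blinfun_apply (diag d) x" by (simp add: assms(2) diag_apply scaleC_scaleC mult.commute)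
qed

lemma diag_base: "e \<in> E \<Longrightarrow> blinfun_apply (diag d) e = d e *\<^sub>C e"
  by (rule h_ext) (auto simp: h_diag h_scale h_E)

lemma op_exp_diag: "op_exp (diag d) = diag (\<lambda>e. exp (d e))"
  by (rule diag_eqI[OF cendo_op_exp[OF cendo_diag]]) (rule op_exp_eigenvector[OF cendo_diag diag_base])

lemma scaleR_diag: "t *\<^sub>R diag d = diag (\<lambda>e. complex_of_real t * d e)"
  by (auto simp: blinfun_eq_iff blinfun.scaleR_left h_scaleR h_diag intro!: h_ext)

lemma iop_diag: "iop (diag d) = diag (\<lambda>e. \<i> * d e)"
  by (auto simp: blinfun_eq_iff iop_apply h_scale h_diag intro!: h_ext)

text \<open>The complex power with exponent \<open>s\<close> of the positive operator whose
  eigenvalues are \<open>exp (l e)\<close>.\<close>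

definition dpow :: "('v \<Rightarrow> real) \<Rightarrow> complex \<Rightarrow> ('v \<Rightarrow>\<^sub>L 'v)" where
  "dpow l s = diag (\<lambda>e. exp (s * complex_of_real (l e)))"

lemma dpow_add: "dpow l s o\<^sub>L dpow l t = dpow l (s + t)" and dpow_0: "dpow l 0 = id_blinfun"
  by (simp_all add: dpow_def diag_compose diag_one distrib_right exp_add)

lemma dpow_GL: "dpow l s \<in> carrier GL" and inv_dpow: "inv\<^bsub>GL\<^esub> (dpow l s) = dpow l (- s)"
proof -
  have "cendo (blinfun_apply (dpow l s))" for s unfolding dpow_def by (rule cendo_diag)
  then have GL: "dpow l s \<in> carrier GL" for s
    by (rule GL_I[of _ "dpow l (- s)"]) (simp_all add: dpow_add dpow_0)
  then show "dpow l s \<in> carrier GL" .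
  show "inv\<^bsub>GL\<^esub> (dpow l s) = dpow l (- s)" by (rule GL_inv_eqI[OF GL _ GL]) (simp add: dpow_add dpow_0)
qed

lemma h_dpow: "h (blinfun_apply (dpow l s) x) y = h x (blinfun_apply (dpow l (cnj s)) y)"
proof -
  have "h (blinfun_apply (dpow l s) x) y = (\<Sum>e\<in>E. exp (s * complex_of_real (l e)) * h x e * cnj (h y e))"
    by (subst h_expand) (simp add: dpow_def h_diag)
  moreover have "h x (blinfun_apply (dpow l (cnj s)) y) = (\<Sum>e\<in>E. h x e * cnj (exp (cnj s * complex_of_real (l e)) * h y e))"
    by (subst h_expand) (simp add: dpow_def h_diag)
  ultimately show ?thesis by (simp add: exp_cnj mult_ac)
qed

lemma regular_dpow:
  assumes "F \<in> regular"
  shows "\<exists>xs. \<forall>s. F (dpow l s) = expsum xs s"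
  using assms
proof induction
  case (const c)
  show ?case by (intro exI[of _ "[(c, 0)]"]) simp
next
  case (coef f \<tau> x)
  define r where "r = (\<lambda>e. if \<tau> then l e else - l e)"
  obtain xs where xs: "\<forall>s. expsum xs s = (\<Sum>e\<in>E. (h x e * f e) * exp (s * complex_of_real (r e)))"
    using expsum_sum[OF finite_E, of "\<lambda>e. h x e * f e" r] by blast
  have "f (blinfun_apply (rep \<tau> (dpow l s)) x) = expsum xs s" for s
  proof -
    have "rep \<tau> (dpow l s) = diag (\<lambda>e. exp (s * complex_of_real (r e)))"
      by (cases \<tau>) (simp_all add: r_def rep_True rep_False dpow_GL inv_dpow, simp_all add: dpow_def)
    then have "f (blinfun_apply (rep \<tau> (dpow l s)) x) = (\<Sum>e\<in>E. (exp (s * complex_of_real (r e)) * h x e) * f e)"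
      by (simp add: diag_apply clin_sum[OF coef] clin_scale[OF coef])
    then show ?thesis by (simp add: xs mult_ac)
  qed
  then show ?case by blast
next
  case (add F1 F2)
  obtain xs where xs: "\<forall>s. F1 (dpow l s) = expsum xs s" using add.IH(1) by blast
  obtain ys where ys: "\<forall>s. F2 (dpow l s) = expsum ys s" using add.IH(2) by blast
  show ?case by (rule exI[of _ "xs @ ys"]) (simp add: xs ys)
next
  case (mult F1 F2)
  obtain xs where xs: "\<forall>s. F1 (dpow l s) = expsum xs s" using mult.IH(1) by blast
  obtain ys where ys: "\<forall>s. F2 (dpow l s) = expsum ys s" using mult.IH(2) by blast
  obtain zs where "\<forall>s. expsum zs s = expsum xs s * expsum ys s" using expsum_mult[of xs ys] by blast
  then show ?case by (intro exI[of _ zs]) (simp add: xs ys)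
qed

text \<open>Powers with natural exponents stay in the closure. Along the complex powers a regular
  function is an exponential sum, which vanishes identically once it vanishes at the natural
  numbers.\<close>

lemma dpow_Zc:
  assumes "dpow l 1 \<in> Zc"
  shows "dpow l s \<in> Zc"
proof (rule Zc_I[OF dpow_GL])
  fix F assume F: "F \<in> regular" "\<And>g. g \<in> G \<Longrightarrow> F g = 0"
  have "dpow l (of_nat n) \<in> Zc" for n
  proof (induction n)
    case 0
    show ?case by (simp add: dpow_0 G_Zc id_in)
  next
    case (Suc n)
    then show ?case using Zc_compose[OF assms Suc] by (simp add: dpow_add)
  qed
  then have 0: "F (dpow l (of_nat n)) = 0" for n using Zc_D F by blast
  obtain xs where xs: "\<forall>s. F (dpow l s) = expsum xs s" using regular_dpow[OF F(1)] by blast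
  then show "F (dpow l s) = 0" using expsum_zero[of xs s] 0 by simp
qed

text \<open>The imaginary powers are unitary and in the Zariski closure, hence in \<open>G\<close>.
  So their generator lies in the Lie algebra, and \<i> times the generator produces the real
  powers.\<close>

lemma dpow_GC:
  assumes "dpow l 1 \<in> Zc"
  shows "dpow l (complex_of_real t) \<in> GC"
proof -
  define Y where "Y = diag (\<lambda>e. \<i> * complex_of_real (- t * l e))"
  have "op_exp (r *\<^sub>R Y) \<in> G" for r
  proof -
    have eq: "op_exp (r *\<^sub>R Y) = dpow l (\<i> * complex_of_real (- r * t))"
      by (simp add: Y_def scaleR_diag op_exp_diag dpow_def mult_ac)
    show ?thesis unfolding eq
    proof (rule unitary_Zc_in_G[OF dpow_Zc[OF assms]])
      fix x y
      have "blinfun_apply (dpow l (cnj (\<i> * complex_of_real (- r * t)))) (blinfun_apply (dpow l (\<i> * complex_of_real (- r * t))) y) = y"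
        by (simp add: dpow_add dpow_0 flip: blinfun_apply_blinfun_compose)
      then show "h (blinfun_apply (dpow l (\<i> * complex_of_real (- r * t))) x) (blinfun_apply (dpow l (\<i> * complex_of_real (- r * t))) y) = h x y"
        unfolding h_dpow[of l _ x] by simp
    qed
  qed
  then have "Y \<in> lie" by (simp add: lie_iff)
  moreover have "iop Y = diag (\<lambda>e. complex_of_real t * complex_of_real (l e))"
    unfolding Y_def iop_diag by (simp add: algebra_simps)
  ultimately show ?thesis using GC_exp_iop[of Y] by (simp add: op_exp_diag dpow_def)
qed

end

text \<open>Polar decomposition inside the closure: \<open>P\<close>, the adjoint of
  \<open>a\<close> times \<open>a\<close>, lies there, and so do its real powers, which belong to
  the complexification as well. The factor \<open>u\<close> is unitary and in the closure, hence in
  \<open>G\<close>, and \<open>a\<close> is \<open>u\<close> times the square root of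
  \<open>P\<close>.\<close>

theorem (in unitary_group) Zc_GC:
  assumes a: "a \<in> Zc"
  shows "a \<in> GC"
proof -
  have ca: "cendo (blinfun_apply a)" by (rule GL_cendo[OF Zc_GL[OF a]])
  define P where "P = adj a o\<^sub>L a"
  have P_Zc: "P \<in> Zc" unfolding P_def by (intro Zc_compose Zc_adj a)
  have hP: "h (blinfun_apply P x) y = h (blinfun_apply a x) (blinfun_apply a y)" for x y
    by (simp add: P_def h_adj ca)
  have "h (blinfun_apply P x) y = h x (blinfun_apply P y)" for x y
    using hP[of x y] hP[of y x] h_cnj[of x "blinfun_apply P y"] h_cnj[of "blinfun_apply a x" "blinfun_apply a y"] by simp
  then obtain B \<mu> where B: "H.orthonormal B" "cv.span B = UNIV"
    "\<And>b. b \<in> B \<Longrightarrow> blinfun_apply P b = complex_of_real (\<mu> b) *\<^sub>C b"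
    by (rule eigenbasis_exists[OF GL_cendo[OF Zc_GL[OF P_Zc]]]) (rule that; assumption)
  interpret B: unitary_group G h B
    by unfold_locales (simp_all add: hermitian h_inv B)
  have pos: "\<mu> b > 0" if b: "b \<in> B" for b
  proof -
    have "complex_of_real (\<mu> b) = h (blinfun_apply P b) b" by (simp add: B(3) b h_scale B.h_E)
    also have "\<dots> = complex_of_real (sqn (blinfun_apply a b))" by (simp add: hP h_self)
    finally have "\<mu> b = sqn (blinfun_apply a b)" by simp
    moreover have "sqn (blinfun_apply a b) \<noteq> 0"
    proof
      assume "sqn (blinfun_apply a b) = 0"
      then have "blinfun_apply a b = blinfun_apply a 0" using sqn_eq_0 by (simp add: blinfun.zero_right)
      then have "b = 0" using GL_inv_apply(1)[OF Zc_GL[OF a]] by metis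
      then show False using B.h_E[OF b b] by simp
    qed
    ultimately show ?thesis using sqn_nonneg[of "blinfun_apply a b"] by (simp add: less_le)
  qed
  define l where "l = (\<lambda>b. ln (\<mu> b))"
  have P1: "P = B.dpow l 1" unfolding B.dpow_def
  proof (rule B.diag_eqI[OF GL_cendo[OF Zc_GL[OF P_Zc]]])
    fix b assume b: "b \<in> B"
    have "exp (1 * complex_of_real (l b)) = complex_of_real (\<mu> b)" using pos[OF b] by (simp add: l_def exp_of_real)
    then show "blinfun_apply P b = exp (1 * complex_of_real (l b)) *\<^sub>C b" using B(3)[OF b] by simp
  qed
  define W where "W = (\<lambda>t. B.dpow l (complex_of_real t))"
  have W_Zc: "W t \<in> Zc" for t unfolding W_def by (rule B.dpow_Zc) (use P_Zc P1 in simp)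
  have W_GC: "W t \<in> GC" for t unfolding W_def by (rule B.dpow_GC) (use P_Zc P1 in simp)
  have W_add: "W s o\<^sub>L W t = W (s + t)" and W_0: "W 0 = id_blinfun" for s t
    by (simp_all add: W_def B.dpow_add B.dpow_0)
  define u where "u = a o\<^sub>L W (- 1/2)"
  have "u \<in> G"
  proof (rule unitary_Zc_in_G)
    show "u \<in> Zc" unfolding u_def by (intro Zc_compose a W_Zc)
    fix x y
    have "h (blinfun_apply u x) (blinfun_apply u y) = h (blinfun_apply (P o\<^sub>L W (- 1/2)) x) (blinfun_apply (W (- 1/2)) y)"
      by (simp add: u_def hP)
    also have "P o\<^sub>L W (- 1/2) = W (1/2)" using W_add[of 1 "- 1/2"] by (simp add: P1 W_def)
    also have "h (blinfun_apply (W (1/2)) x) (blinfun_apply (W (- 1/2)) y) = h x (blinfun_apply (W (1/2) o\<^sub>L W (- 1/2)) y)"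
      using B.h_dpow[of l "complex_of_real (1/2)" x] by (simp add: W_def)
    also have "\<dots> = h x y" by (simp add: W_add W_0)
    finally show "h (blinfun_apply u x) (blinfun_apply u y) = h x y" .
  qed
  moreover have "a = u o\<^sub>L W (1/2)" by (simp add: u_def blinfun_compose_assoc W_add W_0) (simp add: blinfun_eq_iff)
  ultimately show ?thesis using GC_compose[OF G_GC W_GC] by simp
qed

section \<open>Points of the algebra of regular functions\<close>

text \<open>A character \<open>ch\<close> of the algebra of regular functions is evaluation at the operator whose matrix
  coefficients are the values of \<open>ch\<close>; the relation \<open>b b\<^sup>-\<^sup>1 = 1\<close> between coefficients makes it invertible.\<close>

lemma regular_character_eval:
  fixes ch :: "(('v::fd_complex_space \<Rightarrow>\<^sub>L 'v) \<Rightarrow> complex) \<Rightarrow> complex"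
  assumes add: "\<And>f k. f \<in> regular \<Longrightarrow> k \<in> regular \<Longrightarrow> ch (\<lambda>x. f x + k x) = ch f + ch k"
    and mult: "\<And>f k. f \<in> regular \<Longrightarrow> k \<in> regular \<Longrightarrow> ch (\<lambda>x. f x * k x) = ch f * ch k"
    and const: "\<And>c. ch (\<lambda>x. c) = c"
  shows "\<exists>a\<in>carrier GL. \<forall>F\<in>regular. ch F = F a"
proof -
  obtain B :: "'v set" and r where B: "finite B" "\<And>b. clin (r b)" "\<And>x. (\<Sum>b\<in>B. r b x *\<^sub>C b) = x"
    "\<And>c. (\<Sum>b\<in>B. c b *\<^sub>C b) = 0 \<Longrightarrow> \<forall>b\<in>B. c b = 0" by (rule coordinates_exist) (rule that; assumption)
  have ex: "l y = (\<Sum>b\<in>B. r b y * l b)" if l: "clin l" for l y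
  proof -
    have "l y = l (\<Sum>b\<in>B. r b y *\<^sub>C b)" by (simp add: B(3))
    then show ?thesis by (simp only: clin_sum[OF l] clin_scale[OF l])
  qed
  have sum: "ch (\<lambda>x. \<Sum>i\<in>I. k i x) = (\<Sum>i\<in>I. ch (k i))" if k: "\<And>i. k i \<in> regular" for k and I :: "'v set"
  proof (induction I rule: infinite_finite_induct)
    case (insert i I)
    then show ?case using add[OF k[of i] fun_algebra_sum[OF fun_algebra_regular, of I k, OF k]] by simp
  qed (simp_all add: const)
  have cmult: "ch (\<lambda>x. c * k x) = c * ch k" if "k \<in> regular" for c k
    using mult[OF regular.const that] by (simp add: const)
  define coef where "coef = (\<lambda>l s x (b :: 'v \<Rightarrow>\<^sub>L 'v). l (blinfun_apply (rep s b) x) :: complex)"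
  have coef: "coef l s x \<in> regular" if "clin l" for l s x unfolding coef_def by (rule regular.coef[OF that])
  define A where "A = (\<lambda>s x. \<Sum>e\<in>B. ch (coef (r e) s x) *\<^sub>C e)"
  have A: "ch (coef l s x) = l (A s x)" if l: "clin l" for l s x
  proof -
    have "coef l s x = (\<lambda>b. \<Sum>e\<in>B. l e * coef (r e) s x b)"
    proof
      show "coef l s x b = (\<Sum>e\<in>B. l e * coef (r e) s x b)" for b
        unfolding coef_def by (subst ex[OF l]) (simp add: mult.commute)
    qed
    then have "ch (coef l s x) = (\<Sum>e\<in>B. ch (\<lambda>b. l e * coef (r e) s x b))"
      by (simp only:) (intro sum fun_algebra_cmult[OF fun_algebra_regular] coef B(2))
    also have "\<dots> = (\<Sum>e\<in>B. l e * ch (coef (r e) s x))" by (intro sum.cong refl cmult coef B(2))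
    also have "\<dots> = l (A s x)"
      unfolding A_def by (simp only: clin_sum[OF l] clin_scale[OF l] mult.commute)
    finally show ?thesis .
  qed
  have eqI: "x = y" if "\<And>e. r e x = r e y" for x y :: 'v
  proof -
    have "x = (\<Sum>b\<in>B. r b x *\<^sub>C b)" by (rule B(3)[symmetric])
    also have "\<dots> = (\<Sum>b\<in>B. r b y *\<^sub>C b)" by (simp only: that)
    finally show ?thesis by (simp only: B(3))
  qed
  have cendo_A: "cendo (A s)" for s
  proof (rule cendoI; rule eqI)
    fix x y c e
    have "coef (r e) s (x + y) = (\<lambda>b. coef (r e) s x b + coef (r e) s y b)"
      by (simp add: coef_def fun_eq_iff blinfun.add_right clin_add[OF B(2)])
    then show "r e (A s (x + y)) = r e (A s x + A s y)"
      unfolding clin_add[OF B(2)] A[OF B(2), symmetric] using add[OF coef[OF B(2)] coef[OF B(2)]] by (simp only:)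
    have "coef (r e) s (c *\<^sub>C x) = (\<lambda>b. c * coef (r e) s x b)"
      by (simp add: coef_def fun_eq_iff cendo_scale[OF cendo_rep] clin_scale[OF B(2)])
    then show "r e (A s (c *\<^sub>C x)) = r e (c *\<^sub>C A s x)"
      unfolding clin_scale[OF B(2)] A[OF B(2), symmetric] using cmult[OF coef[OF B(2)]] by (simp only:)
  qed
  have A_cancel: "A s (A (\<not> s) x) = x" for s x
  proof (rule eqI)
    fix e
    have "(\<lambda>b. r e x) = (\<lambda>b. \<Sum>e'\<in>B. coef (r e') (\<not> s) x b * coef (r e) s e' b)"
    proof
      fix b :: "'v \<Rightarrow>\<^sub>L 'v"
      have "r e x = r e (blinfun_apply (rep s b) (blinfun_apply (rep (\<not> s) b) x))" by (simp only: rep_cancel)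
      also have "\<dots> = (\<Sum>e'\<in>B. coef (r e') (\<not> s) x b * coef (r e) s e' b)"
        unfolding coef_def by (rule ex[OF clin_comp[OF B(2) cendo_rep]])
      finally show "r e x = (\<Sum>e'\<in>B. coef (r e') (\<not> s) x b * coef (r e) s e' b)" .
    qed
    then have "r e x = ch (\<lambda>b. \<Sum>e'\<in>B. coef (r e') (\<not> s) x b * coef (r e) s e' b)" by (metis const)
    also have "\<dots> = (\<Sum>e'\<in>B. ch (\<lambda>b. coef (r e') (\<not> s) x b * coef (r e) s e' b))"
      by (intro sum regular.mult coef B(2))
    also have "\<dots> = (\<Sum>e'\<in>B. r e' (A (\<not> s) x) * r e (A s e'))"
      by (intro sum.cong refl) (simp only: mult[OF coef[OF B(2)] coef[OF B(2)]] A[OF B(2)])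
    also have "\<dots> = r e (A s (A (\<not> s) x))" by (rule ex[OF clin_comp[OF B(2) cendo_A], symmetric])
    finally show "r e (A s (A (\<not> s) x)) = r e x" by simp
  qed
  define a where "a = (\<lambda>s. Blinfun (A s))"
  have a: "blinfun_apply (a s) = A s" for s
    unfolding a_def by (rule bounded_linear_Blinfun_apply[OF cendo_bounded_linear[OF cendo_A]])
  have aa: "a s o\<^sub>L a (\<not> s) = id_blinfun" for s by (rule blinfun_eqI) (simp add: a A_cancel)
  have aGL: "a s \<in> carrier GL" for s
    by (rule GL_I[of _ "a (\<not> s)"]) (use aa[of s] aa[of "\<not> s"] in \<open>simp_all add: a cendo_A\<close>)
  have "inv\<^bsub>GL\<^esub> (a True) = a False" by (rule GL_inv_eqI[OF aGL _ aGL]) (use aa[of False] in simp)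
  then have rep: "rep s (a True) = a s" for s by (cases s) (simp_all add: rep_True rep_False aGL)
  have "ch F = F (a True)" if "F \<in> regular" for F
    using that
  proof induction
    case (coef l s x)
    show ?case using A[OF coef, of s x] by (simp add: coef_def rep a)
  qed (simp_all add: const add mult)
  then show ?thesis using aGL by blast
qed

text \<open>The weak Nullstellensatz for the coordinate ring. The matrix coefficients with respect
  to a basis are finitely many generators, so the spans of words of bounded length exhaust the ring
  by finite dimensional spaces.\<close>

lemma regular_character_exists:
  assumes "fun_ideal (regular :: (('v::fd_complex_space \<Rightarrow>\<^sub>L 'v) \<Rightarrow> complex) set) J" "(\<lambda>x. 1) \<notin> J"
  obtains a where "a \<in> carrier GL" "\<And>F. F \<in> J \<Longrightarrow> F a = 0"
proof -
  obtain B :: "'v set" and r where B: "finite B" "\<And>b. clin (r b)" "\<And>x. (\<Sum>b\<in>B. r b x *\<^sub>C b) = x"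
    "\<And>c. (\<Sum>b\<in>B. c b *\<^sub>C b) = 0 \<Longrightarrow> \<forall>b\<in>B. c b = 0" by (rule coordinates_exist) (rule that; assumption)
  define L where "L = (\<lambda>(s, e, e') (b :: 'v \<Rightarrow>\<^sub>L 'v). r e' (blinfun_apply (rep s b) e)) ` (UNIV \<times> B \<times> B)"
  have finL: "finite L" unfolding L_def using B(1) by (intro finite_imageI finite_cartesian_product) auto
  have span: "\<exists>n. F \<in> fv.span (words L n)" if "F \<in> regular" for F
    using that
  proof induction
    case (const c)
    have "fun_scale c (\<lambda>x. 1) \<in> fv.span (words L 0)" by (intro fv.span_scale fv.span_base) simp
    then show ?case by (intro exI[of _ 0]) (simp add: fun_scale_def[of c])
  next
    case (coef l s x)
    have "(\<lambda>b. l (blinfun_apply (rep s b) x)) = (\<Sum>(e, e')\<in>B \<times> B. fun_scale (r e x * l e') (\<lambda>b. r e' (blinfun_apply (rep s b) e)))"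
    proof
      fix b :: "'v \<Rightarrow>\<^sub>L 'v"
      have ap: "(\<Sum>i\<in>I. fun_scale (c i) (k i)) b = (\<Sum>i\<in>I. c i * k i b)" for I :: "('v \<times> 'v) set" and c and k :: "_ \<Rightarrow> ('v \<Rightarrow>\<^sub>L 'v) \<Rightarrow> complex"
        by (induction I rule: infinite_finite_induct) (simp_all add: fun_scale_def)
      have "l (blinfun_apply (rep s b) x) = l (\<Sum>e'\<in>B. r e' (blinfun_apply (rep s b) (\<Sum>e\<in>B. r e x *\<^sub>C e)) *\<^sub>C e')"
        by (simp add: B(3))
      also have "\<dots> = (\<Sum>e'\<in>B. \<Sum>e\<in>B. r e x * l e' * r e' (blinfun_apply (rep s b) e))"
        by (simp only: clin_sum[OF coef] clin_scale[OF coef] cendo_sum[OF cendo_rep] cendo_scale[OF cendo_rep]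
            clin_sum[OF B(2)] clin_scale[OF B(2)]) (simp add: sum_distrib_left sum_distrib_right mult_ac)
      also have "\<dots> = (\<Sum>e\<in>B. \<Sum>e'\<in>B. r e x * l e' * r e' (blinfun_apply (rep s b) e))" by (rule sum.swap)
      finally show "l (blinfun_apply (rep s b) x) = (\<Sum>(e, e')\<in>B \<times> B. fun_scale (r e x * l e') (\<lambda>b. r e' (blinfun_apply (rep s b) e))) b"
        unfolding case_prod_unfold ap by (simp add: sum.cartesian_product case_prod_unfold)
    qed
    also have "\<dots> \<in> fv.span (words L 1)"
    proof (intro fv.span_sum, clarify, intro fv.span_scale fv.span_base)
      fix e e' assume "e \<in> B" "e' \<in> B"
      then have "(\<lambda>b. r e' (blinfun_apply (rep s b) e)) \<in> L" unfolding L_def by (intro image_eqI[of _ _ "(s, e, e')"]) auto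
      then show "(\<lambda>b. r e' (blinfun_apply (rep s b) e)) \<in> words L 1" by (auto simp: image_iff)
    qed
    finally show ?case by (rule exI)
  next
    case (add F1 F2)
    obtain n where n: "F1 \<in> fv.span (words L n)" using add.IH(1) by (elim exE)
    obtain k where k: "F2 \<in> fv.span (words L k)" using add.IH(2) by (elim exE)
    have "F1 + F2 \<in> fv.span (words L (n + k))"
      using n k fv.span_mono[OF words_mono[of n "n + k" L]] fv.span_mono[OF words_mono[of k "n + k" L]]
      by (intro fv.span_add) auto
    then show ?case by (intro exI[of _ "n + k"]) (simp only: plus_fun_def)
  next
    case (mult F1 F2)
    obtain n where n: "F1 \<in> fv.span (words L n)" using mult.IH(1) by (elim exE)
    obtain k where k: "F2 \<in> fv.span (words L k)" using mult.IH(2) by (elim exE)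
    show ?case by (intro exI[of _ "n + k"] words_span_mult n k)
  qed
  obtain ch where ch: "\<And>f k. f \<in> regular \<Longrightarrow> k \<in> regular \<Longrightarrow> ch (\<lambda>x. f x + k x) = ch f + ch k"
    "\<And>f k. f \<in> regular \<Longrightarrow> k \<in> regular \<Longrightarrow> ch (\<lambda>x. f x * k x) = ch f * ch k"
    "\<And>c. ch (\<lambda>x. c) = c" "\<And>f. f \<in> J \<Longrightarrow> ch f = 0"
    by (rule character_exists[OF fun_algebra_regular span finite_words[OF finL] assms]) (assumption | rule that; assumption)+
  have "\<exists>a\<in>carrier GL. \<forall>F\<in>regular. ch F = F a"
    by (rule regular_character_eval[of ch], erule (1) ch(1), erule (1) ch(2), rule ch(3))
  then obtain a where a: "a \<in> carrier GL" "\<forall>F\<in>regular. ch F = F a" by (elim bexE)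
  have "F a = 0" if "F \<in> J" for F
    using a(2) ch(4)[OF that] assms(1) that by (auto simp: fun_ideal_def)
  then show thesis by (rule that[OF a(1)])
qed

section \<open>Closedness of the complex orbit\<close>

context orbit_space begin

section \<open>Regular functions averaged over the stabilizer\<close>

definition stab :: "('v \<Rightarrow>\<^sub>L 'v) set" where
  "stab = {g \<in> G. blinfun_apply g v = v}"

lemma stab_lin_group: "lin_group stab"
proof (rule lin_group.intro)
  show "compact stab"
  proof -
    have "closed {g :: 'v \<Rightarrow>\<^sub>L 'v. blinfun_apply g v = v}"
      by (intro closed_Collect_eq continuous_intros)
    moreover have "stab = G \<inter> {g. blinfun_apply g v = v}" by (auto simp: stab_def)
    ultimately show ?thesis using compact_G by auto
  qed
  show "subgroup stab GL"
  proof (rule group.subgroupI[OF group_GL])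
    show "stab \<subseteq> carrier GL" by (auto simp: stab_def in_GL)
    show "stab \<noteq> {}" using id_in by (auto simp: stab_def)
    show "inv\<^bsub>GL\<^esub> a \<in> stab" if "a \<in> stab" for a
      using that inv_in inv_apply(1)[of a v] by (auto simp: stab_def)
    show "a \<otimes>\<^bsub>GL\<^esub> b \<in> stab" if "a \<in> stab" "b \<in> stab" for a b
      using that compose_in by (auto simp: stab_def GL_mult)
  qed
qed

sublocale St: lin_group stab by (rule stab_lin_group)

text \<open>Averaging over the stabilizer on the right makes a function on the group descend to the
  orbit.\<close>

definition sm :: "(('v \<Rightarrow>\<^sub>L 'v) \<Rightarrow> complex) \<Rightarrow> ('v \<Rightarrow>\<^sub>L 'v) \<Rightarrow> complex" where
  "sm F g = St.cmean (\<lambda>k. F (g o\<^sub>L k))"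

lemma sepfun_sm:
  assumes "F \<in> regular"
  obtains S where "S \<in> sepfun G regular" "\<And>g b. g \<in> G \<Longrightarrow> b \<in> G \<Longrightarrow> sm F (g o\<^sub>L b) = sm (S g) b"
proof -
  obtain S where S: "S \<in> sepfun G regular" "\<forall>g\<in>G. \<forall>b\<in>carrier GL. F (g o\<^sub>L b) = S g b"
    using regular_sepfun[OF assms] by (elim bexE)
  have "sm F (g o\<^sub>L b) = sm (S g) b" if g: "g \<in> G" and b: "b \<in> G" for g b
    unfolding sm_def
  proof (rule St.cmean_cong)
    obtain F' where F': "F' \<in> regular" "\<forall>k\<in>carrier GL. F' k = F ((g o\<^sub>L b) o\<^sub>L k)"
      using regular_left[OF assms in_GL[OF compose_in[OF g b]]] by (elim bexE)
    show "continuous_on stab (\<lambda>k. F ((g o\<^sub>L b) o\<^sub>L k))"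
      by (rule continuous_on_eq[OF St.regular_continuous[OF F'(1)]]) (simp add: F'(2) St.in_GL)
    show "F ((g o\<^sub>L b) o\<^sub>L k) = S g (b o\<^sub>L k)" if "k \<in> stab" for k
      using S(2) g GL_compose[OF in_GL[OF b] St.in_GL[OF that]] by (simp add: blinfun_compose_assoc)
  qed
  then show thesis by (rule that[OF S(1)])
qed

lemma continuous_left:
  assumes "F \<in> regular" "g \<in> G"
  shows "continuous_on stab (\<lambda>k. F (g o\<^sub>L k))"
proof -
  obtain F' where F': "F' \<in> regular" "\<forall>k\<in>carrier GL. F' k = F (g o\<^sub>L k)"
    using regular_left[OF assms(1) in_GL[OF assms(2)]] by (elim bexE)
  show ?thesis by (rule continuous_on_eq[OF St.regular_continuous[OF F'(1)]]) (simp add: F'(2) St.in_GL)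
qed

lemma sm_stab:
  assumes F: "F \<in> regular" and g: "g \<in> G" "g' \<in> G" and eq: "blinfun_apply g v = blinfun_apply g' v"
  shows "sm F g = sm F g'"
proof -
  define k where "k = inv\<^bsub>GL\<^esub> g' o\<^sub>L g"
  have k: "k \<in> stab" unfolding stab_def k_def using g eq by (simp add: compose_in inv_in inv_apply)
  have "g = g' o\<^sub>L k" by (simp add: k_def blinfun_eq_iff inv_apply g)
  then have "sm F g = St.cmean (\<lambda>k'. F (g' o\<^sub>L (k o\<^sub>L k')))" by (simp add: sm_def blinfun_compose_assoc)
  also have "\<dots> = sm F g'" unfolding sm_def by (rule St.cmean_left[OF continuous_left[OF F g(2)] k])
  finally show ?thesis .
qed

lemma sm_sepfun_continuous:
  assumes "S \<in> sepfun G regular" "b \<in> G"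
  shows "continuous_on G (\<lambda>g. sm (S g) b)"
  using assms(1)
proof induction
  case (prod c f)
  have "sm (\<lambda>x. c g * f x) b = c g * sm f b" for g
    unfolding sm_def by (rule St.cmean_cmult[OF continuous_left[OF prod(2) assms(2)]])
  then show ?case using prod(1) by (simp add: continuous_on_mult_right)
next
  case (add S1 S2)
  have reg: "S g \<in> regular" if "S \<in> sepfun G regular" for S g
    using that by induction (auto intro: regular.intros)
  have "sm (\<lambda>x. S1 g x + S2 g x) b = sm (S1 g) b + sm (S2 g) b" for g
    unfolding sm_def by (intro St.cmean_add continuous_left reg add.hyps assms(2))
  then show ?case using add.IH by (simp add: continuous_on_add)
qed

lemma continuous_sm:
  assumes F: "F \<in> regular"
  shows "continuous_on G (sm F)"
proof -
  obtain S where S: "S \<in> sepfun G regular" "\<And>g b. g \<in> G \<Longrightarrow> b \<in> G \<Longrightarrow> sm F (g o\<^sub>L b) = sm (S g) b"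
    by (rule sepfun_sm[OF F]) (rule that; assumption)
  have "g o\<^sub>L id_blinfun = g" for g :: "'v \<Rightarrow>\<^sub>L 'v" by (simp add: blinfun_eq_iff)
  then have "sm (S g) id_blinfun = sm F g" if "g \<in> G" for g using S(2)[OF that id_in] by simp
  then show ?thesis by (rule continuous_on_eq[OF sm_sepfun_continuous[OF S(1) id_in]])
qed

text \<open>The function on the orbit induced by \<open>sm F\<close>. The choice of the group
  element is immaterial, because \<open>sm F\<close> takes equal values on elements of
  \<open>G\<close> with the same image of \<open>v\<close>.\<close>

definition push :: "(('v \<Rightarrow>\<^sub>L 'v) \<Rightarrow> complex) \<Rightarrow> 'v \<Rightarrow> complex" where
  "push F x = (if x \<in> M then sm F (SOME g. g \<in> G \<and> blinfun_apply g v = x) else 0)"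

lemma push_apply:
  assumes F: "F \<in> regular" and g: "g \<in> G"
  shows "push F (blinfun_apply g v) = sm F g"
proof -
  define g' where "g' = (SOME g'. g' \<in> G \<and> blinfun_apply g' v = blinfun_apply g v)"
  have "g' \<in> G \<and> blinfun_apply g' v = blinfun_apply g v" unfolding g'_def by (rule someI[of _ g]) (simp add: g)
  then have "sm F g' = sm F g" by (intro sm_stab F g) auto
  then show ?thesis using in_M[OF g] by (simp add: push_def g'_def)
qed

lemma push_outside: "x \<notin> M \<Longrightarrow> push F x = 0"
  by (simp add: push_def)

text \<open>By compactness the orbit carries the quotient topology of the group: the preimage of a
  closed set is the image of a compact set of group elements.\<close>

lemma push_cont_fun:
  assumes F: "F \<in> regular"
  shows "push F \<in> cont_fun M"
proof -
  have "continuous_on M (push F)"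
    unfolding continuous_on_closed_vimage[OF compact_imp_closed[OF compact_M]]
  proof (intro allI impI)
    fix C :: "complex set" assume C: "closed C"
    have "closed (sm F -` C \<inter> G)"
      using continuous_sm[OF F] C compact_imp_closed[OF compact_G] by (simp add: continuous_on_closed_vimage)
    then have "compact (G \<inter> (sm F -` C \<inter> G))" by (rule compact_Int_closed[OF compact_G])
    then have "compact ((\<lambda>g. blinfun_apply g v) ` (G \<inter> (sm F -` C \<inter> G)))"
      by (intro compact_continuous_image continuous_intros)
    moreover have "(\<lambda>g. blinfun_apply g v) ` (G \<inter> (sm F -` C \<inter> G)) = push F -` C \<inter> M"
      by (auto simp: push_apply[OF F] in_M elim!: M_E)
    ultimately show "closed (push F -` C \<inter> M)" by (simp add: compact_imp_closed)
  qed
  then show ?thesis by (simp add: cont_fun_def push_outside)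
qed

text \<open>Left translates of a regular function stay in a finite dimensional space, and averaging
  over the stabilizer acts on the right, so this descends to the orbit.\<close>

lemma push_gfin:
  assumes F: "F \<in> regular"
  shows "gfin (push F)"
proof -
  obtain S where S: "S \<in> sepfun G regular" "\<And>g b. g \<in> G \<Longrightarrow> b \<in> G \<Longrightarrow> sm F (g o\<^sub>L b) = sm (S g) b"
    by (rule sepfun_sm[OF F]) (rule that; assumption)
  have "\<exists>T. finite T \<and> (\<forall>g. push (S g) \<in> fv.span T) \<and> (\<forall>g. S g \<in> regular)"
    using S(1)
  proof induction
    case (prod c f)
    have "push (\<lambda>x. c g * f x) = fun_scale (c g) (push f)" for g
    proof (rule cont_fun_ext)
      show "push (\<lambda>x. c g * f x) \<in> cont_fun M" by (intro push_cont_fun fun_algebra_cmult[OF fun_algebra_regular] prod(2))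
      show "fun_scale (c g) (push f) \<in> cont_fun M" by (rule L.D_scale[OF push_cont_fun[OF prod(2)]])
      fix b assume b: "b \<in> G"
      show "push (\<lambda>x. c g * f x) (blinfun_apply b v) = fun_scale (c g) (push f) (blinfun_apply b v)"
        unfolding fun_scale_def push_apply[OF prod(2) b] push_apply[OF fun_algebra_cmult[OF fun_algebra_regular prod(2)] b]
        unfolding sm_def by (rule St.cmean_cmult[OF continuous_left[OF prod(2) b]])
    qed
    then show ?case using prod(2)
      by (intro exI[of _ "{push f}"] conjI allI) (simp_all add: fv.span_scale fv.span_base fun_algebra_cmult[OF fun_algebra_regular])
  next
    case (add S1 S2)
    obtain T1 where T1: "finite T1" "\<And>g. push (S1 g) \<in> fv.span T1" "\<And>g. S1 g \<in> regular" using add.IH(1) by (elim exE conjE) blast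
    obtain T2 where T2: "finite T2" "\<And>g. push (S2 g) \<in> fv.span T2" "\<And>g. S2 g \<in> regular" using add.IH(2) by (elim exE conjE) blast
    have eq: "push (\<lambda>x. S1 g x + S2 g x) = push (S1 g) + push (S2 g)" for g
    proof (rule cont_fun_ext)
      show "push (\<lambda>x. S1 g x + S2 g x) \<in> cont_fun M" by (intro push_cont_fun regular.add T1(3) T2(3))
      show "push (S1 g) + push (S2 g) \<in> cont_fun M" by (intro L.D_add push_cont_fun T1(3) T2(3))
      fix b assume b: "b \<in> G"
      show "push (\<lambda>x. S1 g x + S2 g x) (blinfun_apply b v) = (push (S1 g) + push (S2 g)) (blinfun_apply b v)"
        unfolding plus_fun_def push_apply[OF T1(3) b] push_apply[OF T2(3) b] push_apply[OF regular.add[OF T1(3) T2(3)] b]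
        unfolding sm_def by (intro St.cmean_add continuous_left T1(3) T2(3) b)
    qed
    have "push (\<lambda>x. S1 g x + S2 g x) \<in> fv.span (T1 \<union> T2)" for g
      unfolding eq using T1(2)[of g] T2(2)[of g] fv.span_mono[of T1 "T1 \<union> T2"] fv.span_mono[of T2 "T1 \<union> T2"]
      by (intro fv.span_add) auto
    then show ?case using T1 T2 by (intro exI[of _ "T1 \<union> T2"] conjI allI) (simp_all add: regular.add)
  qed
  then obtain T where T: "finite T" "\<And>g. push (S g) \<in> fv.span T" "\<And>g. S g \<in> regular" by (elim exE conjE) blast
  have qT: "qr g (push F) \<in> fv.span T" if g: "g \<in> G" for g
  proof -
    have "qr g (push F) = push (S (inv\<^bsub>GL\<^esub> g))"
    proof (rule cont_fun_ext)
      show "qr g (push F) \<in> cont_fun M" by (rule qr_cont_fun[OF g push_cont_fun[OF F]])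
      show "push (S (inv\<^bsub>GL\<^esub> g)) \<in> cont_fun M" by (rule push_cont_fun[OF T(3)])
      fix b assume b: "b \<in> G"
      have "qr g (push F) (blinfun_apply b v) = push F (blinfun_apply (inv\<^bsub>GL\<^esub> g o\<^sub>L b) v)" by (simp add: quasiregular_def)
      also have "\<dots> = sm F (inv\<^bsub>GL\<^esub> g o\<^sub>L b)" by (rule push_apply[OF F compose_in[OF inv_in[OF g] b]])
      also have "\<dots> = push (S (inv\<^bsub>GL\<^esub> g)) (blinfun_apply b v)"
        unfolding push_apply[OF T(3) b] by (rule S(2)[OF inv_in[OF g] b])
      finally show "qr g (push F) (blinfun_apply b v) = push (S (inv\<^bsub>GL\<^esub> g)) (blinfun_apply b v)" .
    qed
    then show ?thesis using T(2) by simp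
  qed
  show ?thesis unfolding gfin_def by (intro conjI push_cont_fun F exI[of _ T] ballI T(1) qT)
qed

text \<open>Let \<open>z\<close> be a point where all polynomials vanishing on the orbit vanish. The functions
  \<open>p (b v) - p z\<close> generate a proper ideal, since averaging a relation \<open>1 = \<Sum> (p (b v) - p z) F b\<close> over the
  stabilizer makes it one between polynomials on the orbit; a zero \<open>a\<close> of the ideal satisfies \<open>a v = z\<close>.\<close>

lemma dense_imp_GC_point:
  assumes comm: "commutative_orbit G M" and dense: "poly_closure M = cont_fun M"
    and z: "\<And>p. p \<in> hol_poly \<Longrightarrow> (\<And>x. x \<in> M \<Longrightarrow> p x = 0) \<Longrightarrow> p z = 0"
  shows "\<exists>a\<in>GC. blinfun_apply a v = z"
proof -
  have sm_poly: "\<exists>q\<in>hol_poly. \<forall>g\<in>G. q (blinfun_apply g v) = sm F g" if F: "F \<in> regular" for F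
  proof -
    have "push F \<in> A0" by (rule dense_imp_gfin_poly[OF comm dense push_gfin[OF F]])
    then obtain q where q: "q \<in> hol_poly" "push F = rs q" unfolding A0_def by (elim imageE)
    show ?thesis
      by (rule bexI[OF _ q(1)]) (simp add: push_apply[OF F, symmetric] q(2) rs_apply)
  qed
  define D where "D = (\<lambda>p (b :: 'v \<Rightarrow>\<^sub>L 'v). p (blinfun_apply (rep True b) v) - p z :: complex)"
  have D_reg: "D p \<in> regular" if "p \<in> hol_poly" for p
  proof -
    have "(\<lambda>b. p (blinfun_apply (rep True b) v)) \<in> regular"
      using that
    proof induction
      case (linear l)
      then show ?case by (rule regular.coef)
    next
      case (add p q)
      show ?case by (rule regular.add[OF add.IH])
    next
      case (mult p q)
      show ?case by (rule regular.mult[OF mult.IH])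
    qed (rule regular.const)
    then show ?thesis unfolding D_def by (intro fun_algebra_diff[OF fun_algebra_regular] regular.const)
  qed
  \<comment> \<open>The relation is required on \<open>G\<close> only. So every regular function
    vanishing on \<open>G\<close> lies in the ideal, which places a zero of the ideal in the Zariski
    closure.\<close>
  define J where "J = {F \<in> regular. \<exists>ps. (\<forall>(p, k)\<in>set ps. p \<in> hol_poly \<and> k \<in> regular) \<and> (\<forall>g\<in>G. F g = (\<Sum>(p, k)\<leftarrow>ps. D p g * k g))}"
  have J_I: "F \<in> J" if "F \<in> regular" "\<forall>(p, k)\<in>set ps. p \<in> hol_poly \<and> k \<in> regular" "\<And>g. g \<in> G \<Longrightarrow> F g = (\<Sum>(p, k)\<leftarrow>ps. D p g * k g)" for F ps
    unfolding J_def using that by blast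
  have J_E: P if "F \<in> J" "\<And>ps. F \<in> regular \<Longrightarrow> \<forall>(p, k)\<in>set ps. p \<in> hol_poly \<and> k \<in> regular \<Longrightarrow> (\<forall>g\<in>G. F g = (\<Sum>(p, k)\<leftarrow>ps. D p g * k g)) \<Longrightarrow> P" for F P
    using that(1) unfolding J_def by (elim CollectE conjE exE) (rule that(2))
  have ideal: "fun_ideal regular J" unfolding fun_ideal_def
  proof (intro conjI ballI)
    show "J \<subseteq> regular" unfolding J_def by (rule Collect_restrict)
    show "(\<lambda>x. 0) \<in> J" by (rule J_I[of _ "[]"]) (simp_all add: regular.const)
    fix f k assume f: "f \<in> J" and k: "k \<in> J"
    obtain ps where ps: "f \<in> regular" "\<forall>(p, k)\<in>set ps. p \<in> hol_poly \<and> k \<in> regular" "\<forall>g\<in>G. f g = (\<Sum>(p, k)\<leftarrow>ps. D p g * k g)"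
      by (rule J_E[OF f]) (rule that; assumption)
    obtain qs where qs: "k \<in> regular" "\<forall>(p, k)\<in>set qs. p \<in> hol_poly \<and> k \<in> regular" "\<forall>g\<in>G. k g = (\<Sum>(p, k)\<leftarrow>qs. D p g * k g)"
      by (rule J_E[OF k]) (rule that; assumption)
    show "(\<lambda>x. f x + k x) \<in> J"
      by (rule J_I[OF regular.add[OF ps(1) qs(1)], of "ps @ qs"]) (use ps(2,3) qs(2,3) in auto)
  next
    fix f k :: "('v \<Rightarrow>\<^sub>L 'v) \<Rightarrow> complex" assume f: "f \<in> regular" and k: "k \<in> J"
    obtain qs where qs: "k \<in> regular" "\<forall>(p, k)\<in>set qs. p \<in> hol_poly \<and> k \<in> regular" "\<forall>g\<in>G. k g = (\<Sum>(p, k)\<leftarrow>qs. D p g * k g)"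
      by (rule J_E[OF k]) (rule that; assumption)
    show "(\<lambda>x. f x * k x) \<in> J"
    proof (rule J_I[OF regular.mult[OF f qs(1)]])
      show "\<forall>(p, k)\<in>set (map (\<lambda>(p, k). (p, \<lambda>x. f x * k x)) qs). p \<in> hol_poly \<and> k \<in> regular"
        using qs(2) by (auto intro: regular.mult[OF f])
      fix g assume g: "g \<in> G"
      have "f g * (\<Sum>(p, k)\<leftarrow>qs. D p g * k g) = (\<Sum>(p, k)\<leftarrow>map (\<lambda>(p, k). (p, \<lambda>x. f x * k x)) qs. D p g * k g)"
        by (induction qs) (auto simp: distrib_left mult.left_commute)
      then show "f g * k g = (\<Sum>(p, k)\<leftarrow>map (\<lambda>(p, k). (p, \<lambda>x. f x * k x)) qs. D p g * k g)" using qs(3) g by simp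
    qed
  qed
  have "(\<lambda>x. 1) \<notin> J"
  proof
    assume J1: "(\<lambda>x. 1) \<in> J"
    obtain ps where ps: "\<forall>(p, k)\<in>set ps. p \<in> hol_poly \<and> k \<in> regular" "\<forall>g\<in>G. 1 = (\<Sum>(p, k)\<leftarrow>ps. D p g * k g)"
      by (rule J_E[OF J1]) (rule that; assumption)
    \<comment> \<open>On \<open>G\<close> the factors \<open>D p\<close> do not change under right
      multiplication by the stabilizer, so averaging affects only the coefficients \<open>k\<close>.
      Their averages are polynomials on the orbit, and replacing them makes the relation a
      polynomial that vanishes at \<open>z\<close> term by term.\<close>
    have "\<exists>q\<in>hol_poly. q z = 0 \<and> (\<forall>g\<in>G. q (blinfun_apply g v) = St.cmean (\<lambda>h. \<Sum>(p, k)\<leftarrow>ps. D p (g o\<^sub>L h) * k (g o\<^sub>L h))) \<and>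
      (\<forall>g\<in>G. continuous_on stab (\<lambda>h. \<Sum>(p, k)\<leftarrow>ps. D p (g o\<^sub>L h) * k (g o\<^sub>L h)))"
      using ps(1)
    proof (induction ps)
      case Nil
      show ?case by (rule bexI[OF _ hol_poly.const[of 0]]) (simp add: St.cmean_const)
    next
      case (Cons pk ps)
      obtain p k where pk: "pk = (p, k)" by (cases pk)
      have p: "p \<in> hol_poly" and k: "k \<in> regular" using Cons.prems by (auto simp: pk)
      have prems: "\<forall>(p, k)\<in>set ps. p \<in> hol_poly \<and> k \<in> regular" using Cons.prems by simp
      obtain q where q: "q \<in> hol_poly" "q z = 0" "\<forall>g\<in>G. q (blinfun_apply g v) = St.cmean (\<lambda>h. \<Sum>(p, k)\<leftarrow>ps. D p (g o\<^sub>L h) * k (g o\<^sub>L h))"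
        "\<forall>g\<in>G. continuous_on stab (\<lambda>h. \<Sum>(p, k)\<leftarrow>ps. D p (g o\<^sub>L h) * k (g o\<^sub>L h))"
        using Cons.IH[OF prems] by (elim bexE conjE)
      obtain q1 where q1: "q1 \<in> hol_poly" "\<forall>g\<in>G. q1 (blinfun_apply g v) = sm k g" using sm_poly[OF k] by (elim bexE)
      define q' where "q' = (\<lambda>x. (p x - p z) * q1 x + q x)"
      have cont: "continuous_on stab (\<lambda>h. D p (g o\<^sub>L h) * k (g o\<^sub>L h))" if "g \<in> G" for g
        by (intro continuous_on_mult continuous_left D_reg p k that)
      show ?case
      proof (rule bexI[of _ q'], intro conjI ballI)
        show "q' \<in> hol_poly" unfolding q'_def by (intro hol_poly.add hol_poly.mult hol_poly_diff hol_poly.const p q q1)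
        show "q' z = 0" by (simp add: q'_def q(2))
        fix g assume g: "g \<in> G"
        show "continuous_on stab (\<lambda>h. \<Sum>(p, k)\<leftarrow>pk # ps. D p (g o\<^sub>L h) * k (g o\<^sub>L h))"
          using continuous_on_add[OF cont[OF g] bspec[OF q(4) g]] by (simp add: pk)
        have "St.cmean (\<lambda>h. \<Sum>(p, k)\<leftarrow>pk # ps. D p (g o\<^sub>L h) * k (g o\<^sub>L h)) =
            St.cmean (\<lambda>h. D p (g o\<^sub>L h) * k (g o\<^sub>L h)) + St.cmean (\<lambda>h. \<Sum>(p, k)\<leftarrow>ps. D p (g o\<^sub>L h) * k (g o\<^sub>L h))"
          using St.cmean_add[OF cont[OF g] bspec[OF q(4) g]] by (simp add: pk)
        also have "St.cmean (\<lambda>h. D p (g o\<^sub>L h) * k (g o\<^sub>L h)) = St.cmean (\<lambda>h. (p (blinfun_apply g v) - p z) * k (g o\<^sub>L h))"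
        proof (rule St.cmean_cong[OF cont[OF g]])
          fix h assume h: "h \<in> stab"
          then have "rep True (g o\<^sub>L h) = g o\<^sub>L h" "blinfun_apply h v = v"
            by (auto simp: stab_def intro!: rep_True in_GL compose_in g)
          then show "D p (g o\<^sub>L h) * k (g o\<^sub>L h) = (p (blinfun_apply g v) - p z) * k (g o\<^sub>L h)" by (simp add: D_def)
        qed
        also have "\<dots> = (p (blinfun_apply g v) - p z) * sm k g"
          unfolding sm_def by (rule St.cmean_cmult[OF continuous_left[OF k g]])
        finally show "q' (blinfun_apply g v) = St.cmean (\<lambda>h. \<Sum>(p, k)\<leftarrow>pk # ps. D p (g o\<^sub>L h) * k (g o\<^sub>L h))"
          using q(3) q1(2) g by (simp add: q'_def)
      qed
    qed
    then obtain q where q: "q \<in> hol_poly" "q z = 0" "\<forall>g\<in>G. q (blinfun_apply g v) = St.cmean (\<lambda>h. \<Sum>(p, k)\<leftarrow>ps. D p (g o\<^sub>L h) * k (g o\<^sub>L h))"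
      "\<forall>g\<in>G. continuous_on stab (\<lambda>h. \<Sum>(p, k)\<leftarrow>ps. D p (g o\<^sub>L h) * k (g o\<^sub>L h))" by (elim bexE conjE)
    have one: "q (blinfun_apply g v) = 1" if g: "g \<in> G" for g
    proof -
      have "St.cmean (\<lambda>h. \<Sum>(p, k)\<leftarrow>ps. D p (g o\<^sub>L h) * k (g o\<^sub>L h)) = St.cmean (\<lambda>h. 1)"
        by (rule St.cmean_cong[OF bspec[OF q(4) g]]) (use ps(2) compose_in[OF g] in \<open>auto simp: stab_def\<close>)
      then show ?thesis using q(3) g by (simp add: St.cmean_const)
    qed
    define q1 where "q1 = (\<lambda>x. q x - 1)"
    \<comment> \<open>The averaged relation says that \<open>q\<close> is 1 on the orbit. By the
      hypothesis on \<open>z\<close> it must then be 1 at \<open>z\<close>, where it is 0 by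
      construction.\<close>
    have "q1 z = 0"
    proof (rule z)
      show "q1 \<in> hol_poly" unfolding q1_def by (rule hol_poly_diff[OF q(1) hol_poly.const])
      show "q1 x = 0" if x: "x \<in> M" for x
      proof -
        obtain g where "g \<in> G" "x = blinfun_apply g v" by (rule M_E[OF x])
        then show ?thesis by (simp add: q1_def one)
      qed
    qed
    then show False by (simp add: q1_def q(2))
  qed
  then obtain a where a: "a \<in> carrier GL" "\<And>F. F \<in> J \<Longrightarrow> F a = 0"
    by (rule regular_character_exists[OF ideal]) (rule that; assumption)
  have "a \<in> Zc"
  proof (rule Zc_I[OF a(1)])
    fix F :: "('v \<Rightarrow>\<^sub>L 'v) \<Rightarrow> complex" assume F: "F \<in> regular" "\<And>g. g \<in> G \<Longrightarrow> F g = 0"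
    have "F \<in> J" by (rule J_I[of _ "[]"]) (simp_all add: F)
    then show "F a = 0" by (rule a(2))
  qed
  moreover obtain h E where "unitary_group G h E" using unitary_group_exists by blast
  ultimately have aGC: "a \<in> GC" using unitary_group.Zc_GC by blast
  have poly: "p (blinfun_apply a v) = p z" if p: "p \<in> hol_poly" for p
  proof -
    have "D p \<in> J" by (rule J_I[of _ "[(p, \<lambda>x. 1)]"]) (simp_all add: D_reg p regular.const)
    then have "D p a = 0" by (rule a(2))
    then show ?thesis by (simp add: D_def rep_True a(1))
  qed
  obtain B :: "'v set" and r where B: "finite B" "\<And>b. clin (r b)" "\<And>x. (\<Sum>b\<in>B. r b x *\<^sub>C b) = x"
    "\<And>c. (\<Sum>b\<in>B. c b *\<^sub>C b) = 0 \<Longrightarrow> \<forall>b\<in>B. c b = 0" by (rule coordinates_exist) (rule that; assumption)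
  have "blinfun_apply a v = (\<Sum>b\<in>B. r b (blinfun_apply a v) *\<^sub>C b)" by (rule B(3)[symmetric])
  also have "\<dots> = (\<Sum>b\<in>B. r b z *\<^sub>C b)" by (simp only: poly[OF hol_poly.linear[OF B(2)]])
  also have "\<dots> = z" by (rule B(3))
  finally show ?thesis using aGC by blast
qed

text \<open>Polynomials vanishing on \<open>M\<close> vanish on the complex orbit and, by
  continuity, at its limit points. So each limit point satisfies the condition under which an
  operator of the complexification maps \<open>v\<close> to it.\<close>

lemma dense_imp_closed:
  assumes comm: "commutative_orbit G M" and dense: "poly_closure M = cont_fun M"
  shows "closed (orbit_of GC v)"
  unfolding closed_sequential_limits
proof (intro allI impI, elim conjE)
  fix x z assume x: "\<forall>n. x n \<in> orbit_of GC v" and lim: "x \<longlonglongrightarrow> z"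
  have "p z = 0" if p: "p \<in> hol_poly" "\<And>y. y \<in> M \<Longrightarrow> p y = 0" for p
  proof -
    have "p (x n) = 0" for n
    proof -
      obtain a where "a \<in> GC" "x n = blinfun_apply a v" using x by (auto simp: orbit_of_def)
      then show ?thesis using GC_vanish[OF p(1) p(2)[OF in_M]] by simp
    qed
    moreover have "isCont p z" using hol_poly_continuous_on[OF p(1), of UNIV] by (simp add: continuous_on_eq_continuous_at)
    then have "(\<lambda>n. p (x n)) \<longlonglongrightarrow> p z" by (rule isCont_tendsto_compose[OF _ lim])
    ultimately show ?thesis by (simp add: LIMSEQ_const_iff)
  qed
  then obtain a where "a \<in> GC" "blinfun_apply a v = z" using dense_imp_GC_point[OF comm dense] by blast
  then show "z \<in> orbit_of GC v" by (auto simp: orbit_of_def)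
qed

end

theorem theorem6:
  fixes G :: "('v::fd_complex_space \<Rightarrow>\<^sub>L 'v) set" and v :: 'v
  assumes "subgroup G GL" and "compact G" and "connected G"
    and "\<And>w. (\<forall>g\<in>G. blinfun_apply g w = w) \<Longrightarrow> w = 0"
    and "commutative_orbit G (orbit_of G v)"
  shows "(poly_closure (orbit_of G v) = cont_fun (orbit_of G v) \<longleftrightarrow>
            closed (orbit_of (complexification G) v)) \<and>
         (antisymmetric_on (orbit_of G v) (poly_closure (orbit_of G v)) \<longleftrightarrow>
            v \<in> nilpotent_cone G) \<and>
         (v \<in> nilpotent_cone G \<longrightarrow> poly_hull (orbit_of G v) \<subseteq> nilpotent_cone G)"
proof -
  interpret lin_group G by (rule lin_group.intro[OF assms(1,2)])
  interpret orbit_space G v by unfold_locales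
  show ?thesis
    using dense_imp_closed[OF assms(5)] closed_imp_dense[OF assms(5)]
      antisymmetric_imp_nilpotent[OF assms(5,4)] nilpotent_imp_antisymmetric hull_in_nilpotent_cone
    by blast
qed

end
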